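(* Let $d\ge2$ and let $M:\mathbb R\to\mathbb R$ be a measurable function with $\mathbb E[M(Z)^2]<\infty$ and $J_2(M)=\mathbb E[M(Z)H_2(Z)]\ne0$, where $Z\sim\mathcal N(0,1)$ and $H_2(t)=t^2-1$. Set $S_\ell(M)=\int_{\mathbb S^d}M(T_\ell(x))\,dx$. Then $$d_W\left(\frac{S_{2\ell}(M)-\mathbb E[S_{2\ell}(M)]}{\sqrt{\mathrm{Var}[S_{2\ell}(M)]}},\mathcal N(0,1)\right)=O(\ell^{-\frac12}),\qquad\text{as }\ell\to\infty;$$ in particular, $$\frac{S_{2\ell}(M)-\mathbb E[S_{2\ell}(M)]}{\sqrt{\mathrm{Var}[S_{2\ell}(M)]}}\ \longrightarrow\ \mathcal N(0,1)\quad\text{in law}.$$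
   Context: Let $\mathbb S^d\subset\mathbb R^{d+1}$ be the unit sphere with Lebesgue (surface) measure $dx$ of total mass $\mu_d=2\pi^{(d+1)/2}/\Gamma(\frac{d+1}2)$. For $\ell\ge1$ let $(Y_{\ell,m;d})_{m=1}^{n_{\ell;d}}$ be a real orthonormal basis of the space of spherical harmonics of degree $\ell$ on $\mathbb S^d$, where $n_{\ell;d}=\frac{2\ell+d-1}{\ell}\binom{\ell+d-2}{\ell-1}$. Let $$T_\ell(x)=\sum_{m=1}^{n_{\ell;d}}a_{\ell,m}Y_{\ell,m;d}(x),\qquad x\in\mathbb S^d,$$ with $(a_{\ell,m})_m$ i.i.d. centred Gaussian random variables of variance $\mu_d/n_{\ell;d}$. Equivalently $T_\ell$ is the centred Gaussian field with $\mathbb E[T_\ell(x)T_\ell(y)]=G_{\ell;d}(\cos d(x,y))$, where $d(x,y)$ is the spherical distance and $G_{\ell;d}$ is the Gegenbauer polynomial $P_\ell^{(\frac d2-1,\frac d2-1)}$ normalized by $G_{\ell;d}(1)=1$ (so each $T_\ell(x)$ is standard Gaussian). $\mathcal N(0,1)$ denotes a standard Gaussian random variable, and $d_W(Z,N)=\sup_{h}|\mathbb E[h(Z)]-\mathbb E[h(N)]|$, the supremum being over $1$-Lipschitz functions $h:\mathbb R\to\mathbb R$, is the Wasserstein distance. *)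

theory Defs
  imports "HOL-Probability.Probability"
begin

section \<open>The unit sphere\<close>

text \<open>
  Surface measure on the unit sphere of an \<open>n\<close>-dimensional Euclidean space, by integration in
  polar coordinates: \<open>\<sigma>(A)\<close> is \<open>n\<close> times the Lebesgue measure of the cone
  \<open>{r x | 0 < r < 1, x \<in> A}\<close>. The underlying space is the sphere itself with its Borel sets,
  so values of integrands off the sphere are irrelevant.
\<close>

definition surface_measure :: "'a::euclidean_space measure" where
  "surface_measure =
     scale_measure (ennreal (real DIM('a)))
       (distr (restrict_space lborel (ball 0 1 - {0})) (restrict_space borel (sphere 0 1))
          (\<lambda>x. x /\<^sub>R norm x))"

text \<open>The total mass \<open>\<mu>\<^sub>d\<close> of the \<open>d\<close>-dimensional sphere.\<close>

definition sphere_mass :: "nat \<Rightarrow> real" where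
  "sphere_mass d = 2 * pi powr ((real d + 1) / 2) / Gamma ((real d + 1) / 2)"

lemma space_surface_measure [simp]: "space surface_measure = sphere 0 1"
  by (simp add: surface_measure_def space_scale_measure space_restrict_space)

lemma sets_surface_measure [simp, measurable_cong]:
  "sets surface_measure = sets (restrict_space borel (sphere 0 1))"
  by (simp add: surface_measure_def)

lemma radial_projection_measurable:
  "(\<lambda>x. x /\<^sub>R norm x)
     \<in> restrict_space lborel (ball (0::'a::euclidean_space) 1 - {0})
         \<rightarrow>\<^sub>M restrict_space borel (sphere 0 1)"
  by (intro measurable_restrict_space2 measurable_restrict_space1)
     (auto simp: space_restrict_space)

lemma emeasure_surface_measure_sphere:
  assumes "DIM('a::euclidean_space) = d + 1"
  shows "emeasure surface_measure (sphere (0::'a) 1) = ennreal (sphere_mass d)"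
proof -
  let ?p = "\<lambda>x::'a. x /\<^sub>R norm x"
  let ?B = "ball (0::'a) 1 - {0}"
  let ?R = "restrict_space lborel ?B"
  have sph: "sphere (0::'a) 1 \<in> sets (restrict_space borel (sphere 0 1))"
    by (simp add: sets_restrict_space_iff)
  have pre: "?p -` sphere 0 1 \<inter> space ?R = ?B"
    by (auto simp: space_restrict_space)
  have "emeasure (distr ?R (restrict_space borel (sphere 0 1)) ?p) (sphere 0 1) = emeasure ?R ?B"
    using emeasure_distr[OF radial_projection_measurable sph] pre by simp
  also have "\<dots> = emeasure lborel ?B"
    by (subst emeasure_restrict_space) auto
  also have "\<dots> = emeasure lborel (ball (0::'a) 1)"
    by (rule emeasure_Diff_null_set) auto
  also have "\<dots> = ennreal (unit_ball_vol (real d + 1))"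
    using emeasure_ball[of 1 "0::'a"] assms by (simp add: add.commute)
  finally have "emeasure surface_measure (sphere (0::'a) 1)
      = ennreal (real d + 1) * ennreal (unit_ball_vol (real d + 1))"
    using assms by (simp add: surface_measure_def add.commute)
  also have "\<dots> = ennreal ((real d + 1) * unit_ball_vol (real d + 1))"
    by (simp add: ennreal_mult)
  also have "(real d + 1) * unit_ball_vol (real d + 1) = sphere_mass d"
  proof -
    define D where "D = (real d + 1) / 2"
    have "D > 0" by (simp add: D_def)
    then have "Gamma (D + 1) = D * Gamma D"
      by (intro Gamma_plus1) (auto elim!: nonpos_Ints_cases)
    then have "2 * D * (pi powr D / Gamma (D + 1)) = 2 * pi powr D / Gamma D"
      using \<open>D > 0\<close> by simp
    moreover have "2 * D = real d + 1" by (simp add: D_def)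
    ultimately show ?thesis
      unfolding unit_ball_vol_def sphere_mass_def D_def[symmetric] by simp
  qed
  finally show ?thesis .
qed

section \<open>Spherical harmonics\<close>

definition laplacian :: "('a::euclidean_space \<Rightarrow> real) \<Rightarrow> 'a \<Rightarrow> real" where
  "laplacian f x = (\<Sum>b\<in>Basis. (deriv ^^ 2) (\<lambda>t. f (x + t *\<^sub>R b)) 0)"

text \<open>
  Spherical harmonics of degree \<open>l\<close>: restrictions to the sphere of harmonic polynomials that are
  homogeneous of degree \<open>l\<close> (the zero function included). Only the values on the sphere matter.
\<close>

definition spherical_harmonic :: "nat \<Rightarrow> ('a::euclidean_space \<Rightarrow> real) \<Rightarrow> bool" where
  "spherical_harmonic l f \<longleftrightarrow>
     (\<exists>p. real_polynomial_function p \<and>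
          (\<forall>t x. p (t *\<^sub>R x) = t ^ l * p x) \<and>
          (\<forall>x. laplacian p x = 0) \<and>
          (\<forall>x\<in>sphere 0 1. f x = p x))"

text \<open>
  The number \<open>n\<^bsub>l;d\<^esub>\<close>, used for \<open>l \<ge> 1\<close>; the division is exact, see \<open>real_harmonic_dim\<close>.
\<close>

definition harmonic_dim :: "nat \<Rightarrow> nat \<Rightarrow> nat" where
  "harmonic_dim d l = ((2 * l + d - 1) * ((l + d - 2) choose (l - 1))) div l"

lemma real_harmonic_dim:
  assumes "d \<ge> 2" "l \<ge> 1"
  shows "real (harmonic_dim d l)
    = (2 * real l + real d - 1) / real l * real ((l + d - 2) choose (l - 1))"
proof -
  obtain k where k: "l = Suc k" using assms by (cases l) auto
  obtain e where e: "d = Suc (Suc e)" using assms by (metis add_2_eq_Suc le_Suc_ex)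
  have eq: "Suc k * (Suc (k + e) choose k) + Suc k * (Suc (k + e) choose Suc k)
      = Suc (Suc (k + e)) * (Suc (k + e) choose k)"
    using Suc_times_binomial[of k "Suc (k + e)"] by (simp add: algebra_simps)
  have "(2 * l + d - 1) * ((l + d - 2) choose (l - 1))
      = Suc k * (Suc (k + e) choose k) + Suc (Suc (k + e)) * (Suc (k + e) choose k)"
    by (simp add: k e algebra_simps)
  also have "\<dots> = l * (2 * (Suc (k + e) choose k) + (Suc (k + e) choose Suc k))"
    unfolding eq[symmetric] k by (simp only: algebra_simps mult_2)
  finally have "l dvd (2 * l + d - 1) * ((l + d - 2) choose (l - 1))"
    by (simp only: dvd_triv_left)
  then have "real (harmonic_dim d l)
      = real ((2 * l + d - 1) * ((l + d - 2) choose (l - 1))) / real l"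
    unfolding harmonic_dim_def by (rule real_of_nat_div)
  also have "\<dots> = (2 * real l + real d - 1) / real l * real ((l + d - 2) choose (l - 1))"
    using assms by (simp add: of_nat_diff)
  finally show ?thesis .
qed

definition orthonormal_harmonic_basis ::
    "nat \<Rightarrow> nat \<Rightarrow> (nat \<Rightarrow> 'a::euclidean_space \<Rightarrow> real) \<Rightarrow> bool" where
  "orthonormal_harmonic_basis d l Y \<longleftrightarrow>
     (\<forall>m\<in>{1..harmonic_dim d l}. spherical_harmonic l (Y m)) \<and>
     (\<forall>m\<in>{1..harmonic_dim d l}. \<forall>m'\<in>{1..harmonic_dim d l}.
        (\<integral>x. Y m x * Y m' x \<partial>surface_measure) = (if m = m' then 1 else 0)) \<and>
     (\<forall>f. spherical_harmonic l f \<longrightarrow>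
        (\<exists>c. \<forall>x\<in>sphere 0 1. f x = (\<Sum>m = 1..harmonic_dim d l. c m * Y m x)))"

section \<open>Random eigenfunctions and their functionals\<close>

text \<open>
  The variables \<open>a m\<close>, \<open>1 \<le> m \<le> n\<^bsub>l;d\<^esub>\<close>, are i.i.d. centred Gaussian of variance
  \<open>\<mu>\<^sub>d / n\<^bsub>l;d\<^esub>\<close>; the library parametrises normal densities by the standard deviation.
\<close>

definition gaussian_coefficients ::
    "'w measure \<Rightarrow> nat \<Rightarrow> nat \<Rightarrow> (nat \<Rightarrow> 'w \<Rightarrow> real) \<Rightarrow> bool" where
  "gaussian_coefficients P d l a \<longleftrightarrow>
     prob_space.indep_vars P (\<lambda>_. borel) a {1..harmonic_dim d l} \<and>
     (\<forall>m\<in>{1..harmonic_dim d l}.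
        distributed P lborel (a m)
          (normal_density 0 (sqrt (sphere_mass d / real (harmonic_dim d l)))))"

definition eigenfunction ::
    "nat \<Rightarrow> (nat \<Rightarrow> nat \<Rightarrow> 'w \<Rightarrow> real) \<Rightarrow> (nat \<Rightarrow> nat \<Rightarrow> 'a \<Rightarrow> real) \<Rightarrow> nat \<Rightarrow> 'w \<Rightarrow> 'a \<Rightarrow> real" where
  "eigenfunction d a Y l \<omega> x = (\<Sum>m = 1..harmonic_dim d l. a l m \<omega> * Y l m x)"

definition sphere_functional ::
    "nat \<Rightarrow> (nat \<Rightarrow> nat \<Rightarrow> 'w \<Rightarrow> real) \<Rightarrow> (nat \<Rightarrow> nat \<Rightarrow> 'a::euclidean_space \<Rightarrow> real) \<Rightarrow>
     (real \<Rightarrow> real) \<Rightarrow> nat \<Rightarrow> 'w \<Rightarrow> real" where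
  "sphere_functional d a Y M l \<omega> = (\<integral>x. M (eigenfunction d a Y l \<omega> x) \<partial>surface_measure)"

definition standardized :: "'w measure \<Rightarrow> ('w \<Rightarrow> real) \<Rightarrow> 'w \<Rightarrow> real" where
  "standardized P X \<omega> =
     (X \<omega> - prob_space.expectation P X) / sqrt (prob_space.variance P X)"

definition hermite2 :: "real \<Rightarrow> real" where
  "hermite2 t = t\<^sup>2 - 1"

definition J2 :: "(real \<Rightarrow> real) \<Rightarrow> real" where
  "J2 M = (\<integral>t. M t * hermite2 t \<partial>std_normal_distribution)"

text \<open>
  The Wasserstein distance of two laws on the line (for laws with finite first moment).
  It takes values in the extended reals, so that the supremum is never a default value.
\<close>

definition wasserstein :: "real measure \<Rightarrow> real measure \<Rightarrow> ereal" where
  "wasserstein \<mu> \<nu> =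
     (SUP h\<in>{h :: real \<Rightarrow> real. 1-lipschitz_on UNIV h}.
        ereal \<bar>(\<integral>t. h t \<partial>\<mu>) - (\<integral>t. h t \<partial>\<nu>)\<bar>)"

end

theory Submission
  imports Defs
begin

text \<open>
  The Hermite expansion of \<open>M\<close> splits the functional into chaoses, and the second one dominates. The
  variance of everything of order at least \<open>q\<close> is, relative to it, at most of order
  \<open>n \<integral> \<bar>G\<bar>\<^sup>q\<close>, by Mehler's formula. Sonine's energy method for the Gegenbauer equation bounds the
  decay of the kernel \<open>G\<close> and makes this quantity \<open>O(l\<^sup>-\<^sup>1\<^sup>/\<^sup>2)\<close> for \<open>q = 3\<close> and \<open>O(l\<^sup>-\<^sup>1)\<close> for \<open>q = 5\<close>.
  The chaoses of order at least five are therefore removed in \<open>L\<^sup>2\<close> with an error \<open>O(l\<^sup>-\<^sup>1\<^sup>/\<^sup>2)\<close>.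

  The second chaos is a centred sum of \<open>n\<close> squares of independent Gaussian coefficients, for which
  Stein's method with Gaussian integration by parts gives the rate \<open>n\<^sup>-\<^sup>1\<^sup>/\<^sup>2\<close>. Removing the chaoses of
  order three and four in \<open>L\<^sup>2\<close> as well would be too expensive. They stay in Stein's equation, where they are almost
  orthogonal to functions of the second chaos, so that they contribute their variance
  \<open>O(l\<^sup>-\<^sup>1\<^sup>/\<^sup>2)\<close> instead of its square root.
\<close>

text \<open>The case d = 2 is the critical one. The kernel decays like (l sin t)^(-(d-1)/2), and for
  d = 2 this makes n times the integral of |G|^4 of order log(l)/l. Its square root misses the rate
  by a logarithm, so order four has to stay in Stein's equation together with order three, and order
  five is the first that may be discarded in mean square. For d = 2 the term n^(-1/2) is itself of
  order l^(-1/2). No theory of Gegenbauer polynomials enters. \<open>G\<close> is the normalized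
  reproducing kernel of the harmonics; reflections alone make it a function of the angle, and
  homogeneity with Laplace's equation yields its differential equation. The same equation shows that
  harmonics of degree at least one have mean zero, because nonzero constants do not solve it.
  Mehler's formula has to serve functions that are merely square integrable. It is an explicit power
  series for sines and cosines, which are dense, and it is carried to the limit as an inequality
  that contains finitely many Hermite coefficients. The probability lives on a product of standard
  Gaussians; the given coefficients enter only through their joint law.\<close>

definition square_integrable :: "'a measure \<Rightarrow> ('a \<Rightarrow> real) \<Rightarrow> bool" where
  "square_integrable M f \<longleftrightarrow> f \<in> borel_measurable M \<and> integrable M (\<lambda>x. (f x)\<^sup>2)"

lemma square_integrable_mult:
  assumes "square_integrable M f" "square_integrable M g"
  shows "integrable M (\<lambda>x. f x * g x)"
proof (rule Bochner_Integration.integrable_bound)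
  show "integrable M (\<lambda>x. (f x)\<^sup>2 + (g x)\<^sup>2)"
    using assms by (auto simp: square_integrable_def)
  have [measurable]: "f \<in> borel_measurable M" "g \<in> borel_measurable M"
    using assms by (auto simp: square_integrable_def)
  show "(\<lambda>x. f x * g x) \<in> borel_measurable M" by measurable
  have "\<bar>a * b\<bar> \<le> a\<^sup>2 + b\<^sup>2" for a b :: real
  proof -
    have "2 * \<bar>a\<bar> * \<bar>b\<bar> \<le> \<bar>a\<bar>\<^sup>2 + \<bar>b\<bar>\<^sup>2" by (rule sum_squares_bound)
    moreover have "0 \<le> \<bar>a\<bar> * \<bar>b\<bar>" by simp
    ultimately show ?thesis unfolding abs_mult power2_abs by linarith
  qed
  then show "AE x in M. norm (f x * g x) \<le> norm ((f x)\<^sup>2 + (g x)\<^sup>2)" by simp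
qed

lemma square_integrable_add:
  assumes "square_integrable M f" "square_integrable M g"
  shows "square_integrable M (\<lambda>x. f x + g x)"
proof -
  have "integrable M (\<lambda>x. (f x)\<^sup>2 + (g x)\<^sup>2 + 2 * (f x * g x))"
    using assms square_integrable_mult[OF assms] by (auto simp: square_integrable_def)
  then show ?thesis using assms
    by (auto simp: square_integrable_def power2_sum mult.assoc)
qed

lemma square_integrable_cmult:
  "square_integrable M f \<Longrightarrow> square_integrable M (\<lambda>x. c * f x)"
  by (auto simp: square_integrable_def power_mult_distrib)

lemma square_integrable_diff:
  "square_integrable M f \<Longrightarrow> square_integrable M g \<Longrightarrow> square_integrable M (\<lambda>x. f x - g x)"
  using square_integrable_add[of M f "\<lambda>x. (-1) * g x"] square_integrable_cmult[of M g "-1"]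
  by simp

lemma square_integrable_zero: "square_integrable M (\<lambda>x. 0)"
  by (simp add: square_integrable_def)

lemma square_integrable_sum:
  "(\<And>i. i \<in> A \<Longrightarrow> square_integrable M (f i)) \<Longrightarrow> square_integrable M (\<lambda>x. \<Sum>i\<in>A. f i x)"
  by (induction A rule: infinite_finite_induct)
     (auto intro: square_integrable_zero square_integrable_add)

lemma square_integrable_bounded:
  assumes "finite_measure M" "f \<in> borel_measurable M" "\<And>x. x \<in> space M \<Longrightarrow> \<bar>f x\<bar> \<le> B"
  shows "square_integrable M f"
  unfolding square_integrable_def
proof
  interpret finite_measure M by fact
  show "f \<in> borel_measurable M" by fact
  have "(f x)\<^sup>2 \<le> B\<^sup>2" if "x \<in> space M" for x
    using power_mono[OF assms(3)[OF that] abs_ge_zero, of 2] by simp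
  then show "integrable M (\<lambda>x. (f x)\<^sup>2)"
    using assms(2) by (intro integrable_const_bound[where B="B\<^sup>2"]) auto
qed

lemma (in finite_measure) square_integrable_imp_integrable:
  assumes "square_integrable M f" shows "integrable M f"
proof -
  have "square_integrable M (\<lambda>_. 1)" by (simp add: square_integrable_def)
  from square_integrable_mult[OF assms this] show ?thesis by simp
qed

lemma Cauchy_Schwarz_integral:
  assumes "square_integrable M f" "square_integrable M g"
  shows "(\<integral>x. f x * g x \<partial>M)\<^sup>2 \<le> (\<integral>x. (f x)\<^sup>2 \<partial>M) * (\<integral>x. (g x)\<^sup>2 \<partial>M)"
proof -
  define a b c where "a = (\<integral>x. (f x)\<^sup>2 \<partial>M)" and "b = (\<integral>x. f x * g x \<partial>M)" and "c = (\<integral>x. (g x)\<^sup>2 \<partial>M)"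
  have int: "integrable M (\<lambda>x. (f x)\<^sup>2)" "integrable M (\<lambda>x. (g x)\<^sup>2)" "integrable M (\<lambda>x. f x * g x)"
    using assms square_integrable_mult[OF assms] by (auto simp: square_integrable_def)
  \<comment> \<open>Nonnegativity of this quadratic in t contains the inequality; t = b/c is its
    minimiser.\<close>
  have key: "0 \<le> a - 2 * t * b + t\<^sup>2 * c" for t
  proof -
    have "0 \<le> (\<integral>x. (f x - t * g x)\<^sup>2 \<partial>M)" by (rule integral_nonneg_AE) simp
    also have "(\<integral>x. (f x - t * g x)\<^sup>2 \<partial>M) = (\<integral>x. (f x)\<^sup>2 - 2 * t * (f x * g x) + t\<^sup>2 * (g x)\<^sup>2 \<partial>M)"
      by (rule Bochner_Integration.integral_cong) (auto simp: power2_eq_square algebra_simps)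
    also have "\<dots> = a - 2 * t * b + t\<^sup>2 * c"
      using int by (simp add: a_def b_def c_def)
    finally show ?thesis .
  qed
  have c: "c \<ge> 0" unfolding c_def by simp
  have "b\<^sup>2 \<le> a * c"
  proof (cases "c = 0")
    case True
    have "b = 0"
    proof (rule ccontr)
      assume "b \<noteq> 0"
      \<comment> \<open>For c = 0 the quadratic is a - 2 t b, and this t makes it equal to
        -1.\<close>
      with key[of "(a + 1) / (2 * b)"] True show False by (simp add: field_simps)
    qed
    with True show ?thesis by simp
  next
    case False
    with c have "c > 0" by simp
    from key[of "b / c"] have "0 \<le> (a - 2 * (b / c) * b + (b / c)\<^sup>2 * c) * c"
      using c by simp
    also have "\<dots> = a * c - b\<^sup>2" using \<open>c > 0\<close> by (simp add: field_simps power2_eq_square)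
    finally show ?thesis by simp
  qed
  then show ?thesis unfolding a_def b_def c_def .
qed

lemma Cauchy_Schwarz_integral_abs:
  assumes "square_integrable M f" "square_integrable M g"
  shows "(\<integral>x. \<bar>f x * g x\<bar> \<partial>M) \<le> sqrt (\<integral>x. (f x)\<^sup>2 \<partial>M) * sqrt (\<integral>x. (g x)\<^sup>2 \<partial>M)"
proof -
  have "square_integrable M (\<lambda>x. \<bar>f x\<bar>)" "square_integrable M (\<lambda>x. \<bar>g x\<bar>)"
    using assms by (auto simp: square_integrable_def)
  from Cauchy_Schwarz_integral[OF this]
  have "(\<integral>x. \<bar>f x * g x\<bar> \<partial>M)\<^sup>2 \<le> (\<integral>x. (f x)\<^sup>2 \<partial>M) * (\<integral>x. (g x)\<^sup>2 \<partial>M)"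
    by (simp add: abs_mult)
  then show ?thesis unfolding real_sqrt_mult[symmetric] by (rule real_le_rsqrt)
qed

lemma (in prob_space) expectation_abs_le_sqrt:
  assumes "square_integrable M f"
  shows "expectation (\<lambda>x. \<bar>f x\<bar>) \<le> sqrt (expectation (\<lambda>x. (f x)\<^sup>2))"
proof -
  have "square_integrable M (\<lambda>_. 1)"
    by (simp add: square_integrable_def)
  from Cauchy_Schwarz_integral_abs[OF assms this] show ?thesis by (simp add: prob_space)
qed

text \<open>Continuity of the inner product: the difference is du dv + u' dv + du v', and
  Cauchy-Schwarz handles each term. It carries Hermite coefficients, norms and correlations from
  trigonometric sums to general functions.\<close>

lemma tendsto_integral_mult_L2:
  fixes u v :: "nat \<Rightarrow> 'a \<Rightarrow> real"
  assumes u: "\<And>n. square_integrable M (u n)" "square_integrable M u'"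
    "(\<lambda>n. \<integral>x. (u n x - u' x)\<^sup>2 \<partial>M) \<longlonglongrightarrow> 0"
    and v: "\<And>n. square_integrable M (v n)" "square_integrable M v'"
    "(\<lambda>n. \<integral>x. (v n x - v' x)\<^sup>2 \<partial>M) \<longlonglongrightarrow> 0"
  shows "(\<lambda>n. \<integral>x. u n x * v n x \<partial>M) \<longlonglongrightarrow> (\<integral>x. u' x * v' x \<partial>M)"
proof -
  let ?nu = "\<lambda>n. \<integral>x. (u n x - u' x)\<^sup>2 \<partial>M" and ?nv = "\<lambda>n. \<integral>x. (v n x - v' x)\<^sup>2 \<partial>M"
  have du: "square_integrable M (\<lambda>x. u n x - u' x)" for n
    using u by (intro square_integrable_diff)
  have dv: "square_integrable M (\<lambda>x. v n x - v' x)" for n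
    using v by (intro square_integrable_diff)
  have "(\<lambda>n. \<integral>x. (u n x - u' x) * (v n x - v' x) \<partial>M) \<longlonglongrightarrow> 0"
  proof (rule Lim_null_comparison)
    show "(\<lambda>n. sqrt (?nu n * ?nv n)) \<longlonglongrightarrow> 0"
      using tendsto_real_sqrt[OF tendsto_mult[OF u(3) v(3)]] by simp
    show "\<forall>\<^sub>F n in sequentially. norm (\<integral>x. (u n x - u' x) * (v n x - v' x) \<partial>M) \<le> sqrt (?nu n * ?nv n)"
      by (intro always_eventually allI real_le_rsqrt) (use Cauchy_Schwarz_integral[OF du dv] in simp)
  qed
  moreover have "(\<lambda>n. \<integral>x. u' x * (v n x - v' x) \<partial>M) \<longlonglongrightarrow> 0"
  proof (rule Lim_null_comparison)
    show "(\<lambda>n. sqrt ((\<integral>x. (u' x)\<^sup>2 \<partial>M) * ?nv n)) \<longlonglongrightarrow> 0"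
      using tendsto_real_sqrt[OF tendsto_mult[OF tendsto_const v(3)]] by simp
    show "\<forall>\<^sub>F n in sequentially. norm (\<integral>x. u' x * (v n x - v' x) \<partial>M) \<le> sqrt ((\<integral>x. (u' x)\<^sup>2 \<partial>M) * ?nv n)"
      by (intro always_eventually allI real_le_rsqrt) (use Cauchy_Schwarz_integral[OF u(2) dv] in simp)
  qed
  moreover have "(\<lambda>n. \<integral>x. (u n x - u' x) * v' x \<partial>M) \<longlonglongrightarrow> 0"
  proof (rule Lim_null_comparison)
    show "(\<lambda>n. sqrt (?nu n * (\<integral>x. (v' x)\<^sup>2 \<partial>M))) \<longlonglongrightarrow> 0"
      using tendsto_real_sqrt[OF tendsto_mult[OF u(3) tendsto_const]] by simp
    show "\<forall>\<^sub>F n in sequentially. norm (\<integral>x. (u n x - u' x) * v' x \<partial>M) \<le> sqrt (?nu n * (\<integral>x. (v' x)\<^sup>2 \<partial>M))"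
      by (intro always_eventually allI real_le_rsqrt) (use Cauchy_Schwarz_integral[OF du v(2)] in simp)
  qed
  ultimately have "(\<lambda>n. (\<integral>x. (u n x - u' x) * (v n x - v' x) \<partial>M) + (\<integral>x. u' x * (v n x - v' x) \<partial>M)
     + (\<integral>x. (u n x - u' x) * v' x \<partial>M) + (\<integral>x. u' x * v' x \<partial>M)) \<longlonglongrightarrow> 0 + 0 + 0 + (\<integral>x. u' x * v' x \<partial>M)"
    by (intro tendsto_add tendsto_const)
  moreover have "(\<integral>x. (u n x - u' x) * (v n x - v' x) \<partial>M) + (\<integral>x. u' x * (v n x - v' x) \<partial>M)
     + (\<integral>x. (u n x - u' x) * v' x \<partial>M) + (\<integral>x. u' x * v' x \<partial>M) = (\<integral>x. u n x * v n x \<partial>M)" for n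
  proof -
    have "(\<integral>x. (u n x - u' x) * (v n x - v' x) \<partial>M) + (\<integral>x. u' x * (v n x - v' x) \<partial>M)
     + (\<integral>x. (u n x - u' x) * v' x \<partial>M) + (\<integral>x. u' x * v' x \<partial>M)
     = (\<integral>x. (u n x - u' x) * (v n x - v' x) + u' x * (v n x - v' x) + (u n x - u' x) * v' x + u' x * v' x \<partial>M)"
      using square_integrable_mult[OF du dv] square_integrable_mult[OF u(2) dv]
        square_integrable_mult[OF du v(2)] square_integrable_mult[OF u(2) v(2)]
      by simp
    also have "\<dots> = (\<integral>x. u n x * v n x \<partial>M)"
      by (rule Bochner_Integration.integral_cong) (auto simp: algebra_simps)
    finally show ?thesis .
  qed
  ultimately show ?thesis by simp
qed

section \<open>Hermite polynomials\<close>

text \<open>The probabilists' polynomials, generated by x - d/dx, the adjoint of the derivative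
  under the Gaussian law. In this form \<open>Hermite_ibp\<close> follows from one integration by
  parts.\<close>

primrec Hermite :: "nat \<Rightarrow> real poly" where
  "Hermite 0 = 1"
| "Hermite (Suc n) = [:0, 1:] * Hermite n - pderiv (Hermite n)"

abbreviation He :: "nat \<Rightarrow> real \<Rightarrow> real" where
  "He n \<equiv> poly (Hermite n)"

section \<open>Functions of polynomial growth and one-dimensional Gaussian integration by
  parts\<close>

lemma prob_space_std_normal [simp]: "prob_space std_normal_distribution"
  by (rule prob_space_normal_density) simp

text \<open>The powers of 1 + x^2 are at least 1, so exponents may be increased freely, and they are
  polynomials, hence integrable under the Gaussian law.\<close>

definition poly_growth :: "(real \<Rightarrow> real) \<Rightarrow> bool" where
  "poly_growth g \<longleftrightarrow> (\<exists>C N. \<forall>x. \<bar>g x\<bar> \<le> C * (1 + x\<^sup>2) ^ N)"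

lemma poly_growth_mult:
  assumes "poly_growth f" "poly_growth g" shows "poly_growth (\<lambda>x. f x * g x)"
proof -
  obtain C N where 1: "\<And>x. \<bar>f x\<bar> \<le> C * (1 + x\<^sup>2) ^ N" using assms by (auto simp: poly_growth_def)
  obtain D K where 2: "\<And>x. \<bar>g x\<bar> \<le> D * (1 + x\<^sup>2) ^ K" using assms by (auto simp: poly_growth_def)
  have "\<bar>f x * g x\<bar> \<le> (C * D) * (1 + x\<^sup>2) ^ (N + K)" for x
    using mult_mono[OF 1[of x] 2[of x]] order_trans[OF abs_ge_zero 1[of x]]
    by (simp add: abs_mult power_add mult_ac)
  then show ?thesis unfolding poly_growth_def by blast
qed

lemma poly_growth_add:
  assumes "poly_growth f" "poly_growth g" shows "poly_growth (\<lambda>x. f x + g x)"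
proof -
  obtain C N where 1: "\<And>x. \<bar>f x\<bar> \<le> C * (1 + x\<^sup>2) ^ N" using assms by (auto simp: poly_growth_def)
  obtain D K where 2: "\<And>x. \<bar>g x\<bar> \<le> D * (1 + x\<^sup>2) ^ K" using assms by (auto simp: poly_growth_def)
  have "\<bar>f x + g x\<bar> \<le> (C + D) * (1 + x\<^sup>2) ^ (N + K)" for x
  proof -
    have "0 \<le> C" "0 \<le> D" using order_trans[OF abs_ge_zero 1[of 0]] order_trans[OF abs_ge_zero 2[of 0]] by auto
    then have "C * (1 + x\<^sup>2) ^ N \<le> C * (1 + x\<^sup>2) ^ (N + K)" "D * (1 + x\<^sup>2) ^ K \<le> D * (1 + x\<^sup>2) ^ (N + K)"
      by (auto intro!: mult_left_mono power_increasing)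
    with 1[of x] 2[of x] show ?thesis by (simp add: algebra_simps)
  qed
  then show ?thesis unfolding poly_growth_def by blast
qed

lemma poly_growth_bounded: "(\<And>x. \<bar>f x\<bar> \<le> B) \<Longrightarrow> poly_growth f"
  unfolding poly_growth_def by (rule exI[of _ B], rule exI[of _ 0]) simp

lemma poly_growth_poly: "poly_growth (poly p)"
proof (induction p)
  case 0
  show ?case by (rule poly_growth_bounded[of _ 0]) simp
next
  case (pCons a p)
  then obtain C N where 1: "\<And>x. \<bar>poly p x\<bar> \<le> C * (1 + x\<^sup>2) ^ N" by (auto simp: poly_growth_def)
  have "\<bar>poly (pCons a p) x\<bar> \<le> (\<bar>a\<bar> + C) * (1 + x\<^sup>2) ^ (Suc N)" for x
  proof -
    have x: "\<bar>x\<bar> \<le> 1 + x\<^sup>2"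
    proof -
      have "0 \<le> (\<bar>x\<bar> - 1)\<^sup>2 + \<bar>x\<bar>" by simp
      then have "0 \<le> x\<^sup>2 + 1 - \<bar>x\<bar>" by (simp add: power2_eq_square algebra_simps)
      then show ?thesis by simp
    qed
    have "\<bar>a\<bar> * 1 \<le> \<bar>a\<bar> * (1 + x\<^sup>2) ^ (Suc N)" by (intro mult_left_mono one_le_power) auto
    moreover have "\<bar>x\<bar> * \<bar>poly p x\<bar> \<le> (1 + x\<^sup>2) * (C * (1 + x\<^sup>2) ^ N)"
      by (intro mult_mono x 1) auto
    ultimately show ?thesis
      using abs_triangle_ineq[of a "x * poly p x"] by (simp add: abs_mult algebra_simps)
  qed
  then show ?case unfolding poly_growth_def by blast
qed

lemma std_normal_integral:
  assumes "f \<in> borel_measurable borel"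
  shows "(\<integral>x. f x \<partial>std_normal_distribution) = (\<integral>x. std_normal_density x * f x \<partial>lborel)"
  using assms by (subst integral_density) auto

lemma std_normal_integrable_iff:
  fixes f :: "real \<Rightarrow> real"
  assumes "f \<in> borel_measurable borel"
  shows "integrable std_normal_distribution f \<longleftrightarrow> integrable lborel (\<lambda>x. std_normal_density x * f x)"
  using assms by (subst integrable_density) auto

lemma integrable_std_normal_poly: "integrable std_normal_distribution (poly p)"
  unfolding poly_altdef
  by (intro Bochner_Integration.integrable_sum integrable_mult_right
      integrable_std_normal_distribution_moment)

lemma integrable_std_normal_poly_growth:
  assumes "poly_growth f" and [measurable]: "f \<in> borel_measurable borel"
  shows "integrable std_normal_distribution f"
proof -
  obtain C N where 1: "\<And>x. \<bar>f x\<bar> \<le> C * (1 + x\<^sup>2) ^ N" using assms by (auto simp: poly_growth_def)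
  have "integrable std_normal_distribution (\<lambda>x. C * (1 + x\<^sup>2) ^ N)"
  proof (rule integrable_mult_right)
    have "(\<lambda>x::real. (1 + x\<^sup>2) ^ N) = poly ([:1, 0, 1:] ^ N)"
      by (auto simp: power2_eq_square)
    then show "integrable std_normal_distribution (\<lambda>x. (1 + x\<^sup>2) ^ N)"
      using integrable_std_normal_poly by metis
  qed
  then show ?thesis
    by (rule Bochner_Integration.integrable_bound) (use 1 in \<open>auto intro!: AE_I2 intro: order_trans[OF _ abs_ge_self]\<close>)
qed

lemma square_integrable_poly_growth:
  assumes "poly_growth f" and [measurable]: "f \<in> borel_measurable borel"
  shows "square_integrable std_normal_distribution f"
  using integrable_std_normal_poly_growth[OF poly_growth_mult[OF assms(1) assms(1)]]
  by (auto simp: square_integrable_def power2_eq_square)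

lemma borel_measurable_poly [measurable]:
  "poly p \<in> borel_measurable (borel :: real measure)"
  by (rule borel_measurable_continuous_onI) (intro continuous_on_poly continuous_on_id)

lemma square_integrable_poly: "square_integrable std_normal_distribution (poly p)"
  by (rule square_integrable_poly_growth) (auto intro: poly_growth_poly)

text \<open>With u = (1 + x^2)/2 the product is a constant times u^N exp(-u). The general filter
  covers both ends of the line.\<close>

lemma tendsto_std_normal_density_growth:
  assumes "filterlim (\<lambda>x::real. (1 + x\<^sup>2) / 2) at_top F"
  shows "((\<lambda>x. std_normal_density x * (1 + x\<^sup>2) ^ N) \<longlongrightarrow> 0) F"
proof -
  have "((\<lambda>x. ((1 + x\<^sup>2) / 2) ^ N / exp ((1 + x\<^sup>2) / 2)) \<longlongrightarrow> 0) F"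
    by (rule filterlim_compose[OF tendsto_power_div_exp_0 assms])
  from tendsto_mult[OF tendsto_const[of "exp (1/2) * 2 ^ N / sqrt (2 * pi)"] this]
  moreover have "exp (1/2) * 2 ^ N / sqrt (2 * pi) * (((1 + x\<^sup>2) / 2) ^ N / exp ((1 + x\<^sup>2) / 2))
      = std_normal_density x * (1 + x\<^sup>2) ^ N" for x :: real
  proof -
    have "exp ((1 + x\<^sup>2) / 2) = exp (1/2) / exp (- x\<^sup>2 / 2)"
      by (simp only: exp_diff[symmetric]) (simp add: add_divide_distrib)
    then show ?thesis by (simp only: std_normal_density_def power_divide) simp
  qed
  ultimately show ?thesis by simp
qed

lemma filterlim_half_square:
  fixes f :: "'a \<Rightarrow> real"
  assumes "filterlim f at_top F"
  shows "filterlim (\<lambda>x. (1 + (f x)\<^sup>2) / 2) at_top F"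
proof (rule filterlim_at_top_mono[OF assms])
  have "t \<le> (1 + t\<^sup>2) / 2" for t :: real
    using zero_le_power2[of "t - 1"] by (simp add: power2_eq_square algebra_simps)
  then show "\<forall>\<^sub>F x in F. f x \<le> (1 + (f x)\<^sup>2) / 2" by simp
qed

text \<open>The fundamental theorem of calculus on the whole line for the product of g with the
  density, whose derivative is g' - x g times the density; the boundary terms vanish by the growth
  condition.\<close>

lemma std_normal_ibp:
  fixes g g' :: "real \<Rightarrow> real"
  assumes der: "\<And>x. (g has_real_derivative g' x) (at x)"
    and cont: "\<And>x. isCont g' x" and growth: "poly_growth g" "poly_growth g'"
  shows "(\<integral>x. x * g x \<partial>std_normal_distribution) = (\<integral>x. g' x \<partial>std_normal_distribution)"
proof -
  let ?phi = std_normal_density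
  have "isCont g x" for x using der by (rule DERIV_isCont)
  then have [measurable]: "g' \<in> borel_measurable borel" "g \<in> borel_measurable borel"
    using cont by (auto intro!: borel_measurable_continuous_onI simp: continuous_on_eq_continuous_at)
  have pg: "poly_growth (\<lambda>x. x * g x)"
    using poly_growth_mult[OF poly_growth_poly[of "[:0, 1:]"] growth(1)] by simp
  have int1: "integrable lborel (\<lambda>x. ?phi x * g' x)"
    using integrable_std_normal_poly_growth[OF growth(2)] std_normal_integrable_iff[of g'] by simp
  have int2: "integrable lborel (\<lambda>x. ?phi x * (x * g x))"
    using integrable_std_normal_poly_growth[OF pg] std_normal_integrable_iff[of "\<lambda>x. x * g x"] by simp
  have dphi: "(?phi has_real_derivative - x * ?phi x) (at x)" for x
    unfolding std_normal_density_def
    by (auto intro!: derivative_eq_intros simp: power2_eq_square field_simps)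
  obtain C N where CN: "\<And>x. \<bar>g x\<bar> \<le> C * (1 + x\<^sup>2) ^ N" using growth by (auto simp: poly_growth_def)
  have lim: "((\<lambda>x. ?phi x * g x) \<longlongrightarrow> 0) F"
    if "filterlim (\<lambda>x::real. (1 + x\<^sup>2) / 2) at_top F" for F
  proof (rule Lim_null_comparison)
    show "((\<lambda>x. C * (?phi x * (1 + x\<^sup>2) ^ N)) \<longlongrightarrow> 0) F"
      using tendsto_mult[OF tendsto_const tendsto_std_normal_density_growth[OF that]] by simp
    have "norm (?phi x * g x) \<le> C * (?phi x * (1 + x\<^sup>2) ^ N)" for x
      using mult_left_mono[OF CN[of x] normal_density_nonneg[of 0 1 x]] by (simp add: abs_mult mult_ac)
    then show "\<forall>\<^sub>F x in F. norm (?phi x * g x) \<le> C * (?phi x * (1 + x\<^sup>2) ^ N)" by simp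
  qed
  have "(LBINT x=-\<infinity>..\<infinity>. ?phi x * g' x - ?phi x * (x * g x)) = 0 - 0"
  proof (rule interval_integral_FTC_integrable[where F="\<lambda>x. ?phi x * g x"])
    show "((\<lambda>x. ?phi x * g x) has_vector_derivative ?phi x * g' x - ?phi x * (x * g x)) (at x)" for x
      unfolding has_real_derivative_iff_has_vector_derivative[symmetric]
      by (auto intro!: derivative_eq_intros dphi der simp: algebra_simps)
    show "isCont (\<lambda>x. ?phi x * g' x - ?phi x * (x * g x)) x" for x
      using cont \<open>\<And>x. isCont g x\<close> DERIV_isCont[OF dphi]
      by (intro isCont_diff isCont_mult continuous_ident) auto
    show "set_integrable lborel (einterval (- \<infinity>) \<infinity>) (\<lambda>x. ?phi x * g' x - ?phi x * (x * g x))"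
      using int1 int2 by (simp add: set_integrable_def)
    have "filterlim (\<lambda>x::real. (1 + x\<^sup>2) / 2) at_top at_top"
      by (rule filterlim_half_square[OF filterlim_ident])
    from lim[OF this] show "(((\<lambda>x. ?phi x * g x) \<circ> real_of_ereal) \<longlongrightarrow> 0) (at_left \<infinity>)"
      by (simp add: ereal_tendsto_simps)
    have "filterlim (\<lambda>x::real. (1 + x\<^sup>2) / 2) at_top at_bot"
      using filterlim_half_square[OF filterlim_uminus_at_top_at_bot] by simp
    from lim[OF this] show "(((\<lambda>x. ?phi x * g x) \<circ> real_of_ereal) \<longlongrightarrow> 0) (at_right (-\<infinity>))"
      by (simp add: ereal_tendsto_simps)
  qed auto
  then have "(\<integral>x. ?phi x * g' x - ?phi x * (x * g x) \<partial>lborel) = 0"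
    by (simp add: interval_lebesgue_integral_def set_lebesgue_integral_def)
  with int1 int2 show ?thesis by (simp add: std_normal_integral)
qed

text \<open>Apply \<open>std_normal_ibp\<close> to the product of the lower Hermite polynomial with
  g: the term in which the polynomial is differentiated is the one that the recursion
  subtracts.\<close>

lemma Hermite_ibp:
  assumes der: "\<And>x. (g has_real_derivative g' x) (at x)"
    and cont: "\<And>x. isCont g' x" and growth: "poly_growth g" "poly_growth g'"
  shows "(\<integral>x. He (Suc n) x * g x \<partial>std_normal_distribution) = (\<integral>x. He n x * g' x \<partial>std_normal_distribution)"
proof -
  let ?p = "Hermite n"
  have "isCont g x" for x using der by (rule DERIV_isCont)
  then have [measurable]: "g' \<in> borel_measurable borel" "g \<in> borel_measurable borel"
    using cont by (auto intro!: borel_measurable_continuous_onI simp: continuous_on_eq_continuous_at)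
  have si: "square_integrable std_normal_distribution g" "square_integrable std_normal_distribution g'"
    using growth by (auto intro: square_integrable_poly_growth)
  have i: "integrable std_normal_distribution (\<lambda>x. poly q x * g x)"
    "integrable std_normal_distribution (\<lambda>x. poly q x * g' x)" for q
    by (rule square_integrable_mult[OF square_integrable_poly si(1)],
        rule square_integrable_mult[OF square_integrable_poly si(2)])
  have "(\<integral>x. x * (poly ?p x * g x) \<partial>std_normal_distribution) =
    (\<integral>x. poly (pderiv ?p) x * g x + poly ?p x * g' x \<partial>std_normal_distribution)"
  proof (rule std_normal_ibp)
    show "((\<lambda>x. poly ?p x * g x) has_real_derivative poly (pderiv ?p) x * g x + poly ?p x * g' x) (at x)" for x
      by (rule DERIV_cong[OF DERIV_mult[OF poly_DERIV der]]) simp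
    show "isCont (\<lambda>x. poly (pderiv ?p) x * g x + poly ?p x * g' x) x" for x
      using cont \<open>\<And>x. isCont g x\<close> by (intro isCont_add isCont_mult poly_isCont) auto
    show "poly_growth (\<lambda>x. poly ?p x * g x)" by (rule poly_growth_mult[OF poly_growth_poly growth(1)])
    have "poly_growth (\<lambda>x. poly (pderiv ?p) x * g x)" "poly_growth (\<lambda>x. poly ?p x * g' x)"
      by (rule poly_growth_mult[OF poly_growth_poly growth(1)], rule poly_growth_mult[OF poly_growth_poly growth(2)])
    then show "poly_growth (\<lambda>x. poly (pderiv ?p) x * g x + poly ?p x * g' x)"
      by (rule poly_growth_add)
  qed
  also have "\<dots> = (\<integral>x. poly (pderiv ?p) x * g x \<partial>std_normal_distribution) + (\<integral>x. poly ?p x * g' x \<partial>std_normal_distribution)"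
    by (rule Bochner_Integration.integral_add[OF i(1) i(2)])
  also have "(\<integral>x. x * (poly ?p x * g x) \<partial>std_normal_distribution) =
    (\<integral>x. poly ([:0,1:] * ?p) x * g x \<partial>std_normal_distribution)"
    by (rule Bochner_Integration.integral_cong) (auto simp: mult.assoc)
  finally have "(\<integral>x. poly ([:0,1:] * ?p) x * g x \<partial>std_normal_distribution) =
    (\<integral>x. poly (pderiv ?p) x * g x \<partial>std_normal_distribution) + (\<integral>x. poly ?p x * g' x \<partial>std_normal_distribution)" .
  moreover have "(\<integral>x. He (Suc n) x * g x \<partial>std_normal_distribution) =
     (\<integral>x. poly ([:0,1:] * ?p) x * g x - poly (pderiv ?p) x * g x \<partial>std_normal_distribution)"
    by (rule Bochner_Integration.integral_cong) (auto simp: left_diff_distrib)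
  moreover have "\<dots> = (\<integral>x. poly ([:0,1:] * ?p) x * g x \<partial>std_normal_distribution) -
     (\<integral>x. poly (pderiv ?p) x * g x \<partial>std_normal_distribution)"
    by (rule Bochner_Integration.integral_diff[OF i(1) i(1)])
  ultimately show ?thesis by linarith
qed

section \<open>Trigonometric sums are dense in \<open>L\<^sup>2\<close>\<close>

text \<open>This class serves two ends: its Gaussian expectations are explicit, and the
  product-to-sum formulas make it an algebra, as Stone-Weierstrass demands.\<close>

inductive_set trig_sums :: "(real \<Rightarrow> real) set" where
  cos: "(\<lambda>x. cos (s * x)) \<in> trig_sums"
| sin: "(\<lambda>x. sin (s * x)) \<in> trig_sums"
| add: "f \<in> trig_sums \<Longrightarrow> g \<in> trig_sums \<Longrightarrow> (\<lambda>x. f x + g x) \<in> trig_sums"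
| cmult: "f \<in> trig_sums \<Longrightarrow> (\<lambda>x. c * f x) \<in> trig_sums"

lemma trig_sums_const: "(\<lambda>x. c) \<in> trig_sums"
  using trig_sums.cmult[OF trig_sums.cos[of 0], of c] by simp

lemma continuous_on_trig_sums: "f \<in> trig_sums \<Longrightarrow> continuous_on A f"
  by (induction rule: trig_sums.induct) (auto intro!: continuous_intros)

lemma trig_sums_measurable [measurable (raw)]: "f \<in> trig_sums \<Longrightarrow> f \<in> borel_measurable borel"
  by (auto intro!: borel_measurable_continuous_onI continuous_on_trig_sums)

lemma trig_sums_bounded: "f \<in> trig_sums \<Longrightarrow> \<exists>B. \<forall>x. \<bar>f x\<bar> \<le> B"
proof (induction rule: trig_sums.induct)
  case (add f g)
  then obtain B C where "\<forall>x. \<bar>f x\<bar> \<le> B" "\<forall>x. \<bar>g x\<bar> \<le> C" by auto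
  then have "\<forall>x. \<bar>f x + g x\<bar> \<le> B + C" by (metis abs_triangle_ineq add_mono order_trans)
  then show ?case by blast
next
  case (cmult f c)
  then obtain B where "\<forall>x. \<bar>f x\<bar> \<le> B" by auto
  then have "\<forall>x. \<bar>c * f x\<bar> \<le> \<bar>c\<bar> * B" by (simp add: abs_mult mult_left_mono)
  then show ?case by blast
qed (auto intro: exI[of _ 1])

lemma trig_sums_mult:
  assumes "f \<in> trig_sums" "g \<in> trig_sums"
  shows "(\<lambda>x. f x * g x) \<in> trig_sums"
  using assms(1)
proof (induction rule: trig_sums.induct)
  case (add f f')
  from trig_sums.add[OF add.IH] show ?case by (simp add: distrib_right)
next
  case (cmult f c)
  from trig_sums.cmult[OF cmult.IH, of c] show ?case by (simp add: mult.assoc)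
next
  case (cos s)
  show ?case using assms(2)
  proof (induction rule: trig_sums.induct)
    case (cos t)
    have "(\<lambda>x. 1/2 * (cos ((s - t) * x) + cos ((s + t) * x))) \<in> trig_sums"
      by (intro trig_sums.intros)
    then show ?case unfolding cos_times_cos by (simp add: algebra_simps add_divide_distrib diff_divide_distrib)
  next
    case (sin t)
    have "(\<lambda>x. 1/2 * (sin ((s + t) * x) + (-1) * sin ((s - t) * x))) \<in> trig_sums"
      by (intro trig_sums.intros)
    then show ?case unfolding cos_times_sin by (simp add: algebra_simps add_divide_distrib diff_divide_distrib)
  next
    case (add f f')
    from trig_sums.add[OF add.IH] show ?case by (simp add: distrib_left)
  next
    case (cmult f c)
    from trig_sums.cmult[OF cmult.IH, of c] show ?case by (simp add: mult.left_commute)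
  qed
next
  case (sin s)
  show ?case using assms(2)
  proof (induction rule: trig_sums.induct)
    case (cos t)
    have "(\<lambda>x. 1/2 * (sin ((s + t) * x) + sin ((s - t) * x))) \<in> trig_sums"
      by (intro trig_sums.intros)
    then show ?case unfolding sin_times_cos by (simp add: algebra_simps add_divide_distrib diff_divide_distrib)
  next
    case (sin t)
    have "(\<lambda>x. 1/2 * (cos ((s - t) * x) + (-1) * cos ((s + t) * x))) \<in> trig_sums"
      by (intro trig_sums.intros)
    then show ?case unfolding sin_times_sin by (simp add: algebra_simps add_divide_distrib diff_divide_distrib)
  next
    case (add f f')
    from trig_sums.add[OF add.IH] show ?case by (simp add: distrib_left)
  next
    case (cmult f c)
    from trig_sums.cmult[OF cmult.IH, of c] show ?case by (simp add: mult.left_commute)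
  qed
qed

lemma trig_sums_polynomial:
  fixes q :: "real \<Rightarrow> real"
  assumes "real_polynomial_function q" "p \<in> trig_sums"
  shows "(\<lambda>x. q (p x)) \<in> trig_sums"
  using assms(1)
proof (induction rule: real_polynomial_function.induct)
  case (linear f)
  interpret bounded_linear f by fact
  have "f y = f 1 * y" for y using scaleR[of y 1] by (simp add: mult.commute)
  then have "(\<lambda>x. f (p x)) = (\<lambda>x. f 1 * p x)" by blast
  then show ?case using trig_sums.cmult[OF assms(2), of "f 1"] by metis
next
  case (const c) show ?case by (rule trig_sums_const)
next
  case (add f g) then show ?case by (intro trig_sums.add)
next
  case (mult f g) then show ?case by (intro trig_sums_mult)
qed

lemma trig_sums_uniform_approx:
  assumes f: "continuous_on UNIV f" and e: "0 < e"
  shows "\<exists>g\<in>trig_sums. \<forall>x\<in>{- real N..real N}. \<bar>f x - g x\<bar> < e"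
proof -
  interpret function_ring_on trig_sums "{- real N..real N}"
  proof
    fix x y assume x: "x \<in> {- real N..real N}" and y: "y \<in> {- real N..real N}" and "x \<noteq> y"
    then have N: "real N > 0" by auto
    have b: "- (pi/2) \<le> z / real N" "z / real N \<le> pi/2" if "z \<in> {- real N..real N}" for z
    proof -
      have "-1 \<le> z / real N" "z / real N \<le> 1" using that N by (auto simp: divide_simps)
      with pi_ge_two show "- (pi/2) \<le> z / real N" "z / real N \<le> pi/2" by linarith+
    qed
    \<comment> \<open>The slope 1/N maps the interval into [-1, 1], where the sine is injective; so
      this single function separates the points.\<close>
    have "sin (x / real N) \<noteq> sin (y / real N)"
    proof
      assume "sin (x / real N) = sin (y / real N)"
      then have "x / real N = y / real N" using sin_inj_pi[OF b[OF x] b[OF y]] by blast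
      with N \<open>x \<noteq> y\<close> show False by simp
    qed
    then have "sin (1 / real N * x) \<noteq> sin (1 / real N * y)" by simp
    then show "\<exists>f\<in>trig_sums. f x \<noteq> f y" by (intro bexI[OF _ trig_sums.sin[of "1 / real N"]])
  qed (rule compact_Icc continuous_on_trig_sums trig_sums.add trig_sums_mult trig_sums_const; assumption)+
  show ?thesis
    using Stone_Weierstrass_basic[OF continuous_on_subset[OF f] e] by simp
qed

section \<open>Mean square approximation by trigonometric sums for an arbitrary law on the
  line\<close>

context real_distribution
begin

definition trig_approx :: "(real \<Rightarrow> real) \<Rightarrow> bool" where
  "trig_approx f \<longleftrightarrow> square_integrable M f \<and> (\<forall>e>0. \<exists>g\<in>trig_sums. (\<integral>x. (f x - g x)\<^sup>2 \<partial>M) < e)"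

lemma trig_approx_square_integrable: "trig_approx f \<Longrightarrow> square_integrable M f"
  by (simp add: trig_approx_def)

lemma trig_approxE:
  assumes "trig_approx f" "e > 0"
  obtains g where "g \<in> trig_sums" "(\<integral>x. (f x - g x)\<^sup>2 \<partial>M) < e"
  using assms unfolding trig_approx_def by blast

lemma square_integrable_trig_sums: "f \<in> trig_sums \<Longrightarrow> square_integrable M f"
  using trig_sums_bounded[of f] square_integrable_bounded[OF finite_measure_axioms, of f]
  by (auto simp: trig_sums_measurable)

lemma integral_square_add_le:
  assumes "square_integrable M f" "square_integrable M g"
  shows "(\<integral>x. (f x + g x)\<^sup>2 \<partial>M) \<le> 2 * (\<integral>x. (f x)\<^sup>2 \<partial>M) + 2 * (\<integral>x. (g x)\<^sup>2 \<partial>M)"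
proof -
  have "(\<integral>x. (f x + g x)\<^sup>2 \<partial>M) \<le> (\<integral>x. 2 * (f x)\<^sup>2 + 2 * (g x)\<^sup>2 \<partial>M)"
  proof (rule integral_mono)
    show "integrable M (\<lambda>x. (f x + g x)\<^sup>2)"
      using square_integrable_add[OF assms] by (simp add: square_integrable_def)
    show "integrable M (\<lambda>x. 2 * (f x)\<^sup>2 + 2 * (g x)\<^sup>2)"
      using assms by (simp add: square_integrable_def)
    show "(f x + g x)\<^sup>2 \<le> 2 * (f x)\<^sup>2 + 2 * (g x)\<^sup>2" for x
      using sum_squares_bound[of "f x" "g x"] by (simp add: power2_sum)
  qed
  also have "\<dots> = 2 * (\<integral>x. (f x)\<^sup>2 \<partial>M) + 2 * (\<integral>x. (g x)\<^sup>2 \<partial>M)"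
    using assms by (simp add: square_integrable_def)
  finally show ?thesis .
qed

lemma trig_approx_closure:
  assumes "square_integrable M f" "\<And>e. e > 0 \<Longrightarrow> \<exists>g. trig_approx g \<and> (\<integral>x. (f x - g x)\<^sup>2 \<partial>M) < e"
  shows "trig_approx f"
  unfolding trig_approx_def
proof (intro conjI assms(1) allI impI)
  fix e :: real assume "e > 0"
  then obtain g where g: "trig_approx g" "(\<integral>x. (f x - g x)\<^sup>2 \<partial>M) < e / 4"
    using assms(2)[of "e / 4"] by auto
  have "e / 4 > 0" using \<open>e > 0\<close> by simp
  with g(1) obtain h where h: "h \<in> trig_sums" "(\<integral>x. (g x - h x)\<^sup>2 \<partial>M) < e / 4"
    by (rule trig_approxE)
  have "(\<integral>x. ((f x - g x) + (g x - h x))\<^sup>2 \<partial>M) \<le> 2 * (\<integral>x. (f x - g x)\<^sup>2 \<partial>M) + 2 * (\<integral>x. (g x - h x)\<^sup>2 \<partial>M)"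
    using assms(1) g(1) h(1)
    by (intro integral_square_add_le square_integrable_diff)
       (simp_all add: trig_approx_square_integrable square_integrable_trig_sums)
  with g h have "(\<integral>x. (f x - h x)\<^sup>2 \<partial>M) < e" by simp
  with h show "\<exists>g\<in>trig_sums. (\<integral>x. (f x - g x)\<^sup>2 \<partial>M) < e" by blast
qed

lemma trig_approx_lim:
  assumes "square_integrable M f" "\<And>n. trig_approx (g n)" "(\<lambda>n. \<integral>x. (f x - g n x)\<^sup>2 \<partial>M) \<longlonglongrightarrow> 0"
  shows "trig_approx f"
proof (rule trig_approx_closure[OF assms(1)])
  fix e :: real assume "e > 0"
  from order_tendstoD(2)[OF assms(3) this] obtain n where "(\<integral>x. (f x - g n x)\<^sup>2 \<partial>M) < e"
    using eventually_happens'[OF sequentially_bot] by blast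
  with assms(2) show "\<exists>g. trig_approx g \<and> (\<integral>x. (f x - g x)\<^sup>2 \<partial>M) < e" by blast
qed

lemma trig_approx_dominated:
  assumes "square_integrable M f" "\<And>n. trig_approx (g n)" "\<And>x. (\<lambda>n. g n x) \<longlonglongrightarrow> f x"
    and B: "square_integrable M B" "\<And>n x. \<bar>f x - g n x\<bar> \<le> B x"
  shows "trig_approx f"
proof (rule trig_approx_lim[OF assms(1,2)])
  have [measurable]: "f \<in> borel_measurable M" "\<And>n. g n \<in> borel_measurable M"
    using assms by (auto simp: trig_approx_def square_integrable_def)
  have "(\<lambda>n. \<integral>x. (f x - g n x)\<^sup>2 \<partial>M) \<longlonglongrightarrow> (\<integral>x. 0 \<partial>M)"
  proof (rule integral_dominated_convergence[where w="\<lambda>x. (B x)\<^sup>2"])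
    show "integrable M (\<lambda>x. (B x)\<^sup>2)" using B by (simp add: square_integrable_def)
    have "(\<lambda>n. (f x - g n x)\<^sup>2) \<longlonglongrightarrow> (f x - f x)\<^sup>2" for x
      by (intro tendsto_intros assms(3))
    then show "AE x in M. (\<lambda>n. (f x - g n x)\<^sup>2) \<longlonglongrightarrow> 0" by simp
    show "AE x in M. norm ((f x - g n x)\<^sup>2) \<le> (B x)\<^sup>2" for n
    proof (rule AE_I2)
      fix x show "norm ((f x - g n x)\<^sup>2) \<le> (B x)\<^sup>2"
        using power_mono[OF B(2)[of x n] abs_ge_zero, of 2] by simp
    qed
  qed auto
  then show "(\<lambda>n. \<integral>x. (f x - g n x)\<^sup>2 \<partial>M) \<longlonglongrightarrow> 0" by simp
qed

lemma trig_approx_trig_sums: "f \<in> trig_sums \<Longrightarrow> trig_approx f"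
  by (auto simp: trig_approx_def square_integrable_trig_sums intro!: bexI[of _ f])

lemma trig_approx_add:
  assumes "trig_approx f" "trig_approx g" shows "trig_approx (\<lambda>x. f x + g x)"
  unfolding trig_approx_def
proof (intro conjI allI impI)
  show "square_integrable M (\<lambda>x. f x + g x)"
    using assms by (intro square_integrable_add trig_approx_square_integrable)
  fix e :: real assume "e > 0"
  then have "e / 4 > 0" by simp
  from assms(1) this obtain p where p: "p \<in> trig_sums" "(\<integral>x. (f x - p x)\<^sup>2 \<partial>M) < e / 4"
    by (rule trig_approxE)
  from assms(2) \<open>e / 4 > 0\<close> obtain q where q: "q \<in> trig_sums" "(\<integral>x. (g x - q x)\<^sup>2 \<partial>M) < e / 4"
    by (rule trig_approxE)
  have "(\<integral>x. ((f x - p x) + (g x - q x))\<^sup>2 \<partial>M) \<le> 2 * (\<integral>x. (f x - p x)\<^sup>2 \<partial>M) + 2 * (\<integral>x. (g x - q x)\<^sup>2 \<partial>M)"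
    using assms p(1) q(1)
    by (intro integral_square_add_le square_integrable_diff)
       (simp_all add: trig_approx_square_integrable square_integrable_trig_sums)
  with p q have "(\<integral>x. (f x + g x - (p x + q x))\<^sup>2 \<partial>M) < e" by (simp add: add_diff_add)
  with p q show "\<exists>h\<in>trig_sums. (\<integral>x. (f x + g x - h x)\<^sup>2 \<partial>M) < e"
    by (intro bexI[of _ "\<lambda>x. p x + q x"]) (auto intro: trig_sums.add[OF p(1) q(1)])
qed

lemma trig_approx_cmult:
  assumes "trig_approx f" shows "trig_approx (\<lambda>x. c * f x)"
  unfolding trig_approx_def
proof (intro conjI allI impI)
  show "square_integrable M (\<lambda>x. c * f x)"
    using assms by (intro square_integrable_cmult trig_approx_square_integrable)
  fix e :: real assume "e > 0"
  have c: "c\<^sup>2 + 1 > 0" by (simp add: add_nonneg_pos)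
  with \<open>e > 0\<close> have "e / (c\<^sup>2 + 1) > 0" by simp
  with assms obtain p where p: "p \<in> trig_sums" "(\<integral>x. (f x - p x)\<^sup>2 \<partial>M) < e / (c\<^sup>2 + 1)"
    by (rule trig_approxE)
  have "(\<integral>x. (c * f x - c * p x)\<^sup>2 \<partial>M) = c\<^sup>2 * (\<integral>x. (f x - p x)\<^sup>2 \<partial>M)"
    by (simp add: right_diff_distrib[symmetric] power_mult_distrib)
  also have "\<dots> \<le> (c\<^sup>2 + 1) * (\<integral>x. (f x - p x)\<^sup>2 \<partial>M)" by (intro mult_right_mono) auto
  also have "\<dots> < e" using p(2) c by (simp add: field_simps)
  finally show "\<exists>h\<in>trig_sums. (\<integral>x. (c * f x - h x)\<^sup>2 \<partial>M) < e"
    by (intro bexI[of _ "\<lambda>x. c * p x"]) (auto intro: trig_sums.cmult[OF p(1)])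
qed

lemma trig_approx_sum:
  "finite A \<Longrightarrow> (\<And>i. i \<in> A \<Longrightarrow> trig_approx (f i)) \<Longrightarrow> trig_approx (\<lambda>x. \<Sum>i\<in>A. f i x)"
proof (induction A rule: finite_induct)
  case empty
  show ?case using trig_approx_trig_sums[OF trig_sums_const[of 0]] by simp
next
  case (insert a A)
  have "trig_approx (\<lambda>x. f a x + (\<Sum>i\<in>A. f i x))"
    by (rule trig_approx_add) (use insert in auto)
  then show ?case using insert(1,2) by simp
qed

text \<open>A trigonometric sum that is close to \<open>f\<close> on a large interval may be large outside of it;
  composing it with a polynomial close to the truncation at \<open>\<plusminus>1\<close> makes it bounded.\<close>

lemma trig_approx_continuous:
  assumes f: "continuous_on UNIV f" "\<And>x. \<bar>f x\<bar> \<le> 1"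
  shows "trig_approx f"
  unfolding trig_approx_def
proof (intro conjI allI impI)
  have [measurable]: "f \<in> borel_measurable borel" using f(1) by (rule borel_measurable_continuous_onI)
  show sf: "square_integrable M f"
    by (rule square_integrable_bounded[OF finite_measure_axioms, of _ 1]) (auto simp: f)
  fix e :: real assume "e > 0"
  \<comment> \<open>On the large interval the error is at most 2 \<epsilon>, and (2 \<epsilon>)^2 is
    at most 4 \<epsilon> since \<epsilon> is at most 1; elsewhere it is at most 3. With \<epsilon>
    at most e/8 and outer mass below e/20 the total is below e/2 + 9e/20 < e.\<close>
  define \<epsilon> where "\<epsilon> = min 1 (e / 8)"
  have eps: "0 < \<epsilon>" "\<epsilon> \<le> 1" "\<epsilon> \<le> e / 8" using \<open>e > 0\<close> by (auto simp: \<epsilon>_def)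
  have "(\<lambda>n. measure M {- real n..real n}) \<longlonglongrightarrow> measure M (\<Union>n. {- real n..real n})"
    by (rule finite_Lim_measure_incseq) (auto simp: incseq_def)
  moreover have "(\<Union>n. {- real n..real n}) = space M"
  proof -
    have "x \<in> (\<Union>n. {- real n..real n})" for x
      using real_arch_simple[of "\<bar>x\<bar>"] by (auto simp: abs_le_iff minus_le_iff)
    then show ?thesis by auto
  qed
  ultimately have "(\<lambda>n. measure M {- real n..real n}) \<longlonglongrightarrow> 1" by (simp only: prob_space)
  from order_tendstoD(1)[OF this, of "1 - e / 20"] \<open>e > 0\<close>
  obtain N where N: "measure M {- real N..real N} > 1 - e / 20"
    using eventually_happens'[OF sequentially_bot] by force
  obtain p where p: "p \<in> trig_sums" "\<And>x. x \<in> {- real N..real N} \<Longrightarrow> \<bar>f x - p x\<bar> < \<epsilon>"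
    using trig_sums_uniform_approx[OF f(1) eps(1), of N] by blast
  obtain B where B: "\<And>x. \<bar>p x\<bar> \<le> B" using trig_sums_bounded[OF p(1)] by auto
  define clip where "clip = (\<lambda>y::real. max (-1) (min 1 y))"
  have "continuous_on {- B..B} clip" unfolding clip_def by (intro continuous_intros)
  from Stone_Weierstrass_real_polynomial_function[OF compact_Icc this eps(1)]
  obtain q where q: "real_polynomial_function q" "\<And>y. y \<in> {- B..B} \<Longrightarrow> \<bar>clip y - q y\<bar> < \<epsilon>" by blast
  define g where "g = (\<lambda>x. q (p x))"
  have g: "g \<in> trig_sums" unfolding g_def by (rule trig_sums_polynomial[OF q(1) p(1)])
  have gclip: "\<bar>clip (p x) - g x\<bar> < \<epsilon>" for x
    unfolding g_def using B[of x] by (intro q(2)) (auto simp: abs_le_iff)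
  have inside: "\<bar>f x - g x\<bar> \<le> 2 * \<epsilon>" if "x \<in> {- real N..real N}" for x
  proof -
    have "\<bar>f x - clip (p x)\<bar> \<le> \<bar>f x - p x\<bar>"
      using f(2)[of x] by (auto simp: clip_def min_def max_def)
    with p(2)[OF that] gclip[of x] show ?thesis by linarith
  qed
  have outside: "\<bar>f x - g x\<bar> \<le> 3" for x
  proof -
    have "\<bar>clip (p x)\<bar> \<le> 1" by (auto simp: clip_def)
    with gclip[of x] f(2)[of x] eps show ?thesis by linarith
  qed
  have bound: "(f x - g x)\<^sup>2 \<le> 4 * \<epsilon> + 9 * indicator (- {- real N..real N}) x" for x
  proof (cases "x \<in> {- real N..real N}")
    case True
    have "\<bar>f x - g x\<bar>\<^sup>2 \<le> (2 * \<epsilon>)\<^sup>2" by (intro power_mono inside True) auto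
    moreover have "\<epsilon>\<^sup>2 \<le> \<epsilon>" using eps by (simp add: power2_eq_square mult_left_le)
    ultimately show ?thesis using True by (simp add: power_mult_distrib)
  next
    case False
    have "\<bar>f x - g x\<bar>\<^sup>2 \<le> 3\<^sup>2" by (intro power_mono outside) auto
    with False eps show ?thesis by simp
  qed
  have "(\<integral>x. (f x - g x)\<^sup>2 \<partial>M) \<le> (\<integral>x. 4 * \<epsilon> + 9 * indicator (- {- real N..real N}) x \<partial>M)"
  proof (rule integral_mono)
    show "integrable M (\<lambda>x. (f x - g x)\<^sup>2)"
      using square_integrable_diff[OF sf square_integrable_trig_sums[OF g]] by (simp add: square_integrable_def)
    show "integrable M (\<lambda>x. 4 * \<epsilon> + 9 * indicator (- {- real N..real N}) x)"
      by (intro Bochner_Integration.integrable_add integrable_const integrable_mult_right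
          integrable_real_indicator) (auto simp: emeasure_eq_measure)
  qed (use bound in auto)
  also have "\<dots> = 4 * \<epsilon> + 9 * measure M (- {- real N..real N})"
    using prob_space by (simp add: emeasure_eq_measure)
  also have "measure M (- {- real N..real N}) = 1 - measure M {- real N..real N}"
    using prob_compl[of "{- real N..real N}"] by (simp add: Compl_eq_Diff_UNIV)
  also have "4 * \<epsilon> + 9 * (1 - measure M {- real N..real N}) < e"
  proof -
    have "4 * a + 9 * (1 - m) < e" if "a \<le> e / 8" "1 - e / 20 < m" for a m :: real
      using that \<open>e > 0\<close> by (simp add: field_simps)
    with eps(3) N show ?thesis by blast
  qed
  finally show "\<exists>g\<in>trig_sums. (\<integral>x. (f x - g x)\<^sup>2 \<partial>M) < e" using g by blast
qed

lemma trig_approx_atMost: "trig_approx (indicator {..a})"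
proof (rule trig_approx_dominated)
  show "square_integrable M (indicator {..a})"
    by (rule square_integrable_bounded[OF finite_measure_axioms, of _ 1]) (auto simp: indicator_def)
  show "trig_approx (\<lambda>x. max 0 (min 1 (1 - real n * (x - a))))" for n
    by (rule trig_approx_continuous) (auto intro!: continuous_intros)
  show "(\<lambda>n. max 0 (min 1 (1 - real n * (x - a)))) \<longlonglongrightarrow> indicator {..a} x" for x
  proof (cases "x \<le> a")
    case True
    then have "real n * (x - a) \<le> 0" for n by (simp add: mult_nonneg_nonpos)
    then have "max 0 (min 1 (1 - real n * (x - a))) = 1" for n
      by (smt (verit, best))
    with True show ?thesis by simp
  next
    case False
    then obtain N where N: "1 < real N * (x - a)" using reals_Archimedean3[of "x - a"] by auto
    have "\<forall>\<^sub>F n in sequentially. max 0 (min 1 (1 - real n * (x - a))) = 0"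
      using eventually_ge_at_top[of N]
    proof eventually_elim
      case (elim n)
      have "real N * (x - a) \<le> real n * (x - a)" using elim False by (intro mult_right_mono) auto
      with N show ?case by linarith
    qed
    with False show ?thesis by (simp add: tendsto_eventually)
  qed
  show "square_integrable M (\<lambda>x. 1)" by (simp add: square_integrable_def)
  show "\<bar>indicator {..a} x - max 0 (min 1 (1 - real n * (x - a)))\<bar> \<le> 1" for n x
    by (auto simp: indicator_def)
qed

text \<open>Dynkin's argument: half-lines form an intersection-stable generator, and approximability
  passes to complements and, by dominated convergence, to countable disjoint unions.\<close>

lemma trig_approx_indicator:
  assumes "A \<in> sets borel" shows "trig_approx (indicator A)"
proof -
  have sq: "square_integrable M (indicator A)" if "A \<in> sets borel" for A
    using that by (intro square_integrable_bounded[OF finite_measure_axioms, of _ 1]) (auto simp: indicator_def)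
  let ?G = "range (\<lambda>a::real. {..a})"
  have gen: "sigma_sets UNIV ?G = sets borel" by (simp add: borel_eq_atMost)
  have st: "Int_stable ?G" by (auto simp: Int_stable_def)
  have pow: "?G \<subseteq> Pow UNIV" by simp
  have "A \<in> sigma_sets UNIV ?G" using assms gen by simp
  with st pow show ?thesis
  proof (induction rule: sigma_sets_induct_disjoint)
    case (basic B) then show ?case using trig_approx_atMost by auto
  next
    case empty
    have "indicator {} = (\<lambda>x::real. 0::real)" by auto
    with trig_approx_trig_sums[OF trig_sums_const[of 0]] show ?case by simp
  next
    case (compl B)
    have "indicator (UNIV - B) = (\<lambda>x::real. 1 + (-1) * indicator B x :: real)"
      by (auto simp: indicator_def)
    with trig_approx_add[OF trig_approx_trig_sums[OF trig_sums_const[of 1]] trig_approx_cmult[OF compl(2), of "-1"]]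
    show ?case by simp
  next
    case (union B)
    then have B: "\<And>i. B i \<in> sets borel" using gen by auto
    show ?case
    proof (rule trig_approx_dominated)
      show "square_integrable M (indicator (\<Union>i. B i))" by (rule sq) (use B in auto)
      show "trig_approx (\<lambda>x. \<Sum>i<n. indicator (B i) x)" for n
        by (rule trig_approx_sum) (use union in auto)
      have eq: "(\<Sum>i<n. indicator (B i) x) = (indicator (\<Union>i<n. B i) x :: real)" for n x
        using union(1) by (subst indicator_UN_disjoint) (auto simp: disjoint_family_on_def)
      show "(\<lambda>n. \<Sum>i<n. indicator (B i) x) \<longlonglongrightarrow> (indicator (\<Union>i. B i) x :: real)" for x
        unfolding eq by (rule LIMSEQ_indicator_UN)
      show "square_integrable M (\<lambda>x. 1)" by (simp add: square_integrable_def)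
      show "\<bar>indicator (\<Union>i. B i) x - (\<Sum>i<n. indicator (B i) x)\<bar> \<le> (1::real)" for n x
        unfolding eq by (auto simp: indicator_def)
    qed
  qed
qed

theorem trig_sums_dense:
  assumes f: "square_integrable M f" shows "trig_approx f"
proof -
  have "f \<in> borel_measurable M" using f by (simp add: square_integrable_def)
  from borel_measurable_implies_sequence_metric[OF this, of 0]
  obtain F where F: "\<And>i. simple_function M (F i)" "\<And>x. (\<lambda>i. F i x) \<longlonglongrightarrow> f x"
    "\<And>i x. \<bar>F i x\<bar> \<le> 2 * \<bar>f x\<bar>"
    by (auto simp: dist_real_def)
  show ?thesis
  proof (rule trig_approx_dominated[OF f _ F(2)])
    show "trig_approx (F i)" for i
    proof -
      have fin: "finite (range (F i))" using simple_functionD(1)[OF F(1)[of i]] by simp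
      have "trig_approx (\<lambda>x. \<Sum>y\<in>range (F i). y * indicator (F i -` {y}) x)"
        using simple_functionD(2)[OF F(1)[of i]]
        by (intro trig_approx_sum fin trig_approx_cmult trig_approx_indicator) simp
      moreover have "(\<Sum>y\<in>range (F i). y * indicator (F i -` {y}) x) = F i x" for x
      proof -
        have "(\<Sum>y\<in>range (F i). y * indicator (F i -` {y}) x) = (\<Sum>y\<in>range (F i). if y = F i x then y else 0)"
          by (intro sum.cong) (auto simp: indicator_def)
        also have "\<dots> = F i x" using fin by (simp add: sum.delta)
        finally show ?thesis .
      qed
      ultimately show ?thesis by simp
    qed
    show "square_integrable M (\<lambda>x. 3 * \<bar>f x\<bar>)"
      using f by (intro square_integrable_cmult) (auto simp: square_integrable_def)
    show "\<bar>f x - F i x\<bar> \<le> 3 * \<bar>f x\<bar>" for i x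
      using F(3)[of i x] by linarith
  qed
qed

end

section \<open>Mehler's formula and the covariance inequality\<close>

text \<open>Not normalized: as \<open>He q\<close> has squared norm q!, the coefficient in the
  Hermite expansion is \<open>hermite_coeff q f / fact q\<close>, and the squared norm of that term
  is \<open>(hermite_coeff q f)\<^sup>2 / fact q\<close>.\<close>

definition hermite_coeff :: "nat \<Rightarrow> (real \<Rightarrow> real) \<Rightarrow> real" where
  "hermite_coeff q f = (\<integral>t. f t * He q t \<partial>std_normal_distribution)"

text \<open>A pair of standard Gaussians with correlation \<rho>, given by the real and imaginary
  parts of its joint characteristic function. Having no density in the definition admits the
  degenerate pair with X = Y, that is \<rho> = 1.\<close>

definition gaussian_pair :: "'w measure \<Rightarrow> ('w \<Rightarrow> real) \<Rightarrow> ('w \<Rightarrow> real) \<Rightarrow> real \<Rightarrow> bool" where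
  "gaussian_pair N X Y \<rho> \<longleftrightarrow> prob_space N \<and> X \<in> borel_measurable N \<and> Y \<in> borel_measurable N \<and>
     (\<forall>s t. (\<integral>\<omega>. cos (s * X \<omega> + t * Y \<omega>) \<partial>N) = exp (- (s\<^sup>2 + 2 * \<rho> * s * t + t\<^sup>2) / 2)) \<and>
     (\<forall>s t. (\<integral>\<omega>. sin (s * X \<omega> + t * Y \<omega>) \<partial>N) = 0)"

lemma std_normal_cos_sin:
  "(\<integral>x. cos (s * x) \<partial>std_normal_distribution) = exp (- s\<^sup>2 / 2)"
  "(\<integral>x. sin (s * x) \<partial>std_normal_distribution) = 0"
proof -
  interpret real_distribution std_normal_distribution by (rule real_dist_normal_dist)
  have i: "integrable std_normal_distribution (\<lambda>x. iexp (s * x))"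
    using integrable_iexp[of "\<lambda>x. s * x"] by simp
  have c: "(CLINT x|std_normal_distribution. iexp (s * x)) = of_real (exp (- s\<^sup>2 / 2))"
    using char_std_normal_distribution unfolding char_def by metis
  have "Re (CLINT x|std_normal_distribution. iexp (s * x)) = (\<integral>x. Re (iexp (s * x)) \<partial>std_normal_distribution)"
    "Im (CLINT x|std_normal_distribution. iexp (s * x)) = (\<integral>x. Im (iexp (s * x)) \<partial>std_normal_distribution)"
    using i by (simp_all add: integral_Re integral_Im)
  then show "(\<integral>x. cos (s * x) \<partial>std_normal_distribution) = exp (- s\<^sup>2 / 2)"
    "(\<integral>x. sin (s * x) \<partial>std_normal_distribution) = 0"
    unfolding c by (simp_all add: Re_exp Im_exp)
qed

text \<open>On this degenerate pair Mehler's formula becomes Parseval's identity.\<close>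

lemma gaussian_pair_std_normal: "gaussian_pair std_normal_distribution (\<lambda>x. x) (\<lambda>x. x) 1"
  unfolding gaussian_pair_def
proof (intro conjI allI)
  fix s t :: real
  have "s\<^sup>2 + 2 * 1 * s * t + t\<^sup>2 = (s + t)\<^sup>2" by (simp add: power2_sum)
  then show "(\<integral>x. cos (s * x + t * x) \<partial>std_normal_distribution) = exp (- (s\<^sup>2 + 2 * 1 * s * t + t\<^sup>2) / 2)"
    unfolding distrib_right[symmetric] std_normal_cos_sin by simp
  show "(\<integral>x. sin (s * x + t * x) \<partial>std_normal_distribution) = 0"
    unfolding distrib_right[symmetric] std_normal_cos_sin ..
qed simp_all

lemma gaussian_pair_sym:
  assumes "gaussian_pair N X Y \<rho>" shows "gaussian_pair N Y X \<rho>"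
  unfolding gaussian_pair_def
proof (intro conjI allI)
  fix s t
  have "(\<integral>\<omega>. cos (s * Y \<omega> + t * X \<omega>) \<partial>N) = (\<integral>\<omega>. cos (t * X \<omega> + s * Y \<omega>) \<partial>N)"
    by (simp add: add.commute)
  also have "\<dots> = exp (- (t\<^sup>2 + 2 * \<rho> * t * s + s\<^sup>2) / 2)" using assms by (simp add: gaussian_pair_def)
  finally show "(\<integral>\<omega>. cos (s * Y \<omega> + t * X \<omega>) \<partial>N) = exp (- (s\<^sup>2 + 2 * \<rho> * s * t + t\<^sup>2) / 2)"
    by (simp add: algebra_simps)
  have "(\<integral>\<omega>. sin (s * Y \<omega> + t * X \<omega>) \<partial>N) = (\<integral>\<omega>. sin (t * X \<omega> + s * Y \<omega>) \<partial>N)"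
    by (simp add: add.commute)
  also have "\<dots> = 0" using assms by (simp add: gaussian_pair_def)
  finally show "(\<integral>\<omega>. sin (s * Y \<omega> + t * X \<omega>) \<partial>N) = 0" .
qed (use assms in \<open>auto simp: gaussian_pair_def\<close>)

text \<open>Setting the second frequency to zero leaves the standard normal characteristic function,
  which determines the law.\<close>

lemma gaussian_pair_distr:
  assumes "gaussian_pair N X Y \<rho>"
  shows "distr N borel X = std_normal_distribution"
proof (rule Levy_uniqueness)
  interpret prob_space N using assms by (simp add: gaussian_pair_def)
  have [measurable]: "X \<in> borel_measurable N" using assms by (simp add: gaussian_pair_def)
  show "real_distribution (distr N borel X)" by (rule real_distribution_distr) simp
  show "real_distribution std_normal_distribution" by (rule real_dist_normal_dist)
  show "char (distr N borel X) = char std_normal_distribution"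
  proof
    fix t
    have i: "integrable N (\<lambda>\<omega>. iexp (t * X \<omega>))" by (rule integrable_iexp) auto
    have e: "(\<integral>\<omega>. cos (t * X \<omega> + 0 * Y \<omega>) \<partial>N) = exp (- (t\<^sup>2 + 2 * \<rho> * t * 0 + 0\<^sup>2) / 2)"
      "(\<integral>\<omega>. sin (t * X \<omega> + 0 * Y \<omega>) \<partial>N) = 0"
      using assms by (simp_all only: gaussian_pair_def)
    have "char (distr N borel X) t = (CLINT \<omega>|N. iexp (t * X \<omega>))"
      unfolding char_def by (subst integral_distr) auto
    also have "\<dots> = of_real (exp (- t\<^sup>2 / 2))"
    proof (rule complex_eqI)
      have "Re (CLINT \<omega>|N. iexp (t * X \<omega>)) = (\<integral>\<omega>. Re (iexp (t * X \<omega>)) \<partial>N)"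
        by (rule integral_Re[OF i, symmetric])
      also have "\<dots> = Re (of_real (exp (- t\<^sup>2 / 2)))" using e(1) by (simp add: Re_exp)
      finally show "Re (CLINT \<omega>|N. iexp (t * X \<omega>)) = Re (of_real (exp (- t\<^sup>2 / 2)))" .
      have "Im (CLINT \<omega>|N. iexp (t * X \<omega>)) = (\<integral>\<omega>. Im (iexp (t * X \<omega>)) \<partial>N)"
        by (rule integral_Im[OF i, symmetric])
      also have "\<dots> = Im (of_real (exp (- t\<^sup>2 / 2)))" using e(2) by (simp add: Im_exp)
      finally show "Im (CLINT \<omega>|N. iexp (t * X \<omega>)) = Im (of_real (exp (- t\<^sup>2 / 2)))" .
    qed
    finally show "char (distr N borel X) t = char std_normal_distribution t"
      by (simp add: char_std_normal_distribution)
  qed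
qed

lemma gaussian_pair_integral:
  fixes f :: "real \<Rightarrow> real"
  assumes "gaussian_pair N X Y \<rho>" "f \<in> borel_measurable borel"
  shows "(\<integral>\<omega>. f (X \<omega>) \<partial>N) = (\<integral>x. f x \<partial>std_normal_distribution)"
  using assms by (subst gaussian_pair_distr[OF assms(1), symmetric], subst integral_distr)
    (auto simp: gaussian_pair_def)

lemma gaussian_pair_integrable_iff:
  fixes f :: "real \<Rightarrow> real"
  assumes "gaussian_pair N X Y \<rho>" "f \<in> borel_measurable borel"
  shows "integrable N (\<lambda>\<omega>. f (X \<omega>)) \<longleftrightarrow> integrable std_normal_distribution f"
  using assms by (subst gaussian_pair_distr[OF assms(1), symmetric], subst integrable_distr_eq)
    (auto simp: gaussian_pair_def)

lemma square_integrable_std_normal_measurable: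
  "square_integrable std_normal_distribution f \<Longrightarrow> f \<in> borel_measurable borel"
  by (simp add: square_integrable_def)

lemma gaussian_pair_square_integrable:
  assumes "gaussian_pair N X Y \<rho>" "square_integrable std_normal_distribution f"
  shows "square_integrable N (\<lambda>\<omega>. f (X \<omega>))" "square_integrable N (\<lambda>\<omega>. f (Y \<omega>))"
proof -
  have f[measurable]: "f \<in> borel_measurable borel" using assms(2) by (rule square_integrable_std_normal_measurable)
  have [measurable]: "X \<in> borel_measurable N" "Y \<in> borel_measurable N" using assms by (auto simp: gaussian_pair_def)
  show "square_integrable N (\<lambda>\<omega>. f (X \<omega>))"
    using assms(2) gaussian_pair_integrable_iff[OF assms(1), of "\<lambda>x. (f x)\<^sup>2"]
    by (simp add: square_integrable_def)
  show "square_integrable N (\<lambda>\<omega>. f (Y \<omega>))"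
    using assms(2) gaussian_pair_integrable_iff[OF gaussian_pair_sym[OF assms(1)], of "\<lambda>x. (f x)\<^sup>2"]
    by (simp add: square_integrable_def)
qed

lemma hermite_coeff_add:
  assumes "square_integrable std_normal_distribution f" "square_integrable std_normal_distribution g"
  shows "hermite_coeff q (\<lambda>x. f x + g x) = hermite_coeff q f + hermite_coeff q g"
  unfolding hermite_coeff_def distrib_right
  by (intro Bochner_Integration.integral_add square_integrable_mult square_integrable_poly assms)

lemma hermite_coeff_cmult: "hermite_coeff q (\<lambda>x. c * f x) = c * hermite_coeff q f"
  by (simp add: hermite_coeff_def mult.assoc)

lemma hermite_coeff_cos_sin_Suc:
  "hermite_coeff (Suc q) (\<lambda>x. cos (s * x)) = - s * hermite_coeff q (\<lambda>x. sin (s * x))"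
  "hermite_coeff (Suc q) (\<lambda>x. sin (s * x)) = s * hermite_coeff q (\<lambda>x. cos (s * x))"
proof -
  have pg: "poly_growth (\<lambda>x. cos (s * x))" "poly_growth (\<lambda>x. sin (s * x))"
    by (rule poly_growth_bounded[of _ 1], simp)+
  have pg': "poly_growth (\<lambda>x. - s * sin (s * x))" "poly_growth (\<lambda>x. s * cos (s * x))"
    by (rule poly_growth_bounded[of _ "\<bar>s\<bar>"], simp add: abs_mult mult_left_le)+
  have "(\<integral>x. He (Suc q) x * cos (s * x) \<partial>std_normal_distribution) = (\<integral>x. He q x * (- s * sin (s * x)) \<partial>std_normal_distribution)"
    by (rule Hermite_ibp[OF _ _ pg(1) pg'(1)]) (auto intro!: derivative_eq_intros continuous_intros)
  then show "hermite_coeff (Suc q) (\<lambda>x. cos (s * x)) = - s * hermite_coeff q (\<lambda>x. sin (s * x))"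
    unfolding hermite_coeff_def integral_mult_right_zero[symmetric] by (simp only: mult_ac)
  have "(\<integral>x. He (Suc q) x * sin (s * x) \<partial>std_normal_distribution) = (\<integral>x. He q x * (s * cos (s * x)) \<partial>std_normal_distribution)"
    by (rule Hermite_ibp[OF _ _ pg(2) pg'(2)]) (auto intro!: derivative_eq_intros continuous_intros)
  then show "hermite_coeff (Suc q) (\<lambda>x. sin (s * x)) = s * hermite_coeff q (\<lambda>x. cos (s * x))"
    unfolding hermite_coeff_def integral_mult_right_zero[symmetric] by (simp only: mult_ac)
qed

lemma hermite_coeff_cos_sin:
  "hermite_coeff q (\<lambda>x. cos (s * x)) = (if even q then (-1) ^ (q div 2) * s ^ q * exp (- s\<^sup>2 / 2) else 0)"
  "hermite_coeff q (\<lambda>x. sin (s * x)) = (if odd q then (-1) ^ (q div 2) * s ^ q * exp (- s\<^sup>2 / 2) else 0)"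
proof (induction q)
  case 0
  show "hermite_coeff 0 (\<lambda>x. cos (s * x)) = (if even 0 then (-1) ^ (0 div 2) * s ^ 0 * exp (- s\<^sup>2 / 2) else 0)"
    "hermite_coeff 0 (\<lambda>x. sin (s * x)) = (if odd 0 then (-1) ^ (0 div 2) * s ^ 0 * exp (- s\<^sup>2 / 2) else 0)"
    by (simp_all add: hermite_coeff_def std_normal_cos_sin)
next
  case (Suc q)
  have "(-1) ^ (Suc q div 2) = - ((-1) ^ (q div 2) :: real)" if "odd q"
    using that by (auto elim!: oddE)
  with Suc show "hermite_coeff (Suc q) (\<lambda>x. cos (s * x)) = (if even (Suc q) then (-1) ^ (Suc q div 2) * s ^ Suc q * exp (- s\<^sup>2 / 2) else 0)"
    by (simp add: hermite_coeff_cos_sin_Suc)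
  from Suc show "hermite_coeff (Suc q) (\<lambda>x. sin (s * x)) = (if odd (Suc q) then (-1) ^ (Suc q div 2) * s ^ Suc q * exp (- s\<^sup>2 / 2) else 0)"
    by (simp add: hermite_coeff_cos_sin_Suc)
qed

lemma hermite_coeff_cos_sin_mult:
  "hermite_coeff q (\<lambda>x. cos (s * x)) * hermite_coeff q (\<lambda>x. cos (t * x))
    = (if even q then exp (- s\<^sup>2 / 2) * exp (- t\<^sup>2 / 2) * (s * t) ^ q else 0)"
  "hermite_coeff q (\<lambda>x. sin (s * x)) * hermite_coeff q (\<lambda>x. sin (t * x))
    = (if even q then 0 else exp (- s\<^sup>2 / 2) * exp (- t\<^sup>2 / 2) * (s * t) ^ q)"
proof -
  have sign: "(-1) ^ (q div 2) * a * b * ((-1) ^ (q div 2) * c * d) = b * d * (a * c)" for a b c d :: real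
  proof -
    have "(-1) ^ (q div 2) * a * b * ((-1) ^ (q div 2) * c * d) = ((-1) ^ (q div 2) * (-1) ^ (q div 2)) * (b * d * (a * c))"
      by (simp only: mult_ac)
    also have "(-1) ^ (q div 2) * (-1) ^ (q div 2) = (1::real)"
      by (simp add: power_mult_distrib[symmetric])
    finally show ?thesis by simp
  qed
  show "hermite_coeff q (\<lambda>x. cos (s * x)) * hermite_coeff q (\<lambda>x. cos (t * x))
    = (if even q then exp (- s\<^sup>2 / 2) * exp (- t\<^sup>2 / 2) * (s * t) ^ q else 0)"
   "hermite_coeff q (\<lambda>x. sin (s * x)) * hermite_coeff q (\<lambda>x. sin (t * x))
    = (if even q then 0 else exp (- s\<^sup>2 / 2) * exp (- t\<^sup>2 / 2) * (s * t) ^ q)"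
    unfolding hermite_coeff_cos_sin power_mult_distrib by (auto simp only: sign if_True if_False split: if_split)
qed

lemma square_integrable_trig: "f \<in> trig_sums \<Longrightarrow> square_integrable std_normal_distribution f"
  using real_distribution.square_integrable_trig_sums[OF real_dist_normal_dist] .

lemma gaussian_pair_trig:
  assumes "gaussian_pair N X Y \<rho>"
  shows "(\<integral>\<omega>. cos (s * X \<omega>) * cos (t * Y \<omega>) \<partial>N) = exp (- s\<^sup>2 / 2) * exp (- t\<^sup>2 / 2) * cosh (\<rho> * s * t)"
    "(\<integral>\<omega>. sin (s * X \<omega>) * sin (t * Y \<omega>) \<partial>N) = exp (- s\<^sup>2 / 2) * exp (- t\<^sup>2 / 2) * sinh (\<rho> * s * t)"
    "(\<integral>\<omega>. sin (s * X \<omega>) * cos (t * Y \<omega>) \<partial>N) = 0"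
    "(\<integral>\<omega>. cos (s * X \<omega>) * sin (t * Y \<omega>) \<partial>N) = 0"
proof -
  interpret prob_space N using assms by (simp add: gaussian_pair_def)
  have [measurable]: "X \<in> borel_measurable N" "Y \<in> borel_measurable N" using assms by (auto simp: gaussian_pair_def)
  have e: "(\<integral>\<omega>. cos (s * X \<omega> + t * Y \<omega>) \<partial>N) = exp (- (s\<^sup>2 + 2 * \<rho> * s * t + t\<^sup>2) / 2)"
    "(\<integral>\<omega>. sin (s * X \<omega> + t * Y \<omega>) \<partial>N) = 0" for s t
    using assms by (auto simp: gaussian_pair_def)
  have ee: "exp (- (s\<^sup>2 + 2 * \<rho> * s * t + t\<^sup>2) / 2) = exp (- s\<^sup>2 / 2) * exp (- t\<^sup>2 / 2) * exp (- (\<rho> * s * t))"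
    "exp (- (s\<^sup>2 + 2 * \<rho> * s * (- t) + (- t)\<^sup>2) / 2) = exp (- s\<^sup>2 / 2) * exp (- t\<^sup>2 / 2) * exp (\<rho> * s * t)"
    unfolding exp_add[symmetric] by (simp_all add: field_simps)
  have i: "integrable N (\<lambda>\<omega>. cos (s * X \<omega> + t * Y \<omega>))" "integrable N (\<lambda>\<omega>. sin (s * X \<omega> + t * Y \<omega>))" for s t
    by (auto intro!: integrable_const_bound[where B=1])
  note ic = Bochner_Integration.integral_add[OF i(1)[of s "-t"] i(1)[of s t]]
    Bochner_Integration.integral_diff[OF i(1)[of s "-t"] i(1)[of s t]]
    Bochner_Integration.integral_add[OF i(2)[of s t] i(2)[of s "-t"]]
    Bochner_Integration.integral_diff[OF i(2)[of s t] i(2)[of s "-t"]]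
  have "(\<integral>\<omega>. cos (s * X \<omega>) * cos (t * Y \<omega>) \<partial>N) = (\<integral>\<omega>. cos (s * X \<omega> + (-t) * Y \<omega>) + cos (s * X \<omega> + t * Y \<omega>) \<partial>N) / 2"
    unfolding cos_times_cos by simp
  then show "(\<integral>\<omega>. cos (s * X \<omega>) * cos (t * Y \<omega>) \<partial>N) = exp (- s\<^sup>2 / 2) * exp (- t\<^sup>2 / 2) * cosh (\<rho> * s * t)"
    unfolding ic e ee by (simp add: cosh_field_def exp_minus field_simps)
  have "(\<integral>\<omega>. sin (s * X \<omega>) * sin (t * Y \<omega>) \<partial>N) = (\<integral>\<omega>. cos (s * X \<omega> + (-t) * Y \<omega>) - cos (s * X \<omega> + t * Y \<omega>) \<partial>N) / 2"
    unfolding sin_times_sin by simp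
  then show "(\<integral>\<omega>. sin (s * X \<omega>) * sin (t * Y \<omega>) \<partial>N) = exp (- s\<^sup>2 / 2) * exp (- t\<^sup>2 / 2) * sinh (\<rho> * s * t)"
    unfolding ic e ee by (simp add: sinh_field_def exp_minus field_simps)
  have "(\<integral>\<omega>. sin (s * X \<omega>) * cos (t * Y \<omega>) \<partial>N) = (\<integral>\<omega>. sin (s * X \<omega> + t * Y \<omega>) + sin (s * X \<omega> + (-t) * Y \<omega>) \<partial>N) / 2"
    unfolding sin_times_cos by simp
  then show "(\<integral>\<omega>. sin (s * X \<omega>) * cos (t * Y \<omega>) \<partial>N) = 0"
    unfolding ic e by simp
  have "(\<integral>\<omega>. cos (s * X \<omega>) * sin (t * Y \<omega>) \<partial>N) = (\<integral>\<omega>. sin (s * X \<omega> + t * Y \<omega>) - sin (s * X \<omega> + (-t) * Y \<omega>) \<partial>N) / 2"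
    unfolding cos_times_sin by simp
  then show "(\<integral>\<omega>. cos (s * X \<omega>) * sin (t * Y \<omega>) \<partial>N) = 0"
    unfolding ic e by simp
qed

text \<open>By bilinearity it is enough to treat products of a sine or cosine of X with one of Y.
  For equal types the expectation is a multiple of cosh or sinh of \<rho> s t, and the series is its
  power series; mixed products vanish on both sides by parity.\<close>

lemma Mehler_trig_sums:
  assumes P: "gaussian_pair N X Y \<rho>" and f: "f \<in> trig_sums" and g: "g \<in> trig_sums"
  shows "(\<lambda>q. \<rho> ^ q * (hermite_coeff q f * hermite_coeff q g) / fact q) sums (\<integral>\<omega>. f (X \<omega>) * g (Y \<omega>) \<partial>N)"
proof -
  have scale: "A * ((\<rho> * s * t) ^ q /\<^sub>R fact q) = \<rho> ^ q * (A * (s * t) ^ q) / fact q" for A s t :: real and q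
    by (simp add: power_mult_distrib divide_inverse)
  show ?thesis
  using f
proof (induction rule: trig_sums.induct)
  case (add f f')
  have i: "integrable N (\<lambda>\<omega>. f (X \<omega>) * g (Y \<omega>))" "integrable N (\<lambda>\<omega>. f' (X \<omega>) * g (Y \<omega>))"
    by (intro square_integrable_mult gaussian_pair_square_integrable[OF P] square_integrable_trig add g)+
  show ?case
    using sums_add[OF add.IH] i
    by (simp add: hermite_coeff_add square_integrable_trig add.hyps distrib_right distrib_left add_divide_distrib)
next
  case (cmult f c)
  show ?case using sums_mult[OF cmult.IH, of c] by (simp add: hermite_coeff_cmult mult_ac)
next
  case (cos s)
  show ?case using g
  proof (induction rule: trig_sums.induct)
    case (add g g')
    have i: "integrable N (\<lambda>\<omega>. cos (s * X \<omega>) * g (Y \<omega>))" "integrable N (\<lambda>\<omega>. cos (s * X \<omega>) * g' (Y \<omega>))"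
      using trig_sums.cos[of s] add.hyps
      by (intro square_integrable_mult gaussian_pair_square_integrable[OF P]; intro square_integrable_trig; simp)+
    show ?case
      using sums_add[OF add.IH] i
      by (simp add: hermite_coeff_add square_integrable_trig add.hyps distrib_right distrib_left add_divide_distrib)
  next
    case (cmult g c)
    show ?case using sums_mult[OF cmult.IH, of c] by (simp add: hermite_coeff_cmult mult_ac)
  next
    case (cos t)
    have "(\<lambda>q. exp (- s\<^sup>2 / 2) * exp (- t\<^sup>2 / 2) * (if even q then (\<rho> * s * t) ^ q /\<^sub>R fact q else 0))
      sums (exp (- s\<^sup>2 / 2) * exp (- t\<^sup>2 / 2) * cosh (\<rho> * s * t))"
      by (intro sums_mult cosh_converges)
    moreover have "exp (- s\<^sup>2 / 2) * exp (- t\<^sup>2 / 2) * (if even q then (\<rho> * s * t) ^ q /\<^sub>R fact q else 0)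
      = \<rho> ^ q * (hermite_coeff q (\<lambda>x. cos (s * x)) * hermite_coeff q (\<lambda>x. cos (t * x))) / fact q" for q
      unfolding hermite_coeff_cos_sin_mult using scale by (cases "even q") (simp_all only: if_True if_False mult_zero_right div_0 scaleR_zero_right)
    ultimately show ?case by (simp only: gaussian_pair_trig[OF P])
  next
    case (sin t)
    have "\<rho> ^ q * (hermite_coeff q (\<lambda>x. cos (s * x)) * hermite_coeff q (\<lambda>x. sin (t * x))) / fact q = 0" for q
      by (simp add: hermite_coeff_cos_sin)
    then show ?case by (simp only: gaussian_pair_trig[OF P] sums_zero)
  qed
next
  case (sin s)
  show ?case using g
  proof (induction rule: trig_sums.induct)
    case (add g g')
    have i: "integrable N (\<lambda>\<omega>. sin (s * X \<omega>) * g (Y \<omega>))" "integrable N (\<lambda>\<omega>. sin (s * X \<omega>) * g' (Y \<omega>))"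
      using trig_sums.sin[of s] add.hyps
      by (intro square_integrable_mult gaussian_pair_square_integrable[OF P]; intro square_integrable_trig; simp)+
    show ?case
      using sums_add[OF add.IH] i
      by (simp add: hermite_coeff_add square_integrable_trig add.hyps distrib_right distrib_left add_divide_distrib)
  next
    case (cmult g c)
    show ?case using sums_mult[OF cmult.IH, of c] by (simp add: hermite_coeff_cmult mult_ac)
  next
    case (sin t)
    have "(\<lambda>q. exp (- s\<^sup>2 / 2) * exp (- t\<^sup>2 / 2) * (if even q then 0 else (\<rho> * s * t) ^ q /\<^sub>R fact q))
      sums (exp (- s\<^sup>2 / 2) * exp (- t\<^sup>2 / 2) * sinh (\<rho> * s * t))"
      by (intro sums_mult sinh_converges)
    moreover have "exp (- s\<^sup>2 / 2) * exp (- t\<^sup>2 / 2) * (if even q then 0 else (\<rho> * s * t) ^ q /\<^sub>R fact q)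
      = \<rho> ^ q * (hermite_coeff q (\<lambda>x. sin (s * x)) * hermite_coeff q (\<lambda>x. sin (t * x))) / fact q" for q
      unfolding hermite_coeff_cos_sin_mult using scale by (cases "even q") (simp_all only: if_True if_False mult_zero_right div_0 scaleR_zero_right)
    ultimately show ?case by (simp only: gaussian_pair_trig[OF P])
  next
    case (cos t)
    have "\<rho> ^ q * (hermite_coeff q (\<lambda>x. sin (s * x)) * hermite_coeff q (\<lambda>x. cos (t * x))) / fact q = 0" for q
      by (simp add: hermite_coeff_cos_sin)
    then show ?case by (simp only: gaussian_pair_trig[OF P] sums_zero)
  qed
qed
qed

text \<open>After k terms each remaining one carries a power of \<rho> of size at most |\<rho>|^k,
  and what it multiplies sums to the tail of Parseval's identity.\<close>

lemma covariance_inequality_trig_sums: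
  assumes P: "gaussian_pair N X Y \<rho>" and rho: "\<bar>\<rho>\<bar> \<le> 1" and f: "f \<in> trig_sums"
  shows "\<bar>(\<integral>\<omega>. f (X \<omega>) * f (Y \<omega>) \<partial>N) - (\<Sum>q<k. \<rho> ^ q * (hermite_coeff q f)\<^sup>2 / fact q)\<bar>
    \<le> \<bar>\<rho>\<bar> ^ k * ((\<integral>x. (f x)\<^sup>2 \<partial>std_normal_distribution) - (\<Sum>q<k. (hermite_coeff q f)\<^sup>2 / fact q))"
proof -
  define a where "a q = (hermite_coeff q f)\<^sup>2 / fact q" for q
  have a: "a q \<ge> 0" for q by (simp add: a_def)
  have 1: "(\<lambda>q. \<rho> ^ q * a q) sums (\<integral>\<omega>. f (X \<omega>) * f (Y \<omega>) \<partial>N)"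
    using Mehler_trig_sums[OF P f f] by (simp add: a_def power2_eq_square)
  have 2: "a sums (\<integral>x. (f x)\<^sup>2 \<partial>std_normal_distribution)"
    using Mehler_trig_sums[OF gaussian_pair_std_normal f f] by (simp add: a_def[abs_def] power2_eq_square)
  let ?S = "(\<integral>\<omega>. f (X \<omega>) * f (Y \<omega>) \<partial>N) - (\<Sum>q<k. \<rho> ^ q * a q)"
  let ?T = "\<bar>\<rho>\<bar> ^ k * ((\<integral>x. (f x)\<^sup>2 \<partial>std_normal_distribution) - (\<Sum>q<k. a q))"
  have 3: "(\<lambda>i. \<rho> ^ (i + k) * a (i + k)) sums ?S" by (rule sums_split_initial_segment[OF 1])
  have 4: "(\<lambda>i. \<bar>\<rho>\<bar> ^ k * a (i + k)) sums ?T" by (intro sums_mult sums_split_initial_segment 2)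
  have le: "\<bar>\<rho> ^ (i + k) * a (i + k)\<bar> \<le> \<bar>\<rho>\<bar> ^ k * a (i + k)" for i
  proof -
    have "\<bar>\<rho>\<bar> ^ (i + k) \<le> \<bar>\<rho>\<bar> ^ k" using rho by (intro power_decreasing) auto
    then show ?thesis using a[of "i + k"] by (simp add: abs_mult power_abs mult_right_mono)
  qed
  have "?S \<le> ?T" by (rule sums_le[OF _ 3 4]) (use le in \<open>simp add: abs_le_iff\<close>)
  moreover have "- ?S \<le> ?T" by (rule sums_le[OF _ sums_minus[OF 3] 4]) (use le in \<open>simp add: abs_le_iff\<close>)
  ultimately have "\<bar>?S\<bar> \<le> ?T" by linarith
  then show ?thesis by (simp add: a_def)
qed

text \<open>Both sides contain only a correlation, a norm and k Hermite coefficients, all continuous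
  in mean square because X and Y are standard Gaussian. The inequality thus passes to the limit
  along trigonometric sums, with no infinite series to interchange.\<close>

theorem covariance_inequality:
  assumes P: "gaussian_pair N X Y \<rho>" and rho: "\<bar>\<rho>\<bar> \<le> 1" and f: "square_integrable std_normal_distribution f"
  shows "\<bar>(\<integral>\<omega>. f (X \<omega>) * f (Y \<omega>) \<partial>N) - (\<Sum>q<k. \<rho> ^ q * (hermite_coeff q f)\<^sup>2 / fact q)\<bar>
    \<le> \<bar>\<rho>\<bar> ^ k * ((\<integral>x. (f x)\<^sup>2 \<partial>std_normal_distribution) - (\<Sum>q<k. (hermite_coeff q f)\<^sup>2 / fact q))"
proof -
  interpret G: real_distribution std_normal_distribution by (rule real_dist_normal_dist)
  have "\<exists>g\<in>trig_sums. (\<integral>x. (f x - g x)\<^sup>2 \<partial>std_normal_distribution) < inverse (real (Suc n))" for n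
    using G.trig_approxE[OF G.trig_sums_dense[OF f], of "inverse (real (Suc n))"] by (metis inverse_positive_iff_positive of_nat_0_less_iff zero_less_Suc)
  then obtain g where g: "\<And>n. g n \<in> trig_sums"
    "\<And>n. (\<integral>x. (f x - g n x)\<^sup>2 \<partial>std_normal_distribution) < inverse (real (Suc n))" by metis
  have sg: "square_integrable std_normal_distribution (g n)" for n by (rule square_integrable_trig[OF g(1)])
  have lim: "(\<lambda>n. \<integral>x. (g n x - f x)\<^sup>2 \<partial>std_normal_distribution) \<longlonglongrightarrow> 0"
  proof (rule Lim_null_comparison[OF _ LIMSEQ_inverse_real_of_nat])
    have "(\<integral>x. (g n x - f x)\<^sup>2 \<partial>std_normal_distribution) \<le> inverse (real (Suc n))" for n
      using less_imp_le[OF g(2)[of n]] by (simp only: power2_commute[of "f _"])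
    then show "\<forall>\<^sub>F n in sequentially. norm (\<integral>x. (g n x - f x)\<^sup>2 \<partial>std_normal_distribution) \<le> inverse (real (Suc n))"
      by (simp del: of_nat_Suc)
  qed
  have c: "(\<lambda>n. hermite_coeff q (g n)) \<longlonglongrightarrow> hermite_coeff q f" for q
    unfolding hermite_coeff_def
    by (rule tendsto_integral_mult_L2) (auto simp: sg f lim square_integrable_poly)
  have s: "(\<lambda>n. \<integral>x. (g n x)\<^sup>2 \<partial>std_normal_distribution) \<longlonglongrightarrow> (\<integral>x. (f x)\<^sup>2 \<partial>std_normal_distribution)"
    unfolding power2_eq_square by (rule tendsto_integral_mult_L2[OF sg f lim sg f lim])
  have m: "f \<in> borel_measurable borel" "g n \<in> borel_measurable borel" for n
    using sg f by (auto intro: square_integrable_std_normal_measurable)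
  have limX: "(\<lambda>n. \<integral>\<omega>. (g n (X \<omega>) - f (X \<omega>))\<^sup>2 \<partial>N) \<longlonglongrightarrow> 0"
    using lim m by (subst gaussian_pair_integral[OF P, of "\<lambda>x. (g _ x - f x)\<^sup>2"]) auto
  have limY: "(\<lambda>n. \<integral>\<omega>. (g n (Y \<omega>) - f (Y \<omega>))\<^sup>2 \<partial>N) \<longlonglongrightarrow> 0"
    using lim m by (subst gaussian_pair_integral[OF gaussian_pair_sym[OF P], of "\<lambda>x. (g _ x - f x)\<^sup>2"]) auto
  have e: "(\<lambda>n. \<integral>\<omega>. g n (X \<omega>) * g n (Y \<omega>) \<partial>N) \<longlonglongrightarrow> (\<integral>\<omega>. f (X \<omega>) * f (Y \<omega>) \<partial>N)"
    by (rule tendsto_integral_mult_L2)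
       (auto simp: limX limY intro!: gaussian_pair_square_integrable[OF P] sg f)
  have l: "(\<lambda>n. \<bar>(\<integral>\<omega>. g n (X \<omega>) * g n (Y \<omega>) \<partial>N) - (\<Sum>q<k. \<rho> ^ q * (hermite_coeff q (g n))\<^sup>2 / fact q)\<bar>)
      \<longlonglongrightarrow> \<bar>(\<integral>\<omega>. f (X \<omega>) * f (Y \<omega>) \<partial>N) - (\<Sum>q<k. \<rho> ^ q * (hermite_coeff q f)\<^sup>2 / fact q)\<bar>"
    by (intro tendsto_intros e c) simp
  have r: "(\<lambda>n. \<bar>\<rho>\<bar> ^ k * ((\<integral>x. (g n x)\<^sup>2 \<partial>std_normal_distribution) - (\<Sum>q<k. (hermite_coeff q (g n))\<^sup>2 / fact q)))
      \<longlonglongrightarrow> \<bar>\<rho>\<bar> ^ k * ((\<integral>x. (f x)\<^sup>2 \<partial>std_normal_distribution) - (\<Sum>q<k. (hermite_coeff q f)\<^sup>2 / fact q))"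
    by (intro tendsto_intros s c) simp
  show ?thesis
    by (rule LIMSEQ_le[OF l r]) (use covariance_inequality_trig_sums[OF P rho g(1)] in blast)
qed

section \<open>Stein's equation\<close>

lemma std_normal_density_DERIV: "(std_normal_density has_real_derivative - t * std_normal_density t) (at t)"
  unfolding std_normal_density_def
  by (auto intro!: derivative_eq_intros simp: power2_eq_square field_simps)

lemma isCont_std_normal_density: "isCont std_normal_density t"
  by (rule DERIV_isCont[OF std_normal_density_DERIV])

lemma std_normal_density_pos: "std_normal_density x > 0"
  by (rule normal_density_pos) simp

lemma std_normal_density_minus [simp]: "std_normal_density (- x) = std_normal_density x"
  by (simp add: std_normal_density_def)

lemma poly_growth_ident: "poly_growth (\<lambda>x. x)"
  using poly_growth_poly[of "[:0, 1:]"] by (simp add: poly_growth_def)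

lemma integrable_lborel_std_normal_growth:
  assumes "poly_growth f" and "f \<in> borel_measurable borel"
  shows "integrable lborel (\<lambda>x. std_normal_density x * f x)"
  using integrable_std_normal_poly_growth[OF assms] std_normal_integrable_iff[OF assms(2)] by simp

lemma tendsto_std_normal_density_poly_at_bot:
  assumes "poly_growth f"
  shows "((\<lambda>x. f x * std_normal_density x) \<longlongrightarrow> 0) at_bot"
proof -
  obtain C N where CN: "\<And>x. \<bar>f x\<bar> \<le> C * (1 + x\<^sup>2) ^ N" using assms by (auto simp: poly_growth_def)
  have "filterlim (\<lambda>x::real. (1 + x\<^sup>2) / 2) at_top at_bot"
    using filterlim_half_square[OF filterlim_uminus_at_top_at_bot] by simp
  from tendsto_mult[OF tendsto_const tendsto_std_normal_density_growth[OF this]]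
  have lim: "((\<lambda>x. C * (std_normal_density x * (1 + x\<^sup>2) ^ N)) \<longlongrightarrow> 0) at_bot" by simp
  have "norm (f x * std_normal_density x) \<le> C * (std_normal_density x * (1 + x\<^sup>2) ^ N)" for x
    using mult_left_mono[OF CN[of x] normal_density_nonneg[of 0 1 x]] by (simp add: abs_mult mult_ac)
  then show ?thesis by (intro Lim_null_comparison[OF always_eventually lim]) simp
qed

lemma set_integrable_std_normal_poly:
  "set_integrable lborel A (\<lambda>t. poly p t * std_normal_density t)" if "A \<in> sets borel"
  using integrable_lborel_std_normal_growth[OF poly_growth_poly[of p] borel_measurable_poly] that
  unfolding set_integrable_def by (intro integrable_mult_indicator) (simp_all add: mult.commute)

text \<open>The derivative of p times the density is (p' - t p) times the density. This evaluates
  the two comparison integrals of \<open>stein_bound_left\<close>.\<close>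

lemma Gaussian_antiderivative:
  assumes "\<And>t. poly r t = poly (pderiv p) t - t * poly p t"
  shows "(LBINT t=-\<infinity>..ereal x. poly r t * std_normal_density t) = poly p x * std_normal_density x"
proof -
  let ?F = "\<lambda>t. poly p t * std_normal_density t"
  have "(LBINT t=-\<infinity>..ereal x. poly r t * std_normal_density t) = ?F x - 0"
  proof (rule interval_integral_FTC_integrable[where F="?F"])
    show "(?F has_vector_derivative poly r t * std_normal_density t) (at t)" for t
      unfolding has_real_derivative_iff_has_vector_derivative[symmetric]
      by (rule DERIV_cong[OF DERIV_mult[OF poly_DERIV std_normal_density_DERIV]])
         (simp add: assms algebra_simps)
    show "isCont (\<lambda>t. poly r t * std_normal_density t) t" for t
      by (intro isCont_mult poly_isCont isCont_std_normal_density)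
    show "set_integrable lborel (einterval (-\<infinity>) (ereal x)) (\<lambda>t. poly r t * std_normal_density t)"
      by (rule set_integrable_std_normal_poly) simp
    show "((?F \<circ> real_of_ereal) \<longlongrightarrow> 0) (at_right (-\<infinity>))"
      using tendsto_std_normal_density_poly_at_bot[OF poly_growth_poly, of p]
      by (simp add: ereal_tendsto_simps)
    have "isCont ?F x" by (intro isCont_mult poly_isCont isCont_std_normal_density)
    then have "(?F \<longlongrightarrow> ?F x) (at_left x)"
      by (simp add: isCont_def filterlim_at_split)
    then show "((?F \<circ> real_of_ereal) \<longlongrightarrow> ?F x) (at_left (ereal x))"
      by (simp add: ereal_tendsto_simps)
  qed simp
  then show ?thesis by simp
qed

text \<open>\<open>g\<close> stands for a test function minus its Gaussian mean, the right-hand side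
  of Stein's equation.\<close>

locale stein_function =
  fixes g :: "real \<Rightarrow> real"
  assumes lip: "\<And>s t. \<bar>g s - g t\<bar> \<le> \<bar>s - t\<bar>"
    and centred: "(\<integral>x. g x \<partial>std_normal_distribution) = 0"
begin

lemma continuous: "isCont g t"
proof -
  have "1-lipschitz_on UNIV g" by (rule lipschitz_onI) (auto simp: dist_real_def lip)
  then have "continuous_on UNIV g" by (rule lipschitz_on_continuous_on)
  then show ?thesis by (simp add: continuous_on_eq_continuous_at)
qed

lemma measurable_g [measurable]: "g \<in> borel_measurable borel"
  using continuous by (intro borel_measurable_continuous_onI) (simp add: continuous_on_eq_continuous_at)

lemma growth: "poly_growth g"
proof -
  have "\<bar>g t\<bar> \<le> (\<bar>g 0\<bar> + 1) * (1 + t\<^sup>2) ^ 1" for t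
  proof -
    have "\<bar>g t\<bar> \<le> \<bar>g 0\<bar> + \<bar>t\<bar>" using lip[of t 0] by simp
    moreover have "\<bar>t\<bar> \<le> 1 + t\<^sup>2"
    proof -
      have "0 \<le> (\<bar>t\<bar> - 1)\<^sup>2 + \<bar>t\<bar>" by simp
      then show ?thesis by (simp add: power2_eq_square algebra_simps)
    qed
    moreover have "0 \<le> \<bar>g 0\<bar> * t\<^sup>2" by simp
    ultimately have "\<bar>g t\<bar> \<le> \<bar>g 0\<bar> + 1 + (\<bar>g 0\<bar> * t\<^sup>2 + t\<^sup>2)" by linarith
    then show ?thesis by (simp add: distrib_right distrib_left)
  qed
  then show ?thesis unfolding poly_growth_def by blast
qed

lemma integrable_g: "integrable std_normal_distribution g"
  by (rule integrable_std_normal_poly_growth[OF growth measurable_g])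

text \<open>Centring gives |g(0)| = |E[g(0) - g(Z)]|, which is at most E|Z|, hence at most 1, for a
  standard Gaussian Z.\<close>

lemma bound: "\<bar>g t\<bar> \<le> 1 + \<bar>t\<bar>"
proof -
  interpret prob_space std_normal_distribution by simp
  have si: "square_integrable std_normal_distribution (\<lambda>x. x)"
    by (rule square_integrable_poly_growth[OF poly_growth_ident]) simp
  have "(\<integral>x. \<bar>x\<bar> \<partial>std_normal_distribution) \<le> sqrt (\<integral>x. x\<^sup>2 \<partial>std_normal_distribution)"
    by (rule expectation_abs_le_sqrt[OF si])
  also have "(\<integral>x. x\<^sup>2 \<partial>std_normal_distribution) = 1"
    using std_normal_distribution_even_moments(1)[of 1] by simp
  finally have abs1: "(\<integral>x. \<bar>x\<bar> \<partial>std_normal_distribution) \<le> 1" by simp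
  have "\<bar>g 0\<bar> = \<bar>\<integral>x. g 0 - g x \<partial>std_normal_distribution\<bar>"
    using integrable_g centred prob_space by simp
  also have "\<dots> \<le> (\<integral>x. \<bar>g 0 - g x\<bar> \<partial>std_normal_distribution)" by (rule integral_abs_bound)
  also have "\<dots> \<le> (\<integral>x. \<bar>x\<bar> \<partial>std_normal_distribution)"
  proof (rule integral_mono)
    show "integrable std_normal_distribution (\<lambda>x. \<bar>g 0 - g x\<bar>)" using integrable_g by simp
    show "integrable std_normal_distribution (\<lambda>x. \<bar>x\<bar>)"
      using square_integrable_imp_integrable[OF si] by simp
    show "\<bar>g 0 - g x\<bar> \<le> \<bar>x\<bar>" for x using lip[of 0 x] by simp
  qed
  finally have "\<bar>g 0\<bar> \<le> 1" using abs1 by simp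
  with lip[of t 0] show ?thesis by simp
qed

text \<open>Stein's equation f' - x f = g says that f times the density has derivative
  \<open>kern\<close>. The solution used is therefore the primitive \<open>prim\<close>, started at
  minus infinity, divided by the density.\<close>

definition kern :: "real \<Rightarrow> real" where "kern t = g t * std_normal_density t"

definition prim :: "real \<Rightarrow> real" where "prim x = (LBINT t=-\<infinity>..ereal x. kern t)"

lemma isCont_kern: "isCont kern t"
  unfolding kern_def[abs_def] by (intro isCont_mult continuous isCont_std_normal_density)

lemma integrable_kern: "integrable lborel kern"
  using integrable_lborel_std_normal_growth[OF growth measurable_g]
  by (simp add: kern_def[abs_def] mult.commute)

lemma set_integrable_kern: "A \<in> sets borel \<Longrightarrow> set_integrable lborel A kern"
  unfolding set_integrable_def by (intro integrable_mult_indicator integrable_kern) simp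

lemma interval_integrable_kern: "interval_lebesgue_integrable lborel a b kern"
  unfolding interval_lebesgue_integrable_def by (auto intro: set_integrable_kern)

lemma integral_kern: "(\<integral>t. kern t \<partial>lborel) = 0"
  using centred std_normal_integral[OF measurable_g] by (simp add: kern_def[abs_def] mult.commute)

lemma DERIV_prim: "(prim has_real_derivative kern x) (at x)"
proof -
  have "((\<lambda>u. LBINT y=x-1..u. kern y) has_vector_derivative (kern x)) (at x within {x-1..x+1})"
    by (rule interval_integral_FTC2)
       (auto intro: continuous_at_imp_continuous_on simp: isCont_kern)
  then have "((\<lambda>u. LBINT y=x-1..u. kern y) has_real_derivative (kern x)) (at x)"
    unfolding has_real_derivative_iff_has_vector_derivative by (simp add: at_within_Icc_at)
  then have "((\<lambda>u. prim (x-1) + (LBINT y=x-1..u. kern y)) has_real_derivative (kern x)) (at x)"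
    by (auto intro!: derivative_eq_intros)
  moreover have "prim (x-1) + (LBINT y=x-1..u. kern y) = prim u" for u
    unfolding prim_def by (rule interval_integral_sum) (rule interval_integrable_kern)
  ultimately show ?thesis by simp
qed

lemma prim_bound: "\<bar>prim x\<bar> \<le> 2"
proof -
  interpret prob_space std_normal_distribution by simp
  have "\<bar>prim x\<bar> = \<bar>\<integral>t. indicator (einterval (-\<infinity>) (ereal x)) t * kern t \<partial>lborel\<bar>"
    by (simp add: prim_def interval_lebesgue_integral_def set_lebesgue_integral_def)
  also have "\<dots> \<le> (\<integral>t. \<bar>indicator (einterval (-\<infinity>) (ereal x)) t * kern t\<bar> \<partial>lborel)"
    by (rule integral_abs_bound)
  also have "\<dots> \<le> (\<integral>t. \<bar>kern t\<bar> \<partial>lborel)"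
  proof (rule integral_mono)
    show "integrable lborel (\<lambda>t. \<bar>indicator (einterval (-\<infinity>) (ereal x)) t * kern t\<bar>)"
      using set_integrable_kern[of "einterval (-\<infinity>) (ereal x)"] unfolding set_integrable_def by simp
    show "integrable lborel (\<lambda>t. \<bar>kern t\<bar>)" using integrable_kern by simp
    show "\<bar>indicator (einterval (-\<infinity>) (ereal x)) t * kern t\<bar> \<le> \<bar>kern t\<bar>" for t
      by (auto simp: indicator_def)
  qed
  also have "\<dots> = (\<integral>t. \<bar>g t\<bar> \<partial>std_normal_distribution)"
    by (subst std_normal_integral) (auto simp: kern_def abs_mult mult.commute)
  also have "\<dots> \<le> (\<integral>t. 1 + (1 + t\<^sup>2) / 2 \<partial>std_normal_distribution)"
  proof (rule integral_mono)
    show "integrable std_normal_distribution (\<lambda>x. \<bar>g x\<bar>)" using integrable_g by simp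
    show "integrable std_normal_distribution (\<lambda>x. 1 + (1 + x\<^sup>2) / 2)"
      using integrable_std_normal_distribution_moment[of 2] by simp
    show "\<bar>g t\<bar> \<le> 1 + (1 + t\<^sup>2) / 2" for t
    proof -
      have "0 \<le> (\<bar>t\<bar> - 1)\<^sup>2" by simp
      then have "\<bar>t\<bar> \<le> (1 + t\<^sup>2) / 2" by (simp add: power2_eq_square algebra_simps)
      with bound[of t] show ?thesis by linarith
    qed
  qed
  also have "\<dots> = 2"
    using integrable_std_normal_distribution_moment[of 2] std_normal_distribution_even_moments(1)[of 1]
      prob_space by simp
  finally show ?thesis .
qed

text \<open>The left side is |f'| times the density. Writing the density at x as the integral of -t
  times the density over t < x puts both terms under one integral, with integrand (x (g(t) - g(x)) +
  (x - t) g(x)) times the density; this vanishes at t = x and is at most 3 |x| (x - t) times the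
  density.\<close>

lemma stein_bound_left:
  assumes x: "x \<le> -1"
  shows "\<bar>x * prim x + g x * std_normal_density x\<bar> \<le> 3 * std_normal_density x"
proof -
  let ?phi = std_normal_density
  let ?A = "einterval (-\<infinity>) (ereal x)"
  have A: "t \<in> ?A \<longleftrightarrow> t < x" for t by (simp add: einterval_iff)
  have minf: "-\<infinity> \<le> ereal x" by simp
  \<comment> \<open>An integrand with an elementary primitive that still vanishes to first order at
    t = x. Since -t (t^2 - x^2) is at least 2 x^2 (x - t) for t < x < 0, the factor 3/(2|x|) makes
    it dominate 3 |x| (x - t).\<close>
  let ?W = "\<lambda>t. (- t * (t\<^sup>2 - x\<^sup>2)) * ?phi t"
  have one: "(LBINT t=-\<infinity>..ereal x. - t * ?phi t) = ?phi x"
    using Gaussian_antiderivative[of "[:0, -1:]" 1 x] by simp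
  have two: "(LBINT t=-\<infinity>..ereal x. ?W t) = 2 * ?phi x"
    using Gaussian_antiderivative[of "[:0, x\<^sup>2, 0, -1:]" "[:2 - x\<^sup>2, 0, 1:]" x]
    by (simp add: pderiv_pCons power2_eq_square algebra_simps)
  have i1: "set_integrable lborel ?A (\<lambda>t. - t * ?phi t)"
    using set_integrable_std_normal_poly[of ?A "[:0, -1:]"] by simp
  have i2: "set_integrable lborel ?A ?W"
    using set_integrable_std_normal_poly[of ?A "[:0, x\<^sup>2, 0, -1:]"]
    by (simp add: power2_eq_square algebra_simps)
  have i0: "set_integrable lborel ?A kern" by (rule set_integrable_kern) simp
  have le: "\<bar>x * kern t + g x * (- t * ?phi t)\<bar> \<le> 3 / (2 * \<bar>x\<bar>) * ?W t" if "t < x" for t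
  proof -
    have "x * kern t + g x * (- t * ?phi t) = (x * (g t - g x) + (x - t) * g x) * ?phi t"
      by (simp add: kern_def algebra_simps)
    moreover have "\<bar>x * (g t - g x) + (x - t) * g x\<bar> \<le> 3 / (2 * \<bar>x\<bar>) * (- t * (t\<^sup>2 - x\<^sup>2))"
    proof -
      have "\<bar>x * (g t - g x) + (x - t) * g x\<bar> \<le> \<bar>x\<bar> * \<bar>g t - g x\<bar> + (x - t) * \<bar>g x\<bar>"
        using that by (intro order_trans[OF abs_triangle_ineq]) (simp add: abs_mult)
      also have "\<dots> \<le> \<bar>x\<bar> * (x - t) + (x - t) * (1 + \<bar>x\<bar>)"
        using that lip[of t x] bound[of x] by (intro add_mono mult_left_mono) auto
      also have "\<dots> = (x - t) * (1 + 2 * \<bar>x\<bar>)" by (simp add: algebra_simps)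
      also have "\<dots> \<le> (x - t) * (3 * \<bar>x\<bar>)" using that x by (intro mult_left_mono) auto
      also have "\<dots> \<le> 3 / (2 * \<bar>x\<bar>) * (- t * (t\<^sup>2 - x\<^sup>2))"
      proof -
        define a where "a = - x"
        define b where "b = - t"
        have ab: "a \<ge> 1" "b > a" using x that by (auto simp: a_def b_def)
        have "2 * (a * a) \<le> b * (b + a)"
        proof -
          have "a * a \<le> b * a" "a * a \<le> b * b" using ab by (auto intro!: mult_mono)
          then show ?thesis by (simp add: algebra_simps)
        qed
        then have "(b - a) * (2 * (a * a)) \<le> (b - a) * (b * (b + a))" using ab by (intro mult_left_mono) auto
        then have "(b - a) * (3 * a) \<le> 3 / (2 * a) * (b * (b\<^sup>2 - a\<^sup>2))"
          using ab by (simp add: field_simps power2_eq_square)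
        moreover have "\<bar>x\<bar> = a" "x = - a" "t = - b" using ab by (auto simp: a_def b_def)
        ultimately show ?thesis by simp
      qed
      finally show ?thesis .
    qed
    ultimately show ?thesis
      by (simp only: abs_mult abs_of_nonneg[OF normal_density_nonneg] mult.assoc[symmetric])
        (rule mult_right_mono, simp_all)
  qed
  have "x * prim x + g x * ?phi x = (LBINT t=-\<infinity>..ereal x. x * kern t + g x * (- t * ?phi t))"
    unfolding one[symmetric] prim_def
  proof (subst interval_lebesgue_integral_add(2))
    show "interval_lebesgue_integrable lborel (-\<infinity>) (ereal x) (\<lambda>t. x * kern t)"
      using i0 by (simp add: interval_lebesgue_integrable_def)
    show "interval_lebesgue_integrable lborel (-\<infinity>) (ereal x) (\<lambda>t. g x * (- t * ?phi t))"
    proof -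
      have "set_integrable lborel ?A (\<lambda>t. g x * (- t * ?phi t))"
        by (rule set_integrable_mult_right) (rule i1)
      then show ?thesis by (simp add: interval_lebesgue_integrable_def)
    qed
  qed (simp only: interval_lebesgue_integral_mult_right)
  then have "\<bar>x * prim x + g x * ?phi x\<bar> = \<bar>LBINT t:?A. x * kern t + g x * (- t * ?phi t)\<bar>"
    by (simp add: interval_lebesgue_integral_def)
  also have "\<dots> \<le> (LBINT t:?A. 3 / (2 * \<bar>x\<bar>) * ?W t)"
    unfolding set_lebesgue_integral_def
  proof (rule order_trans[OF integral_abs_bound integral_mono])
    have "set_integrable lborel ?A (\<lambda>t. x * kern t + g x * (- t * ?phi t))"
      using i0 i1 by (intro set_integral_add set_integrable_mult_right) auto
    then show "integrable lborel (\<lambda>t. \<bar>indicat_real ?A t *\<^sub>R (x * kern t + g x * (- t * ?phi t))\<bar>)"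
      unfolding set_integrable_def by simp
    have "set_integrable lborel ?A (\<lambda>t. 3 / (2 * \<bar>x\<bar>) * ?W t)"
      using i2 by (intro set_integrable_mult_right) auto
    then show "integrable lborel (\<lambda>t. indicat_real ?A t *\<^sub>R (3 / (2 * \<bar>x\<bar>) * ?W t))"
      unfolding set_integrable_def .
    show "\<bar>indicat_real ?A t *\<^sub>R (x * kern t + g x * (- t * ?phi t))\<bar> \<le> indicat_real ?A t *\<^sub>R (3 / (2 * \<bar>x\<bar>) * ?W t)" for t
      using le[of t] A[of t] by (simp add: indicator_def)
  qed
  also have "\<dots> = 3 / (2 * \<bar>x\<bar>) * (2 * ?phi x)"
  proof -
    have "(LBINT t:?A. ?W t) = 2 * ?phi x"
      using two by (simp only: interval_lebesgue_integral_le_eq[OF minf])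
    then show ?thesis by (simp only: set_integral_mult_right)
  qed
  also have "\<dots> \<le> 3 * ?phi x"
  proof -
    have "3 / (2 * \<bar>x\<bar>) \<le> 3 / 2" using x by (intro divide_left_mono) auto
    then have "3 / (2 * \<bar>x\<bar>) * (2 * ?phi x) \<le> 3 / 2 * (2 * ?phi x)"
      by (intro mult_right_mono) simp_all
    then show ?thesis by linarith
  qed
  finally show ?thesis .
qed

lemma mirror: "stein_function (\<lambda>t. g (- t))"
proof
  show "\<bar>g (- s) - g (- t)\<bar> \<le> \<bar>s - t\<bar>" for s t using lip[of "- s" "- t"] by simp
  have "(\<integral>x. std_normal_density x * g x \<partial>lborel) = (\<integral>x. std_normal_density (- x) * g (- x) \<partial>lborel)"
    using lborel_integral_real_affine[of "-1" "\<lambda>x. std_normal_density x * g x" 0] by simp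
  then show "(\<integral>x. g (- x) \<partial>std_normal_distribution) = 0"
    using centred by (simp add: std_normal_integral)
qed

text \<open>Because \<open>kern\<close> has integral zero, integrating from the right gives minus
  the primitive from the left. So the right tail of \<open>g\<close> is the left tail of its mirror
  image.\<close>

lemma prim_mirror: "stein_function.prim (\<lambda>t. g (- t)) (- x) = - prim x"
proof -
  interpret m: stein_function "\<lambda>t. g (- t)" by (rule mirror)
  have "m.prim (- x) = (LBINT t=-\<infinity>..ereal (- x). kern (- t))"
    by (simp add: m.prim_def m.kern_def kern_def)
  also have "\<dots> = (LBINT t=ereal x..\<infinity>. kern t)"
    by (subst interval_integral_reflect) simp
  finally have "prim x + m.prim (- x) = (LBINT t=-\<infinity>..\<infinity>. kern t)"
    unfolding prim_def using interval_integral_sum[OF interval_integrable_kern, of "-\<infinity>" "ereal x" \<infinity>] by simp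
  also have "\<dots> = 0"
    using integral_kern by (simp add: interval_lebesgue_integral_def set_lebesgue_integral_def)
  finally show ?thesis by simp
qed

text \<open>The expression is f' for the Stein solution f. Both tails give 3; for |x| at most 1 the
  crude bounds |prim| <= 2, |g| <= 2 and monotonicity of the density give 2 divided by the density
  at 1, plus 2.\<close>

lemma stein_bound:
  "\<bar>x * (prim x / std_normal_density x) + g x\<bar> \<le> 2 / std_normal_density 1 + 3"
proof -
  let ?phi = std_normal_density
  have pos: "?phi x > 0" for x by (rule std_normal_density_pos)
  have eq: "\<bar>x * (prim x / ?phi x) + g x\<bar> = \<bar>x * prim x + g x * ?phi x\<bar> / ?phi x"
  proof -
    have "x * (prim x / ?phi x) + g x = (x * prim x + g x * ?phi x) / ?phi x"
      using pos[of x] by (simp add: add_divide_distrib)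
    then show ?thesis using pos[of x] by (simp only: abs_divide abs_of_pos)
  qed
  have div: "\<bar>x * prim x + g x * ?phi x\<bar> / ?phi x \<le> 3"
    if "\<bar>x * prim x + g x * ?phi x\<bar> \<le> 3 * ?phi x"
    using that pos[of x] by (simp only: pos_divide_le_eq)
  have three: "3 \<le> 2 / ?phi 1 + 3" using pos[of 1] by simp
  consider "x \<le> -1" | "1 \<le> x" | "\<bar>x\<bar> \<le> 1" by linarith
  then show ?thesis
  proof cases
    case 1
    show ?thesis unfolding eq by (rule order_trans[OF div[OF stein_bound_left[OF 1]] three])
  next
    case 2
    interpret m: stein_function "\<lambda>t. g (- t)" by (rule mirror)
    have "\<bar>(- x) * m.prim (- x) + g (- (- x)) * ?phi (- x)\<bar> \<le> 3 * ?phi (- x)"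
      by (rule m.stein_bound_left) (use 2 in simp)
    then have "\<bar>x * prim x + g x * ?phi x\<bar> \<le> 3 * ?phi x"
      by (simp add: prim_mirror)
    then show ?thesis unfolding eq by (rule order_trans[OF div three])
  next
    case 3
    have "?phi 1 \<le> ?phi x"
      using power_mono[OF 3 abs_ge_zero, of 2] by (simp add: std_normal_density_def divide_right_mono)
    then have "\<bar>prim x / ?phi x\<bar> \<le> 2 / ?phi 1"
      unfolding abs_divide abs_of_pos[OF pos] using prim_bound[of x] pos[of 1] by (intro frac_le) auto
    then have "\<bar>x * (prim x / ?phi x)\<bar> \<le> 1 * (2 / ?phi 1)"
      unfolding abs_mult using 3 by (intro mult_mono) auto
    moreover have "\<bar>g x\<bar> \<le> 2" using bound[of x] 3 by linarith
    ultimately show ?thesis by linarith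
  qed
qed

lemma DERIV_stein:
  "((\<lambda>x. prim x / std_normal_density x) has_real_derivative
     x * (prim x / std_normal_density x) + g x) (at x)"
proof (rule DERIV_cong[OF DERIV_divide[OF DERIV_prim std_normal_density_DERIV]])
  have "((a * c) * c - p * (- y * c)) / (c * c) = y * (p / c) + a" if "c > 0" for a c p y :: real
    using that by (simp add: field_simps)
  from this[OF std_normal_density_pos]
  show "(kern x * std_normal_density x - prim x * (- x * std_normal_density x)) /
      (std_normal_density x * std_normal_density x) = x * (prim x / std_normal_density x) + g x"
    unfolding kern_def .
  show "std_normal_density x \<noteq> 0" using std_normal_density_pos[of x] by simp
qed

end

text \<open>One L serves all 1-Lipschitz h, as the supremum in the Wasserstein distance requires.
  Continuity of f' is recorded because Gaussian integration by parts is based on the fundamental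
  theorem of calculus.\<close>

theorem stein_solution:
  "\<exists>L>0. \<forall>h::real \<Rightarrow> real. 1-lipschitz_on UNIV h \<longrightarrow>
     (\<exists>f f'. (\<forall>x. (f has_real_derivative f' x) (at x)) \<and> (\<forall>x. isCont f' x) \<and> (\<forall>x. \<bar>f' x\<bar> \<le> L) \<and>
        (\<forall>x. f' x - x * f x = h x - (\<integral>t. h t \<partial>std_normal_distribution)))"
proof (intro exI[of _ "2 / std_normal_density 1 + 3"] conjI allI impI)
  show "2 / std_normal_density 1 + 3 > 0" using std_normal_density_pos[of 1] by (simp add: add_pos_pos)
  fix h :: "real \<Rightarrow> real" assume h: "1-lipschitz_on UNIV h"
  define g where "g t = h t - (\<integral>t. h t \<partial>std_normal_distribution)" for t
  interpret G: prob_space std_normal_distribution by simp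
  have lip: "\<bar>h s - h t\<bar> \<le> \<bar>s - t\<bar>" for s t
    using lipschitz_onD[OF h, of s t] by (simp add: dist_real_def)
  have "continuous_on UNIV h" using h by (rule lipschitz_on_continuous_on)
  then have [measurable]: "h \<in> borel_measurable borel" by (rule borel_measurable_continuous_onI)
  have "integrable std_normal_distribution h"
  proof (rule integrable_std_normal_poly_growth)
    have "poly_growth (\<lambda>t. \<bar>h 0\<bar> + \<bar>t\<bar>)"
    proof (rule poly_growth_add)
      show "poly_growth (\<lambda>t. \<bar>h 0\<bar>)" by (rule poly_growth_bounded[of _ "\<bar>h 0\<bar>"]) simp
      show "poly_growth (\<lambda>t. \<bar>t\<bar>)"
        using poly_growth_ident by (simp add: poly_growth_def)
    qed
    then obtain C N where CN: "\<And>t. \<bar>\<bar>h 0\<bar> + \<bar>t\<bar>\<bar> \<le> C * (1 + t\<^sup>2) ^ N"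
      by (auto simp: poly_growth_def)
    have "\<bar>h t\<bar> \<le> C * (1 + t\<^sup>2) ^ N" for t
      using CN[of t] lip[of t 0] by simp
    then show "poly_growth h" unfolding poly_growth_def by blast
  qed simp
  then interpret stein_function g
    by unfold_locales (simp_all add: g_def lip G.prob_space[simplified])
  show "\<exists>f f'. (\<forall>x. (f has_real_derivative f' x) (at x)) \<and> (\<forall>x. isCont f' x) \<and>
     (\<forall>x. \<bar>f' x\<bar> \<le> 2 / std_normal_density 1 + 3) \<and>
        (\<forall>x. f' x - x * f x = h x - (\<integral>t. h t \<partial>std_normal_distribution))"
  proof (intro exI conjI allI)
    show "((\<lambda>x. prim x / std_normal_density x) has_real_derivative
       x * (prim x / std_normal_density x) + g x) (at x)" for x
      by (rule DERIV_stein)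
    show "isCont (\<lambda>x. x * (prim x / std_normal_density x) + g x) x" for x
      using DERIV_isCont[OF DERIV_stein, of x] continuous[of x]
      by (intro isCont_add isCont_mult continuous_ident)
    show "\<bar>x * (prim x / std_normal_density x) + g x\<bar> \<le> 2 / std_normal_density 1 + 3" for x
      by (rule stein_bound)
    show "x * (prim x / std_normal_density x) + g x - x * (prim x / std_normal_density x) =
      h x - (\<integral>t. h t \<partial>std_normal_distribution)" for x
      by (simp add: g_def)
  qed
qed

section \<open>Hermite orthogonality\<close>

lemma pderiv_Hermite_Suc: "pderiv (Hermite (Suc n)) = smult (real (Suc n)) (Hermite n)"
proof (induction n)
  case 0
  show ?case by (simp add: pderiv_pCons)
next
  case (Suc n)
  have "pderiv (Hermite (Suc (Suc n))) = Hermite (Suc n) + [:0, 1:] * pderiv (Hermite (Suc n)) - pderiv (pderiv (Hermite (Suc n)))"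
    by (simp add: pderiv_diff pderiv_mult pderiv_pCons del: Hermite.simps(2))
       (simp add: pderiv_diff pderiv_mult pderiv_pCons)
  also have "\<dots> = Hermite (Suc n) + smult (real (Suc n)) ([:0, 1:] * Hermite n - pderiv (Hermite n))"
    unfolding Suc pderiv_smult by (simp add: smult_diff_right del: Hermite.simps)
  also have "[:0, 1:] * Hermite n - pderiv (Hermite n) = Hermite (Suc n)" by simp
  also have "Hermite (Suc n) + smult (real (Suc n)) (Hermite (Suc n)) = smult (real (Suc (Suc n))) (Hermite (Suc n))"
    by (simp only: of_nat_Suc[of "Suc n"] smult_add_left smult_1_left)
  finally show ?case .
qed

lemma Hermite_ibp_poly:
  "(\<integral>x. He (Suc n) x * poly p x \<partial>std_normal_distribution) = (\<integral>x. He n x * poly (pderiv p) x \<partial>std_normal_distribution)"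
  by (rule Hermite_ibp[OF poly_DERIV _ poly_growth_poly poly_growth_poly]) (rule poly_isCont)

text \<open>Each integration by parts lowers one Hermite polynomial and differentiates the other,
  which is again a lowering up to its degree as a factor.\<close>

lemma hermite_coeff_He: "hermite_coeff q (He p) = (if p = q then fact q else 0)"
proof (induction q arbitrary: p)
  case 0
  interpret prob_space std_normal_distribution by simp
  show ?case
  proof (cases p)
    case 0 then show ?thesis using prob_space by (simp add: hermite_coeff_def)
  next
    case (Suc k)
    have "hermite_coeff 0 (He p) = (\<integral>x. He (Suc k) x * poly 1 x \<partial>std_normal_distribution)"
      by (simp add: hermite_coeff_def Suc del: Hermite.simps(2))
    also have "\<dots> = 0" unfolding Hermite_ibp_poly by simp
    finally show ?thesis unfolding Suc by (simp del: Hermite.simps(2))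
  qed
next
  case (Suc q)
  have "hermite_coeff (Suc q) (He p) = (\<integral>x. He (Suc q) x * poly (Hermite p) x \<partial>std_normal_distribution)"
    by (simp add: hermite_coeff_def mult.commute del: Hermite.simps(2))
  also have "\<dots> = (\<integral>x. He q x * poly (pderiv (Hermite p)) x \<partial>std_normal_distribution)"
    by (rule Hermite_ibp_poly)
  also have "\<dots> = (if p = Suc q then fact (Suc q) else 0)"
  proof (cases p)
    case 0 then show ?thesis by simp
  next
    case (Suc k)
    have "(\<integral>x. He q x * poly (pderiv (Hermite p)) x \<partial>std_normal_distribution) = real (Suc k) * hermite_coeff q (He k)"
      unfolding Suc pderiv_Hermite_Suc hermite_coeff_def by (simp add: mult_ac flip: integral_mult_right_zero)
    then show ?thesis using Suc.IH[of k] Suc by (auto split: if_splits)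
  qed
  finally show ?case .
qed

lemma Hermite_explicit:
  "Hermite 1 = [:0, 1:]" "Hermite 2 = [:-1, 0, 1:]" "Hermite 3 = [:0, -3, 0, 1:]" "Hermite 4 = [:3, 0, -6, 0, 1:]"
  by (simp_all add: numeral_eq_Suc pderiv_pCons one_pCons)

section \<open>Integration by parts on Gaussian space\<close>

definition gauss_space :: "nat set \<Rightarrow> (nat \<Rightarrow> real) measure" where
  "gauss_space I = (\<Pi>\<^sub>M i\<in>I. std_normal_distribution)"

lemma product_prob_space_gauss: "product_prob_space (\<lambda>_. std_normal_distribution)"
  by (rule product_prob_spaceI) simp

lemma prob_space_gauss_space: "prob_space (gauss_space I)"
  unfolding gauss_space_def by (rule prob_space_PiM) simp

lemma gauss_space_component [measurable]: "m \<in> I \<Longrightarrow> (\<lambda>b. b m) \<in> borel_measurable (gauss_space I)"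
proof -
  assume "m \<in> I"
  then have "(\<lambda>b. b m) \<in> gauss_space I \<rightarrow>\<^sub>M std_normal_distribution"
    unfolding gauss_space_def by (rule measurable_component_singleton)
  then show ?thesis by (simp cong: measurable_cong_sets)
qed

text \<open>A weight that factorises over the coordinates: all its powers are integrable by Fubini,
  and in a single coordinate it is a constant times 1 + t^2, which matches
  \<open>poly_growth\<close>.\<close>

definition Theta :: "nat set \<Rightarrow> (nat \<Rightarrow> real) \<Rightarrow> real" where
  "Theta I b = (\<Prod>i\<in>I. 1 + (b i)\<^sup>2)"

lemma Theta_ge_1: "Theta I b \<ge> 1"
  unfolding Theta_def by (rule prod_ge_1) simp

lemma sum_squares_le_Theta: "finite I \<Longrightarrow> (\<Sum>i\<in>I. (b i)\<^sup>2) \<le> Theta I b"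
proof -
  assume "finite I"
  then have "1 + (\<Sum>i\<in>I. (b i)\<^sup>2) \<le> Theta I b"
  proof (induction I rule: finite_induct)
    case (insert i I)
    have "Theta (insert i I) b = Theta I b + (b i)\<^sup>2 * Theta I b" using insert by (simp add: Theta_def algebra_simps)
    moreover have "(b i)\<^sup>2 * 1 \<le> (b i)\<^sup>2 * Theta I b" by (intro mult_left_mono Theta_ge_1) simp
    ultimately show ?case using insert by simp
  qed (simp add: Theta_def)
  then show ?thesis by simp
qed

lemma integrable_Theta_power:
  assumes "finite I" shows "integrable (gauss_space I) (\<lambda>b. Theta I b ^ K)"
proof -
  interpret product_prob_space "\<lambda>_. std_normal_distribution" UNIV by (rule product_prob_space_gauss)
  have "integrable std_normal_distribution (\<lambda>x. (1 + x\<^sup>2) ^ K)"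
  proof -
    have "(\<lambda>x::real. (1 + x\<^sup>2) ^ K) = poly ([:1, 0, 1:] ^ K)" by (auto simp: power2_eq_square)
    then show ?thesis using integrable_std_normal_poly by metis
  qed
  then have "integrable (\<Pi>\<^sub>M i\<in>I. std_normal_distribution) (\<lambda>b. \<Prod>i\<in>I. (1 + (b i)\<^sup>2) ^ K)"
    by (intro product_integrable_prod assms)
  then show ?thesis by (simp add: gauss_space_def Theta_def prod_power_distrib)
qed

text \<open>The bound is asked for every b, extensional or not, so that single coordinates may be
  overwritten freely.\<close>

definition theta_growth :: "nat set \<Rightarrow> ((nat \<Rightarrow> real) \<Rightarrow> real) \<Rightarrow> bool" where
  "theta_growth I \<Phi> \<longleftrightarrow> (\<exists>C K. \<forall>b. \<bar>\<Phi> b\<bar> \<le> C * Theta I b ^ K)"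

lemma theta_growth_add:
  assumes "theta_growth I f" "theta_growth I g" shows "theta_growth I (\<lambda>b. f b + g b)"
proof -
  obtain C N where 1: "\<And>b. \<bar>f b\<bar> \<le> C * Theta I b ^ N" using assms by (auto simp: theta_growth_def)
  obtain D K where 2: "\<And>b. \<bar>g b\<bar> \<le> D * Theta I b ^ K" using assms by (auto simp: theta_growth_def)
  have "\<bar>f b + g b\<bar> \<le> (\<bar>C\<bar> + \<bar>D\<bar>) * Theta I b ^ (N + K)" for b
  proof -
    have "C * Theta I b ^ N \<le> \<bar>C\<bar> * Theta I b ^ N" "D * Theta I b ^ K \<le> \<bar>D\<bar> * Theta I b ^ K"
      using Theta_ge_1[of I b] by (intro mult_right_mono; simp)+
    moreover have "\<bar>C\<bar> * Theta I b ^ N \<le> \<bar>C\<bar> * Theta I b ^ (N + K)" "\<bar>D\<bar> * Theta I b ^ K \<le> \<bar>D\<bar> * Theta I b ^ (N + K)"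
      using Theta_ge_1[of I b] by (intro mult_left_mono power_increasing; simp)+
    ultimately show ?thesis using 1[of b] 2[of b] unfolding distrib_right by linarith
  qed
  then show ?thesis unfolding theta_growth_def by blast
qed

lemma theta_growth_mult:
  assumes "theta_growth I f" "theta_growth I g" shows "theta_growth I (\<lambda>b. f b * g b)"
proof -
  obtain C N where 1: "\<And>b. \<bar>f b\<bar> \<le> C * Theta I b ^ N" using assms by (auto simp: theta_growth_def)
  obtain D K where 2: "\<And>b. \<bar>g b\<bar> \<le> D * Theta I b ^ K" using assms by (auto simp: theta_growth_def)
  have "\<bar>f b * g b\<bar> \<le> (C * D) * Theta I b ^ (N + K)" for b
    using mult_mono[OF 1[of b] 2[of b]] order_trans[OF abs_ge_zero 1[of b]]
    by (simp add: abs_mult power_add mult_ac)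
  then show ?thesis unfolding theta_growth_def by blast
qed

lemma theta_growth_bounded: "(\<And>b. \<bar>f b\<bar> \<le> B) \<Longrightarrow> theta_growth I f"
  unfolding theta_growth_def by (rule exI[of _ B], rule exI[of _ 0]) simp

lemma theta_growth_mono:
  assumes "theta_growth I g" "\<And>b. \<bar>f b\<bar> \<le> \<bar>g b\<bar>" shows "theta_growth I f"
  using assms unfolding theta_growth_def by (meson order_trans)

lemma theta_growth_component:
  assumes "finite I" "m \<in> I" shows "theta_growth I (\<lambda>b. b m)"
  unfolding theta_growth_def
proof (intro exI allI)
  fix b :: "nat \<Rightarrow> real"
  have "(b m)\<^sup>2 \<le> (\<Sum>i\<in>I. (b i)\<^sup>2)" 
    using assms by (intro member_le_sum[of m I "\<lambda>i. (b i)\<^sup>2"]) auto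
  also have "\<dots> \<le> Theta I b" by (rule sum_squares_le_Theta[OF assms(1)])
  also have "\<dots> \<le> (Theta I b)\<^sup>2" using Theta_ge_1[of I b] by (simp add: power2_eq_square)
  finally have "\<bar>b m\<bar> \<le> Theta I b" using Theta_ge_1[of I b] by (simp add: abs_le_square_iff[symmetric])
  then show "\<bar>b m\<bar> \<le> 1 * Theta I b ^ 1" by simp
qed

lemma integrable_theta_growth:
  assumes "finite I" "theta_growth I f" and [measurable]: "f \<in> borel_measurable (gauss_space I)"
  shows "integrable (gauss_space I) f"
proof -
  obtain C K where 1: "\<And>b. \<bar>f b\<bar> \<le> C * Theta I b ^ K" using assms by (auto simp: theta_growth_def)
  show ?thesis
  proof (rule Bochner_Integration.integrable_bound)
    show "integrable (gauss_space I) (\<lambda>b. C * Theta I b ^ K)"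
      by (intro integrable_mult_right integrable_Theta_power assms)
    show "AE b in gauss_space I. norm (f b) \<le> norm (C * Theta I b ^ K)"
      using 1 by (intro AE_I2) (auto intro: order_trans[OF _ abs_ge_self])
  qed simp
qed

text \<open>Fubini, integrating over coordinate m first, reduces this to
  \<open>std_normal_ibp\<close>.\<close>

lemma gauss_space_ibp:
  assumes I: "finite I" "m \<in> I"
    and meas: "\<Phi> \<in> borel_measurable (gauss_space I)" "\<Phi>' \<in> borel_measurable (gauss_space I)"
    and der: "\<And>b t. ((\<lambda>t. \<Phi> (b(m := t))) has_real_derivative \<Phi>' (b(m := t))) (at t)"
    and cont: "\<And>b t. isCont (\<lambda>t. \<Phi>' (b(m := t))) t"
    and growth: "theta_growth I \<Phi>" "theta_growth I \<Phi>'"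
  shows "(\<integral>b. b m * \<Phi> b \<partial>gauss_space I) = (\<integral>b. \<Phi>' b \<partial>gauss_space I)"
proof -
  interpret product_prob_space "\<lambda>_. std_normal_distribution" UNIV by (rule product_prob_space_gauss)
  define J where "J = I - {m}"
  have J: "I = insert m J" "m \<notin> J" "finite J" using I by (auto simp: J_def)
  have pg: "poly_growth (\<lambda>t. f (b(m := t)))" if tg: "theta_growth I f" for f b
  proof -
    obtain C K where 1: "\<And>b. \<bar>f b\<bar> \<le> C * Theta I b ^ K" using tg by (auto simp: theta_growth_def)
    have "Theta I (b(m := t)) = (1 + t\<^sup>2) * Theta J b" for t
      unfolding Theta_def J(1) using J(2,3) by (simp add: prod.insert) (intro disjI2 prod.cong, auto)
    then have "\<bar>f (b(m := t))\<bar> \<le> (C * Theta J b ^ K) * (1 + t\<^sup>2) ^ K" for t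
      using 1[of "b(m := t)"] by (simp add: power_mult_distrib mult_ac)
    then show ?thesis unfolding poly_growth_def by blast
  qed
  have i1: "integrable (gauss_space I) (\<lambda>b. b m * \<Phi> b)"
    using I meas growth
    by (intro integrable_theta_growth theta_growth_mult theta_growth_component borel_measurable_times gauss_space_component)
  have i2: "integrable (gauss_space I) \<Phi>'"
    using I meas growth by (intro integrable_theta_growth)
  have "(\<integral>b. b m * \<Phi> b \<partial>gauss_space I) = (\<integral>b. (\<integral>t. (b(m := t)) m * \<Phi> (b(m := t)) \<partial>std_normal_distribution) \<partial>(\<Pi>\<^sub>M i\<in>J. std_normal_distribution))"
    unfolding gauss_space_def J(1)
    by (rule product_integral_insert[OF J(3,2)]) (use i1 in \<open>simp add: gauss_space_def J(1)\<close>)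
  also have "\<dots> = (\<integral>b. (\<integral>t. \<Phi>' (b(m := t)) \<partial>std_normal_distribution) \<partial>(\<Pi>\<^sub>M i\<in>J. std_normal_distribution))"
  proof (rule Bochner_Integration.integral_cong[OF refl])
    fix b
    show "(\<integral>t. (b(m := t)) m * \<Phi> (b(m := t)) \<partial>std_normal_distribution) = (\<integral>t. \<Phi>' (b(m := t)) \<partial>std_normal_distribution)"
      using std_normal_ibp[of "\<lambda>t. \<Phi> (b(m := t))" "\<lambda>t. \<Phi>' (b(m := t))",
          OF der cont pg[OF growth(1)] pg[OF growth(2)]] by simp
  qed
  also have "\<dots> = (\<integral>b. \<Phi>' b \<partial>gauss_space I)"
    unfolding gauss_space_def J(1)
    by (rule product_integral_insert[OF J(3,2), symmetric]) (use i2 in \<open>simp add: gauss_space_def J(1)\<close>)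
  finally show ?thesis .
qed

lemma std_normal_iexp: "(CLINT x|std_normal_distribution. iexp (s * x)) = of_real (exp (- s\<^sup>2 / 2))"
  using char_std_normal_distribution unfolding char_def by metis

lemma gauss_space_cos_sin:
  assumes "finite I"
  shows "(\<integral>b. cos (\<Sum>i\<in>I. c i * b i) \<partial>gauss_space I) = exp (- (\<Sum>i\<in>I. (c i)\<^sup>2) / 2)"
    "(\<integral>b. sin (\<Sum>i\<in>I. c i * b i) \<partial>gauss_space I) = 0"
proof -
  interpret product_prob_space "\<lambda>_. std_normal_distribution" UNIV by (rule product_prob_space_gauss)
  interpret G: prob_space "gauss_space I" by (rule prob_space_gauss_space)
  have prod: "iexp (\<Sum>i\<in>I. c i * b i) = (\<Prod>i\<in>I. iexp (c i * b i))" for b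
    using assms by (simp add: sum_distrib_left exp_sum)
  have i: "integrable (gauss_space I) (\<lambda>b. iexp (\<Sum>i\<in>I. c i * b i))"
    by (rule G.integrable_iexp) auto
  have "(CLINT b|gauss_space I. iexp (\<Sum>i\<in>I. c i * b i)) = (\<Prod>i\<in>I. CLINT x|std_normal_distribution. iexp (c i * x))"
    unfolding prod gauss_space_def
    by (rule product_integral_prod[OF assms]) (rule prob_space.integrable_iexp[OF prob_space_std_normal], auto)
  also have "\<dots> = of_real (\<Prod>i\<in>I. exp (- (c i)\<^sup>2 / 2))"
    by (simp only: std_normal_iexp of_real_prod)
  also have "(\<Prod>i\<in>I. exp (- (c i)\<^sup>2 / 2)) = exp (- (\<Sum>i\<in>I. (c i)\<^sup>2) / 2)"
    using assms by (simp only: exp_sum[symmetric] sum_divide_distrib[symmetric] sum_negf)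
  finally have e: "(CLINT b|gauss_space I. iexp (\<Sum>i\<in>I. c i * b i)) = of_real (exp (- (\<Sum>i\<in>I. (c i)\<^sup>2) / 2))" .
  have "(\<integral>b. Re (iexp (\<Sum>i\<in>I. c i * b i)) \<partial>gauss_space I) = exp (- (\<Sum>i\<in>I. (c i)\<^sup>2) / 2)"
    unfolding integral_Re[OF i] e by simp
  then show "(\<integral>b. cos (\<Sum>i\<in>I. c i * b i) \<partial>gauss_space I) = exp (- (\<Sum>i\<in>I. (c i)\<^sup>2) / 2)"
    by (simp add: Re_exp)
  have "(\<integral>b. Im (iexp (\<Sum>i\<in>I. c i * b i)) \<partial>gauss_space I) = 0"
    unfolding integral_Im[OF i] e by simp
  then show "(\<integral>b. sin (\<Sum>i\<in>I. c i * b i) \<partial>gauss_space I) = 0"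
    by (simp add: Im_exp)
qed

section \<open>Gaussian fields with finitely many coefficients\<close>

text \<open>The field is the sum of b_m y_m with independent standard Gaussian b_m.
  \<open>unit\<close> makes its values standard Gaussian, \<open>mean\<close> removes the first
  chaos, and \<open>orth\<close> makes the quadratic functional a multiple of the centred sum of the
  b_m^2, which is the source of the explicit second chaos.\<close>

locale gaussian_field = finite_measure S for S :: "'b measure" +
  fixes I :: "nat set" and y :: "nat \<Rightarrow> 'b \<Rightarrow> real"
  assumes fin: "finite I"
    and y_measurable: "\<And>m. m \<in> I \<Longrightarrow> y m \<in> borel_measurable S"
    and unit: "\<And>x. x \<in> space S \<Longrightarrow> (\<Sum>m\<in>I. (y m x)\<^sup>2) = 1"
    and orth: "\<And>m m'. m \<in> I \<Longrightarrow> m' \<in> I \<Longrightarrow>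
      (\<integral>x. y m x * y m' x \<partial>S) = (if m = m' then measure S (space S) / real (card I) else 0)"
    and mean: "\<And>m. m \<in> I \<Longrightarrow> (\<integral>x. y m x \<partial>S) = 0"
    and mass: "measure S (space S) > 0"
begin

abbreviation P :: "(nat \<Rightarrow> real) measure" where "P \<equiv> gauss_space I"
abbreviation \<mu> :: real where "\<mu> \<equiv> measure S (space S)"
abbreviation N :: real where "N \<equiv> real (card I)"

definition T :: "(nat \<Rightarrow> real) \<Rightarrow> 'b \<Rightarrow> real" where "T b x = (\<Sum>m\<in>I. b m * y m x)"
text \<open>The covariance of the field at two points; see \<open>field_pair\<close>.\<close>

definition G :: "'b \<Rightarrow> 'b \<Rightarrow> real" where "G x x' = (\<Sum>m\<in>I. y m x * y m x')"
definition SF :: "(real \<Rightarrow> real) \<Rightarrow> (nat \<Rightarrow> real) \<Rightarrow> real" where "SF f b = (\<integral>x. f (T b x) \<partial>S)"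

sublocale P: prob_space P by (rule prob_space_gauss_space)
sublocale SP: pair_sigma_finite S P ..
sublocale SS: pair_sigma_finite S S ..
sublocale FSS: finite_measure "S \<Otimes>\<^sub>M S"
  by (rule finite_measure_pair_measure) (rule finite_measure_axioms)+
sublocale SSP: pair_sigma_finite "S \<Otimes>\<^sub>M S" P ..

lemma space_nonempty: "space S \<noteq> {}"
  using mass by auto

lemma N_pos: "N > 0"
proof -
  obtain x where "x \<in> space S" using space_nonempty by blast
  from unit[OF this] have "I \<noteq> {}" by auto
  then show ?thesis using fin by (simp add: card_gt_0_iff)
qed

lemma y_le: assumes "m \<in> I" "x \<in> space S" shows "\<bar>y m x\<bar> \<le> 1"
proof -
  have "(y m x)\<^sup>2 \<le> (\<Sum>m\<in>I. (y m x)\<^sup>2)" using assms fin by (intro member_le_sum[of m I "\<lambda>m. (y m x)\<^sup>2"]) auto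
  then show ?thesis using unit[OF assms(2)] by (simp add: abs_square_le_1)
qed

lemma G_le: assumes "x \<in> space S" "x' \<in> space S" shows "\<bar>G x x'\<bar> \<le> 1"
proof -
  have "(G x x')\<^sup>2 \<le> (\<Sum>m\<in>I. (y m x)\<^sup>2) * (\<Sum>m\<in>I. (y m x')\<^sup>2)"
    unfolding G_def by (rule Cauchy_Schwarz_ineq_sum)
  then show ?thesis using unit assms by (simp add: abs_square_le_1)
qed

lemma T_measurable_pair [measurable]: "(\<lambda>z. T (snd z) (fst z)) \<in> borel_measurable (S \<Otimes>\<^sub>M P)"
  unfolding T_def
  by (intro borel_measurable_sum borel_measurable_times measurable_compose[OF measurable_snd gauss_space_component]
      measurable_compose[OF measurable_fst y_measurable])

lemma T_measurable_pair' [measurable]: "(\<lambda>z. T (fst z) (snd z)) \<in> borel_measurable (P \<Otimes>\<^sub>M S)"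
  unfolding T_def
  by (intro borel_measurable_sum borel_measurable_times measurable_compose[OF measurable_fst gauss_space_component]
      measurable_compose[OF measurable_snd y_measurable])

lemma T_measurable_coeff [measurable]: "(\<lambda>b. T b x) \<in> borel_measurable P"
  unfolding T_def by (intro borel_measurable_sum borel_measurable_times gauss_space_component borel_measurable_const)

lemma T_measurable_space [measurable]: "T b \<in> borel_measurable S"
  unfolding T_def[abs_def] by (intro borel_measurable_sum borel_measurable_times y_measurable borel_measurable_const)

lemma G_measurable [measurable]: "(\<lambda>z. G (fst z) (snd z)) \<in> borel_measurable (S \<Otimes>\<^sub>M S)"
  unfolding G_def
  by (intro borel_measurable_sum borel_measurable_times measurable_compose[OF measurable_fst y_measurable]
      measurable_compose[OF measurable_snd y_measurable])

lemma field_pair: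
  assumes "x \<in> space S" "x' \<in> space S"
  shows "gaussian_pair P (\<lambda>b. T b x) (\<lambda>b. T b x') (G x x')"
  unfolding gaussian_pair_def
proof (intro conjI allI)
  fix s t :: real
  have comb: "s * T b x + t * T b x' = (\<Sum>m\<in>I. (s * y m x + t * y m x') * b m)" for b
    unfolding T_def sum_distrib_left sum.distrib[symmetric] by (rule sum.cong) (auto simp: algebra_simps)
  have "(\<Sum>m\<in>I. (s * y m x + t * y m x')\<^sup>2) = (\<Sum>m\<in>I. s\<^sup>2 * (y m x)\<^sup>2 + 2 * s * t * (y m x * y m x') + t\<^sup>2 * (y m x')\<^sup>2)"
    by (rule sum.cong) (auto simp: power2_eq_square algebra_simps)
  also have "\<dots> = s\<^sup>2 * (\<Sum>m\<in>I. (y m x)\<^sup>2) + 2 * s * t * G x x' + t\<^sup>2 * (\<Sum>m\<in>I. (y m x')\<^sup>2)"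
    unfolding G_def by (simp only: sum.distrib sum_distrib_left)
  also have "\<dots> = s\<^sup>2 + 2 * G x x' * s * t + t\<^sup>2" using unit assms by simp
  finally have sq: "(\<Sum>m\<in>I. (s * y m x + t * y m x')\<^sup>2) = s\<^sup>2 + 2 * G x x' * s * t + t\<^sup>2" .
  show "(\<integral>b. cos (s * T b x + t * T b x') \<partial>P) = exp (- (s\<^sup>2 + 2 * G x x' * s * t + t\<^sup>2) / 2)"
    unfolding comb gauss_space_cos_sin[OF fin] sq ..
  show "(\<integral>b. sin (s * T b x + t * T b x') \<partial>P) = 0"
    unfolding comb gauss_space_cos_sin[OF fin] ..
qed (auto intro: P.prob_space_axioms)

lemma integrable_pair:
  fixes f :: "real \<Rightarrow> real"
  assumes f: "integrable std_normal_distribution f"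
  shows "integrable (S \<Otimes>\<^sub>M P) (\<lambda>(x, b). f (T b x))"
proof (rule SP.Fubini_integrable)
  have m[measurable]: "f \<in> borel_measurable borel" using borel_measurable_integrable[OF f] by simp
  show "(\<lambda>(x, b). f (T b x)) \<in> borel_measurable (S \<Otimes>\<^sub>M P)"
    unfolding split_beta' by measurable
  have e: "(\<integral>b. \<bar>f (T b x)\<bar> \<partial>P) = (\<integral>t. \<bar>f t\<bar> \<partial>std_normal_distribution)" if "x \<in> space S" for x
    by (rule gaussian_pair_integral[OF field_pair[OF that that], of "\<lambda>t. \<bar>f t\<bar>"]) simp
  have "integrable S (\<lambda>x. \<integral>t. \<bar>f t\<bar> \<partial>std_normal_distribution)" by simp
  then show "integrable S (\<lambda>x. \<integral>b. norm (case (x, b) of (x, b) \<Rightarrow> f (T b x)) \<partial>P)"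
    by (rule Bochner_Integration.integrable_cong[THEN iffD1, rotated 2]) (simp_all add: e)
  show "AE x in S. integrable P (\<lambda>b. case (x, b) of (x, b) \<Rightarrow> f (T b x))"
    using f gaussian_pair_integrable_iff[OF field_pair m] by (intro AE_I2) simp
qed

text \<open>Integrability under the Gaussian law controls the integral over S for almost every b; on
  the exceptional null set \<open>SF\<close> has the default value 0. Splitting \<open>SF\<close>
  along a sum of such functions is therefore done almost everywhere.\<close>

lemma AE_integrable_field:
  fixes f :: "real \<Rightarrow> real"
  assumes "integrable std_normal_distribution f"
  shows "AE b in P. integrable S (\<lambda>x. f (T b x))"
  using SP.AE_integrable_snd[OF integrable_pair[OF assms]] .

lemma SF_measurable [measurable]:
  assumes [measurable]: "f \<in> borel_measurable borel" shows "SF f \<in> borel_measurable P"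
  unfolding SF_def[abs_def] by (rule borel_measurable_lebesgue_integral) (simp add: split_beta')

lemma expectation_SF:
  fixes f :: "real \<Rightarrow> real"
  assumes f: "integrable std_normal_distribution f"
  shows "P.expectation (SF f) = \<mu> * (\<integral>t. f t \<partial>std_normal_distribution)"
proof -
  have m[measurable]: "f \<in> borel_measurable borel" using borel_measurable_integrable[OF f] by simp
  have "P.expectation (SF f) = (\<integral>x. (\<integral>b. f (T b x) \<partial>P) \<partial>S)"
    unfolding SF_def by (rule SP.Fubini_integral[OF integrable_pair[OF f]])
  also have "\<dots> = (\<integral>x. (\<integral>t. f t \<partial>std_normal_distribution) \<partial>S)"
    by (rule Bochner_Integration.integral_cong[OF refl]) (rule gaussian_pair_integral[OF field_pair m])
  finally show ?thesis by simp
qed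

text \<open>The square becomes a double integral over S, exchanged with the expectation.
  Cauchy-Schwarz supplies absolute integrability, since the correlation of f at two points is at
  most its Gaussian second moment, uniformly in the points.\<close>

lemma square_SF:
  assumes f: "square_integrable std_normal_distribution f"
  shows "square_integrable P (SF f)"
    "P.expectation (\<lambda>b. (SF f b)\<^sup>2) = (\<integral>z. (\<integral>b. f (T b (fst z)) * f (T b (snd z)) \<partial>P) \<partial>(S \<Otimes>\<^sub>M S))"
    "integrable (S \<Otimes>\<^sub>M S) (\<lambda>z. \<integral>b. f (T b (fst z)) * f (T b (snd z)) \<partial>P)"
proof -
  have m[measurable]: "f \<in> borel_measurable borel" using f by (rule square_integrable_std_normal_measurable)
  have [measurable]: "(\<lambda>w. T (snd w) (fst (fst w))) \<in> borel_measurable ((S \<Otimes>\<^sub>M S) \<Otimes>\<^sub>M P)"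
    using measurable_compose[OF _ T_measurable_pair, of "\<lambda>w. (fst (fst w), snd w)" "(S \<Otimes>\<^sub>M S) \<Otimes>\<^sub>M P"] by simp
  have [measurable]: "(\<lambda>w. T (snd w) (snd (fst w))) \<in> borel_measurable ((S \<Otimes>\<^sub>M S) \<Otimes>\<^sub>M P)"
    using measurable_compose[OF _ T_measurable_pair, of "\<lambda>w. (snd (fst w), snd w)" "(S \<Otimes>\<^sub>M S) \<Otimes>\<^sub>M P"] by simp
  let ?h = "\<lambda>(z, b). f (T b (fst z)) * f (T b (snd z))"
  have hm: "?h \<in> borel_measurable ((S \<Otimes>\<^sub>M S) \<Otimes>\<^sub>M P)" unfolding split_beta' by measurable
  have sq: "square_integrable P (\<lambda>b. f (T b x))" if "x \<in> space S" for x
    by (rule gaussian_pair_square_integrable(1)[OF field_pair[OF that that] f])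
  have e2: "P.expectation (\<lambda>b. (f (T b x))\<^sup>2) = (\<integral>t. (f t)\<^sup>2 \<partial>std_normal_distribution)" if "x \<in> space S" for x
    by (rule gaussian_pair_integral[OF field_pair[OF that that], of "\<lambda>t. (f t)\<^sup>2"]) simp
  have bnd: "(\<integral>b. \<bar>f (T b x) * f (T b x')\<bar> \<partial>P) \<le> (\<integral>t. (f t)\<^sup>2 \<partial>std_normal_distribution)"
    if "x \<in> space S" "x' \<in> space S" for x x'
  proof -
    have "0 \<le> (\<integral>t. (f t)\<^sup>2 \<partial>std_normal_distribution)" by simp
    then show ?thesis
      using Cauchy_Schwarz_integral_abs[OF sq[OF that(1)] sq[OF that(2)]] unfolding e2[OF that(1)] e2[OF that(2)] by simp
  qed
  have hi: "integrable ((S \<Otimes>\<^sub>M S) \<Otimes>\<^sub>M P) ?h"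
  proof (rule SSP.Fubini_integrable[OF hm])
    show "integrable (S \<Otimes>\<^sub>M S) (\<lambda>z. \<integral>b. norm (?h (z, b)) \<partial>P)"
    proof (rule FSS.integrable_const_bound[of _ "\<integral>t. (f t)\<^sup>2 \<partial>std_normal_distribution"])
      show "AE z in S \<Otimes>\<^sub>M S. norm (\<integral>b. norm (?h (z, b)) \<partial>P) \<le> (\<integral>t. (f t)\<^sup>2 \<partial>std_normal_distribution)"
        using bnd by (intro AE_I2) (auto simp: space_pair_measure)
      show "(\<lambda>z. \<integral>b. norm (?h (z, b)) \<partial>P) \<in> borel_measurable (S \<Otimes>\<^sub>M S)"
        by (rule P.borel_measurable_lebesgue_integral) (simp add: split_beta')
    qed
    show "AE z in S \<Otimes>\<^sub>M S. integrable P (\<lambda>b. ?h (z, b))"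
      by (intro AE_I2) (auto simp: space_pair_measure intro!: square_integrable_mult sq)
  qed
  have ae: "AE b in P. (SF f b)\<^sup>2 = (\<integral>z. f (T b (fst z)) * f (T b (snd z)) \<partial>(S \<Otimes>\<^sub>M S))"
    using SSP.AE_integrable_snd[OF hi]
  proof eventually_elim
    case (elim b)
    have "(\<integral>z. f (T b (fst z)) * f (T b (snd z)) \<partial>(S \<Otimes>\<^sub>M S)) = (\<integral>x. (\<integral>x'. f (T b x) * f (T b x') \<partial>S) \<partial>S)"
      using SS.integral_fst'[OF elim] by simp
    also have "\<dots> = (SF f b)\<^sup>2" by (simp add: SF_def power2_eq_square)
    finally show ?case by (rule sym)
  qed
  have i: "integrable P (\<lambda>b. \<integral>z. f (T b (fst z)) * f (T b (snd z)) \<partial>(S \<Otimes>\<^sub>M S))"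
    using SSP.integrable_snd[OF hi] by simp
  have "integrable P (\<lambda>b. (SF f b)\<^sup>2)"
    by (subst integrable_cong_AE[OF _ _ ae]) (use i in auto)
  then show "square_integrable P (SF f)" by (simp add: square_integrable_def)
  have "P.expectation (\<lambda>b. (SF f b)\<^sup>2) = (\<integral>b. (\<integral>z. f (T b (fst z)) * f (T b (snd z)) \<partial>(S \<Otimes>\<^sub>M S)) \<partial>P)"
    by (rule integral_cong_AE[OF _ _ ae]) (use i in auto)
  also have "\<dots> = (\<integral>z. (\<integral>b. f (T b (fst z)) * f (T b (snd z)) \<partial>P) \<partial>(S \<Otimes>\<^sub>M S))"
    by (rule SSP.Fubini_integral[OF hi])
  finally show "P.expectation (\<lambda>b. (SF f b)\<^sup>2) = (\<integral>z. (\<integral>b. f (T b (fst z)) * f (T b (snd z)) \<partial>P) \<partial>(S \<Otimes>\<^sub>M S))" .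
  show "integrable (S \<Otimes>\<^sub>M S) (\<lambda>z. \<integral>b. f (T b (fst z)) * f (T b (snd z)) \<partial>P)"
    using SSP.integrable_fst[OF hi] by simp
qed

text \<open>By Mehler's formula the second moment of the q-th chaos functional is q! times
  \<open>B q\<close>; \<open>A q\<close> controls all orders from q on at once.\<close>

definition B :: "nat \<Rightarrow> real" where "B q = (\<integral>z. G (fst z) (snd z) ^ q \<partial>(S \<Otimes>\<^sub>M S))"
definition A :: "nat \<Rightarrow> real" where "A q = (\<integral>z. \<bar>G (fst z) (snd z)\<bar> ^ q \<partial>(S \<Otimes>\<^sub>M S))"

lemma integrable_G_power: "integrable (S \<Otimes>\<^sub>M S) (\<lambda>z. G (fst z) (snd z) ^ q)"
  "integrable (S \<Otimes>\<^sub>M S) (\<lambda>z. \<bar>G (fst z) (snd z)\<bar> ^ q)"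
  by (rule FSS.integrable_const_bound[of _ 1];
      auto simp: space_pair_measure power_abs intro!: AE_I2 power_le_one G_le)+

text \<open>This is \<open>covariance_inequality\<close> integrated over all pairs of
  points.\<close>

lemma second_moment:
  assumes f: "square_integrable std_normal_distribution f"
  shows "\<bar>P.expectation (\<lambda>b. (SF f b)\<^sup>2) - (\<Sum>q<k. (hermite_coeff q f)\<^sup>2 / fact q * B q)\<bar>
    \<le> A k * ((\<integral>t. (f t)\<^sup>2 \<partial>std_normal_distribution) - (\<Sum>q<k. (hermite_coeff q f)\<^sup>2 / fact q))"
proof -
  let ?E = "\<lambda>z. \<integral>b. f (T b (fst z)) * f (T b (snd z)) \<partial>P"
  let ?c = "\<lambda>q. (hermite_coeff q f)\<^sup>2 / fact q"
  let ?R = "(\<integral>t. (f t)\<^sup>2 \<partial>std_normal_distribution) - (\<Sum>q<k. ?c q)"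
  let ?g = "\<lambda>z. G (fst z) (snd z)"
  have i: "integrable (S \<Otimes>\<^sub>M S) (\<lambda>z. \<Sum>q<k. ?c q * ?g z ^ q)"
    by (intro Bochner_Integration.integrable_sum integrable_mult_right integrable_G_power)
  have "(\<Sum>q<k. ?c q * B q) = (\<integral>z. (\<Sum>q<k. ?c q * ?g z ^ q) \<partial>(S \<Otimes>\<^sub>M S))"
    unfolding B_def
    by (subst Bochner_Integration.integral_sum) (auto intro!: integrable_mult_right integrable_G_power)
  then have "P.expectation (\<lambda>b. (SF f b)\<^sup>2) - (\<Sum>q<k. ?c q * B q) = (\<integral>z. ?E z - (\<Sum>q<k. ?c q * ?g z ^ q) \<partial>(S \<Otimes>\<^sub>M S))"
    unfolding square_SF(2)[OF f] using Bochner_Integration.integral_diff[OF square_SF(3)[OF f] i] by simp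
  then have "\<bar>P.expectation (\<lambda>b. (SF f b)\<^sup>2) - (\<Sum>q<k. ?c q * B q)\<bar>
      = \<bar>\<integral>z. ?E z - (\<Sum>q<k. ?c q * ?g z ^ q) \<partial>(S \<Otimes>\<^sub>M S)\<bar>" by (rule arg_cong)
  also have "\<dots> \<le> (\<integral>z. \<bar>?E z - (\<Sum>q<k. ?c q * ?g z ^ q)\<bar> \<partial>(S \<Otimes>\<^sub>M S))" by (rule integral_abs_bound)
  also have "\<dots> \<le> (\<integral>z. \<bar>?g z\<bar> ^ k * ?R \<partial>(S \<Otimes>\<^sub>M S))"
  proof (rule integral_mono)
    show "integrable (S \<Otimes>\<^sub>M S) (\<lambda>z. \<bar>?E z - (\<Sum>q<k. ?c q * ?g z ^ q)\<bar>)"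
      using square_SF(3)[OF f] i by simp
    show "integrable (S \<Otimes>\<^sub>M S) (\<lambda>z. \<bar>?g z\<bar> ^ k * ?R)" by (intro integrable_mult_left integrable_G_power)
    fix z assume "z \<in> space (S \<Otimes>\<^sub>M S)"
    then have z: "fst z \<in> space S" "snd z \<in> space S" by (auto simp: space_pair_measure)
    show "\<bar>?E z - (\<Sum>q<k. ?c q * ?g z ^ q)\<bar> \<le> \<bar>?g z\<bar> ^ k * ?R"
      using covariance_inequality[OF field_pair[OF z] G_le[OF z] f, of k] by (simp add: mult.commute)
  qed
  also have "\<dots> = A k * ?R" by (simp add: A_def)
  finally show ?thesis .
qed

lemma integrable_y: "m \<in> I \<Longrightarrow> integrable S (y m)"
  by (rule integrable_const_bound[of _ 1]) (auto intro!: AE_I2 y_le y_measurable)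

lemma integrable_yy: "m \<in> I \<Longrightarrow> m' \<in> I \<Longrightarrow> integrable S (\<lambda>x. y m x * y m' x)"
  by (rule integrable_const_bound[of _ 1])
     (auto intro!: AE_I2 y_le y_measurable borel_measurable_times mult_le_one simp: abs_mult)

lemma integral_SS_product:
  fixes u v :: "'b \<Rightarrow> real"
  assumes "integrable S u" "integrable S v"
  shows "integrable (S \<Otimes>\<^sub>M S) (\<lambda>z. u (fst z) * v (snd z))"
    "(\<integral>z. u (fst z) * v (snd z) \<partial>(S \<Otimes>\<^sub>M S)) = (\<integral>x. u x \<partial>S) * (\<integral>x. v x \<partial>S)"
proof -
  have [measurable]: "u \<in> borel_measurable S" "v \<in> borel_measurable S" using assms by auto
  show i: "integrable (S \<Otimes>\<^sub>M S) (\<lambda>z. u (fst z) * v (snd z))"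
  proof (rule SS.Fubini_integrable)
    show "integrable S (\<lambda>x. \<integral>y. norm (u (fst (x, y)) * v (snd (x, y))) \<partial>S)"
      using assms by (simp add: abs_mult)
  qed (use assms in auto)
  show "(\<integral>z. u (fst z) * v (snd z) \<partial>(S \<Otimes>\<^sub>M S)) = (\<integral>x. u x \<partial>S) * (\<integral>x. v x \<partial>S)"
    using SS.integral_fst'[OF i] by simp
qed

lemma B_values: "B 0 = \<mu>\<^sup>2" "B 1 = 0" "B 2 = \<mu>\<^sup>2 / N"
proof -
  show "B 0 = \<mu>\<^sup>2"
    using integral_SS_product(2)[of "\<lambda>_. 1" "\<lambda>_. 1"] by (simp add: B_def power2_eq_square)
  have "B 1 = (\<Sum>m\<in>I. \<integral>z. y m (fst z) * y m (snd z) \<partial>(S \<Otimes>\<^sub>M S))"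
    unfolding B_def G_def power_one_right
    by (rule Bochner_Integration.integral_sum) (rule integral_SS_product; rule integrable_y; assumption)
  also have "\<dots> = 0"
    by (rule sum.neutral) (simp add: integral_SS_product(2)[OF integrable_y integrable_y] mean)
  finally show "B 1 = 0" .
  have sq: "(G x x')\<^sup>2 = (\<Sum>m\<in>I. \<Sum>m'\<in>I. (y m x * y m' x) * (y m x' * y m' x'))" for x x'
    unfolding G_def power2_eq_square sum_product by (intro sum.cong refl) (simp only: mult_ac)
  have "B 2 = (\<Sum>m\<in>I. \<Sum>m'\<in>I. \<integral>z. (y m (fst z) * y m' (fst z)) * (y m (snd z) * y m' (snd z)) \<partial>(S \<Otimes>\<^sub>M S))"
    unfolding B_def sq
    by (subst Bochner_Integration.integral_sum, intro Bochner_Integration.integrable_sum integral_SS_product(1)[OF integrable_yy integrable_yy],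
        assumption+, intro sum.cong refl Bochner_Integration.integral_sum integral_SS_product(1)[OF integrable_yy integrable_yy]) assumption+
  also have "\<dots> = (\<Sum>m\<in>I. \<Sum>m'\<in>I. if m = m' then (\<mu> / N)\<^sup>2 else 0)"
    by (intro sum.cong refl) (simp add: integral_SS_product(2)[OF integrable_yy integrable_yy] orth power2_eq_square)
  also have "\<dots> = N * (\<mu> / N)\<^sup>2" using fin by simp
  also have "\<dots> = \<mu>\<^sup>2 / N" using N_pos by (simp add: power2_eq_square)
  finally show "B 2 = \<mu>\<^sup>2 / N" .
qed

lemma A_nonneg: "A q \<ge> 0"
  unfolding A_def by simp

text \<open>As |G| is at most 1, the third absolute moment is at most the second. This allows crude
  norms of the chaoses of order three and four that are uniform in the field.\<close>

lemma A3_le: "N * A 3 \<le> \<mu>\<^sup>2"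
proof -
  have "A 3 \<le> B 2"
    unfolding A_def B_def
  proof (rule integral_mono[OF integrable_G_power(2) integrable_G_power(1)])
    fix z assume "z \<in> space (S \<Otimes>\<^sub>M S)"
    then have "\<bar>G (fst z) (snd z)\<bar> \<le> 1" by (auto simp: space_pair_measure intro: G_le)
    then have "\<bar>G (fst z) (snd z)\<bar> ^ 3 \<le> \<bar>G (fst z) (snd z)\<bar> ^ 2" by (intro power_decreasing) auto
    then show "\<bar>G (fst z) (snd z)\<bar> ^ 3 \<le> G (fst z) (snd z) ^ 2" by simp
  qed
  then show ?thesis unfolding B_values using N_pos by (simp add: field_simps)
qed

end

section \<open>Polynomial functionals of the field\<close>

context gaussian_field
begin

text \<open>Differentiating a functional in a coefficient brings a factor y_m under the integral;
  bounded weights form a class that absorbs these factors.\<close>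

definition bounded_weight :: "('b \<Rightarrow> real) \<Rightarrow> bool" where
  "bounded_weight w \<longleftrightarrow> w \<in> borel_measurable S \<and> (\<exists>C. \<forall>x\<in>space S. \<bar>w x\<bar> \<le> C)"

lemma bounded_weight_const: "bounded_weight (\<lambda>x. c)"
  by (auto simp: bounded_weight_def)

lemma bounded_weight_y: "m \<in> I \<Longrightarrow> bounded_weight (y m)"
  unfolding bounded_weight_def using y_le y_measurable by blast

lemma bounded_weight_mult:
  assumes "bounded_weight v" "bounded_weight w" shows "bounded_weight (\<lambda>x. v x * w x)"
proof -
  obtain C D where C: "\<And>x. x \<in> space S \<Longrightarrow> \<bar>v x\<bar> \<le> C" "\<And>x. x \<in> space S \<Longrightarrow> \<bar>w x\<bar> \<le> D"
    using assms by (auto simp: bounded_weight_def)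
  have "\<bar>v x * w x\<bar> \<le> C * D" if "x \<in> space S" for x
    unfolding abs_mult using C[OF that] order_trans[OF abs_ge_zero C(1)[OF that]] by (intro mult_mono) auto
  then show ?thesis using assms by (auto simp: bounded_weight_def)
qed

lemma bounded_weight_add:
  assumes "bounded_weight v" "bounded_weight w" shows "bounded_weight (\<lambda>x. v x + w x)"
proof -
  obtain C D where C: "\<And>x. x \<in> space S \<Longrightarrow> \<bar>v x\<bar> \<le> C" "\<And>x. x \<in> space S \<Longrightarrow> \<bar>w x\<bar> \<le> D"
    using assms by (auto simp: bounded_weight_def)
  have "\<bar>v x + w x\<bar> \<le> C + D" if "x \<in> space S" for x
    using C[OF that] by linarith
  then show ?thesis using assms by (auto simp: bounded_weight_def)
qed

lemma bounded_weight_cmult: "bounded_weight w \<Longrightarrow> bounded_weight (\<lambda>x. c * w x)"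
  by (rule bounded_weight_mult[OF bounded_weight_const])

lemma bounded_weight_T: "bounded_weight (T b)"
proof -
  have "\<bar>T b x\<bar> \<le> (\<Sum>m\<in>I. \<bar>b m\<bar>)" if "x \<in> space S" for x
  proof -
    have "\<bar>T b x\<bar> \<le> (\<Sum>m\<in>I. \<bar>b m * y m x\<bar>)" unfolding T_def by (rule sum_abs)
    also have "\<dots> \<le> (\<Sum>m\<in>I. \<bar>b m\<bar>)" using y_le that by (intro sum_mono) (simp add: abs_mult mult_left_le)
    finally show ?thesis .
  qed
  then show ?thesis unfolding bounded_weight_def using T_measurable_space by blast
qed

lemma bounded_weight_poly: "bounded_weight v \<Longrightarrow> bounded_weight (\<lambda>x. poly p (v x))"
proof (induction p)
  case (pCons a p)
  have "bounded_weight (\<lambda>x. a + v x * poly p (v x))"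
    by (rule bounded_weight_add[OF bounded_weight_const bounded_weight_mult[OF pCons.prems pCons.IH[OF pCons.prems]]])
  then show ?case by simp
qed (simp add: bounded_weight_const)

lemma bounded_weight_integrable: "bounded_weight w \<Longrightarrow> integrable S w"
  unfolding bounded_weight_def by (auto intro!: integrable_const_bound AE_I2)

text \<open>Differentiation under the integral without a domination argument: induction peels one
  factor u + t v off the polynomial and moves u or v into the weight, so the weight must stay
  arbitrary.\<close>

lemma DERIV_integral_poly:
  assumes "bounded_weight w" "bounded_weight u" "bounded_weight v"
  shows "((\<lambda>t. \<integral>x. w x * poly p (u x + t * v x) \<partial>S) has_real_derivative
    (\<integral>x. w x * v x * poly (pderiv p) (u x + t * v x) \<partial>S)) (at t)"
  using assms(1)
proof (induction p arbitrary: w)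
  case 0
  then show ?case by simp
next
  case (pCons a p)
  have bw: "bounded_weight (\<lambda>x. u x + t * v x)" for t
    by (intro bounded_weight_add bounded_weight_cmult assms)
  have int: "integrable S (\<lambda>x. g x * poly q (u x + t * v x))" if "bounded_weight g" for g q t
    by (rule bounded_weight_integrable[OF bounded_weight_mult[OF that bounded_weight_poly[OF bw]]])
  have wu: "bounded_weight (\<lambda>x. w x * u x)" and wv: "bounded_weight (\<lambda>x. w x * v x)"
    using pCons.prems assms by (auto intro: bounded_weight_mult)
  have eq: "(\<integral>x. w x * poly (pCons a p) (u x + t * v x) \<partial>S) =
    (\<integral>x. w x * a \<partial>S) + (\<integral>x. w x * u x * poly p (u x + t * v x) \<partial>S) + t * (\<integral>x. w x * v x * poly p (u x + t * v x) \<partial>S)" for t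
  proof -
    have "(\<integral>x. w x * poly (pCons a p) (u x + t * v x) \<partial>S) =
      (\<integral>x. w x * a + w x * u x * poly p (u x + t * v x) + t * (w x * v x * poly p (u x + t * v x)) \<partial>S)"
      by (rule Bochner_Integration.integral_cong) (auto simp: algebra_simps)
    also have "\<dots> = (\<integral>x. w x * a \<partial>S) + (\<integral>x. w x * u x * poly p (u x + t * v x) \<partial>S) + t * (\<integral>x. w x * v x * poly p (u x + t * v x) \<partial>S)"
      using int[OF wu] int[OF wv] bounded_weight_integrable[OF pCons.prems] by simp
    finally show ?thesis .
  qed
  let ?d = "(\<integral>x. w x * u x * v x * poly (pderiv p) (u x + t * v x) \<partial>S) +
    ((\<integral>x. w x * v x * poly p (u x + t * v x) \<partial>S) + t * (\<integral>x. w x * v x * v x * poly (pderiv p) (u x + t * v x) \<partial>S))"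
  have "((\<lambda>t. (\<integral>x. w x * a \<partial>S) + (\<integral>x. w x * u x * poly p (u x + t * v x) \<partial>S) + t * (\<integral>x. w x * v x * poly p (u x + t * v x) \<partial>S))
     has_real_derivative 0 + d1 + (1 * (\<integral>x. w x * v x * poly p (u x + t * v x) \<partial>S) + d2 * t)) (at t)"
    if "((\<lambda>t. \<integral>x. w x * u x * poly p (u x + t * v x) \<partial>S) has_real_derivative d1) (at t)"
       "((\<lambda>t. \<integral>x. w x * v x * poly p (u x + t * v x) \<partial>S) has_real_derivative d2) (at t)" for d1 d2
    by (intro DERIV_add DERIV_const DERIV_mult DERIV_ident that)
  from this[OF pCons.IH[OF wu] pCons.IH[OF wv]]
  have "((\<lambda>t. \<integral>x. w x * poly (pCons a p) (u x + t * v x) \<partial>S) has_real_derivative ?d) (at t)"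
    unfolding eq by (rule DERIV_cong) simp
  moreover have "?d = (\<integral>x. w x * v x * poly (pderiv (pCons a p)) (u x + t * v x) \<partial>S)"
  proof -
    have "?d = (\<integral>x. w x * u x * v x * poly (pderiv p) (u x + t * v x) +
       (w x * v x * poly p (u x + t * v x) + t * (w x * v x * v x * poly (pderiv p) (u x + t * v x))) \<partial>S)"
      using int[OF bounded_weight_mult[OF wu assms(3)]] int[OF wv] int[OF bounded_weight_mult[OF wv assms(3)]] by simp
    also have "\<dots> = (\<integral>x. w x * v x * poly (pderiv (pCons a p)) (u x + t * v x) \<partial>S)"
      by (rule Bochner_Integration.integral_cong) (auto simp: pderiv_pCons algebra_simps)
    finally show ?thesis .
  qed
  ultimately show ?case by simp
qed

definition Qw :: "('b \<Rightarrow> real) \<Rightarrow> real poly \<Rightarrow> (nat \<Rightarrow> real) \<Rightarrow> real" where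
  "Qw w p b = (\<integral>x. w x * poly p (T b x) \<partial>S)"

abbreviation Q :: "real poly \<Rightarrow> (nat \<Rightarrow> real) \<Rightarrow> real" where "Q p \<equiv> SF (poly p)"

lemma Q_eq: "Q p b = Qw (\<lambda>x. 1) p b"
  by (simp add: Qw_def SF_def)

lemma Qw_integrable: "bounded_weight w \<Longrightarrow> integrable S (\<lambda>x. w x * poly p (T b x))"
  by (rule bounded_weight_integrable[OF bounded_weight_mult[OF _ bounded_weight_poly[OF bounded_weight_T]]])

lemma Q_integrable: "integrable S (\<lambda>x. poly p (T b x))"
  using Qw_integrable[OF bounded_weight_const[of 1]] by simp

lemma Q_add: "Q (p + q) b = Q p b + Q q b"
  unfolding SF_def using Q_integrable by simp

lemma Q_diff: "Q (p - q) b = Q p b - Q q b"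
  unfolding SF_def using Q_integrable by simp

lemma Q_smult: "Q (smult c p) b = c * Q p b"
  unfolding SF_def by simp

lemma Qw_smult: "Qw w (smult c p) b = c * Qw w p b"
  unfolding Qw_def by (simp add: mult.left_commute)

lemma Q_const: "Q [:c:] b = c * \<mu>"
  unfolding SF_def by simp

lemma Q_ident: "Q [:0, 1:] b = 0"
proof -
  have "Q [:0, 1:] b = (\<integral>x. (\<Sum>m\<in>I. b m * y m x) \<partial>S)" by (simp add: SF_def T_def)
  also have "\<dots> = (\<Sum>m\<in>I. b m * (\<integral>x. y m x \<partial>S))"
    by (subst Bochner_Integration.integral_sum) (auto intro!: integrable_mult_right integrable_y)
  also have "\<dots> = 0" by (simp add: mean)
  finally show ?thesis .
qed

lemma Qw_measurable [measurable]:
  assumes "bounded_weight w" shows "Qw w p \<in> borel_measurable P"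
proof -
  have [measurable]: "w \<in> borel_measurable S" using assms by (simp add: bounded_weight_def)
  show ?thesis
    unfolding Qw_def[abs_def] by (rule borel_measurable_lebesgue_integral) (simp add: split_beta')
qed

lemma T_square_le: assumes "x \<in> space S" shows "(T b x)\<^sup>2 \<le> Theta I b"
proof -
  have "(T b x)\<^sup>2 \<le> (\<Sum>m\<in>I. (b m)\<^sup>2) * (\<Sum>m\<in>I. (y m x)\<^sup>2)" unfolding T_def by (rule Cauchy_Schwarz_ineq_sum)
  also have "\<dots> = (\<Sum>m\<in>I. (b m)\<^sup>2)" using unit[OF assms] by simp
  also have "\<dots> \<le> Theta I b" by (rule sum_squares_le_Theta[OF fin])
  finally show ?thesis .
qed

lemma Qw_growth:
  assumes w: "bounded_weight w" shows "theta_growth I (Qw w p)"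
proof -
  obtain C where C: "\<And>x. x \<in> space S \<Longrightarrow> \<bar>w x\<bar> \<le> C" using w by (auto simp: bounded_weight_def)
  obtain D K where DK: "\<And>t. \<bar>poly p t\<bar> \<le> D * (1 + t\<^sup>2) ^ K" using poly_growth_poly[of p] by (auto simp: poly_growth_def)
  have D0: "D \<ge> 0" using order_trans[OF abs_ge_zero DK[of 0]] by simp
  have "\<bar>Qw w p b\<bar> \<le> (\<mu> * (C * D * 2 ^ K)) * Theta I b ^ K" for b
  proof -
    have "\<bar>w x * poly p (T b x)\<bar> \<le> C * (D * (2 * Theta I b) ^ K)" if x: "x \<in> space S" for x
      unfolding abs_mult
    proof (rule mult_mono[OF C[OF x]])
      have "1 + (T b x)\<^sup>2 \<le> 2 * Theta I b" using T_square_le[OF x, of b] Theta_ge_1[of I b] by linarith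
      then have "D * (1 + (T b x)\<^sup>2) ^ K \<le> D * (2 * Theta I b) ^ K"
        using D0 by (intro mult_left_mono power_mono) auto
      with DK[of "T b x"] show "\<bar>poly p (T b x)\<bar> \<le> D * (2 * Theta I b) ^ K" by linarith
    qed (use order_trans[OF abs_ge_zero C[OF x]] in auto)
    then have "(\<integral>x. \<bar>w x * poly p (T b x)\<bar> \<partial>S) \<le> (\<integral>x. C * (D * (2 * Theta I b) ^ K) \<partial>S)"
      by (intro integral_mono integrable_abs Qw_integrable w) auto
    then have "\<bar>Qw w p b\<bar> \<le> \<mu> * (C * (D * (2 * Theta I b) ^ K))"
      unfolding Qw_def by (intro order_trans[OF integral_abs_bound]) simp
    then show ?thesis by (simp add: power_mult_distrib mult_ac)
  qed
  then show ?thesis unfolding theta_growth_def by blast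
qed

lemma T_update:
  assumes "m \<in> I" shows "T (b(m := t)) x = T (b(m := 0)) x + t * y m x"
proof -
  have "T (b(m := t)) x = (\<Sum>k\<in>I. (b(m := 0)) k * y k x + (if k = m then t * y m x else 0))"
    unfolding T_def by (rule sum.cong) auto
  also have "\<dots> = T (b(m := 0)) x + t * y m x"
    unfolding T_def sum.distrib using assms fin by simp
  finally show ?thesis .
qed

lemma DERIV_Qw:
  assumes w: "bounded_weight w" and m: "m \<in> I"
  shows "((\<lambda>t. Qw w p (b(m := t))) has_real_derivative Qw (\<lambda>x. w x * y m x) (pderiv p) (b(m := t))) (at t)"
proof -
  have "Qw v q (b(m := s)) = (\<integral>x. v x * poly q (T (b(m := 0)) x + s * y m x) \<partial>S)" for v q s
    unfolding Qw_def by (rule Bochner_Integration.integral_cong[OF refl]) (simp only: T_update[OF m, of b s])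
  then show ?thesis
    using DERIV_integral_poly[OF w bounded_weight_T[of "b(m := 0)"] bounded_weight_y[OF m], of p t] by (simp only:)
qed

text \<open>The sum of b_m y_m is the field itself, which becomes one more polynomial factor. This
  contraction and \<open>sum_Qw_unit\<close> turn sums over coordinates back into functionals of the
  field.\<close>

lemma sum_Qw_mult: "(\<Sum>m\<in>I. b m * Qw (y m) p b) = Q ([:0, 1:] * p) b"
proof -
  have "(\<Sum>m\<in>I. b m * Qw (y m) p b) = (\<integral>x. (\<Sum>m\<in>I. b m * (y m x * poly p (T b x))) \<partial>S)"
    unfolding Qw_def
    by (subst Bochner_Integration.integral_sum) (auto intro!: integrable_mult_right Qw_integrable bounded_weight_y)
  also have "\<dots> = Q ([:0, 1:] * p) b"
    unfolding SF_def
    by (rule Bochner_Integration.integral_cong) (simp_all add: T_def[of b] sum_distrib_right mult.assoc)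
  finally show ?thesis .
qed

lemma sum_Qw_unit: "(\<Sum>m\<in>I. Qw (\<lambda>x. y m x * y m x) p b) = Q p b"
proof -
  have "(\<Sum>m\<in>I. Qw (\<lambda>x. y m x * y m x) p b) = (\<integral>x. (\<Sum>m\<in>I. y m x * y m x * poly p (T b x)) \<partial>S)"
    unfolding Qw_def
    by (subst Bochner_Integration.integral_sum) (auto intro!: Qw_integrable bounded_weight_mult bounded_weight_y)
  also have "\<dots> = Q p b"
    unfolding SF_def
    by (rule Bochner_Integration.integral_cong)
       (simp_all add: sum_distrib_right[symmetric] unit power2_eq_square[symmetric])
  finally show ?thesis .
qed

text \<open>Orthogonality of the y_m. As \<open>Hermite 2\<close> has derivative 2x, the gradient of
  the second chaos is a multiple of b, so pairing a gradient with it is covered by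
  \<open>sum_Qw_mult\<close>.\<close>

lemma Qw_ident: assumes "m \<in> I" shows "Qw (y m) [:0, 1:] b = \<mu> / N * b m"
proof -
  have "Qw (y m) [:0, 1:] b = (\<integral>x. (\<Sum>k\<in>I. b k * (y m x * y k x)) \<partial>S)"
    unfolding Qw_def by (simp add: T_def sum_distrib_left mult_ac)
  also have "\<dots> = (\<Sum>k\<in>I. b k * (\<integral>x. y m x * y k x \<partial>S))"
    using assms by (subst Bochner_Integration.integral_sum) (auto intro!: integrable_mult_right integrable_yy)
  also have "\<dots> = (\<Sum>k\<in>I. if k = m then b k * (\<mu> / N) else 0)"
    by (rule sum.cong) (use assms in \<open>auto simp: orth\<close>)
  also have "\<dots> = \<mu> / N * b m" using assms fin by simp
  finally show ?thesis .
qed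

lemma Q_measurable [measurable]: "Q p \<in> borel_measurable P"
  by (rule SF_measurable) simp

lemma Q_growth: "theta_growth I (Q p)"
  using Qw_growth[OF bounded_weight_const[of 1], of p] by (simp add: Q_eq[abs_def])

lemma lipschitz_of_derivative:
  fixes f :: "real \<Rightarrow> real"
  assumes f: "\<And>x. (f has_real_derivative f' x) (at x)" and L: "\<And>x. \<bar>f' x\<bar> \<le> L"
  shows "\<bar>f s - f t\<bar> \<le> L * \<bar>s - t\<bar>"
  using field_differentiable_bound[of UNIV f f' L s t] f L by simp

lemma composition_growth:
  assumes f: "\<And>x. (f has_real_derivative f' x) (at x)" and L: "\<And>x. \<bar>f' x\<bar> \<le> L"
  shows "theta_growth I (\<lambda>b. f (Q r b))"
proof (rule theta_growth_mono)
  show "theta_growth I (\<lambda>b. \<bar>f 0\<bar> + L * \<bar>Q r b\<bar>)"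
  proof (intro theta_growth_add theta_growth_mult)
    show "theta_growth I (\<lambda>b. \<bar>Q r b\<bar>)" by (rule theta_growth_mono[OF Q_growth[of r]]) simp
  qed (rule theta_growth_bounded[of _ "\<bar>f 0\<bar>"], simp, rule theta_growth_bounded[of _ "\<bar>L\<bar>"], simp)
  show "\<bar>f (Q r b)\<bar> \<le> \<bar>\<bar>f 0\<bar> + L * \<bar>Q r b\<bar>\<bar>" for b
    using lipschitz_of_derivative[OF f L, of "Q r b" 0] by simp
qed

text \<open>The first factor on the left is the Gaussian divergence of the vector field with
  components \<open>Qw (y m) p\<close>: their sum against b_m is the functional of x p, and the sum
  of their partial derivatives is the functional of p'. The right side pairs this vector field with
  the gradient of f(Q r).\<close>

lemma functional_ibp:
  assumes f: "\<And>x. (f has_real_derivative f' x) (at x)" and f': "\<And>x. isCont f' x" and L: "\<And>x. \<bar>f' x\<bar> \<le> L"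
  shows "(\<integral>b. Q ([:0, 1:] * p - pderiv p) b * f (Q r b) \<partial>P) =
    (\<integral>b. f' (Q r b) * (\<Sum>m\<in>I. Qw (y m) p b * Qw (y m) (pderiv r) b) \<partial>P)"
proof -
  have fc: "isCont f x" for x using f by (rule DERIV_isCont)
  have [measurable]: "f \<in> borel_measurable borel" "f' \<in> borel_measurable borel"
    using fc f' by (auto intro!: borel_measurable_continuous_onI simp: continuous_on_eq_continuous_at)
  have f'g: "theta_growth I (\<lambda>b. f' (Q r b))" by (rule theta_growth_bounded[of _ L]) (rule L)
  have fg: "theta_growth I (\<lambda>b. f (Q r b))" by (rule composition_growth[OF f L])
  let ?y2 = "\<lambda>m x. y m x * y m x"
  let ?Phi = "\<lambda>m b. Qw (y m) p b * f (Q r b)"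
  let ?Phi1 = "\<lambda>m b. Qw (?y2 m) (pderiv p) b * f (Q r b)"
  let ?Phi2 = "\<lambda>m b. Qw (y m) p b * (f' (Q r b) * Qw (y m) (pderiv r) b)"
  have w: "bounded_weight (y m)" "bounded_weight (?y2 m)" if "m \<in> I" for m
    using that by (auto intro: bounded_weight_y bounded_weight_mult)
  have meas: "?Phi m \<in> borel_measurable P" "?Phi1 m \<in> borel_measurable P" "?Phi2 m \<in> borel_measurable P" if "m \<in> I" for m
    using w[OF that] by (auto intro!: borel_measurable_times measurable_compose[OF Q_measurable] Qw_measurable)
  have growth: "theta_growth I (?Phi m)" "theta_growth I (?Phi1 m)" "theta_growth I (?Phi2 m)" if "m \<in> I" for m
    using w[OF that] by (auto intro!: theta_growth_mult fg f'g Qw_growth)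
  have step: "(\<integral>b. b m * ?Phi m b \<partial>P) = (\<integral>b. ?Phi1 m b \<partial>P) + (\<integral>b. ?Phi2 m b \<partial>P)" if m: "m \<in> I" for m
  proof -
    have dQ: "((\<lambda>t. Q r (b(m := t))) has_real_derivative Qw (y m) (pderiv r) (b(m := t))) (at t)" for b t
      using DERIV_Qw[OF bounded_weight_const[of 1] m, of r b t] by (simp add: Q_eq)
    have dW: "((\<lambda>t. Qw v q (b(m := t))) has_real_derivative Qw (\<lambda>x. v x * y m x) (pderiv q) (b(m := t))) (at t)"
      if "bounded_weight v" for v q b t by (rule DERIV_Qw[OF that m])
    have "(\<integral>b. b m * ?Phi m b \<partial>P) = (\<integral>b. ?Phi1 m b + ?Phi2 m b \<partial>P)"
    proof (rule gauss_space_ibp[OF fin m])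
      show "((\<lambda>t. ?Phi m (b(m := t))) has_real_derivative ?Phi1 m (b(m := t)) + ?Phi2 m (b(m := t))) (at t)" for b t
        by (rule DERIV_cong[OF DERIV_mult[OF dW[OF w(1)[OF m]] DERIV_chain2[OF f dQ]]]) (simp add: mult_ac)
      have cW: "isCont (\<lambda>t. Qw v q (b(m := t))) t" if "bounded_weight v" for v q b t
        by (rule DERIV_isCont[OF dW[OF that]])
      have cQ: "isCont (\<lambda>t. Q r (b(m := t))) t" for b t by (rule DERIV_isCont[OF dQ])
      show "isCont (\<lambda>t. ?Phi1 m (b(m := t)) + ?Phi2 m (b(m := t))) t" for b t
        by (intro isCont_add isCont_mult cW w[OF m] isCont_o2[OF cQ fc] isCont_o2[OF cQ f'])
      show "(\<lambda>b. ?Phi1 m b + ?Phi2 m b) \<in> borel_measurable P" using meas[OF m] by (intro borel_measurable_add)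
      show "theta_growth I (\<lambda>b. ?Phi1 m b + ?Phi2 m b)" using growth[OF m] by (intro theta_growth_add)
    qed (use meas[OF m] growth[OF m] in auto)
    also have "\<dots> = (\<integral>b. ?Phi1 m b \<partial>P) + (\<integral>b. ?Phi2 m b \<partial>P)"
      by (intro Bochner_Integration.integral_add integrable_theta_growth fin meas growth m)
    finally show ?thesis .
  qed
  have intQ: "integrable P (\<lambda>b. Q q b * f (Q r b))" for q
    by (intro integrable_theta_growth fin theta_growth_mult Q_growth fg borel_measurable_times measurable_compose[OF Q_measurable] Q_measurable) simp
  have "(\<Sum>m\<in>I. \<integral>b. b m * ?Phi m b \<partial>P) = (\<integral>b. (\<Sum>m\<in>I. b m * ?Phi m b) \<partial>P)"
    by (rule Bochner_Integration.integral_sum[symmetric])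
       (intro integrable_theta_growth fin theta_growth_mult[OF theta_growth_component growth(1)] borel_measurable_times[OF gauss_space_component meas(1)])
  also have "\<dots> = (\<integral>b. Q ([:0, 1:] * p) b * f (Q r b) \<partial>P)"
    by (rule Bochner_Integration.integral_cong[OF refl])
       (simp only: sum_Qw_mult[symmetric] sum_distrib_right mult.assoc)
  finally have 1: "(\<Sum>m\<in>I. \<integral>b. b m * ?Phi m b \<partial>P) = (\<integral>b. Q ([:0, 1:] * p) b * f (Q r b) \<partial>P)" .
  have "(\<Sum>m\<in>I. \<integral>b. ?Phi1 m b \<partial>P) = (\<integral>b. (\<Sum>m\<in>I. ?Phi1 m b) \<partial>P)"
    by (rule Bochner_Integration.integral_sum[symmetric]) (intro integrable_theta_growth fin growth meas)
  also have "\<dots> = (\<integral>b. Q (pderiv p) b * f (Q r b) \<partial>P)"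
    by (rule Bochner_Integration.integral_cong[OF refl]) (simp only: sum_Qw_unit[symmetric] sum_distrib_right)
  finally have 2: "(\<Sum>m\<in>I. \<integral>b. ?Phi1 m b \<partial>P) = (\<integral>b. Q (pderiv p) b * f (Q r b) \<partial>P)" .
  have "(\<Sum>m\<in>I. \<integral>b. ?Phi2 m b \<partial>P) = (\<integral>b. (\<Sum>m\<in>I. ?Phi2 m b) \<partial>P)"
    by (rule Bochner_Integration.integral_sum[symmetric]) (intro integrable_theta_growth fin growth meas)
  also have "\<dots> = (\<integral>b. f' (Q r b) * (\<Sum>m\<in>I. Qw (y m) p b * Qw (y m) (pderiv r) b) \<partial>P)"
    by (rule Bochner_Integration.integral_cong[OF refl]) (simp only: sum_distrib_left mult.left_commute)
  finally have 3: "(\<Sum>m\<in>I. \<integral>b. ?Phi2 m b \<partial>P) = (\<integral>b. f' (Q r b) * (\<Sum>m\<in>I. Qw (y m) p b * Qw (y m) (pderiv r) b) \<partial>P)" .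
  have "(\<Sum>m\<in>I. \<integral>b. b m * ?Phi m b \<partial>P) = (\<Sum>m\<in>I. \<integral>b. ?Phi1 m b \<partial>P) + (\<Sum>m\<in>I. \<integral>b. ?Phi2 m b \<partial>P)"
    unfolding sum.distrib[symmetric] by (rule sum.cong[OF refl step])
  then have main: "(\<integral>b. Q ([:0, 1:] * p) b * f (Q r b) \<partial>P) - (\<integral>b. Q (pderiv p) b * f (Q r b) \<partial>P)
     = (\<integral>b. f' (Q r b) * (\<Sum>m\<in>I. Qw (y m) p b * Qw (y m) (pderiv r) b) \<partial>P)"
    unfolding 1 2 3 by linarith
  have "(\<integral>b. Q ([:0, 1:] * p - pderiv p) b * f (Q r b) \<partial>P) =
     (\<integral>b. Q ([:0, 1:] * p) b * f (Q r b) - Q (pderiv p) b * f (Q r b) \<partial>P)"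
    unfolding Q_diff left_diff_distrib ..
  also have "\<dots> = (\<integral>b. Q ([:0, 1:] * p) b * f (Q r b) \<partial>P) - (\<integral>b. Q (pderiv p) b * f (Q r b) \<partial>P)"
    by (rule Bochner_Integration.integral_diff[OF intQ intQ])
  finally show ?thesis unfolding main .
qed

text \<open>The case p = x, where the vector field is a multiple of b by
  \<open>Qw_ident\<close>.\<close>

lemma functional_ibp_2:
  assumes f: "\<And>x. (f has_real_derivative f' x) (at x)" and f': "\<And>x. isCont f' x" and L: "\<And>x. \<bar>f' x\<bar> \<le> L"
  shows "(\<integral>b. Q (Hermite 2) b * f (Q r b) \<partial>P) = \<mu> / N * (\<integral>b. f' (Q r b) * Q ([:0, 1:] * pderiv r) b \<partial>P)"
proof -
  have H: "Hermite 2 = [:0, 1:] * [:0, 1:] - pderiv [:0, 1:]"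
    by (simp add: numeral_2_eq_2 pderiv_pCons one_pCons)
  have "(\<Sum>m\<in>I. Qw (y m) [:0, 1:] b * Qw (y m) (pderiv r) b) = \<mu> / N * Q ([:0, 1:] * pderiv r) b" for b
    unfolding sum_Qw_mult[symmetric] sum_distrib_left by (rule sum.cong) (simp_all add: Qw_ident)
  then show ?thesis
    unfolding H functional_ibp[OF f f' L] by (simp add: mult.left_commute)
qed

text \<open>Here the gradient of the inner functional is the multiple of b. For q at least 2 this is
  the near orthogonality of the higher chaoses to functions of the second: the pairing comes out
  with a factor \<mu> / N.\<close>

lemma functional_ibp_Hermite:
  assumes f: "\<And>x. (f has_real_derivative f' x) (at x)" and f': "\<And>x. isCont f' x" and L: "\<And>x. \<bar>f' x\<bar> \<le> L"
  shows "(\<integral>b. Q (Hermite (Suc q)) b * f (Q (smult c (Hermite 2)) b) \<partial>P) =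
    2 * c * \<mu> / N * (\<integral>b. f' (Q (smult c (Hermite 2)) b) * Q ([:0, 1:] * Hermite q) b \<partial>P)"
proof -
  have d: "pderiv (smult c (Hermite 2)) = smult (2 * c) [:0, 1:]"
    by (simp add: Hermite_explicit pderiv_pCons)
  have "(\<Sum>m\<in>I. Qw (y m) (Hermite q) b * Qw (y m) (pderiv (smult c (Hermite 2))) b) = 2 * c * \<mu> / N * Q ([:0, 1:] * Hermite q) b" for b
    unfolding sum_Qw_mult[symmetric] sum_distrib_left d Qw_smult by (rule sum.cong) (simp_all add: Qw_ident)
  then show ?thesis
    unfolding Hermite.simps functional_ibp[OF f f' L] by (simp add: mult.left_commute)
qed

end

section \<open>The quantitative central limit theorem for Gaussian fields\<close>

context gaussian_field
begin

text \<open>The ratio of \<open>A q\<close> to \<open>B 2\<close>, that is, the weight of the orders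
  from q on relative to the second chaos.\<close>

definition \<kappa> :: "nat \<Rightarrow> real" where "\<kappa> q = N * A q / \<mu>\<^sup>2"

lemma \<kappa>_nonneg: "\<kappa> q \<ge> 0"
  using A_nonneg N_pos by (simp add: \<kappa>_def)

lemma \<kappa>3_le: "\<kappa> 3 \<le> 1"
  using A3_le mass by (simp add: \<kappa>_def)

lemma integral_He_square: "(\<integral>t. (He q t)\<^sup>2 \<partial>std_normal_distribution) = fact q"
  using hermite_coeff_He[of q q] by (simp add: hermite_coeff_def power2_eq_square)

lemma Q_Hermite2_square: "P.expectation (\<lambda>b. (Q (Hermite 2) b)\<^sup>2) = 2 * \<mu>\<^sup>2 / N"
proof -
  have s: "(\<Sum>q<3. g q * (hermite_coeff q (He 2))\<^sup>2 / fact q) = g 2 * 2" for g :: "nat \<Rightarrow> real"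
    by (simp add: eval_nat_numeral hermite_coeff_He lessThan_Suc del: Hermite.simps)
  \<comment> \<open>For k = 3 the sum already contains the whole squared norm of
    \<open>He 2\<close>, so the error term vanishes and the estimate is an identity.\<close>
  have "\<bar>P.expectation (\<lambda>b. (Q (Hermite 2) b)\<^sup>2) - 2 * B 2\<bar> \<le> A 3 * 0"
    using second_moment[OF square_integrable_poly[of "Hermite 2"], of 3] s[of B] s[of "\<lambda>_. 1"]
    by (simp add: integral_He_square mult.commute)
  then show ?thesis by (simp add: B_values)
qed

lemma Q_Hermite_square_le:
  assumes "q \<ge> 3" shows "P.expectation (\<lambda>b. (Q (Hermite q) b)\<^sup>2) \<le> fact q * A 3"
proof -
  have "\<bar>P.expectation (\<lambda>b. (Q (Hermite q) b)\<^sup>2) - 0\<bar> \<le> A 3 * (fact q - 0)"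
    using second_moment[OF square_integrable_poly[of "Hermite q"], of 3] assms
    by (simp add: integral_He_square hermite_coeff_He)
  then show ?thesis by (simp add: mult.commute)
qed

lemma square_integrable_Q: "square_integrable P (Q p)"
  by (rule square_SF(1)[OF square_integrable_poly])

lemma integrable_Q: "integrable P (Q p)"
  by (rule P.square_integrable_imp_integrable[OF square_integrable_Q])

lemma expectation_abs_cmult_Q:
  assumes "a\<^sup>2 * P.expectation (\<lambda>b. (Q p b)\<^sup>2) \<le> r\<^sup>2" "r \<ge> 0"
  shows "P.expectation (\<lambda>b. \<bar>a * Q p b\<bar>) \<le> r"
proof -
  have "P.expectation (\<lambda>b. \<bar>a * Q p b\<bar>) \<le> sqrt (P.expectation (\<lambda>b. (a * Q p b)\<^sup>2))"
    by (rule P.expectation_abs_le_sqrt) (rule square_integrable_cmult[OF square_integrable_Q])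
  also have "\<dots> \<le> sqrt (r\<^sup>2)" using assms(1) by (intro real_sqrt_le_mono) (simp add: power_mult_distrib)
  finally show ?thesis using assms(2) by simp
qed

text \<open>\<open>s\<close> is the standard deviation of the second chaos. With F = F2 + W the
  expression is (E f'(F) - E[F2 f(F)]) - E[W (f(F) - f(F2))] - E[W f(F2)]. Integration by parts
  makes the first bracket at most L (2 + 6 \<alpha> + 28 \<beta>) / sqrt N and the last term at most
  L (4 \<alpha> + 14 \<beta>) / sqrt N; the middle one costs L E[W^2], where squaring the sum of two
  chaoses doubles their variances.\<close>

lemma stein_estimate:
  fixes c :: "nat \<Rightarrow> real"
  assumes c2: "c 2 \<noteq> 0"
    and f: "\<And>x. (f has_real_derivative f' x) (at x)" and f': "\<And>x. isCont f' x" and L: "\<And>x. \<bar>f' x\<bar> \<le> L"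
  defines "s \<equiv> \<bar>c 2\<bar> * \<mu> * sqrt (2 / N)"
  defines "p \<equiv> smult (c 2 / s) (Hermite 2) + (smult (c 3 / s) (Hermite 3) + smult (c 4 / s) (Hermite 4))"
  defines "\<alpha> \<equiv> \<bar>c 3 / c 2\<bar>" and "\<beta> \<equiv> \<bar>c 4 / c 2\<bar>"
  shows "\<bar>P.expectation (\<lambda>b. f' (Q p b) - Q p b * f (Q p b))\<bar>
    \<le> L * (2 + 10 * \<alpha> + 42 * \<beta>) / sqrt N + L * (6 * \<alpha>\<^sup>2 + 24 * \<beta>\<^sup>2) * \<kappa> 3"
proof -
  have L0: "L \<ge> 0" using order_trans[OF abs_ge_zero L[of 0]] .
  have s0: "s > 0" unfolding s_def using c2 mass N_pos by simp
  have s2: "s\<^sup>2 = (c 2)\<^sup>2 * \<mu>\<^sup>2 * 2 / N" unfolding s_def using N_pos by (simp add: power_mult_distrib)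
  define a where "a q = c q / s" for q
  have p_eq: "p = smult (a 2) (Hermite 2) + (smult (a 3) (Hermite 3) + smult (a 4) (Hermite 4))"
    by (simp add: p_def a_def)
  have aq: "(a q)\<^sup>2 = (c q / c 2)\<^sup>2 * (N / (2 * \<mu>\<^sup>2))" for q
    unfolding a_def power_divide s2 using c2 N_pos mass by (simp add: field_simps)
  have a22: "(a 2)\<^sup>2 = N / (2 * \<mu>\<^sup>2)" using aq[of 2] c2 by simp
  have fc: "isCont f x" for x using f by (rule DERIV_isCont)
  have [measurable]: "f \<in> borel_measurable borel" "f' \<in> borel_measurable borel"
    using fc f' by (auto intro!: borel_measurable_continuous_onI simp: continuous_on_eq_continuous_at)
  define F where "F = Q p"
  define F2 where "F2 = Q (smult (a 2) (Hermite 2))"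
  define W where "W = Q (smult (a 3) (Hermite 3) + smult (a 4) (Hermite 4))"
  have F_split: "F b = F2 b + W b" for b unfolding F_def F2_def W_def p_eq by (rule Q_add)
  have W_split: "W b = a 3 * Q (Hermite 3) b + a 4 * Q (Hermite 4) b" for b
    unfolding W_def Q_add Q_smult ..
  have lipf: "\<bar>f u - f v\<bar> \<le> L * \<bar>u - v\<bar>" for u v by (rule lipschitz_of_derivative[OF f L])
  have n22: "P.expectation (\<lambda>b. \<bar>a 2 * Q (Hermite 2) b\<bar>) \<le> 1"
    by (rule expectation_abs_cmult_Q) (use N_pos mass in \<open>simp_all add: a22 Q_Hermite2_square\<close>)
  have n42: "P.expectation (\<lambda>b. \<bar>a 4 * Q (Hermite 2) b\<bar>) \<le> \<beta>"
    by (rule expectation_abs_cmult_Q) (use N_pos mass in \<open>simp_all add: aq[of 4] Q_Hermite2_square \<beta>_def power_divide\<close>)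
  have v3: "(a 3)\<^sup>2 * P.expectation (\<lambda>b. (Q (Hermite 3) b)\<^sup>2) \<le> 3 * \<alpha>\<^sup>2 * \<kappa> 3"
  proof -
    have "(a 3)\<^sup>2 * P.expectation (\<lambda>b. (Q (Hermite 3) b)\<^sup>2) \<le> (a 3)\<^sup>2 * (fact 3 * A 3)"
      by (intro mult_left_mono Q_Hermite_square_le) auto
    also have "\<dots> = 3 * \<alpha>\<^sup>2 * \<kappa> 3"
      unfolding aq \<alpha>_def \<kappa>_def by (simp add: fact_numeral field_simps)
    finally show ?thesis .
  qed
  have v4: "(a 4)\<^sup>2 * P.expectation (\<lambda>b. (Q (Hermite 4) b)\<^sup>2) \<le> 12 * \<beta>\<^sup>2 * \<kappa> 3"
  proof -
    have "(a 4)\<^sup>2 * P.expectation (\<lambda>b. (Q (Hermite 4) b)\<^sup>2) \<le> (a 4)\<^sup>2 * (fact 4 * A 3)"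
      by (intro mult_left_mono Q_Hermite_square_le) auto
    also have "\<dots> = 12 * \<beta>\<^sup>2 * \<kappa> 3"
      unfolding aq \<beta>_def \<kappa>_def by (simp add: fact_numeral field_simps)
    finally show ?thesis .
  qed
  have ab0: "\<alpha> \<ge> 0" "\<beta> \<ge> 0" by (simp_all add: \<alpha>_def \<beta>_def)
  \<comment> \<open>The variance is at most 3 \<alpha>^2 because \<open>\<kappa> 3\<close> is at
    most 1; the square root of 3 is rounded up to 2, and in the next bound that of 12 to 4.\<close>
  have n33: "P.expectation (\<lambda>b. \<bar>a 3 * Q (Hermite 3) b\<bar>) \<le> 2 * \<alpha>"
  proof (rule expectation_abs_cmult_Q)
    have "3 * \<alpha>\<^sup>2 * \<kappa> 3 \<le> 3 * \<alpha>\<^sup>2 * 1" using \<kappa>3_le by (intro mult_left_mono) auto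
    moreover have "(2 * \<alpha>)\<^sup>2 = 4 * \<alpha>\<^sup>2" by (simp add: power_mult_distrib)
    ultimately show "(a 3)\<^sup>2 * P.expectation (\<lambda>b. (Q (Hermite 3) b)\<^sup>2) \<le> (2 * \<alpha>)\<^sup>2"
      using v3 zero_le_power2[of \<alpha>] by linarith
  qed (use ab0 in simp)
  have n44: "P.expectation (\<lambda>b. \<bar>a 4 * Q (Hermite 4) b\<bar>) \<le> 4 * \<beta>"
  proof (rule expectation_abs_cmult_Q)
    have "12 * \<beta>\<^sup>2 * \<kappa> 3 \<le> 12 * \<beta>\<^sup>2 * 1" using \<kappa>3_le by (intro mult_left_mono) auto
    moreover have "(4 * \<beta>)\<^sup>2 = 16 * \<beta>\<^sup>2" by (simp add: power_mult_distrib)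
    ultimately show "(a 4)\<^sup>2 * P.expectation (\<lambda>b. (Q (Hermite 4) b)\<^sup>2) \<le> (4 * \<beta>)\<^sup>2"
      using v4 zero_le_power2[of \<beta>] by linarith
  qed (use ab0 in simp)
  have siW: "square_integrable P W" unfolding W_def by (rule square_integrable_Q)
  have vW: "P.expectation (\<lambda>b. (W b)\<^sup>2) \<le> (6 * \<alpha>\<^sup>2 + 24 * \<beta>\<^sup>2) * \<kappa> 3"
  proof -
    have si: "square_integrable P (\<lambda>b. a q * Q (Hermite q) b)" for q
      by (rule square_integrable_cmult[OF square_integrable_Q])
    have "P.expectation (\<lambda>b. (W b)\<^sup>2) \<le> P.expectation (\<lambda>b. 2 * (a 3 * Q (Hermite 3) b)\<^sup>2 + 2 * (a 4 * Q (Hermite 4) b)\<^sup>2)"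
    proof (rule integral_mono)
      show "integrable P (\<lambda>b. (W b)\<^sup>2)" using siW by (simp add: square_integrable_def)
      show "integrable P (\<lambda>b. 2 * (a 3 * Q (Hermite 3) b)\<^sup>2 + 2 * (a 4 * Q (Hermite 4) b)\<^sup>2)"
        using si by (simp add: square_integrable_def)
      show "(W b)\<^sup>2 \<le> 2 * (a 3 * Q (Hermite 3) b)\<^sup>2 + 2 * (a 4 * Q (Hermite 4) b)\<^sup>2" for b
        unfolding W_split using sum_squares_bound[of "a 3 * Q (Hermite 3) b" "a 4 * Q (Hermite 4) b"]
        by (simp add: power2_sum)
    qed
    also have "\<dots> = 2 * P.expectation (\<lambda>b. (a 3 * Q (Hermite 3) b)\<^sup>2) + 2 * P.expectation (\<lambda>b. (a 4 * Q (Hermite 4) b)\<^sup>2)"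
      using si by (simp add: square_integrable_def)
    also have "\<dots> \<le> (6 * \<alpha>\<^sup>2 + 24 * \<beta>\<^sup>2) * \<kappa> 3"
      using v3 v4 by (simp add: power_mult_distrib distrib_right)
    finally show ?thesis .
  qed
  have f'i: "integrable P (\<lambda>b. f' (Q r b) * Q q b)" for r q
    by (intro integrable_theta_growth fin theta_growth_mult Q_growth theta_growth_bounded[of _ L] L
        borel_measurable_times measurable_compose[OF Q_measurable] Q_measurable) simp
  have fi: "integrable P (\<lambda>b. Q q b * f (Q r b))" for r q
    by (intro integrable_theta_growth fin theta_growth_mult Q_growth composition_growth[OF f L]
        borel_measurable_times measurable_compose[OF Q_measurable] Q_measurable) simp
  have f'0: "integrable P (\<lambda>b. f' (Q r b))" for r
    by (intro integrable_theta_growth fin theta_growth_bounded[of _ L] L measurable_compose[OF Q_measurable]) simp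
  have f'bound: "\<bar>P.expectation (\<lambda>b. f' (Q r b) * Q q b)\<bar> \<le> L * P.expectation (\<lambda>b. \<bar>Q q b\<bar>)" for r q
  proof -
    have "\<bar>P.expectation (\<lambda>b. f' (Q r b) * Q q b)\<bar> \<le> P.expectation (\<lambda>b. \<bar>f' (Q r b) * Q q b\<bar>)" by (rule integral_abs_bound)
    also have "\<dots> \<le> P.expectation (\<lambda>b. L * \<bar>Q q b\<bar>)"
    proof (rule integral_mono)
      show "integrable P (\<lambda>b. \<bar>f' (Q r b) * Q q b\<bar>)" using f'i by (rule integrable_abs)
      show "integrable P (\<lambda>b. L * \<bar>Q q b\<bar>)" using integrable_Q by simp
      show "\<bar>f' (Q r b) * Q q b\<bar> \<le> L * \<bar>Q q b\<bar>" for b unfolding abs_mult by (intro mult_right_mono L) simp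
    qed
    finally show ?thesis by simp
  qed
  \<comment> \<open>The prefactor of every integration by parts below. By the normalization its
    square is exactly 1/(2N); this is where the rate N^(-1/2) comes from.\<close>
  have small: "\<bar>a 2 * (\<mu> / N)\<bar> \<le> 1 / sqrt N"
  proof -
    have "(a 2 * (\<mu> / N))\<^sup>2 = 1 / (2 * N)"
      unfolding power_mult_distrib a22 power_divide using mass N_pos by (simp add: power2_eq_square)
    also have "\<dots> \<le> (1 / sqrt N)\<^sup>2" using N_pos by (simp add: power_divide field_simps)
    finally show ?thesis using N_pos by (simp add: abs_le_square_iff[symmetric])
  qed
  \<comment> \<open>The Hermite expansion of x p'(x) from order two on. Its constant term is 2
    \<open>a 2\<close>, and its linear term is invisible to \<open>Q\<close> because the y_m have
    mean zero.\<close>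
  define D where "D = smult (2 * a 2) (Hermite 2) + (smult (3 * a 3) (Hermite 3) + (smult (4 * a 4) (Hermite 4) + smult (12 * a 4) (Hermite 2)))"
  have XD: "[:0, 1:] * pderiv p = D + [:2 * a 2:] + smult (6 * a 3) [:0, 1:]"
    unfolding p_eq D_def by (simp add: Hermite_explicit pderiv_pCons pderiv_add pderiv_smult)
  have QX: "Q ([:0, 1:] * pderiv p) b = Q D b + 2 * a 2 * \<mu>" for b
    unfolding XD Q_add Q_smult Q_ident Q_const by simp
  have "P.expectation (\<lambda>b. F2 b * f (F b)) = a 2 * P.expectation (\<lambda>b. Q (Hermite 2) b * f (Q p b))"
    unfolding F2_def F_def Q_smult by (simp add: mult.assoc)
  also have "\<dots> = a 2 * (\<mu> / N) * P.expectation (\<lambda>b. f' (Q p b) * (Q D b + 2 * a 2 * \<mu>))"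
    unfolding functional_ibp_2[OF f f' L] QX by simp
  also have "P.expectation (\<lambda>b. f' (Q p b) * (Q D b + 2 * a 2 * \<mu>))
      = P.expectation (\<lambda>b. f' (Q p b) * Q D b) + P.expectation (\<lambda>b. f' (Q p b)) * (2 * a 2 * \<mu>)"
    unfolding distrib_left using f'i f'0 by simp
  also have "a 2 * (\<mu> / N) * (P.expectation (\<lambda>b. f' (Q p b) * Q D b) + P.expectation (\<lambda>b. f' (Q p b)) * (2 * a 2 * \<mu>))
      = a 2 * (\<mu> / N) * P.expectation (\<lambda>b. f' (Q p b) * Q D b) + (a 2)\<^sup>2 * (2 * \<mu>\<^sup>2 / N) * P.expectation (\<lambda>b. f' (Q p b))"
    by (simp add: power2_eq_square algebra_simps)
  \<comment> \<open>The second chaos is normalized to variance 1, so the constant term reproduces E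
    f'(F) exactly.\<close>
  also have "(a 2)\<^sup>2 * (2 * \<mu>\<^sup>2 / N) = 1" unfolding a22 using mass N_pos by simp
  finally have t1: "P.expectation (\<lambda>b. F2 b * f (F b)) =
      a 2 * (\<mu> / N) * P.expectation (\<lambda>b. f' (Q p b) * Q D b) + P.expectation (\<lambda>b. f' (Q p b))" by simp
  have nD: "P.expectation (\<lambda>b. \<bar>Q D b\<bar>) \<le> 2 + 6 * \<alpha> + 28 * \<beta>"
  proof -
    have ia: "integrable P (\<lambda>b. \<bar>u * Q q b\<bar>)" for u q using integrable_Q by simp
    have "P.expectation (\<lambda>b. \<bar>Q D b\<bar>) \<le> P.expectation (\<lambda>b. 2 * \<bar>a 2 * Q (Hermite 2) b\<bar> + 3 * \<bar>a 3 * Q (Hermite 3) b\<bar>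
        + 4 * \<bar>a 4 * Q (Hermite 4) b\<bar> + 12 * \<bar>a 4 * Q (Hermite 2) b\<bar>)"
    proof (rule integral_mono)
      show "integrable P (\<lambda>b. \<bar>Q D b\<bar>)" using integrable_Q by simp
      show "\<bar>Q D b\<bar> \<le> 2 * \<bar>a 2 * Q (Hermite 2) b\<bar> + 3 * \<bar>a 3 * Q (Hermite 3) b\<bar>
        + 4 * \<bar>a 4 * Q (Hermite 4) b\<bar> + 12 * \<bar>a 4 * Q (Hermite 2) b\<bar>" for b
        unfolding D_def Q_add Q_smult mult.assoc by linarith
    qed (intro Bochner_Integration.integrable_add integrable_mult_right ia)
    also have "\<dots> = 2 * P.expectation (\<lambda>b. \<bar>a 2 * Q (Hermite 2) b\<bar>) + 3 * P.expectation (\<lambda>b. \<bar>a 3 * Q (Hermite 3) b\<bar>)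
        + 4 * P.expectation (\<lambda>b. \<bar>a 4 * Q (Hermite 4) b\<bar>) + 12 * P.expectation (\<lambda>b. \<bar>a 4 * Q (Hermite 2) b\<bar>)"
      using ia by simp
    also have "\<dots> \<le> 2 + 6 * \<alpha> + 28 * \<beta>" using n22 n33 n44 n42 by linarith
    finally show ?thesis .
  qed
  have t1b: "\<bar>P.expectation (\<lambda>b. F2 b * f (F b)) - P.expectation (\<lambda>b. f' (F b))\<bar> \<le> L * (2 + 6 * \<alpha> + 28 * \<beta>) / sqrt N"
  proof -
    have "\<bar>P.expectation (\<lambda>b. F2 b * f (F b)) - P.expectation (\<lambda>b. f' (F b))\<bar> = \<bar>a 2 * (\<mu> / N)\<bar> * \<bar>P.expectation (\<lambda>b. f' (Q p b) * Q D b)\<bar>"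
      unfolding t1 unfolding F_def by (simp add: abs_mult)
    also have "\<dots> \<le> 1 / sqrt N * (L * (2 + 6 * \<alpha> + 28 * \<beta>))"
      by (intro mult_mono small order_trans[OF f'bound] mult_left_mono nD L0) auto
    finally show ?thesis by simp
  qed
  text \<open>Replacing \<open>f (F)\<close> by \<open>f (F2)\<close> costs only \<open>E[W\<^sup>2]\<close>, because \<open>f\<close> is Lipschitz and \<open>F - F2 = W\<close>;
    functions of the second chaos \<open>F2\<close> are almost orthogonal to \<open>W\<close>.\<close>
  have t2a: "\<bar>P.expectation (\<lambda>b. W b * (f (F b) - f (F2 b)))\<bar> \<le> L * P.expectation (\<lambda>b. (W b)\<^sup>2)"
  proof -
    have "\<bar>P.expectation (\<lambda>b. W b * (f (F b) - f (F2 b)))\<bar> \<le> P.expectation (\<lambda>b. \<bar>W b * (f (F b) - f (F2 b))\<bar>)" by (rule integral_abs_bound)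
    also have "\<dots> \<le> P.expectation (\<lambda>b. L * (W b)\<^sup>2)"
    proof (rule integral_mono)
      show "integrable P (\<lambda>b. \<bar>W b * (f (F b) - f (F2 b))\<bar>)"
        unfolding W_def F_def F2_def right_diff_distrib by (intro integrable_abs Bochner_Integration.integrable_diff fi)
      show "integrable P (\<lambda>b. L * (W b)\<^sup>2)" using siW by (simp add: square_integrable_def)
      show "\<bar>W b * (f (F b) - f (F2 b))\<bar> \<le> L * (W b)\<^sup>2" for b
      proof -
        have "\<bar>W b\<bar> * \<bar>f (F b) - f (F2 b)\<bar> \<le> \<bar>W b\<bar> * (L * \<bar>W b\<bar>)"
          using lipf[of "F b" "F2 b"] unfolding F_split by (intro mult_left_mono) auto
        also have "\<dots> = L * \<bar>W b\<bar>\<^sup>2" unfolding power2_eq_square by (simp only: mult_ac)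
        finally show ?thesis by (simp add: abs_mult)
      qed
    qed
    finally show ?thesis by simp
  qed
  \<comment> \<open>From x He_2 = He_3 + 2x and x He_3 = He_4 + 3 He_2, with the linear part dropped
    because \<open>Q\<close> annihilates it.\<close>
  define Y where "Y = smult (a 3) (Hermite 3) + (smult (a 4) (Hermite 4) + smult (3 * a 4) (Hermite 2))"
  have "P.expectation (\<lambda>b. W b * f (F2 b)) = a 3 * P.expectation (\<lambda>b. Q (Hermite (Suc 2)) b * f (F2 b)) + a 4 * P.expectation (\<lambda>b. Q (Hermite (Suc 3)) b * f (F2 b))"
  proof -
    have "P.expectation (\<lambda>b. W b * f (F2 b)) = P.expectation (\<lambda>b. a 3 * (Q (Hermite (Suc 2)) b * f (F2 b)) + a 4 * (Q (Hermite (Suc 3)) b * f (F2 b)))"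
      unfolding W_split by (simp add: distrib_right mult.assoc eval_nat_numeral del: Hermite.simps)
    then show ?thesis using fi unfolding F2_def by simp
  qed
  also have "\<dots> = 2 * (a 2 * (\<mu> / N)) * P.expectation (\<lambda>b. f' (F2 b) * Q Y b)"
  proof -
    have X: "Y = smult (a 3) ([:0, 1:] * Hermite 2) + (smult (a 4) ([:0, 1:] * Hermite 3) + smult (- 2 * a 3) [:0, 1:])"
      unfolding Y_def by (simp add: Hermite_explicit)
    have "P.expectation (\<lambda>b. f' (F2 b) * Q Y b) =
        P.expectation (\<lambda>b. a 3 * (f' (F2 b) * Q ([:0, 1:] * Hermite 2) b) + a 4 * (f' (F2 b) * Q ([:0, 1:] * Hermite 3) b))"
      unfolding X Q_add Q_smult Q_ident by (simp add: distrib_left mult.left_commute)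
    also have "\<dots> = a 3 * P.expectation (\<lambda>b. f' (F2 b) * Q ([:0, 1:] * Hermite 2) b) + a 4 * P.expectation (\<lambda>b. f' (F2 b) * Q ([:0, 1:] * Hermite 3) b)"
      using f'i unfolding F2_def by simp
    finally show ?thesis
      unfolding F2_def functional_ibp_Hermite[OF f f' L] by (simp add: distrib_left mult_ac)
  qed
  finally have t2b: "P.expectation (\<lambda>b. W b * f (F2 b)) = 2 * (a 2 * (\<mu> / N)) * P.expectation (\<lambda>b. f' (F2 b) * Q Y b)" .
  have nY: "P.expectation (\<lambda>b. \<bar>Q Y b\<bar>) \<le> 2 * \<alpha> + 7 * \<beta>"
  proof -
    have ia: "integrable P (\<lambda>b. \<bar>u * Q q b\<bar>)" for u q using integrable_Q by simp
    have "P.expectation (\<lambda>b. \<bar>Q Y b\<bar>) \<le> P.expectation (\<lambda>b. \<bar>a 3 * Q (Hermite 3) b\<bar> + \<bar>a 4 * Q (Hermite 4) b\<bar> + 3 * \<bar>a 4 * Q (Hermite 2) b\<bar>)"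
    proof (rule integral_mono)
      show "integrable P (\<lambda>b. \<bar>Q Y b\<bar>)" using integrable_Q by simp
      show "\<bar>Q Y b\<bar> \<le> \<bar>a 3 * Q (Hermite 3) b\<bar> + \<bar>a 4 * Q (Hermite 4) b\<bar> + 3 * \<bar>a 4 * Q (Hermite 2) b\<bar>" for b
        unfolding Y_def Q_add Q_smult mult.assoc by linarith
    qed (intro Bochner_Integration.integrable_add integrable_mult_right ia)
    also have "\<dots> = P.expectation (\<lambda>b. \<bar>a 3 * Q (Hermite 3) b\<bar>) + P.expectation (\<lambda>b. \<bar>a 4 * Q (Hermite 4) b\<bar>) + 3 * P.expectation (\<lambda>b. \<bar>a 4 * Q (Hermite 2) b\<bar>)"
      using ia by simp
    also have "\<dots> \<le> 2 * \<alpha> + 7 * \<beta>" using n33 n44 n42 by linarith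
    finally show ?thesis .
  qed
  have t2c: "\<bar>P.expectation (\<lambda>b. W b * f (F2 b))\<bar> \<le> L * (4 * \<alpha> + 14 * \<beta>) / sqrt N"
  proof -
    have "\<bar>P.expectation (\<lambda>b. W b * f (F2 b))\<bar> = 2 * (\<bar>a 2 * (\<mu> / N)\<bar> * \<bar>P.expectation (\<lambda>b. f' (F2 b) * Q Y b)\<bar>)"
      unfolding t2b by (simp add: abs_mult)
    also have "\<dots> \<le> 2 * (1 / sqrt N * (L * (2 * \<alpha> + 7 * \<beta>)))"
      unfolding F2_def by (intro mult_left_mono mult_mono small order_trans[OF f'bound] mult_left_mono nY L0) auto
    also have "\<dots> = L * (4 * \<alpha> + 14 * \<beta>) / sqrt N" by (simp add: algebra_simps add_divide_distrib)
    finally show ?thesis .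
  qed
  have "P.expectation (\<lambda>b. f' (F b) - F b * f (F b)) = P.expectation (\<lambda>b. f' (F b)) - (P.expectation (\<lambda>b. F2 b * f (F b))
     + (P.expectation (\<lambda>b. W b * (f (F b) - f (F2 b))) + P.expectation (\<lambda>b. W b * f (F2 b))))"
  proof -
    have i: "integrable P (\<lambda>b. f' (F b))" "integrable P (\<lambda>b. F2 b * f (F b))" "integrable P (\<lambda>b. W b * f (F b))"
      "integrable P (\<lambda>b. W b * f (F2 b))"
      unfolding F_def F2_def W_def by (rule f'0 fi)+
    have "P.expectation (\<lambda>b. f' (F b) - F b * f (F b)) = P.expectation (\<lambda>b. f' (F b) - (F2 b * f (F b) + W b * f (F b)))"
      unfolding F_split[of b for b] distrib_right ..
    then show ?thesis using i by (simp add: right_diff_distrib)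
  qed
  then have "\<bar>P.expectation (\<lambda>b. f' (F b) - F b * f (F b))\<bar> \<le> L * (2 + 6 * \<alpha> + 28 * \<beta>) / sqrt N
     + L * P.expectation (\<lambda>b. (W b)\<^sup>2) + L * (4 * \<alpha> + 14 * \<beta>) / sqrt N"
    using t1b t2a t2c by linarith
  also have "\<dots> \<le> L * (2 + 6 * \<alpha> + 28 * \<beta>) / sqrt N + L * ((6 * \<alpha>\<^sup>2 + 24 * \<beta>\<^sup>2) * \<kappa> 3) + L * (4 * \<alpha> + 14 * \<beta>) / sqrt N"
    using vW L0 by (intro add_mono mult_left_mono) auto
  also have "\<dots> = L * (2 + 10 * \<alpha> + 42 * \<beta>) / sqrt N + L * (6 * \<alpha>\<^sup>2 + 24 * \<beta>\<^sup>2) * \<kappa> 3"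
    by (simp add: algebra_simps add_divide_distrib)
  finally show ?thesis unfolding F_def .
qed

text \<open>The price of dividing by s instead of the true standard deviation. With \<tau> the ratio
  of the two, E|Z| is at most \<tau> and |1/\<tau> - 1| \<tau> = |\<tau> - 1| is at most |\<tau>^2 -
  1|. If \<tau> = 0 then E|Z| = 0, and the default value of the division does no harm.\<close>

lemma standardized_lipschitz:
  fixes h :: "real \<Rightarrow> real"
  assumes h: "\<And>u v. \<bar>h u - h v\<bar> \<le> \<bar>u - v\<bar>"
    and X: "square_integrable P X" and mean: "P.expectation X = m" and s: "s > 0"
  shows "integrable P (\<lambda>b. h (standardized P X b))"
    "integrable P (\<lambda>b. h ((X b - m) / s))"
    "\<bar>P.expectation (\<lambda>b. h (standardized P X b)) - P.expectation (\<lambda>b. h ((X b - m) / s))\<bar> \<le> \<bar>P.variance X / s\<^sup>2 - 1\<bar>"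
proof -
  define Z where "Z b = (X b - m) / s" for b
  define \<tau> where "\<tau> = sqrt (P.variance X) / s"
  have \<tau>0: "\<tau> \<ge> 0" using s by (simp add: \<tau>_def)
  have \<tau>2: "\<tau>\<^sup>2 = P.variance X / s\<^sup>2" using s by (simp add: \<tau>_def power_divide)
  have siX: "square_integrable P (\<lambda>b. X b - m)"
    by (intro square_integrable_diff X square_integrable_bounded[OF P.finite_measure_axioms, of _ "\<bar>m\<bar>"]) auto
  have siZ: "square_integrable P Z"
    using square_integrable_cmult[OF siX, of "1 / s"] by (simp add: Z_def[abs_def])
  have iZ: "integrable P Z" by (rule P.square_integrable_imp_integrable[OF siZ])
  have st: "standardized P X b = Z b / \<tau>" for b
    using s by (simp add: standardized_def mean Z_def \<tau>_def)
  have EZ2: "P.expectation (\<lambda>b. (Z b)\<^sup>2) = \<tau>\<^sup>2"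
    unfolding \<tau>2 Z_def mean by (simp add: power_divide)
  have hm: "h \<in> borel_measurable borel"
  proof -
    have "1-lipschitz_on UNIV h" by (rule lipschitz_onI) (auto simp: dist_real_def h)
    then show ?thesis by (intro borel_measurable_continuous_onI lipschitz_on_continuous_on)
  qed
  have int: "integrable P (\<lambda>b. h (Z b * k))" for k
  proof (rule Bochner_Integration.integrable_bound)
    show "integrable P (\<lambda>b. \<bar>h 0\<bar> + \<bar>Z b * k\<bar>)" using iZ by simp
    show "(\<lambda>b. h (Z b * k)) \<in> borel_measurable P"
      by (rule measurable_compose[OF _ hm]) (use iZ in simp)
    have "\<bar>h u\<bar> \<le> \<bar>h 0\<bar> + \<bar>u\<bar>" for u using h[of u 0] by simp
    then show "AE b in P. norm (h (Z b * k)) \<le> norm (\<bar>h 0\<bar> + \<bar>Z b * k\<bar>)" by (intro AE_I2) simp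
  qed
  show i1: "integrable P (\<lambda>b. h (standardized P X b))"
    using int[of "1 / \<tau>"] by (simp add: st)
  show i2: "integrable P (\<lambda>b. h ((X b - m) / s))"
    using int[of 1] by (simp add: Z_def)
  have "\<bar>P.expectation (\<lambda>b. h (standardized P X b)) - P.expectation (\<lambda>b. h ((X b - m) / s))\<bar>
     = \<bar>P.expectation (\<lambda>b. h (standardized P X b) - h (Z b))\<bar>"
    using i1 i2 by (simp add: Z_def)
  also have "\<dots> \<le> P.expectation (\<lambda>b. \<bar>h (standardized P X b) - h (Z b)\<bar>)" by (rule integral_abs_bound)
  also have "\<dots> \<le> P.expectation (\<lambda>b. \<bar>1 / \<tau> - 1\<bar> * \<bar>Z b\<bar>)"
  proof (rule integral_mono)
    show "integrable P (\<lambda>b. \<bar>h (standardized P X b) - h (Z b)\<bar>)" using i1 i2 by (simp add: Z_def)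
    show "integrable P (\<lambda>b. \<bar>1 / \<tau> - 1\<bar> * \<bar>Z b\<bar>)" using iZ by simp
    show "\<bar>h (standardized P X b) - h (Z b)\<bar> \<le> \<bar>1 / \<tau> - 1\<bar> * \<bar>Z b\<bar>" for b
    proof -
      have "\<bar>h (standardized P X b) - h (Z b)\<bar> \<le> \<bar>Z b / \<tau> - Z b\<bar>" unfolding st by (rule h)
      also have "Z b / \<tau> - Z b = (1 / \<tau> - 1) * Z b" by (simp add: algebra_simps)
      finally show ?thesis by (simp only: abs_mult)
    qed
  qed
  also have "\<dots> = \<bar>1 / \<tau> - 1\<bar> * P.expectation (\<lambda>b. \<bar>Z b\<bar>)" by simp
  also have "\<dots> \<le> \<bar>1 / \<tau> - 1\<bar> * \<tau>"
    using P.expectation_abs_le_sqrt[OF siZ] \<tau>0 unfolding EZ2 by (intro mult_left_mono) auto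
  also have "\<dots> \<le> \<bar>\<tau>\<^sup>2 - 1\<bar>"
  proof (cases "\<tau> = 0")
    case False
    then have t: "\<tau> > 0" using \<tau>0 by simp
    then have "\<bar>1 / \<tau> - 1\<bar> * \<tau> = \<bar>(1 / \<tau> - 1) * \<tau>\<bar>" by (simp add: abs_mult)
    also have "\<dots> = \<bar>\<tau> - 1\<bar>" using t by (simp add: left_diff_distrib abs_minus_commute)
    also have "\<dots> \<le> \<bar>\<tau> - 1\<bar> * (\<tau> + 1)" using t mult_left_mono[of 1 "\<tau> + 1" "\<bar>\<tau> - 1\<bar>"] by simp
    also have "\<dots> = \<bar>(\<tau> - 1) * (\<tau> + 1)\<bar>" using t by (simp add: abs_mult)
    also have "\<dots> = \<bar>\<tau>\<^sup>2 - 1\<bar>" by (simp add: power2_eq_square algebra_simps)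
    finally show ?thesis by simp
  qed simp
  finally show "\<bar>P.expectation (\<lambda>b. h (standardized P X b)) - P.expectation (\<lambda>b. h ((X b - m) / s))\<bar> \<le> \<bar>P.variance X / s\<^sup>2 - 1\<bar>"
    unfolding \<tau>2 .
qed

text \<open>Three errors add up: replacing the true variance by that of the second chaos
  (\<open>\<kappa> 3\<close>), dropping the remainder R of order at least five (the square root of
  \<open>\<kappa> 5\<close>), and Stein's method for the orders two to four.\<close>

lemma clt_estimate:
  fixes M h :: "real \<Rightarrow> real"
  assumes M: "square_integrable std_normal_distribution M" and J2: "hermite_coeff 2 M \<noteq> 0"
    and h: "\<And>u v. \<bar>h u - h v\<bar> \<le> \<bar>u - v\<bar>"
    and f: "\<And>x. (f has_real_derivative f' x) (at x)" and f': "\<And>x. isCont f' x" and L: "\<And>x. \<bar>f' x\<bar> \<le> L"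
    and stein: "\<And>x. f' x - x * f x = h x - (\<integral>t. h t \<partial>std_normal_distribution)"
  defines "c \<equiv> \<lambda>q. hermite_coeff q M / fact q"
  defines "R \<equiv> \<lambda>t. M t - (\<Sum>q<5. c q * He q t)"
  defines "\<alpha> \<equiv> \<bar>c 3 / c 2\<bar>" and "\<beta> \<equiv> \<bar>c 4 / c 2\<bar>"
  shows "\<bar>P.expectation (\<lambda>b. h (standardized P (SF M) b)) - (\<integral>t. h t \<partial>std_normal_distribution)\<bar>
    \<le> L * (2 + 10 * \<alpha> + 42 * \<beta>) * (1 / sqrt N)
     + (L * (6 * \<alpha>\<^sup>2 + 24 * \<beta>\<^sup>2) + (\<integral>t. (M t)\<^sup>2 \<partial>std_normal_distribution) / (2 * (c 2)\<^sup>2)) * \<kappa> 3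
     + sqrt ((\<integral>t. (R t)\<^sup>2 \<partial>std_normal_distribution) / (2 * (c 2)\<^sup>2)) * sqrt (\<kappa> 5)"
proof -
  interpret G01: prob_space std_normal_distribution by simp
  have c2: "c 2 \<noteq> 0" using J2 by (simp add: c_def)
  define s where "s = \<bar>c 2\<bar> * \<mu> * sqrt (2 / N)"
  have s0: "s > 0" unfolding s_def using c2 mass N_pos by simp
  have s2: "s\<^sup>2 = 2 * (c 2)\<^sup>2 * \<mu>\<^sup>2 / N" unfolding s_def using N_pos by (simp add: power_mult_distrib)
  define p where "p = smult (c 2 / s) (Hermite 2) + (smult (c 3 / s) (Hermite 3) + smult (c 4 / s) (Hermite 4))"
  have siR: "square_integrable std_normal_distribution R"
    unfolding R_def by (intro square_integrable_diff M square_integrable_sum square_integrable_cmult square_integrable_poly)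
  \<comment> \<open>Vanishing coefficients below order five let \<open>second_moment\<close> bound
    the remainder by \<open>A 5\<close> alone.\<close>
  have R_coeff: "hermite_coeff q R = 0" if q: "q < 5" for q
  proof -
    have siH: "square_integrable std_normal_distribution (\<lambda>t. \<Sum>k<5. c k * He k t)"
      by (intro square_integrable_sum square_integrable_cmult square_integrable_poly)
    have "hermite_coeff q (\<lambda>t. \<Sum>k<5. c k * He k t) = (\<integral>t. (\<Sum>k<5. c k * (He k t * He q t)) \<partial>std_normal_distribution)"
      unfolding hermite_coeff_def by (simp only: sum_distrib_right mult.assoc)
    also have "\<dots> = (\<Sum>k<5. c k * hermite_coeff q (He k))"
      unfolding hermite_coeff_def
      by (subst Bochner_Integration.integral_sum) (auto intro!: integrable_mult_right square_integrable_mult square_integrable_poly)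
    also have "\<dots> = (\<Sum>k<5. if k = q then c q * fact q else 0)"
      by (rule sum.cong) (auto simp: hermite_coeff_He)
    also have "\<dots> = hermite_coeff q M" using q by (simp add: c_def)
    finally have "hermite_coeff q (\<lambda>t. \<Sum>k<5. c k * He k t) = hermite_coeff q M" .
    moreover have "hermite_coeff q R = hermite_coeff q M + hermite_coeff q (\<lambda>t. (-1) * (\<Sum>k<5. c k * He k t))"
      using hermite_coeff_add[OF M square_integrable_cmult[OF siH, of "-1"]] by (simp add: R_def)
    ultimately show ?thesis unfolding hermite_coeff_cmult by simp
  qed
  have iM: "integrable std_normal_distribution M" by (rule G01.square_integrable_imp_integrable[OF M])
  have mean: "P.expectation (SF M) = \<mu> * c 0"
    unfolding expectation_SF[OF iM] by (simp add: c_def hermite_coeff_def)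
  have siS: "square_integrable P (SF M)" "square_integrable P (SF R)" by (rule square_SF(1)[OF M], rule square_SF(1)[OF siR])
  have mR[measurable]: "R \<in> borel_measurable borel" using siR by (rule square_integrable_std_normal_measurable)
  have decomp: "AE b in P. (SF M b - \<mu> * c 0) / s = Q p b + SF R b / s"
    using AE_integrable_field[OF G01.square_integrable_imp_integrable[OF siR]]
  proof eventually_elim
    case (elim b)
    have "M t = R t + (\<Sum>q<5. c q * He q t)" for t by (simp add: R_def)
    then have "SF M b = (\<integral>x. R (T b x) + (\<Sum>q<5. c q * He q (T b x)) \<partial>S)" by (simp only: SF_def)
    also have "\<dots> = SF R b + (\<integral>x. (\<Sum>q<5. c q * He q (T b x)) \<partial>S)"
      unfolding SF_def by (intro Bochner_Integration.integral_add elim Bochner_Integration.integrable_sum integrable_mult_right Q_integrable)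
    also have "(\<integral>x. (\<Sum>q<5. c q * He q (T b x)) \<partial>S) = (\<Sum>q<5. c q * Q (Hermite q) b)"
      unfolding SF_def by (subst Bochner_Integration.integral_sum) (auto intro!: integrable_mult_right Q_integrable)
    also have "\<dots> = c 0 * Q (Hermite 0) b + c 1 * Q (Hermite 1) b + c 2 * Q (Hermite 2) b + c 3 * Q (Hermite 3) b + c 4 * Q (Hermite 4) b"
      by (simp add: eval_nat_numeral lessThan_Suc del: Hermite.simps)
    also have "Q (Hermite 0) b = \<mu>" using Q_const[of 1 b] by (simp add: one_pCons)
    also have "Q (Hermite 1) b = 0" unfolding Hermite_explicit by (rule Q_ident)
    finally have "SF M b - \<mu> * c 0 = SF R b + (c 2 * Q (Hermite 2) b + c 3 * Q (Hermite 3) b + c 4 * Q (Hermite 4) b)" by simp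
    then show ?case unfolding p_def Q_add Q_smult by (simp add: add_divide_distrib)
  qed
  let ?Nh = "\<integral>t. h t \<partial>std_normal_distribution"
  note std = standardized_lipschitz[OF h siS(1) mean s0]
  have hm[measurable]: "h \<in> borel_measurable borel"
  proof -
    have "1-lipschitz_on UNIV h" by (rule lipschitz_onI) (auto simp: dist_real_def h)
    then show ?thesis by (intro borel_measurable_continuous_onI lipschitz_on_continuous_on)
  qed
  have ihQ: "integrable P (\<lambda>b. h (Q p b))"
  proof (rule Bochner_Integration.integrable_bound)
    show "integrable P (\<lambda>b. \<bar>h 0\<bar> + \<bar>Q p b\<bar>)" using integrable_Q by simp
    show "(\<lambda>b. h (Q p b)) \<in> borel_measurable P" by measurable
    have "\<bar>h u\<bar> \<le> \<bar>h 0\<bar> + \<bar>u\<bar>" for u using h[of u 0] by simp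
    then show "AE b in P. norm (h (Q p b)) \<le> norm (\<bar>h 0\<bar> + \<bar>Q p b\<bar>)" by (intro AE_I2) simp
  qed
  have iR: "integrable P (SF R)" by (rule P.square_integrable_imp_integrable[OF siS(2)])
  have rem: "\<bar>P.expectation (\<lambda>b. h ((SF M b - \<mu> * c 0) / s)) - P.expectation (\<lambda>b. h (Q p b))\<bar>
      \<le> sqrt ((\<integral>t. (R t)\<^sup>2 \<partial>std_normal_distribution) / (2 * (c 2)\<^sup>2)) * sqrt (\<kappa> 5)"
  proof -
    have "\<bar>P.expectation (\<lambda>b. h ((SF M b - \<mu> * c 0) / s)) - P.expectation (\<lambda>b. h (Q p b))\<bar>
      = \<bar>P.expectation (\<lambda>b. h ((SF M b - \<mu> * c 0) / s) - h (Q p b))\<bar>"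
      using std(2) ihQ by simp
    also have "\<dots> \<le> P.expectation (\<lambda>b. \<bar>h ((SF M b - \<mu> * c 0) / s) - h (Q p b)\<bar>)" by (rule integral_abs_bound)
    also have "\<dots> \<le> P.expectation (\<lambda>b. \<bar>SF R b\<bar> / s)"
    proof (rule integral_mono_AE)
      show "integrable P (\<lambda>b. \<bar>h ((SF M b - \<mu> * c 0) / s) - h (Q p b)\<bar>)" using std(2) ihQ by simp
      show "integrable P (\<lambda>b. \<bar>SF R b\<bar> / s)" using iR by simp
      show "AE b in P. \<bar>h ((SF M b - \<mu> * c 0) / s) - h (Q p b)\<bar> \<le> \<bar>SF R b\<bar> / s"
        using decomp
      proof eventually_elim
        case (elim b)
        have "\<bar>h ((SF M b - \<mu> * c 0) / s) - h (Q p b)\<bar> \<le> \<bar>SF R b / s\<bar>"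
          using h[of "(SF M b - \<mu> * c 0) / s" "Q p b"] unfolding elim by simp
        then show ?case using s0 by simp
      qed
    qed
    also have "\<dots> = P.expectation (\<lambda>b. \<bar>SF R b\<bar>) / s" by simp
    also have "\<dots> \<le> sqrt (P.expectation (\<lambda>b. (SF R b)\<^sup>2)) / s"
      using s0 by (intro divide_right_mono P.expectation_abs_le_sqrt siS) auto
    also have "\<dots> \<le> sqrt (A 5 * (\<integral>t. (R t)\<^sup>2 \<partial>std_normal_distribution)) / s"
    proof -
      have "\<bar>P.expectation (\<lambda>b. (SF R b)\<^sup>2) - 0\<bar> \<le> A 5 * ((\<integral>t. (R t)\<^sup>2 \<partial>std_normal_distribution) - 0)"
        using second_moment[OF siR, of 5] R_coeff by simp
      then show ?thesis using s0 by (intro divide_right_mono) auto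
    qed
    also have "\<dots> = sqrt (A 5 * (\<integral>t. (R t)\<^sup>2 \<partial>std_normal_distribution) / s\<^sup>2)"
      using s0 by (simp add: real_sqrt_divide)
    also have "A 5 * (\<integral>t. (R t)\<^sup>2 \<partial>std_normal_distribution) / s\<^sup>2 = (\<integral>t. (R t)\<^sup>2 \<partial>std_normal_distribution) / (2 * (c 2)\<^sup>2) * \<kappa> 5"
      unfolding s2 \<kappa>_def using N_pos by (simp add: field_simps)
    finally show ?thesis by (simp only: real_sqrt_mult)
  qed
  have steinF: "\<bar>P.expectation (\<lambda>b. h (Q p b)) - ?Nh\<bar> \<le> L * (2 + 10 * \<alpha> + 42 * \<beta>) / sqrt N + L * (6 * \<alpha>\<^sup>2 + 24 * \<beta>\<^sup>2) * \<kappa> 3"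
  proof -
    have "P.expectation (\<lambda>b. h (Q p b)) - ?Nh = P.expectation (\<lambda>b. h (Q p b) - ?Nh)"
      using ihQ by (simp add: P.prob_space)
    also have "\<dots> = P.expectation (\<lambda>b. f' (Q p b) - Q p b * f (Q p b))" unfolding stein ..
    finally show ?thesis
      using stein_estimate[of c, OF c2 f f' L] unfolding p_def s_def \<alpha>_def \<beta>_def by simp
  qed
  have var: "\<bar>P.variance (SF M) / s\<^sup>2 - 1\<bar> \<le> (\<integral>t. (M t)\<^sup>2 \<partial>std_normal_distribution) / (2 * (c 2)\<^sup>2) * \<kappa> 3"
  proof -
    \<comment> \<open>Order zero contributes the squared mean, order one nothing, and order two is
      s^2; so what exceeds these in the second moment is exactly the variance defect.\<close>
    have sum3: "(\<Sum>q<3. (hermite_coeff q M)\<^sup>2 / fact q * B q) = (\<mu> * c 0)\<^sup>2 + s\<^sup>2"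
    proof -
      have "(\<Sum>q<3. (hermite_coeff q M)\<^sup>2 / fact q * B q) = (hermite_coeff 0 M)\<^sup>2 * B 0 + (hermite_coeff 1 M)\<^sup>2 * B 1 + (hermite_coeff 2 M)\<^sup>2 / 2 * B 2"
        by (simp add: eval_nat_numeral lessThan_Suc)
      then show ?thesis unfolding B_values s2 c_def by (simp add: power_divide power_mult_distrib)
    qed
    have "P.variance (SF M) = P.expectation (\<lambda>b. (SF M b)\<^sup>2) - (\<mu> * c 0)\<^sup>2"
      using siS(1) P.square_integrable_imp_integrable[OF siS(1)] mean
      by (subst P.variance_eq) (auto simp: square_integrable_def)
    then have "\<bar>P.variance (SF M) - s\<^sup>2\<bar> = \<bar>P.expectation (\<lambda>b. (SF M b)\<^sup>2) - (\<Sum>q<3. (hermite_coeff q M)\<^sup>2 / fact q * B q)\<bar>"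
      unfolding sum3 by simp
    also have "\<dots> \<le> A 3 * ((\<integral>t. (M t)\<^sup>2 \<partial>std_normal_distribution) - (\<Sum>q<3. (hermite_coeff q M)\<^sup>2 / fact q))"
      by (rule second_moment[OF M])
    also have "\<dots> \<le> A 3 * (\<integral>t. (M t)\<^sup>2 \<partial>std_normal_distribution)"
      using A_nonneg by (intro mult_left_mono) (auto intro!: sum_nonneg)
    finally have "\<bar>P.variance (SF M) - s\<^sup>2\<bar> / s\<^sup>2 \<le> A 3 * (\<integral>t. (M t)\<^sup>2 \<partial>std_normal_distribution) / s\<^sup>2"
      by (intro divide_right_mono) auto
    also have "\<dots> = (\<integral>t. (M t)\<^sup>2 \<partial>std_normal_distribution) / (2 * (c 2)\<^sup>2) * \<kappa> 3"
      unfolding s2 \<kappa>_def using N_pos by (simp add: field_simps)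
    also have "\<bar>P.variance (SF M) - s\<^sup>2\<bar> / s\<^sup>2 = \<bar>P.variance (SF M) / s\<^sup>2 - 1\<bar>"
    proof -
      have "P.variance (SF M) / s\<^sup>2 - 1 = (P.variance (SF M) - s\<^sup>2) / s\<^sup>2" using s0 by (simp add: diff_divide_distrib)
      then show ?thesis by (simp only: abs_divide abs_power2)
    qed
    finally show ?thesis .
  qed
  have "\<bar>P.expectation (\<lambda>b. h (standardized P (SF M) b)) - ?Nh\<bar> \<le>
     (\<integral>t. (M t)\<^sup>2 \<partial>std_normal_distribution) / (2 * (c 2)\<^sup>2) * \<kappa> 3
     + sqrt ((\<integral>t. (R t)\<^sup>2 \<partial>std_normal_distribution) / (2 * (c 2)\<^sup>2)) * sqrt (\<kappa> 5)
     + (L * (2 + 10 * \<alpha> + 42 * \<beta>) / sqrt N + L * (6 * \<alpha>\<^sup>2 + 24 * \<beta>\<^sup>2) * \<kappa> 3)"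
    using order_trans[OF std(3) var] rem steinF by linarith
  then show ?thesis by (simp add: distrib_right)
qed

lemma A_le:
  assumes "\<And>x. x \<in> space S \<Longrightarrow> (\<integral>x'. \<bar>G x x'\<bar> ^ q \<partial>S) \<le> K"
  shows "A q \<le> \<mu> * K"
proof -
  have "A q = (\<integral>x. (\<integral>x'. \<bar>G x x'\<bar> ^ q \<partial>S) \<partial>S)"
    unfolding A_def using SS.integral_fst'[OF integrable_G_power(2)[of q]] by simp
  also have "\<dots> \<le> (\<integral>x. K \<partial>S)"
    using SS.integrable_fst'[OF integrable_G_power(2)[of q]] assms by (intro integral_mono) auto
  finally show ?thesis by simp
qed

end

text \<open>C is fixed by M before the field is given; this uniformity turns estimates for single
  fields into an asymptotic statement in l.\<close>

theorem gaussian_field_clt: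
  assumes M: "square_integrable std_normal_distribution M" and J2: "hermite_coeff 2 M \<noteq> 0"
  shows "\<exists>C\<ge>0. \<forall>(S :: 'b measure) I y h. gaussian_field S I y \<longrightarrow> 1-lipschitz_on UNIV h \<longrightarrow>
    \<bar>(\<integral>b. h (standardized (gauss_space I) (gaussian_field.SF S I y M) b) \<partial>gauss_space I) - (\<integral>t. h t \<partial>std_normal_distribution)\<bar>
    \<le> C * (1 / sqrt (real (card I)) + gaussian_field.\<kappa> S I y 3 + sqrt (gaussian_field.\<kappa> S I y 5))"
proof -
  obtain L where L: "L > 0" and stein: "\<And>h::real \<Rightarrow> real. 1-lipschitz_on UNIV h \<Longrightarrow>
     (\<exists>f f'. (\<forall>x. (f has_real_derivative f' x) (at x)) \<and> (\<forall>x. isCont f' x) \<and> (\<forall>x. \<bar>f' x\<bar> \<le> L) \<and>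
        (\<forall>x. f' x - x * f x = h x - (\<integral>t. h t \<partial>std_normal_distribution)))"
    using stein_solution by blast
  define c where "c q = hermite_coeff q M / fact q" for q
  define R where "R t = M t - (\<Sum>q<5. c q * He q t)" for t
  define \<alpha> where "\<alpha> = \<bar>c 3 / c 2\<bar>"
  define \<beta> where "\<beta> = \<bar>c 4 / c 2\<bar>"
  define C1 where "C1 = L * (2 + 10 * \<alpha> + 42 * \<beta>)"
  define C2 where "C2 = L * (6 * \<alpha>\<^sup>2 + 24 * \<beta>\<^sup>2) + (\<integral>t. (M t)\<^sup>2 \<partial>std_normal_distribution) / (2 * (c 2)\<^sup>2)"
  define C3 where "C3 = sqrt ((\<integral>t. (R t)\<^sup>2 \<partial>std_normal_distribution) / (2 * (c 2)\<^sup>2))"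
  have nonneg: "C1 \<ge> 0" "C2 \<ge> 0" "C3 \<ge> 0"
    using L by (auto simp: C1_def C2_def C3_def \<alpha>_def \<beta>_def)
  show ?thesis
  proof (intro exI[of _ "C1 + C2 + C3"] conjI allI impI)
    show "0 \<le> C1 + C2 + C3" using nonneg by simp
    fix S :: "'b measure" and I y h
    assume "gaussian_field S I y" and h: "1-lipschitz_on UNIV (h :: real \<Rightarrow> real)"
    then interpret F: gaussian_field S I y by simp
    obtain f f' where f: "\<And>x. (f has_real_derivative f' x) (at x)" "\<And>x. isCont f' x" "\<And>x. \<bar>f' x\<bar> \<le> L"
      "\<And>x. f' x - x * f x = h x - (\<integral>t. h t \<partial>std_normal_distribution)" using stein[OF h] by blast
    have lip: "\<bar>h u - h v\<bar> \<le> \<bar>u - v\<bar>" for u v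
      using lipschitz_onD[OF h, of u v] by (simp add: dist_real_def)
    have "\<bar>(\<integral>b. h (standardized (gauss_space I) (F.SF M) b) \<partial>gauss_space I) - (\<integral>t. h t \<partial>std_normal_distribution)\<bar>
      \<le> C1 * (1 / sqrt F.N) + C2 * F.\<kappa> 3 + C3 * sqrt (F.\<kappa> 5)"
      using F.clt_estimate[OF M J2 lip f] unfolding C1_def C2_def C3_def R_def[abs_def] c_def[abs_def] \<alpha>_def \<beta>_def .
    also have "\<dots> \<le> (C1 + C2 + C3) * (1 / sqrt F.N) + (C1 + C2 + C3) * F.\<kappa> 3 + (C1 + C2 + C3) * sqrt (F.\<kappa> 5)"
      using nonneg F.\<kappa>_nonneg by (intro add_mono mult_right_mono) auto
    finally show "\<bar>(\<integral>b. h (standardized (gauss_space I) (F.SF M) b) \<partial>gauss_space I) - (\<integral>t. h t \<partial>std_normal_distribution)\<bar>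
      \<le> (C1 + C2 + C3) * (1 / sqrt F.N + F.\<kappa> 3 + sqrt (F.\<kappa> 5))"
      by (simp add: distrib_left)
  qed
qed

section \<open>Reflections\<close>

text \<open>The Householder reflection; for v = 0 division by zero makes it the identity.
  Reflections replace the rotation group: one of them exchanges any two points of equal norm, and it
  fixes every vector that has equal inner products with both.\<close>

definition reflect :: "'a::real_inner \<Rightarrow> 'a \<Rightarrow> 'a" where
  "reflect v z = z - (2 * (z \<bullet> v) / (v \<bullet> v)) *\<^sub>R v"

lemma reflect_add: "reflect v (x + y) = reflect v x + reflect v y"
  by (simp add: reflect_def inner_add_left distrib_left add_divide_distrib scaleR_add_left)

lemma reflect_scaleR: "reflect v (c *\<^sub>R x) = c *\<^sub>R reflect v x"
  by (simp add: reflect_def scaleR_diff_right)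

lemma linear_reflect: "linear (reflect v)"
  by (rule linearI) (simp_all add: reflect_add reflect_scaleR)

lemma reflect_self_adjoint: "reflect v x \<bullet> y = x \<bullet> reflect v y"
  by (simp add: reflect_def inner_diff_left inner_diff_right inner_commute[of y v])

lemma reflect_reflect [simp]: "reflect v (reflect v x) = x"
proof (cases "v = 0")
  case False
  then have "v \<bullet> v \<noteq> 0" by simp
  then have "reflect v x \<bullet> v = - (x \<bullet> v)" by (simp add: reflect_def inner_diff_left)
  then show ?thesis by (simp add: reflect_def[of v "reflect v x"]) (simp add: reflect_def)
qed (simp add: reflect_def)

lemma reflect_inner: "reflect v x \<bullet> reflect v y = x \<bullet> y"
  by (simp add: reflect_self_adjoint)

lemma norm_reflect [simp]: "norm (reflect v x) = norm x"
  by (simp add: norm_eq_sqrt_inner reflect_inner)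

lemma reflect_orthogonal: "x \<bullet> v = 0 \<Longrightarrow> reflect v x = x"
  by (simp add: reflect_def)

lemma reflect_swap:
  assumes "norm x = norm y" shows "reflect (x - y) x = y"
proof (cases "x = y")
  case False
  have xy: "x \<bullet> x = y \<bullet> y" using assms by (simp add: norm_eq_sqrt_inner)
  have "(x - y) \<bullet> (x - y) = 2 * (x \<bullet> (x - y))"
    using xy by (simp add: inner_diff_left inner_diff_right inner_commute)
  moreover have "(x - y) \<bullet> (x - y) \<noteq> 0" using False by simp
  ultimately show ?thesis by (simp add: reflect_def)
qed (simp add: reflect_def)

lemma reflect_measurable [measurable]: "reflect (v::'a::euclidean_space) \<in> borel_measurable borel"
  unfolding reflect_def[abs_def] by measurable

lemma nn_integral_lborel_shift:
  fixes c :: "'a::euclidean_space"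
  assumes "f \<in> borel_measurable borel"
  shows "(\<integral>\<^sup>+y. f (c + y) \<partial>lborel) = (\<integral>\<^sup>+y. f y \<partial>lborel)"
  using assms by (subst (2) lborel_distr_plus[symmetric, of c], subst nn_integral_distr) auto

text \<open>Both sides, multiplied by the volume of the unit ball, are the same double integral by
  translation invariance; the ball is invariant under the reflection.\<close>

lemma emeasure_lborel_reflect:
  fixes v :: "'a::euclidean_space"
  assumes A[measurable]: "A \<in> sets borel"
  shows "emeasure lborel (reflect v -` A) = emeasure lborel A"
proof -
  let ?R = "reflect v" and ?B = "ball (0::'a) 1"
  have [measurable]: "?B \<in> sets borel" by (rule borel_open[OF open_ball])
  have [measurable]: "?R -` A \<in> sets borel" using measurable_sets[OF reflect_measurable A, of v] by simp
  have "emeasure lborel (?R -` A) * emeasure lborel ?B = (\<integral>\<^sup>+x. indicator A (?R x) * emeasure lborel ?B \<partial>lborel)"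
    by (subst nn_integral_multc) (auto simp: nn_integral_indicator[symmetric] indicator_vimage comp_def simp del: nn_integral_indicator)
  also have "\<dots> = (\<integral>\<^sup>+x. \<integral>\<^sup>+y. indicator A (?R x) * indicator ?B y \<partial>lborel \<partial>lborel)"
    by (subst nn_integral_cmult) auto
  also have "\<dots> = (\<integral>\<^sup>+x. \<integral>\<^sup>+y. indicator A (?R x) * indicator ?B (- ?R x + y) \<partial>lborel \<partial>lborel)"
  proof (rule nn_integral_cong)
    fix x :: 'a
    show "(\<integral>\<^sup>+y. indicator A (?R x) * indicator ?B y \<partial>lborel) = (\<integral>\<^sup>+y. indicator A (?R x) * indicator ?B (- ?R x + y) \<partial>lborel)"
      by (rule nn_integral_lborel_shift[of "\<lambda>y. indicator A (?R x) * indicator ?B y", symmetric]) simp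
  qed
  also have "\<dots> = (\<integral>\<^sup>+y. \<integral>\<^sup>+x. indicator A (?R x) * indicator ?B (- ?R x + y) \<partial>lborel \<partial>lborel)"
    by (rule lborel_pair.Fubini') measurable
  \<comment> \<open>Replacing x by R y + x turns R x into y + R x, so the argument of the ball
    becomes - R x, whose norm is that of x. Now the set is translated and the ball is not.\<close>
  also have "\<dots> = (\<integral>\<^sup>+y. \<integral>\<^sup>+x. indicator A (?R (?R y + x)) * indicator ?B (- ?R (?R y + x) + y) \<partial>lborel \<partial>lborel)"
  proof (rule nn_integral_cong)
    fix y :: 'a
    show "(\<integral>\<^sup>+x. indicator A (?R x) * indicator ?B (- ?R x + y) \<partial>lborel)
      = (\<integral>\<^sup>+x. indicator A (?R (?R y + x)) * indicator ?B (- ?R (?R y + x) + y) \<partial>lborel)"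
      by (rule nn_integral_lborel_shift[of "\<lambda>x. indicator A (?R x) * indicator ?B (- ?R x + y)", symmetric]) simp
  qed
  also have "\<dots> = (\<integral>\<^sup>+y. \<integral>\<^sup>+x. indicator A (?R x + y) * indicator ?B x \<partial>lborel \<partial>lborel)"
    by (simp add: reflect_add add.commute indicator_def)
  also have "\<dots> = (\<integral>\<^sup>+x. \<integral>\<^sup>+y. indicator A (?R x + y) * indicator ?B x \<partial>lborel \<partial>lborel)"
    by (rule lborel_pair.Fubini') measurable
  also have "\<dots> = (\<integral>\<^sup>+x. \<integral>\<^sup>+y. indicator A y * indicator ?B x \<partial>lborel \<partial>lborel)"
  proof (rule nn_integral_cong)
    fix x :: 'a
    show "(\<integral>\<^sup>+y. indicator A (?R x + y) * indicator ?B x \<partial>lborel) = (\<integral>\<^sup>+y. indicator A y * indicator ?B x \<partial>lborel)"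
      by (rule nn_integral_lborel_shift[of "\<lambda>y. indicator A y * indicator ?B x"]) simp
  qed
  also have "\<dots> = (\<integral>\<^sup>+x. emeasure lborel A * indicator ?B x \<partial>lborel)"
    by (subst nn_integral_multc) auto
  also have "\<dots> = emeasure lborel A * emeasure lborel ?B"
    by (subst nn_integral_cmult) auto
  finally have eq: "emeasure lborel (?R -` A) * emeasure lborel ?B = emeasure lborel A * emeasure lborel ?B" .
  have "unit_ball_vol (real DIM('a)) \<noteq> 0"
    using unit_ball_vol_pos[of "real DIM('a)"] by (metis less_irrefl of_nat_0_le_iff)
  then have "emeasure lborel ?B \<noteq> 0" using emeasure_ball[of 1 "0::'a"] by simp
  moreover have "emeasure lborel ?B \<noteq> \<infinity>" using emeasure_ball[of 1 "0::'a"] by simp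
  ultimately show ?thesis using eq by (auto simp: ennreal_mult_cancel_left mult.commute[of _ "emeasure lborel ?B"])
qed

section \<open>Surface measure\<close>

definition radial_cone :: "'a::euclidean_space set \<Rightarrow> 'a set" where
  "radial_cone A = {x. norm x < 1 \<and> x \<noteq> 0 \<and> x /\<^sub>R norm x \<in> A}"

lemma sets_surface_measure_borel:
  "A \<in> sets surface_measure \<longleftrightarrow> A \<in> sets borel \<and> A \<subseteq> sphere 0 1"
  by (auto simp: sets_restrict_space_iff)

lemma radial_cone_measurable:
  fixes A :: "'a::euclidean_space set"
  assumes A: "A \<in> sets borel" shows "radial_cone A \<in> sets borel"
proof -
  have "(\<lambda>x::'a. x /\<^sub>R norm x) \<in> borel_measurable borel" by measurable
  from measurable_sets[OF this A] have "(\<lambda>x. x /\<^sub>R norm x) -` A \<in> sets borel" by simp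
  moreover have "radial_cone A = (\<lambda>x. x /\<^sub>R norm x) -` A \<inter> (ball 0 1 - {0})" by (auto simp: radial_cone_def)
  ultimately show "radial_cone A \<in> sets borel" by (simp add: sets.Int)
qed

lemma emeasure_surface_measure:
  assumes A: "A \<in> sets surface_measure"
  shows "emeasure surface_measure A = ennreal (DIM('a)) * emeasure lborel (radial_cone (A :: 'a::euclidean_space set))"
proof -
  let ?p = "\<lambda>x::'a. x /\<^sub>R norm x"
  let ?B = "ball (0::'a) 1 - {0}"
  have A': "A \<in> sets (restrict_space borel (sphere 0 1))" using A by simp
  have pre: "?p -` A \<inter> space (restrict_space lborel ?B) = radial_cone A"
    by (auto simp: space_restrict_space radial_cone_def)
  have "emeasure (distr (restrict_space lborel ?B) (restrict_space borel (sphere 0 1)) ?p) A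
      = emeasure (restrict_space lborel ?B) (radial_cone A)"
    using emeasure_distr[OF radial_projection_measurable A'] pre by simp
  also have "\<dots> = emeasure lborel (radial_cone A)"
    by (subst emeasure_restrict_space) (auto simp: radial_cone_def)
  finally show ?thesis by (simp add: surface_measure_def)
qed

lemma reflect_measurable_surface [measurable]:
  "reflect (v::'a::euclidean_space) \<in> surface_measure \<rightarrow>\<^sub>M surface_measure"
proof -
  have "reflect v \<in> restrict_space borel (sphere 0 1) \<rightarrow>\<^sub>M restrict_space borel (sphere 0 1)"
    by (intro measurable_restrict_space2 measurable_restrict_space1) (auto simp: space_restrict_space)
  then show ?thesis by (simp cong: measurable_cong_sets)
qed

text \<open>Reflections preserve norms and commute with scaling, so the cone over a preimage is the
  preimage of the cone, and \<open>emeasure_lborel_reflect\<close> applies.\<close>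

lemma distr_surface_measure_reflect:
  "distr surface_measure surface_measure (reflect (v::'a::euclidean_space)) = surface_measure"
proof (rule measure_eqI)
  fix A :: "'a set" assume "A \<in> sets (distr surface_measure surface_measure (reflect v))"
  then have A: "A \<in> sets surface_measure" by simp
  have Ab: "A \<in> sets borel" using A sets_surface_measure_borel by blast
  have B: "reflect v -` A \<inter> sphere 0 1 \<in> sets surface_measure"
    using measurable_sets[OF reflect_measurable_surface A] by simp
  have "radial_cone (reflect v -` A \<inter> sphere 0 1) = reflect v -` radial_cone A"
  proof (rule set_eqI)
    fix x
    show "x \<in> radial_cone (reflect v -` A \<inter> sphere 0 1) \<longleftrightarrow> x \<in> reflect v -` radial_cone A"
    proof (cases "x = 0")
      case True
      have "reflect v 0 = 0" by (rule linear_0[OF linear_reflect])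
      with True show ?thesis by (simp add: radial_cone_def)
    next
      case False
      then have "reflect v x \<noteq> 0" by (metis norm_eq_zero norm_reflect)
      moreover have "x /\<^sub>R norm x \<in> sphere 0 1" using False by simp
      ultimately show ?thesis using False unfolding radial_cone_def by (simp add: reflect_scaleR)
    qed
  qed
  then have "emeasure lborel (radial_cone (reflect v -` A \<inter> sphere 0 1)) = emeasure lborel (radial_cone A)"
    using emeasure_lborel_reflect[OF radial_cone_measurable[OF Ab]] by simp
  then show "emeasure (distr surface_measure surface_measure (reflect v)) A = emeasure surface_measure A"
    using A B by (subst emeasure_distr) (auto simp: emeasure_surface_measure)
qed simp

lemma integral_surface_measure_reflect:
  fixes f :: "'a::euclidean_space \<Rightarrow> real"
  assumes "f \<in> borel_measurable surface_measure"
  shows "(\<integral>x. f (reflect v x) \<partial>surface_measure) = (\<integral>x. f x \<partial>surface_measure)"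
  using assms by (subst (2) distr_surface_measure_reflect[symmetric, of v], subst integral_distr) auto

lemma finite_measure_surface_measure: "finite_measure (surface_measure :: 'a::euclidean_space measure)"
proof (rule finite_measureI)
  have "sphere (0::'a) 1 \<in> sets surface_measure"
    unfolding sets_surface_measure_borel by (simp add: borel_closed)
  then have "emeasure surface_measure (sphere (0::'a) 1) = ennreal (DIM('a)) * emeasure lborel (radial_cone (sphere (0::'a) 1))"
    by (rule emeasure_surface_measure)
  also have "\<dots> \<le> ennreal (DIM('a)) * emeasure lborel (ball (0::'a) 1)"
    by (intro mult_left_mono emeasure_mono) (auto simp: radial_cone_def)
  also have "\<dots> < \<infinity>" by (simp add: emeasure_ball ennreal_mult[symmetric] del: ennreal_of_nat_eq_real_of_nat flip: ennreal_of_nat_eq_real_of_nat) (simp add: ennreal_mult_less_top of_nat_less_top)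
  finally show "emeasure surface_measure (space (surface_measure :: 'a measure)) \<noteq> \<infinity>" by simp
qed

text \<open>The set consists of the two polar caps around e and -e. Any other coordinate of a unit
  vector u has square at most 1 - (u . e)^2, so the cone lies in a box of half-width 1 along e and
  \<delta> in the other directions. The exponent is the dimension of the sphere.\<close>

lemma measure_surface_measure_cap:
  fixes e :: "'a::euclidean_space" and \<delta> :: real
  assumes e: "e \<in> Basis" and \<delta>: "0 \<le> \<delta>"
  shows "measure surface_measure {x \<in> sphere 0 1. 1 - (x \<bullet> e)\<^sup>2 \<le> \<delta>\<^sup>2} \<le> DIM('a) * (2 * (2 * \<delta>) ^ (DIM('a) - 1))"
proof -
  let ?A = "{x \<in> sphere 0 1. 1 - (x \<bullet> e)\<^sup>2 \<le> \<delta>\<^sup>2}"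
  define c :: 'a where "c = (\<Sum>b\<in>Basis. (if b = e then 1 else \<delta>) *\<^sub>R b)"
  have cb: "c \<bullet> b = (if b = e then 1 else \<delta>)" if "b \<in> Basis" for b
    unfolding c_def using that by (simp add: inner_sum_left_Basis)
  have sub: "radial_cone ?A \<subseteq> cbox (- c) c"
  proof
    fix x assume "x \<in> radial_cone ?A"
    then have x: "norm x < 1" "x \<noteq> 0" "1 - ((x /\<^sub>R norm x) \<bullet> e)\<^sup>2 \<le> \<delta>\<^sup>2" by (auto simp: radial_cone_def)
    define u where "u = x /\<^sub>R norm x"
    have nu: "norm u = 1" using x by (simp add: u_def)
    have xu: "x = norm x *\<^sub>R u" using x by (simp add: u_def)
    have "\<bar>x \<bullet> b\<bar> \<le> c \<bullet> b" if b: "b \<in> Basis" for b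
    proof (cases "b = e")
      case True
      then show ?thesis using Basis_le_norm[OF b, of x] x cb[OF b] by simp
    next
      case False
      have "(u \<bullet> b)\<^sup>2 + (u \<bullet> e)\<^sup>2 = (\<Sum>i\<in>{b, e}. (u \<bullet> i)\<^sup>2)" using False by simp
      also have "\<dots> \<le> (\<Sum>i\<in>Basis. (u \<bullet> i)\<^sup>2)" using b e by (intro sum_mono2) auto
      also have "\<dots> = 1" using nu by (simp add: norm_eq_sqrt_inner euclidean_inner[of u u] power2_eq_square)
      finally have "(u \<bullet> b)\<^sup>2 \<le> \<delta>\<^sup>2" using x(3) unfolding u_def by linarith
      then have "\<bar>u \<bullet> b\<bar> \<le> \<delta>" using \<delta> by (simp add: abs_le_square_iff[symmetric])
      then have "norm x * \<bar>u \<bullet> b\<bar> \<le> 1 * \<delta>" using x(1) by (intro mult_mono) auto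
      moreover have "\<bar>x \<bullet> b\<bar> = norm x * \<bar>u \<bullet> b\<bar>" by (subst xu) (simp add: abs_mult)
      ultimately show ?thesis using False cb[OF b] by simp
    qed
    then have "- (c \<bullet> b) \<le> x \<bullet> b \<and> x \<bullet> b \<le> c \<bullet> b" if "b \<in> Basis" for b
      using that by (meson abs_le_D1 abs_le_D2 minus_le_iff)
    then show "x \<in> cbox (- c) c" by (simp add: mem_box)
  qed
  have "?A = sphere 0 1 \<inter> {x. 1 - (x \<bullet> e)\<^sup>2 \<le> \<delta>\<^sup>2}" by auto
  moreover have "closed {x. 1 - (x \<bullet> e)\<^sup>2 \<le> \<delta>\<^sup>2}"
    by (intro closed_Collect_le continuous_intros)
  ultimately have "closed ?A" by (simp only: closed_Int closed_sphere)
  then have "?A \<in> sets borel" by (rule borel_closed)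
  then have A: "?A \<in> sets surface_measure" unfolding sets_surface_measure_borel by auto
  have "emeasure surface_measure ?A \<le> ennreal (DIM('a)) * emeasure lborel (cbox (- c) c)"
    unfolding emeasure_surface_measure[OF A] by (intro mult_left_mono emeasure_mono sub) auto
  also have "emeasure lborel (cbox (- c) c) = (\<Prod>b\<in>Basis. (c - (- c)) \<bullet> b)"
    using cb \<delta> by (intro emeasure_lborel_cbox) auto
  also have "(\<Prod>b\<in>Basis. (c - (- c)) \<bullet> b) = (\<Prod>b\<in>Basis. if b = e then 2 else 2 * \<delta>)"
    by (rule prod.cong) (auto simp: cb inner_add_left)
  also have "\<dots> = 2 * (2 * \<delta>) ^ (DIM('a) - 1)"
    using e by (subst prod.remove[OF _ e]) (auto simp: card_Diff_singleton)
  finally have "emeasure surface_measure ?A \<le> ennreal (DIM('a) * (2 * (2 * \<delta>) ^ (DIM('a) - 1)))"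
    using \<delta> by (simp add: ennreal_mult)
  then show ?thesis
    using \<delta> by (simp add: measure_def enn2real_leI)
qed

section \<open>Second derivatives of polynomials\<close>

text \<open>\<open>g x v\<close> is the gradient applied to v and \<open>B x v w\<close> the
  Hessian. A relation composes well with sums, products and reflections;
  \<open>laplacian_eq_trace\<close> links it to the iterated one-variable derivatives in
  \<open>laplacian\<close>.\<close>

definition second_derivative ::
  "('a::euclidean_space \<Rightarrow> real) \<Rightarrow> ('a \<Rightarrow> 'a \<Rightarrow> real) \<Rightarrow> ('a \<Rightarrow> 'a \<Rightarrow> 'a \<Rightarrow> real) \<Rightarrow> bool" where
  "second_derivative p g B \<longleftrightarrow> (\<forall>x. (p has_derivative g x) (at x)) \<and>
     (\<forall>x v. ((\<lambda>x. g x v) has_derivative B x v) (at x))"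

lemma second_derivative_polynomial:
  assumes "real_polynomial_function p"
  shows "\<exists>g B. second_derivative p g B"
  using assms
proof (induction rule: real_polynomial_function.induct)
  case (linear f)
  then have "second_derivative f (\<lambda>x. f) (\<lambda>x v w. 0)"
    by (auto simp: second_derivative_def bounded_linear_imp_has_derivative)
  then show ?case by blast
next
  case (const c)
  have "second_derivative (\<lambda>x. c) (\<lambda>x v. 0) (\<lambda>x v w. 0)" by (auto simp: second_derivative_def)
  then show ?case by blast
next
  case (add f h)
  then obtain g B g' B' where "second_derivative f g B" "second_derivative h g' B'" by blast
  then have "second_derivative (\<lambda>x. f x + h x) (\<lambda>x v. g x v + g' x v) (\<lambda>x v w. B x v w + B' x v w)"
    by (auto simp: second_derivative_def intro!: has_derivative_add)
  then show ?case by blast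
next
  case (mult f h)
  then obtain g B g' B' where "second_derivative f g B" "second_derivative h g' B'" by blast
  then have 1: "\<And>x. (f has_derivative g x) (at x)" "\<And>x. (h has_derivative g' x) (at x)"
    "\<And>x v. ((\<lambda>x. g x v) has_derivative B x v) (at x)" "\<And>x v. ((\<lambda>x. g' x v) has_derivative B' x v) (at x)"
    by (auto simp: second_derivative_def)
  have "second_derivative (\<lambda>x. f x * h x) (\<lambda>x v. f x * g' x v + g x v * h x)
    (\<lambda>x v w. (f x * B' x v w + g x w * g' x v) + (g x v * g' x w + B x v w * h x))"
    unfolding second_derivative_def by (intro conjI allI has_derivative_add has_derivative_mult 1)
  then show ?case by blast
qed

text \<open>Linearity of the Hessian in v is inherited from that of the gradient by uniqueness of
  derivatives.\<close>

lemma second_derivative_linear: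
  assumes "second_derivative p g B"
  shows "linear (g x)" "linear (B x v)" "linear (\<lambda>v. B x v w)"
proof -
  have 1: "\<And>x. (p has_derivative g x) (at x)" "\<And>x v. ((\<lambda>x. g x v) has_derivative B x v) (at x)"
    using assms by (auto simp: second_derivative_def)
  show lg: "linear (g x)" for x using has_derivative_linear[OF 1(1)] .
  show "linear (B x v)" using has_derivative_linear[OF 1(2)] .
  show "linear (\<lambda>v. B x v w)"
  proof (rule linearI)
    fix a b
    have "((\<lambda>x. g x (a + b)) has_derivative (\<lambda>w. B x a w + B x b w)) (at x)"
      unfolding linear_add[OF lg] by (intro has_derivative_add 1)
    then have "B x (a + b) = (\<lambda>w. B x a w + B x b w)" by (rule has_derivative_unique[OF 1(2)])
    then show "B x (a + b) w = B x a w + B x b w" by simp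
  next
    fix a :: 'a and c :: real
    have "((\<lambda>x. g x (c *\<^sub>R a)) has_derivative (\<lambda>w. c *\<^sub>R B x a w)) (at x)"
      unfolding linear_cmul[OF lg] by (intro has_derivative_scaleR_right 1)
    then have "B x (c *\<^sub>R a) = (\<lambda>w. c *\<^sub>R B x a w)" by (rule has_derivative_unique[OF 1(2)])
    then show "B x (c *\<^sub>R a) w = c *\<^sub>R B x a w" by simp
  qed
qed

lemma laplacian_eq_trace:
  assumes "second_derivative p g B"
  shows "laplacian p x = (\<Sum>b\<in>Basis. B x b b)"
  unfolding laplacian_def
proof (rule sum.cong[OF refl])
  fix b :: 'a
  have 1: "\<And>x. (p has_derivative g x) (at x)" "\<And>x v. ((\<lambda>x. g x v) has_derivative B x v) (at x)"
    using assms by (auto simp: second_derivative_def)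
  have line: "((\<lambda>t. x + t *\<^sub>R b) has_derivative (\<lambda>s. s *\<^sub>R b)) (at t)" for t :: real
    by (auto intro!: derivative_eq_intros)
  have "((\<lambda>t. p (x + t *\<^sub>R b)) has_real_derivative g (x + t *\<^sub>R b) b) (at t)" for t :: real
    using has_derivative_compose[OF line 1(1)] linear_cmul[OF second_derivative_linear(1)[OF assms]]
    by (simp add: has_field_derivative_def mult_commute_abs)
  then have "deriv (\<lambda>t. p (x + t *\<^sub>R b)) = (\<lambda>t. g (x + t *\<^sub>R b) b)" by (auto intro: DERIV_imp_deriv)
  moreover have "((\<lambda>t. g (x + t *\<^sub>R b) b) has_real_derivative B (x + 0 *\<^sub>R b) b b) (at 0)"
    using has_derivative_compose[OF line[of 0] 1(2)] linear_cmul[OF second_derivative_linear(2)[OF assms]]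
    by (simp add: has_field_derivative_def mult_commute_abs)
  then have "deriv (\<lambda>t. g (x + t *\<^sub>R b) b) 0 = B x b b" by (auto dest: DERIV_imp_deriv)
  ultimately show "(deriv ^^ 2) (\<lambda>t. p (x + t *\<^sub>R b)) 0 = B x b b"
    by (simp add: numeral_2_eq_2)
qed

lemma second_derivative_add:
  "second_derivative f g B \<Longrightarrow> second_derivative h g' B' \<Longrightarrow>
    second_derivative (\<lambda>x. f x + h x) (\<lambda>x v. g x v + g' x v) (\<lambda>x v w. B x v w + B' x v w)"
  by (auto simp: second_derivative_def intro!: has_derivative_add)

lemma second_derivative_cmult:
  "second_derivative f g B \<Longrightarrow>
    second_derivative (\<lambda>x. c * f x) (\<lambda>x v. c * g x v) (\<lambda>x v w. c * B x v w)"
  by (auto simp: second_derivative_def intro!: has_derivative_mult_right)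

lemma second_derivative_reflect:
  assumes "second_derivative p g B"
  shows "second_derivative (\<lambda>x. p (reflect s x)) (\<lambda>x v. g (reflect s x) (reflect s v))
    (\<lambda>x v w. B (reflect s x) (reflect s v) (reflect s w))"
proof -
  have 1: "\<And>x. (p has_derivative g x) (at x)" "\<And>x v. ((\<lambda>x. g x v) has_derivative B x v) (at x)"
    using assms by (auto simp: second_derivative_def)
  have r: "(reflect s has_derivative reflect s) (at x)" for x
    by (rule linear_imp_has_derivative[OF linear_reflect])
  show ?thesis unfolding second_derivative_def
    using has_derivative_compose[OF r 1(1)] has_derivative_compose[OF r 1(2)] by blast
qed

text \<open>The trace of a bilinear form is the same in any orthonormal basis; expanding in
  coordinates, self-adjointness moves the reflection onto i and j, and summing over b leaves their
  inner product.\<close>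

lemma trace_reflect:
  fixes B :: "'a::euclidean_space \<Rightarrow> 'a \<Rightarrow> real"
  assumes "\<And>v. linear (B v)" "\<And>w. linear (\<lambda>v. B v w)"
  shows "(\<Sum>b\<in>Basis. B (reflect s b) (reflect s b)) = (\<Sum>b\<in>Basis. B b b)"
proof -
  have exp: "B u w = (\<Sum>i\<in>Basis. \<Sum>j\<in>Basis. (u \<bullet> i) * (w \<bullet> j) * B i j)" for u w
  proof -
    have "B u w = B (\<Sum>i\<in>Basis. (u \<bullet> i) *\<^sub>R i) (\<Sum>j\<in>Basis. (w \<bullet> j) *\<^sub>R j)"
      by (simp add: euclidean_representation)
    also have "\<dots> = (\<Sum>i\<in>Basis. (u \<bullet> i) * B i (\<Sum>j\<in>Basis. (w \<bullet> j) *\<^sub>R j))"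
      by (simp only: linear_sum[OF assms(2)] linear_cmul[OF assms(2)] real_scaleR_def)
    also have "\<dots> = (\<Sum>i\<in>Basis. \<Sum>j\<in>Basis. (u \<bullet> i) * (w \<bullet> j) * B i j)"
      by (simp only: linear_sum[OF assms(1)] linear_cmul[OF assms(1)] real_scaleR_def sum_distrib_left mult.assoc)
    finally show ?thesis .
  qed
  have "(\<Sum>b\<in>Basis. B (reflect s b) (reflect s b)) =
    (\<Sum>b\<in>Basis. \<Sum>i\<in>Basis. \<Sum>j\<in>Basis. (reflect s b \<bullet> i) * (reflect s b \<bullet> j) * B i j)"
    by (subst exp) simp
  also have "\<dots> = (\<Sum>i\<in>Basis. \<Sum>j\<in>Basis. (\<Sum>b\<in>Basis. (reflect s i \<bullet> b) * (reflect s j \<bullet> b)) * B i j)"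
  proof -
    have sw: "(reflect s b \<bullet> i) * (reflect s b \<bullet> j) * B i j = (reflect s i \<bullet> b) * (reflect s j \<bullet> b) * B i j" for b i j
      unfolding reflect_self_adjoint[of s b] inner_commute[of b] ..
    have "(\<Sum>b\<in>Basis. \<Sum>i\<in>Basis. \<Sum>j\<in>Basis. (reflect s b \<bullet> i) * (reflect s b \<bullet> j) * B i j)
      = (\<Sum>b\<in>Basis. \<Sum>i\<in>Basis. \<Sum>j\<in>Basis. (reflect s i \<bullet> b) * (reflect s j \<bullet> b) * B i j)" by (intro sum.cong refl sw)
    also have "\<dots> = (\<Sum>i\<in>Basis. \<Sum>b\<in>Basis. \<Sum>j\<in>Basis. (reflect s i \<bullet> b) * (reflect s j \<bullet> b) * B i j)"
      by (rule sum.swap)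
    also have "\<dots> = (\<Sum>i\<in>Basis. \<Sum>j\<in>Basis. \<Sum>b\<in>Basis. (reflect s i \<bullet> b) * (reflect s j \<bullet> b) * B i j)"
      by (rule sum.cong[OF refl], rule sum.swap)
    finally show ?thesis by (simp only: sum_distrib_right)
  qed
  also have "\<dots> = (\<Sum>i\<in>Basis. \<Sum>j\<in>Basis. (i \<bullet> j) * B i j)"
    by (simp add: euclidean_inner[symmetric] reflect_inner)
  also have "\<dots> = (\<Sum>i\<in>Basis. \<Sum>j\<in>Basis. if i = j then B i j else 0)"
    by (intro sum.cong refl) (simp add: inner_Basis)
  also have "\<dots> = (\<Sum>b\<in>Basis. B b b)" by simp
  finally show ?thesis .
qed

lemma laplacian_reflect:
  assumes "real_polynomial_function p"
  shows "laplacian (\<lambda>x. p (reflect s x)) x = laplacian p (reflect s x)"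
proof -
  obtain g B where gB: "second_derivative p g B" using second_derivative_polynomial[OF assms] by blast
  show ?thesis
    unfolding laplacian_eq_trace[OF gB] laplacian_eq_trace[OF second_derivative_reflect[OF gB]]
    by (rule trace_reflect[OF second_derivative_linear(2,3)[OF gB]])
qed

lemma laplacian_add:
  assumes "real_polynomial_function p" "real_polynomial_function q"
  shows "laplacian (\<lambda>x. p x + q x) x = laplacian p x + laplacian q x"
proof -
  obtain g B where 1: "second_derivative p g B" using second_derivative_polynomial[OF assms(1)] by blast
  obtain g' B' where 2: "second_derivative q g' B'" using second_derivative_polynomial[OF assms(2)] by blast
  show ?thesis
    unfolding laplacian_eq_trace[OF second_derivative_add[OF 1 2]] laplacian_eq_trace[OF 1] laplacian_eq_trace[OF 2]
    by (rule sum.distrib)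
qed

lemma laplacian_cmult:
  assumes "real_polynomial_function p"
  shows "laplacian (\<lambda>x. c * p x) x = c * laplacian p x"
proof -
  obtain g B where gB: "second_derivative p g B" using second_derivative_polynomial[OF assms] by blast
  show ?thesis
    unfolding laplacian_eq_trace[OF second_derivative_cmult[OF gB]] laplacian_eq_trace[OF gB]
    by (rule sum_distrib_left[symmetric])
qed

section \<open>The space of spherical harmonics\<close>

lemma spherical_harmonic_add:
  assumes "spherical_harmonic l f" "spherical_harmonic l g"
  shows "spherical_harmonic l (\<lambda>x. f x + g x)"
proof -
  obtain p q where "real_polynomial_function p" "\<forall>t x. p (t *\<^sub>R x) = t ^ l * p x" "\<forall>x. laplacian p x = 0"
     "\<forall>x\<in>sphere 0 1. f x = p x" "real_polynomial_function q" "\<forall>t x. q (t *\<^sub>R x) = t ^ l * q x" "\<forall>x. laplacian q x = 0"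
     "\<forall>x\<in>sphere 0 1. g x = q x" using assms unfolding spherical_harmonic_def by blast
  then show ?thesis unfolding spherical_harmonic_def
    by (intro exI[of _ "\<lambda>x. p x + q x"]) (simp add: real_polynomial_function.intros(3) laplacian_add distrib_left)
qed

lemma spherical_harmonic_cmult:
  assumes "spherical_harmonic l f"
  shows "spherical_harmonic l (\<lambda>x. c * f x)"
proof -
  obtain p where "real_polynomial_function p" "\<forall>t x. p (t *\<^sub>R x) = t ^ l * p x" "\<forall>x. laplacian p x = 0"
     "\<forall>x\<in>sphere 0 1. f x = p x" using assms unfolding spherical_harmonic_def by blast
  then show ?thesis unfolding spherical_harmonic_def
    by (intro exI[of _ "\<lambda>x. c * p x"])
       (simp add: real_polynomial_function.intros(2,4) laplacian_cmult)
qed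

lemma spherical_harmonic_zero: "spherical_harmonic l (\<lambda>x::'a::euclidean_space. 0)"
proof -
  have "laplacian (\<lambda>x::'a. 0) x = 0" for x
    using laplacian_cmult[of "\<lambda>x::'a. 0" 0 x] by (simp add: real_polynomial_function.intros(2))
  then show ?thesis unfolding spherical_harmonic_def
    by (intro exI[of _ "\<lambda>x. 0"]) (simp add: real_polynomial_function.intros(2))
qed

lemma spherical_harmonic_sum:
  "(\<And>i. i \<in> I \<Longrightarrow> spherical_harmonic l (f i)) \<Longrightarrow> spherical_harmonic l (\<lambda>x. \<Sum>i\<in>I. f i x)"
proof (induction I rule: infinite_finite_induct)
  case (insert i I)
  then have "spherical_harmonic l (\<lambda>x. f i x + (\<Sum>i\<in>I. f i x))" by (intro spherical_harmonic_add) auto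
  then show ?case using insert by simp
qed (simp_all add: spherical_harmonic_zero)

lemma spherical_harmonic_reflect:
  assumes "spherical_harmonic l f"
  shows "spherical_harmonic l (\<lambda>x. f (reflect s x))"
proof -
  obtain p where p: "real_polynomial_function p" "\<forall>t x. p (t *\<^sub>R x) = t ^ l * p x" "\<forall>x. laplacian p x = 0"
     "\<forall>x\<in>sphere 0 1. f x = p x" using assms unfolding spherical_harmonic_def by blast
  have "polynomial_function (reflect s)"
    by (rule polynomial_function_bounded_linear) (simp add: linear_conv_bounded_linear[symmetric] linear_reflect)
  from real_polynomial_function_compose[OF this p(1)]
  have "real_polynomial_function (\<lambda>x. p (reflect s x))" by (simp add: o_def)
  with p show ?thesis unfolding spherical_harmonic_def
    by (intro exI[of _ "\<lambda>x. p (reflect s x)"]) (simp add: laplacian_reflect reflect_scaleR)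
qed

lemma spherical_harmonic_continuous:
  assumes "spherical_harmonic l f"
  shows "continuous_on (sphere 0 1) f"
proof -
  obtain p where p: "real_polynomial_function p" "\<forall>x\<in>sphere 0 1. f x = p x"
    using assms unfolding spherical_harmonic_def by blast
  have "continuous_on (sphere 0 1) p"
    using p(1) by (simp add: continuous_on_polymonial_function real_polynomial_function_eq)
  then show ?thesis by (rule continuous_on_eq) (use p(2) in simp)
qed

lemma spherical_harmonic_measurable [measurable_dest]:
  assumes "spherical_harmonic l f"
  shows "f \<in> borel_measurable surface_measure"
proof -
  have "f \<in> borel_measurable (restrict_space borel (sphere 0 1))"
    by (rule borel_measurable_continuous_on_restrict) (rule spherical_harmonic_continuous[OF assms])
  then show ?thesis by (simp cong: measurable_cong_sets)
qed

lemma spherical_harmonic_bounded: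
  assumes "spherical_harmonic l f"
  shows "\<exists>B. \<forall>x\<in>sphere 0 1. \<bar>f x\<bar> \<le> B"
proof -
  have "compact (f ` sphere 0 1)"
    by (intro compact_continuous_image spherical_harmonic_continuous[OF assms] compact_sphere)
  then have "bounded (f ` sphere 0 1)" by (rule compact_imp_bounded)
  then show ?thesis by (auto simp: bounded_iff)
qed

section \<open>The energy estimate for the Gegenbauer equation\<close>

text \<open>The Gegenbauer equation is written in the angle, with \<open>e = d - 2\<close> and \<open>\<lambda> = l (l + d - 1)\<close>.
  With \<open>c = cos\<close>, \<open>s = sin\<close> and \<open>V = s\<^sup>e\<^sup>+\<^sup>1 (F1\<^sup>2 + \<lambda> F\<^sup>2)\<close>, the corrected energy
  \<open>U = V + (e+1) s\<^sup>e c F F1\<close> has the derivative \<open>- (e+1) s\<^sup>e\<^sup>-\<^sup>1 F F1\<close>, which is of lower order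
  as soon as \<open>tan \<ge> (e+1) / sqrt \<lambda>\<close>.\<close>

locale gegenbauer_solution =
  fixes F F1 F2 :: "real \<Rightarrow> real" and lam :: real and e :: nat
  assumes lam: "lam > 0"
    and F: "\<And>t. (F has_real_derivative F1 t) (at t)"
    and F1: "\<And>t. (F1 has_real_derivative F2 t) (at t)"
    and ode: "\<And>t. sin t \<noteq> 0 \<Longrightarrow> sin t * F2 t + (real e + 1) * cos t * F1 t + lam * sin t * F t = 0"
    and F1_0: "F1 0 = 0" and F_le: "\<And>t. \<bar>F t\<bar> \<le> 1"
begin

definition "energy t = (F1 t)\<^sup>2 + lam * (F t)\<^sup>2"

lemma sin_cos_quadrant:
  assumes "0 < t" "t \<le> pi / 2" shows "sin t > 0" "cos t \<ge> 0"
  using assms by (auto intro!: sin_gt_zero cos_ge_zero)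

text \<open>By the equation the energy has derivative -2 (e+1) cot(t) F1^2, which is not positive on
  the quadrant, and at 0 it is at most lam.\<close>

lemma energy_le: assumes "0 \<le> t" "t \<le> pi / 2" shows "energy t \<le> lam"
proof -
  have "energy t \<le> energy 0"
  proof (rule DERIV_nonpos_imp_nonincreasing[OF assms(1)])
    fix x assume x: "0 \<le> x" "x \<le> t"
    have D: "(energy has_real_derivative 2 * F1 x * (F2 x + lam * F x)) (at x)"
      unfolding energy_def[abs_def]
      by (auto intro!: derivative_eq_intros F F1 simp: algebra_simps)
    have "2 * F1 x * (F2 x + lam * F x) \<le> 0"
    proof (cases "x = 0")
      case False
      with x assms have q: "0 < sin x" "0 \<le> cos x" using sin_cos_quadrant[of x] by auto
      have "sin x * (2 * F1 x * (F2 x + lam * F x)) = 2 * F1 x * (sin x * F2 x + (real e + 1) * cos x * F1 x + lam * sin x * F x)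
         - 2 * (real e + 1) * cos x * (F1 x)\<^sup>2"
        by (simp add: algebra_simps power2_eq_square)
      also have "\<dots> \<le> 0" using ode[of x] q by simp
      finally show ?thesis using q by (simp add: mult_le_0_iff)
    qed (simp add: F1_0)
    with D show "\<exists>y. (energy has_real_derivative y) (at x) \<and> y \<le> 0" by blast
  qed
  also have "\<dots> \<le> lam"
  proof -
    have "(F 0)\<^sup>2 \<le> 1" using F_le[of 0] by (simp add: abs_square_le_1)
    then show ?thesis using lam by (simp add: energy_def F1_0)
  qed
  finally show ?thesis .
qed

definition "V t = sin t ^ (e + 1) * energy t"
definition "U t = V t + (real e + 1) * (F t * F1 t * sin t ^ e * cos t)"

text \<open>The equation gives V' = (e+1) s^e c (lam F^2 - F1^2). The correction term contributes
  the opposite of this, and of the rest only a multiple of F F1 survives.\<close>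

lemma DERIV_U:
  assumes s: "sin t > 0"
  shows "(U has_real_derivative - (real e + 1) * (sin t ^ e / sin t) * (F t * F1 t)) (at t)"
proof -
  define S C f f1 f2 where "S = sin t" and "C = cos t" and "f = F t" and "f1 = F1 t" and "f2 = F2 t"
  have S0: "S > 0" using s by (simp add: S_def)
  have SC: "S\<^sup>2 + C\<^sup>2 = 1" by (simp add: S_def C_def)
  have ode': "S * f2 = - (real e + 1) * C * f1 - lam * S * f"
    using ode[of t] s by (simp add: S_def C_def f_def f1_def f2_def algebra_simps)
  \<comment> \<open>Truncated subtraction makes e - 1 equal to 0 when e = 0, but then the factor e
    vanishes; this is what allows s^(e-1) to be replaced by a quotient.\<close>
  have pw: "real e * S ^ (e - 1) = real e * (S ^ e / S)"
    using S0 by (cases e) auto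
  have dE: "(energy has_real_derivative (2 * f1 * f2 + lam * (2 * f * f1))) (at t)"
    unfolding energy_def[abs_def] f_def f1_def f2_def
    by (auto intro!: derivative_eq_intros F F1)
  have dS: "((\<lambda>t. sin t ^ (e + 1)) has_real_derivative (real e + 1) * S ^ e * C) (at t)"
    unfolding S_def C_def by (rule DERIV_cong[OF DERIV_power[OF DERIV_sin]]) simp
  have dSe: "((\<lambda>t. sin t ^ e) has_real_derivative real e * S ^ (e - 1) * C) (at t)"
    unfolding S_def C_def by (rule DERIV_cong[OF DERIV_power[OF DERIV_sin]]) simp
  have dV: "(V has_real_derivative (real e + 1) * S ^ e * C * (f1\<^sup>2 + lam * f\<^sup>2) + S ^ (e + 1) * (2 * f1 * f2 + lam * (2 * f * f1))) (at t)"
    unfolding V_def[abs_def] using DERIV_mult[OF dS dE]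
    by (rule DERIV_cong) (simp add: energy_def f_def f1_def S_def mult.commute)
  have dF: "((\<lambda>t. F t * F1 t) has_real_derivative f1 * f1 + f * f2) (at t)"
    using DERIV_mult[OF F F1] by (rule DERIV_cong) (simp add: f_def f1_def f2_def mult.commute)
  have dc: "((\<lambda>t. F t * F1 t * sin t ^ e * cos t) has_real_derivative
      (f1 * f1 + f * f2) * S ^ e * C + f * f1 * (real e * S ^ (e - 1) * C) * C - f * f1 * S ^ e * S) (at t)"
    using DERIV_mult[OF DERIV_mult[OF dF dSe] DERIV_cos]
    by (rule DERIV_cong) (simp add: f_def f1_def S_def C_def algebra_simps)
  have "(U has_real_derivative ((real e + 1) * S ^ e * C * (f1\<^sup>2 + lam * f\<^sup>2) + S ^ (e + 1) * (2 * f1 * f2 + lam * (2 * f * f1)))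
     + (real e + 1) * ((f1 * f1 + f * f2) * S ^ e * C + f * f1 * (real e * S ^ (e - 1) * C) * C - f * f1 * S ^ e * S)) (at t)"
    unfolding U_def[abs_def] by (intro DERIV_add dV DERIV_cmult dc)
  moreover have "((real e + 1) * S ^ e * C * (f1\<^sup>2 + lam * f\<^sup>2) + S ^ (e + 1) * (2 * f1 * f2 + lam * (2 * f * f1)))
     + (real e + 1) * ((f1 * f1 + f * f2) * S ^ e * C + f * f1 * (real e * S ^ (e - 1) * C) * C - f * f1 * S ^ e * S)
     = - (real e + 1) * (S ^ e / S) * (f * f1)"
  proof -
    define p where "p = S ^ e / S"
    have Se: "S ^ e = p * S" using S0 by (simp add: p_def)
    have Se1: "S ^ (e + 1) = p * S * S" using Se by simp
    have "S ^ (e + 1) * (2 * f1 * f2 + lam * (2 * f * f1)) = p * S * (2 * f1 * (S * f2) + lam * S * (2 * f * f1))"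
      unfolding Se1 by (simp add: algebra_simps)
    also have "\<dots> = - 2 * (real e + 1) * (p * S) * C * f1\<^sup>2"
      unfolding ode' by (simp add: algebra_simps power2_eq_square)
    finally have 1: "S ^ (e + 1) * (2 * f1 * f2 + lam * (2 * f * f1)) = - 2 * (real e + 1) * (p * S) * C * f1\<^sup>2" .
    have "f * f2 * S ^ e * C = p * C * f * (S * f2)" unfolding Se by (simp add: algebra_simps)
    also have "\<dots> = - (real e + 1) * p * C\<^sup>2 * f * f1 - lam * (p * S) * C * f\<^sup>2"
      unfolding ode' by (simp add: algebra_simps power2_eq_square)
    finally have 2: "f * f2 * S ^ e * C = - (real e + 1) * p * C\<^sup>2 * f * f1 - lam * (p * S) * C * f\<^sup>2" .
    have 3: "(f1 * f1 + f * f2) * S ^ e * C = f1\<^sup>2 * (p * S) * C + f * f2 * S ^ e * C"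
      unfolding Se by (simp add: algebra_simps power2_eq_square)
    have 4: "f * f1 * (real e * S ^ (e - 1) * C) * C = real e * p * C\<^sup>2 * f * f1"
      unfolding pw p_def by (simp add: power2_eq_square)
    have 5: "f * f1 * S ^ e * S = p * S\<^sup>2 * f * f1" unfolding Se by (simp add: power2_eq_square)
    have C2: "S\<^sup>2 = 1 - C\<^sup>2" using SC by simp
    show ?thesis unfolding p_def[symmetric] unfolding 1 3 2 4 5 C2 unfolding Se
      by (simp add: algebra_simps)
  qed
  ultimately show ?thesis by (simp add: S_def f_def f1_def)
qed

definition "kap = (real e + 1) / sqrt lam"

lemma kap_pos: "kap > 0" using lam by (simp add: kap_def)

lemma energy_nonneg: "energy t \<ge> 0" using lam by (simp add: energy_def)

lemma cross_le: "\<bar>F t * F1 t\<bar> \<le> energy t / (2 * sqrt lam)"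
proof -
  have "2 * (sqrt lam * \<bar>F t\<bar>) * \<bar>F1 t\<bar> \<le> (sqrt lam * \<bar>F t\<bar>)\<^sup>2 + \<bar>F1 t\<bar>\<^sup>2" by (rule sum_squares_bound)
  also have "\<dots> = energy t" using lam by (simp add: energy_def power_mult_distrib)
  finally show ?thesis using lam by (simp add: abs_mult field_simps)
qed

text \<open>The last premise says tan t >= \<open>kap\<close>. It keeps the correction below half of
  V, so U and V are comparable, and it bounds the logarithmic derivative of U by \<open>kap\<close>
  / sin^2, the derivative of - \<open>kap\<close> cot.\<close>

lemma U_V:
  assumes "0 < t" "t \<le> pi / 2" "kap * cos t \<le> sin t"
  shows "V t / 2 \<le> U t" "U t \<le> 3 / 2 * V t"
    "\<bar>(real e + 1) * (sin t ^ e / sin t) * (F t * F1 t)\<bar> \<le> kap / (sin t)\<^sup>2 * U t"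
proof -
  have q: "sin t > 0" "cos t \<ge> 0" using sin_cos_quadrant[OF assms(1,2)] by auto
  have V0: "V t \<ge> 0" using q energy_nonneg[of t] by (simp add: V_def)
  have eq: "(real e + 1) * (energy t / (2 * sqrt lam)) * sin t ^ e = kap / 2 * (V t / sin t)"
    using q by (simp add: V_def kap_def mult_ac)
  have "\<bar>U t - V t\<bar> = (real e + 1) * \<bar>F t * F1 t\<bar> * sin t ^ e * cos t"
    using q by (simp add: U_def abs_mult)
  also have "\<dots> \<le> (real e + 1) * (energy t / (2 * sqrt lam)) * sin t ^ e * cos t"
    using q cross_le[of t] by (intro mult_right_mono mult_left_mono) auto
  also have "\<dots> = (kap * cos t / sin t) * (V t / 2)" unfolding eq by (simp add: mult_ac)
  also have "\<dots> \<le> 1 * (V t / 2)"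
    using assms(3) q V0 by (intro mult_right_mono) (auto simp: pos_divide_le_eq)
  finally have *: "\<bar>U t - V t\<bar> \<le> V t / 2" by simp
  then show UV: "V t / 2 \<le> U t" "U t \<le> 3 / 2 * V t" by linarith+
  have "\<bar>(real e + 1) * (sin t ^ e / sin t) * (F t * F1 t)\<bar> = (real e + 1) * \<bar>F t * F1 t\<bar> * sin t ^ e / sin t"
    using q by (simp add: abs_mult)
  also have "\<dots> \<le> (real e + 1) * (energy t / (2 * sqrt lam)) * sin t ^ e / sin t"
    using q cross_le[of t] by (intro divide_right_mono mult_right_mono mult_left_mono) auto
  also have "\<dots> = kap / (sin t)\<^sup>2 * (V t / 2)" unfolding eq using q by (simp add: power2_eq_square mult_ac)
  also have "\<dots> \<le> kap / (sin t)\<^sup>2 * U t" using UV(1) kap_pos by (intro mult_left_mono) auto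
  finally show "\<bar>(real e + 1) * (sin t ^ e / sin t) * (F t * F1 t)\<bar> \<le> kap / (sin t)\<^sup>2 * U t" .
qed

text \<open>Where sin t is at most \<open>kap\<close> the bound |F| <= 1 suffices. Beyond that,
  Gronwall's argument with integrating factor exp(kap cot) shows that U grows by at most exp 1 from
  the angle r on; the factor 3 is 2 times 3/2 from comparing U with V at both ends.\<close>

theorem decay:
  assumes t: "0 < t" "t \<le> pi / 2"
  shows "sin t ^ (e + 1) * (F t)\<^sup>2 \<le> 3 * exp 1 * kap ^ (e + 1)"
proof -
  have q: "sin t > 0" "cos t \<ge> 0" using sin_cos_quadrant[OF t] by auto
  have e3: "1 \<le> 3 * exp (1::real)" using exp_ge_add_one_self[of "1::real"] by simp
  show ?thesis
  proof (cases "sin t \<le> kap")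
    case True
    have "(F t)\<^sup>2 \<le> 1" using F_le[of t] by (simp add: abs_square_le_1)
    then have "sin t ^ (e + 1) * (F t)\<^sup>2 \<le> kap ^ (e + 1) * 1"
      using True q by (intro mult_mono power_mono) auto
    also have "\<dots> \<le> 3 * exp 1 * kap ^ (e + 1)"
      using e3 kap_pos mult_right_mono[of 1 "3 * exp 1" "kap ^ (e + 1)"] by simp
    finally show ?thesis .
  next
    case False
    \<comment> \<open>At this angle \<open>kap\<close> cot r = 1 and sin r is at most
      \<open>kap\<close>, so V r is at most kap^(e+1) lam by \<open>energy_le\<close>.\<close>
    define r where "r = arctan kap"
    have r: "0 < r" "r < pi / 2" using kap_pos arctan_bounded[of kap] by (auto simp: r_def)
    have qr: "sin r > 0" "cos r > 0" using r by (auto intro!: sin_gt_zero cos_gt_zero)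
    have tanr: "tan r = kap" by (simp add: r_def tan_arctan)
    then have sr: "sin r = kap * cos r" using qr by (simp add: tan_def field_simps)
    have kge: "kap * cos x \<le> sin x" if "r \<le> x" "x \<le> pi / 2" for x
    proof -
      have "cos x \<le> cos r" using that r by (intro cos_monotone_0_pi_le) auto
      moreover have "sin r \<le> sin x" using that r by (intro sin_monotone_2pi_le) auto
      moreover have "kap * cos x \<le> kap * cos r"
        using calculation(1) kap_pos by (intro mult_left_mono) auto
      ultimately show ?thesis using sr by linarith
    qed
    have rt: "r \<le> t"
    proof (rule ccontr)
      assume "\<not> r \<le> t"
      then have "sin t \<le> sin r" using t r by (intro sin_monotone_2pi_le) auto
      also have "\<dots> \<le> kap" using sr kap_pos cos_le_one[of r] by (simp add: mult_left_le)
      finally show False using False by simp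
    qed
    let ?P = "\<lambda>x. U x * exp (kap * (cos x / sin x))"
    have "?P t \<le> ?P r"
    proof (rule DERIV_nonpos_imp_nonincreasing[OF rt])
      fix x assume x: "r \<le> x" "x \<le> t"
      have x': "0 < x" "x \<le> pi / 2" using x r t by auto
      have qx: "sin x > 0" using sin_cos_quadrant[OF x'] by simp
      let ?u = "- (real e + 1) * (sin x ^ e / sin x) * (F x * F1 x)"
      have "((\<lambda>x. cos x / sin x) has_real_derivative - 1 / (sin x)\<^sup>2) (at x)"
      proof (rule DERIV_cong[OF DERIV_divide[OF DERIV_cos DERIV_sin]])
        have "- sin x * sin x - cos x * cos x = - (1::real)"
          using sin_cos_squared_add[of x] unfolding power2_eq_square by linarith
        then show "(- sin x * sin x - cos x * cos x) / (sin x * sin x) = - 1 / (sin x)\<^sup>2"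
          by (simp only: power2_eq_square)
      qed (use qx in simp)
      then have "((\<lambda>x. exp (kap * (cos x / sin x))) has_real_derivative exp (kap * (cos x / sin x)) * (kap * (- 1 / (sin x)\<^sup>2))) (at x)"
        by (intro DERIV_chain2[OF DERIV_exp] DERIV_cmult)
      from DERIV_mult[OF DERIV_U[OF qx] this]
      have D: "(?P has_real_derivative (?u - kap / (sin x)\<^sup>2 * U x) * exp (kap * (cos x / sin x))) (at x)"
        by (rule DERIV_cong) (simp add: algebra_simps)
      have "?u \<le> kap / (sin x)\<^sup>2 * U x"
      proof -
        have "?u \<le> \<bar>(real e + 1) * (sin x ^ e / sin x) * (F x * F1 x)\<bar>"
          unfolding minus_mult_left[symmetric] by (rule abs_ge_minus_self)
        also have "\<dots> \<le> kap / (sin x)\<^sup>2 * U x" by (rule U_V(3)[OF x' kge[OF x(1) x'(2)]])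
        finally show ?thesis .
      qed
      then have "(?u - kap / (sin x)\<^sup>2 * U x) * exp (kap * (cos x / sin x)) \<le> 0"
        by (intro mult_nonpos_nonneg) auto
      with D show "\<exists>y. (?P has_real_derivative y) (at x) \<and> y \<le> 0" by blast
    qed
    have kt: "kap * cos t \<le> sin t" using kge[OF rt t(2)] .
    have Vt: "V t / 2 \<le> U t" by (rule U_V(1)[OF t kt])
    have V0: "V t \<ge> 0" using q energy_nonneg[of t] by (simp add: V_def)
    have "U t * 1 \<le> ?P t"
      using Vt V0 q kap_pos by (intro mult_left_mono) auto
    also have "?P t \<le> ?P r" by fact
    also have "kap * (cos r / sin r) = 1" using sr qr kap_pos by simp
    also have "U r * exp 1 \<le> (3 / 2 * V r) * exp 1"
      using U_V(2)[of r] r sr by (intro mult_right_mono) auto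
    also have "V r \<le> kap ^ (e + 1) * lam"
      unfolding V_def using sr kap_pos cos_le_one[of r] qr energy_nonneg[of r] energy_le[of r] r
      by (intro mult_mono power_mono) (auto simp: mult_left_le)
    finally have "U t \<le> (3 / 2 * (kap ^ (e + 1) * lam)) * exp 1" by simp
    with Vt have "V t \<le> 3 * exp 1 * kap ^ (e + 1) * lam" by (simp add: mult_ac)
    moreover have "sin t ^ (e + 1) * (lam * (F t)\<^sup>2) \<le> V t"
      unfolding V_def energy_def using q by (intro mult_left_mono) auto
    ultimately have "lam * (sin t ^ (e + 1) * (F t)\<^sup>2) \<le> lam * (3 * exp 1 * kap ^ (e + 1))"
      by (simp add: mult_ac)
    then show ?thesis using lam by simp
  qed
qed

end

section \<open>The differential equation of zonal harmonics\<close>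

lemma DERIV_along_curve:
  fixes f :: "'a::real_normed_vector \<Rightarrow> real"
  assumes c: "(c has_derivative (\<lambda>h. h *\<^sub>R c')) (at t)" and f: "(f has_derivative g) (at (c t))"
  shows "((\<lambda>t. f (c t)) has_real_derivative g c') (at t)"
proof -
  have "((\<lambda>t. f (c t)) has_derivative (\<lambda>h. g (h *\<^sub>R c'))) (at t)"
    by (rule has_derivative_compose[OF c f])
  moreover have "(\<lambda>h. g (h *\<^sub>R c')) = (*) (g c')"
    using linear_cmul[OF has_derivative_linear[OF f]] by (auto simp: mult.commute)
  ultimately show ?thesis by (simp add: has_field_derivative_def)
qed

text \<open>A great circle satisfies x'' = -x; this is the origin of the gradient term in the second
  derivative.\<close>

lemma zonal_derivatives:
  fixes p :: "'a::euclidean_space \<Rightarrow> real" and b1 b2 :: 'a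
  assumes gB: "second_derivative p g B"
  defines "x \<equiv> \<lambda>t. cos t *\<^sub>R b1 + sin t *\<^sub>R b2"
    and "x' \<equiv> \<lambda>t. (- sin t) *\<^sub>R b1 + cos t *\<^sub>R b2"
  shows "((\<lambda>t. p (x t)) has_real_derivative g (x t) (x' t)) (at t)"
    and "((\<lambda>t. g (x t) (x' t)) has_real_derivative B (x t) (x' t) (x' t) - g (x t) (x t)) (at t)"
proof -
  have 1: "\<And>x. (p has_derivative g x) (at x)" "\<And>x v. ((\<lambda>x. g x v) has_derivative B x v) (at x)"
    using gB by (auto simp: second_derivative_def)
  note lin = second_derivative_linear[OF gB]
  have dx: "(x has_derivative (\<lambda>h. h *\<^sub>R x' t)) (at t)" for t
    unfolding x_def x'_def by (auto intro!: derivative_eq_intros simp: algebra_simps)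
  show "((\<lambda>t. p (x t)) has_real_derivative g (x t) (x' t)) (at t)"
    by (rule DERIV_along_curve[OF dx 1(1)])
  have gv: "((\<lambda>t. g (x t) v) has_real_derivative B (x t) v (x' t)) (at t)" for v t
    by (rule DERIV_along_curve[OF dx 1(2)])
  have split: "g (x t) (x' t) = - sin t * g (x t) b1 + cos t * g (x t) b2" for t
    unfolding x'_def by (simp only: linear_add[OF lin(1)] linear_cmul[OF lin(1)] real_scaleR_def)
  have "((\<lambda>t. - sin t * g (x t) b1 + cos t * g (x t) b2) has_real_derivative
     ((- cos t) * g (x t) b1 + B (x t) b1 (x' t) * (- sin t)) + ((- sin t) * g (x t) b2 + B (x t) b2 (x' t) * cos t)) (at t)"
    by (intro DERIV_add DERIV_mult gv) (auto intro!: derivative_eq_intros)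
  moreover have "((- cos t) * g (x t) b1 + B (x t) b1 (x' t) * (- sin t)) + ((- sin t) * g (x t) b2 + B (x t) b2 (x' t) * cos t)
     = B (x t) (x' t) (x' t) - g (x t) (x t)"
  proof -
    have "B (x t) (x' t) w = - sin t * B (x t) b1 w + cos t * B (x t) b2 w" for w
      unfolding x'_def by (simp only: linear_add[OF lin(3)] linear_cmul[OF lin(3)] real_scaleR_def)
    moreover have "g (x t) (cos t *\<^sub>R b1 + sin t *\<^sub>R b2) = cos t * g (x t) b1 + sin t * g (x t) b2"
      by (simp only: linear_add[OF lin(1)] linear_cmul[OF lin(1)] real_scaleR_def)
    ultimately show ?thesis by (simp add: x_def algebra_simps)
  qed
  ultimately show "((\<lambda>t. g (x t) (x' t)) has_real_derivative B (x t) (x' t) (x' t) - g (x t) (x t)) (at t)"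
    unfolding split by simp
qed

lemma homogeneous_derivatives:
  fixes p :: "'a::euclidean_space \<Rightarrow> real"
  assumes gB: "second_derivative p g B" and hom: "\<And>t x. p (t *\<^sub>R x) = t ^ l * p x"
  shows "g x x = real l * p x" "B x x x = real l * (real l - 1) * p x"
proof -
  have 1: "\<And>x. (p has_derivative g x) (at x)" "\<And>x v. ((\<lambda>x. g x v) has_derivative B x v) (at x)"
    using gB by (auto simp: second_derivative_def)
  note lin = second_derivative_linear[OF gB]
  have line: "((\<lambda>t. t *\<^sub>R x) has_derivative (\<lambda>s. s *\<^sub>R x)) (at t)" for t :: real
    by (auto intro!: derivative_eq_intros)
  have "((\<lambda>t. p (t *\<^sub>R x)) has_real_derivative g (t *\<^sub>R x) x) (at t)" for t :: real
    by (rule DERIV_along_curve[OF line 1(1)])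
  moreover have "((\<lambda>t. t ^ l * p x) has_real_derivative real l * t ^ (l - 1) * p x) (at t)" for t
    by (auto intro!: derivative_eq_intros)
  ultimately have g: "g (t *\<^sub>R x) x = real l * t ^ (l - 1) * p x" for t
    unfolding hom by (rule DERIV_unique)
  from g[of 1] show "g x x = real l * p x" by simp
  have "((\<lambda>t. g (t *\<^sub>R x) x) has_real_derivative B (1 *\<^sub>R x) x x) (at 1)"
    by (rule DERIV_along_curve[OF line[of 1] 1(2)])
  moreover have "((\<lambda>t. real l * t ^ (l - 1) * p x) has_real_derivative real l * (real (l - 1) * 1 ^ (l - 1 - 1)) * p x) (at 1)"
    by (auto intro!: derivative_eq_intros)
  ultimately have "B x x x = real l * real (l - 1) * p x"
    unfolding g using DERIV_unique by fastforce
  then show "B x x x = real l * (real l - 1) * p x"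
    by (cases l) auto
qed

text \<open>The Gegenbauer equation in the angle, read off from Laplace's equation. In the plane of
  the great circle the trace of the Hessian splits into a radial part, known by Euler's relations,
  and a tangential part; each of the e + 1 orthogonal directions contributes a first-order term by
  rotational symmetry.\<close>

lemma zonal_ode:
  fixes p :: "'a::euclidean_space \<Rightarrow> real" and b1 b2 :: 'a
  assumes gB: "second_derivative p g B" and hom: "\<And>t x. p (t *\<^sub>R x) = t ^ l * p x"
    and harm: "\<And>x. laplacian p x = 0"
    and b: "b1 \<in> Basis" "b2 \<in> Basis" "b1 \<noteq> b2" and dim: "DIM('a) = e + 3"
    and inv: "\<And>t a b. b \<in> Basis - {b1, b2} \<Longrightarrow>
      p (cos t *\<^sub>R b1 + sin t *\<^sub>R (cos a *\<^sub>R b2 + sin a *\<^sub>R b)) = p (cos t *\<^sub>R b1 + sin t *\<^sub>R b2)"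
    and s: "sin t \<noteq> 0"
  defines "x \<equiv> cos t *\<^sub>R b1 + sin t *\<^sub>R b2" and "x' \<equiv> (- sin t) *\<^sub>R b1 + cos t *\<^sub>R b2"
  shows "sin t * (B x x' x' - g x x) + (real e + 1) * cos t * g x x' + real l * (real l + real e + 1) * sin t * p x = 0"
proof -
  have 1: "\<And>x. (p has_derivative g x) (at x)" "\<And>x v. ((\<lambda>x. g x v) has_derivative B x v) (at x)"
    using gB by (auto simp: second_derivative_def)
  note lin = second_derivative_linear[OF gB]
  \<comment> \<open>Rotating the point towards c does not change p. The first derivative in the
    rotation angle a vanishes for all a, and differentiating it once more at a = 0 ties the Hessian
    in direction c to the gradient in direction b2.\<close>
  have other: "sin t * B x c c = g x b2" if c: "c \<in> Basis - {b1, b2}" for c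
  proof -
    let ?y = "\<lambda>a. cos t *\<^sub>R b1 + sin t *\<^sub>R (cos a *\<^sub>R b2 + sin a *\<^sub>R c)"
    let ?y' = "\<lambda>a. sin t *\<^sub>R ((- sin a) *\<^sub>R b2 + cos a *\<^sub>R c)"
    have dy: "(?y has_derivative (\<lambda>h. h *\<^sub>R ?y' a)) (at a)" for a
      by (auto intro!: derivative_eq_intros simp: algebra_simps)
    have "((\<lambda>a. p (?y a)) has_real_derivative g (?y a) (?y' a)) (at a)" for a
      by (rule DERIV_along_curve[OF dy 1(1)])
    moreover have "((\<lambda>a. p (?y a)) has_real_derivative 0) (at a)" for a
      unfolding inv[OF c] by simp
    ultimately have "g (?y a) (?y' a) = 0" for a by (rule DERIV_unique)
    then have z: "- sin a * g (?y a) b2 + cos a * g (?y a) c = 0" for a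
      using s by (simp only: linear_add[OF lin(1)] linear_cmul[OF lin(1)] real_scaleR_def mult_eq_0_iff) blast
    have gv: "((\<lambda>a. g (?y a) v) has_real_derivative B (?y a) v (?y' a)) (at a)" for v a
      by (rule DERIV_along_curve[OF dy 1(2)])
    have "((\<lambda>a. - sin a * g (?y a) b2 + cos a * g (?y a) c) has_real_derivative
       ((- cos 0) * g (?y 0) b2 + B (?y 0) b2 (?y' 0) * (- sin 0)) + ((- sin 0) * g (?y 0) c + B (?y 0) c (?y' 0) * cos 0)) (at 0)"
      by (intro DERIV_add DERIV_mult gv) (auto intro!: derivative_eq_intros)
    then have "((- cos 0) * g (?y 0) b2 + B (?y 0) b2 (?y' 0) * (- sin 0)) + ((- sin 0) * g (?y 0) c + B (?y 0) c (?y' 0) * cos 0) = 0"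
      unfolding z by (rule DERIV_unique) simp
    then have "B x c (sin t *\<^sub>R c) = g x b2" by (simp add: x_def)
    then show ?thesis by (simp add: linear_cmul[OF lin(2)])
  qed
  have "(\<Sum>b\<in>Basis. B x b b) = 0" using harm laplacian_eq_trace[OF gB] by metis
  then have "sin t * B x b1 b1 + sin t * B x b2 b2 + (\<Sum>b\<in>Basis - {b1, b2}. sin t * B x b b) = 0"
  proof -
    have "(\<Sum>b\<in>Basis. B x b b) = (\<Sum>b\<in>{b1, b2}. B x b b) + (\<Sum>b\<in>Basis - {b1, b2}. B x b b)"
      by (subst sum.subset_diff[of "{b1, b2}"]) (use b in auto)
    also have "(\<Sum>b\<in>{b1, b2}. B x b b) = B x b1 b1 + B x b2 b2" using b by simp
    finally have "0 = sin t * (B x b1 b1 + B x b2 b2 + (\<Sum>b\<in>Basis - {b1, b2}. B x b b))"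
      using \<open>(\<Sum>b\<in>Basis. B x b b) = 0\<close> by simp
    then show ?thesis by (simp add: distrib_left sum_distrib_left)
  qed
  also have "(\<Sum>b\<in>Basis - {b1, b2}. sin t * B x b b) = (\<Sum>b\<in>Basis - {b1, b2}. g x b2)"
    by (rule sum.cong[OF refl other])
  also have "\<dots> = (real e + 1) * g x b2"
  proof -
    have "card (Basis - {b1, b2}) = e + 1" using b dim by (subst card_Diff_subset) auto
    then show ?thesis by simp
  qed
  finally have trace: "sin t * (B x b1 b1 + B x b2 b2) + (real e + 1) * g x b2 = 0"
    by (simp add: distrib_left)
  \<comment> \<open>The pair x, x' is another orthonormal basis of the plane of b1 and b2, and the
    trace over that plane does not depend on the basis.\<close>
  have rot: "B x b1 b1 + B x b2 b2 = B x x x + B x x' x'"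
  proof -
    have "B x (u *\<^sub>R b1 + v *\<^sub>R b2) (u *\<^sub>R b1 + v *\<^sub>R b2) =
      u * u * B x b1 b1 + u * v * (B x b1 b2 + B x b2 b1) + v * v * B x b2 b2" for u v
      by (simp add: linear_add[OF lin(2)] linear_cmul[OF lin(2)] linear_add[OF lin(3)] linear_cmul[OF lin(3)] algebra_simps)
    from this[of "cos t" "sin t"] this[of "- sin t" "cos t"]
    have "B x x x + B x x' x' = (cos t * cos t + sin t * sin t) * (B x b1 b1 + B x b2 b2)"
      unfolding x_def[symmetric] x'_def[symmetric] by algebra
    then show ?thesis using sin_cos_squared_add2[of t] by (simp add: power2_eq_square)
  qed
  have gb2: "g x b2 = sin t * g x x + cos t * g x x'"
  proof -
    have "sin t * g x x + cos t * g x x' = (sin t * sin t + cos t * cos t) * g x b2"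
      unfolding x_def x'_def
      by (simp only: linear_add[OF lin(1)] linear_cmul[OF lin(1)] real_scaleR_def) algebra
    then show ?thesis using sin_cos_squared_add[of t] by (simp add: power2_eq_square)
  qed
  have E: "g x x = real l * p x" "B x x x = real l * (real l - 1) * p x"
    using homogeneous_derivatives[OF gB hom] by auto
  show ?thesis using trace unfolding rot gb2 E by (simp add: algebra_simps)
qed

section \<open>The covariance kernel\<close>

locale harmonic_basis =
  fixes d l :: nat and Y :: "nat \<Rightarrow> 'a::euclidean_space \<Rightarrow> real"
  assumes d: "d \<ge> 2" and dim: "DIM('a) = d + 1" and l: "l \<ge> 1"
    and basis: "orthonormal_harmonic_basis d l Y"
begin

abbreviation \<sigma> :: "'a measure" where "\<sigma> \<equiv> surface_measure"
abbreviation n :: nat where "n \<equiv> harmonic_dim d l"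
abbreviation \<mu> :: real where "\<mu> \<equiv> sphere_mass d"

sublocale finite_measure \<sigma> by (rule finite_measure_surface_measure)

definition K :: "'a \<Rightarrow> 'a \<Rightarrow> real" where "K x y = (\<Sum>m=1..n. Y m x * Y m y)"

lemma mass_pos: "\<mu> > 0"
  unfolding sphere_mass_def by (intro divide_pos_pos mult_pos_pos Gamma_real_pos) auto

lemma measure_sphere: "measure \<sigma> (sphere 0 1) = \<mu>"
  using emeasure_surface_measure_sphere[OF dim] mass_pos by (simp add: measure_def)

section \<open>Size of the dimension of the space of harmonics\<close>

lemma n_real: "real n = (2 * real l + real d - 1) / real l * real ((l + d - 2) choose (d - 1))"
proof -
  have "(l + d - 2) choose (l - 1) = (l + d - 2) choose (d - 1)"
    using binomial_symmetric[of "l - 1" "l + d - 2"] d l by (simp add: algebra_simps Suc_diff_le)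
  then show ?thesis using real_harmonic_dim[OF d l] by simp
qed

text \<open>Linear growth is enough to turn n^(-1/2) into l^(-1/2). It comes from the bound (N/k)^k
  for binomial coefficients with N/k at least 1.\<close>

lemma n_lower: "real l \<le> real (d - 1) * real n"
proof -
  let ?N = "l + d - 2"
  have k: "d - 1 \<le> ?N" "d - 1 > 0" using d l by auto
  have 1: "1 \<le> real ?N / real (d - 1)" using k by simp
  have "real ?N / real (d - 1) \<le> (real ?N / real (d - 1)) ^ (d - 1)"
    using power_increasing[OF _ 1, of 1 "d - 1"] k by simp
  also have "\<dots> \<le> real (?N choose (d - 1))" by (rule binomial_ge_n_over_k_pow_k[OF k(1)])
  also have "\<dots> \<le> (2 * real l + real d - 1) / real l * real (?N choose (d - 1))"
  proof -
    have "1 \<le> (2 * real l + real d - 1) / real l" using d l by (simp add: field_simps)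
    from mult_right_mono[OF this of_nat_0_le_iff[of "?N choose (d - 1)"]] show ?thesis by (simp only: mult_1_left)
  qed
  finally have "real ?N / real (d - 1) \<le> real n" unfolding n_real .
  then have "real ?N \<le> real (d - 1) * real n" using k(2) by (simp add: field_simps)
  moreover have "real l \<le> real ?N" using d by simp
  ultimately show ?thesis by linarith
qed

lemma n_pos: "n > 0"
  using n_lower l by (cases "n = 0") auto

lemma n_upper: "real n \<le> real ((d + 1) * d ^ (d - 1)) * real l ^ (d - 1)"
proof -
  let ?N = "l + d - 2"
  have "(2 * real l + real d - 1) / real l \<le> real (d + 1)"
  proof -
    have "real d - 1 \<le> (real d - 1) * real l" using d l mult_left_mono[of 1 "real l" "real d - 1"] by simp
    then show ?thesis using l by (simp add: field_simps)
  qed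
  moreover have "?N choose (d - 1) \<le> (d * l) ^ (d - 1)"
  proof -
    have "?N choose (d - 1) \<le> ?N ^ (d - 1)" using d l by (intro binomial_le_pow) auto
    also have "\<dots> \<le> (d * l) ^ (d - 1)"
    proof (rule power_mono)
      obtain k where k: "l = Suc k" using l by (cases l) auto
      obtain e where e: "d = Suc (Suc e)" using d by (metis add_2_eq_Suc le_Suc_ex)
      show "?N \<le> d * l" by (simp add: k e)
    qed simp
    finally show ?thesis .
  qed
  then have "real (?N choose (d - 1)) \<le> real ((d * l) ^ (d - 1))" by (rule of_nat_mono)
  ultimately have "real n \<le> real (d + 1) * real ((d * l) ^ (d - 1))"
    unfolding n_real by (intro mult_mono) auto
  also have "\<dots> = real ((d + 1) * d ^ (d - 1)) * real l ^ (d - 1)"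
    by (simp add: power_mult_distrib algebra_simps)
  finally show ?thesis .
qed

section \<open>The reproducing kernel and its invariance under reflections\<close>

lemma Y_harmonic: "m \<in> {1..n} \<Longrightarrow> spherical_harmonic l (Y m)"
  using basis unfolding orthonormal_harmonic_basis_def by blast

lemma Y_orthonormal: "m \<in> {1..n} \<Longrightarrow> m' \<in> {1..n} \<Longrightarrow> (\<integral>x. Y m x * Y m' x \<partial>\<sigma>) = (if m = m' then 1 else 0)"
  using basis unfolding orthonormal_harmonic_basis_def by blast

lemma harmonic_square_integrable:
  assumes "spherical_harmonic l f" shows "square_integrable \<sigma> f"
proof -
  obtain B where "\<forall>x\<in>sphere 0 1. \<bar>f x\<bar> \<le> B" using spherical_harmonic_bounded[OF assms] by blast
  then show ?thesis
    by (intro square_integrable_bounded[OF finite_measure_axioms spherical_harmonic_measurable[OF assms], of B]) simp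
qed

lemma harmonic_mult_integrable:
  "spherical_harmonic l f \<Longrightarrow> spherical_harmonic l g \<Longrightarrow> integrable \<sigma> (\<lambda>x. f x * g x)"
  by (rule square_integrable_mult[OF harmonic_square_integrable harmonic_square_integrable])

lemma K_harmonic: "spherical_harmonic l (K x)"
  unfolding K_def[abs_def] by (intro spherical_harmonic_sum spherical_harmonic_cmult Y_harmonic)

lemma K_sym: "K x y = K y x"
  by (simp add: K_def mult.commute)

lemma reproducing:
  assumes f: "spherical_harmonic l f" and x: "x \<in> sphere 0 1"
  shows "(\<integral>y. K x y * f y \<partial>\<sigma>) = f x"
proof -
  obtain c where c: "\<And>x. x \<in> sphere 0 1 \<Longrightarrow> f x = (\<Sum>m=1..n. c m * Y m x)"
    using basis f unfolding orthonormal_harmonic_basis_def by blast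
  have coeff: "(\<integral>y. Y m y * f y \<partial>\<sigma>) = c m" if m: "m \<in> {1..n}" for m
  proof -
    have "(\<integral>y. Y m y * f y \<partial>\<sigma>) = (\<integral>y. (\<Sum>k=1..n. c k * (Y m y * Y k y)) \<partial>\<sigma>)"
      by (rule Bochner_Integration.integral_cong[OF refl]) (simp add: c sum_distrib_left mult_ac)
    also have "\<dots> = (\<Sum>k=1..n. c k * (\<integral>y. Y m y * Y k y \<partial>\<sigma>))"
      using m by (subst Bochner_Integration.integral_sum) (auto intro!: harmonic_mult_integrable Y_harmonic)
    also have "\<dots> = (\<Sum>k=1..n. if k = m then c m else 0)"
      by (rule sum.cong[OF refl]) (use m in \<open>simp add: Y_orthonormal\<close>)
    also have "\<dots> = c m" using m by simp
    finally show ?thesis .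
  qed
  have "(\<integral>y. K x y * f y \<partial>\<sigma>) = (\<integral>y. (\<Sum>m=1..n. Y m x * (Y m y * f y)) \<partial>\<sigma>)"
    by (simp only: K_def sum_distrib_right mult.assoc)
  also have "\<dots> = (\<Sum>m=1..n. Y m x * (\<integral>y. Y m y * f y \<partial>\<sigma>))"
    using f by (subst Bochner_Integration.integral_sum) (auto intro!: harmonic_mult_integrable Y_harmonic)
  also have "\<dots> = (\<Sum>m=1..n. c m * Y m x)"
    by (rule sum.cong[OF refl], subst coeff) (auto simp: mult.commute)
  also have "\<dots> = f x" using c[OF x] by simp
  finally show ?thesis .
qed

lemma reflect_sphere: "x \<in> sphere 0 1 \<Longrightarrow> reflect v x \<in> sphere 0 1"
  by simp

text \<open>A reproducing kernel is determined by its function space and the measure, and both are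
  invariant under reflections. Concretely, one integral is evaluated by reproduction once at z and
  once at the reflected x.\<close>

lemma K_reflect:
  assumes x: "x \<in> sphere 0 1" and z: "z \<in> sphere 0 1"
  shows "K (reflect v x) (reflect v z) = K x z"
proof -
  let ?h = "\<lambda>y. K (reflect v x) (reflect v y)"
  have h: "spherical_harmonic l ?h" by (rule spherical_harmonic_reflect[OF K_harmonic])
  have hz: "spherical_harmonic l (\<lambda>y. K z (reflect v y))" by (rule spherical_harmonic_reflect[OF K_harmonic])
  have "?h z = (\<integral>y. K z y * ?h y \<partial>\<sigma>)" by (rule reproducing[OF h z, symmetric])
  also have "\<dots> = (\<integral>y. K z (reflect v y) * ?h (reflect v y) \<partial>\<sigma>)"
    by (rule integral_surface_measure_reflect[symmetric])
       (rule borel_measurable_integrable[OF harmonic_mult_integrable[OF K_harmonic h]])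
  also have "\<dots> = (\<integral>y. K (reflect v x) y * K z (reflect v y) \<partial>\<sigma>)"
    by (simp add: mult.commute)
  also have "\<dots> = K z (reflect v (reflect v x))"
    by (rule reproducing[OF hz reflect_sphere[OF x]])
  finally show ?thesis by (simp add: K_sym)
qed

text \<open>The addition formula on the diagonal: by invariance the value is constant, and its
  integral counts the basis.\<close>

lemma K_diag: assumes x: "x \<in> sphere 0 1" shows "K x x = real n / \<mu>"
proof -
  have const: "K y y = K x x" if y: "y \<in> sphere 0 1" for y
    using K_reflect[OF x x, of "x - y"] reflect_swap[of x y] x y by simp
  have "real n = (\<Sum>m=1..n. \<integral>y. Y m y * Y m y \<partial>\<sigma>)"
  proof -
    have "(\<Sum>m=1..n. \<integral>y. Y m y * Y m y \<partial>\<sigma>) = (\<Sum>m=1..n. 1)"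
      by (rule sum.cong[OF refl], subst Y_orthonormal) auto
    then show ?thesis by simp
  qed
  also have "\<dots> = (\<integral>y. K y y \<partial>\<sigma>)"
    unfolding K_def by (rule Bochner_Integration.integral_sum[symmetric]) (intro harmonic_mult_integrable Y_harmonic)
  also have "\<dots> = (\<integral>y. K x x \<partial>\<sigma>)"
    by (rule Bochner_Integration.integral_cong[OF refl]) (use const in simp)
  also have "\<dots> = K x x * \<mu>" using measure_sphere by simp
  finally show ?thesis using mass_pos by (simp add: field_simps)
qed

lemma K_bound:
  assumes "x \<in> sphere 0 1" "y \<in> sphere 0 1" shows "\<bar>K x y\<bar> \<le> real n / \<mu>"
proof -
  have "(K x y)\<^sup>2 \<le> (\<Sum>m=1..n. (Y m x)\<^sup>2) * (\<Sum>m=1..n. (Y m y)\<^sup>2)"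
    unfolding K_def by (rule Cauchy_Schwarz_ineq_sum)
  also have "\<dots> = (real n / \<mu>)\<^sup>2"
    using K_diag[OF assms(1)] K_diag[OF assms(2)] by (simp add: K_def power2_eq_square)
  finally show ?thesis using mass_pos by (simp add: abs_le_square_iff[symmetric])
qed

text \<open>Scaled to 1 on the diagonal; as a function of the angle this is the normalized
  Gegenbauer polynomial of degree l.\<close>

definition G :: "'a \<Rightarrow> 'a \<Rightarrow> real" where "G x y = \<mu> / real n * K x y"

lemma G_bound: "x \<in> sphere 0 1 \<Longrightarrow> y \<in> sphere 0 1 \<Longrightarrow> \<bar>G x y\<bar> \<le> 1"
  using K_bound[of x y] mass_pos n_pos by (simp add: G_def abs_mult field_simps)

lemma G_reflect: "x \<in> sphere 0 1 \<Longrightarrow> y \<in> sphere 0 1 \<Longrightarrow> G (reflect v x) (reflect v y) = G x y"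
  by (simp add: G_def K_reflect)

lemma G_measurable: "G x \<in> borel_measurable \<sigma>"
  unfolding G_def[abs_def]
  by (intro borel_measurable_times borel_measurable_const spherical_harmonic_measurable[OF K_harmonic])

lemma G_minus:
  assumes "x \<in> sphere 0 1" shows "\<bar>G y (- x)\<bar> = \<bar>G y x\<bar>"
proof -
  obtain p where p: "\<forall>t x. p (t *\<^sub>R x) = t ^ l * p x" "\<forall>x\<in>sphere 0 1. K y x = p x"
    using K_harmonic[of y] unfolding spherical_harmonic_def by blast
  have "K y (- x) = (-1) ^ l * K y x" using p(1)[rule_format, of "-1" x] p(2) assms by simp
  then show ?thesis by (simp add: G_def abs_mult)
qed

section \<open>Zonal harmonics and vanishing means\<close>

lemma obtain_basis:
  obtains b1 b2 :: 'a where "b1 \<in> Basis" "b2 \<in> Basis" "b1 \<noteq> b2"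
proof -
  have "card (Basis :: 'a set) \<ge> 2" using dim d by simp
  then obtain B where "B \<subseteq> (Basis :: 'a set)" "card B = 2" by (meson obtain_subset_with_card_n)
  then obtain b1 b2 where "B = {b1, b2}" "b1 \<noteq> b2" by (auto simp: card_2_iff)
  with \<open>B \<subseteq> Basis\<close> that show ?thesis by blast
qed

lemma circle_sphere:
  fixes b1 b2 :: 'a
  assumes "b1 \<in> Basis" "b2 \<in> Basis" "b1 \<noteq> b2"
  shows "cos t *\<^sub>R b1 + sin t *\<^sub>R b2 \<in> sphere 0 1"
proof -
  have "(cos t *\<^sub>R b1 + sin t *\<^sub>R b2) \<bullet> (cos t *\<^sub>R b1 + sin t *\<^sub>R b2) = 1"
    using assms sin_cos_squared_add3[of t]
    by (simp add: inner_add_left inner_add_right inner_Basis algebra_simps)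
  then show ?thesis by (simp add: norm_eq_sqrt_inner)
qed

text \<open>Two points with the same latitude relative to b are exchanged by the reflection along
  their difference, which is orthogonal to b.\<close>

lemma zonal_invariance:
  fixes f :: "'a \<Rightarrow> real"
  assumes f: "\<And>v y. y \<in> sphere 0 1 \<Longrightarrow> b \<bullet> v = 0 \<Longrightarrow> f (reflect v y) = f y"
    and y: "y \<in> sphere 0 1" "z \<in> sphere 0 1" "b \<bullet> y = b \<bullet> z"
  shows "f y = f z"
proof -
  have "reflect (y - z) y = z" by (rule reflect_swap) (use y in simp)
  with f[OF y(1), of "y - z"] y(3) show ?thesis by (simp add: inner_diff_right)
qed

text \<open>The surrounding space has dimension e + 3 with e = d - 2, which gives the eigenvalue l
  (l + d - 1). Only boundedness, degree and zonality of f enter, so the lemma serves both the kernel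
  and the constant function in \<open>integral_harmonic_zero\<close>.\<close>

lemma zonal_solution:
  fixes b1 b2 :: 'a and f :: "'a \<Rightarrow> real"
  assumes b: "b1 \<in> Basis" "b2 \<in> Basis" "b1 \<noteq> b2"
    and f: "spherical_harmonic l f" and inv: "\<And>v y. y \<in> sphere 0 1 \<Longrightarrow> b1 \<bullet> v = 0 \<Longrightarrow> f (reflect v y) = f y"
    and le: "\<And>y. y \<in> sphere 0 1 \<Longrightarrow> \<bar>f y\<bar> \<le> 1"
  shows "\<exists>F1 F2. gegenbauer_solution (\<lambda>t. f (cos t *\<^sub>R b1 + sin t *\<^sub>R b2)) F1 F2 (real l * (real l + real d - 1)) (d - 2)"
proof -
  obtain p where p: "real_polynomial_function p" "\<And>t x. p (t *\<^sub>R x) = t ^ l * p x" "\<And>x. laplacian p x = 0"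
     "\<And>x. x \<in> sphere 0 1 \<Longrightarrow> f x = p x" using f unfolding spherical_harmonic_def by blast
  obtain g B where gB: "second_derivative p g B" using second_derivative_polynomial[OF p(1)] by blast
  define x where "x t = cos t *\<^sub>R b1 + sin t *\<^sub>R b2" for t
  define x' where "x' t = (- sin t) *\<^sub>R b1 + cos t *\<^sub>R b2" for t
  have xs: "x t \<in> sphere 0 1" for t unfolding x_def by (rule circle_sphere[OF b])
  have fp: "f (x t) = p (x t)" for t by (rule p(4)[OF xs])
  have D: "((\<lambda>t. p (x t)) has_real_derivative g (x t) (x' t)) (at t)"
    "((\<lambda>t. g (x t) (x' t)) has_real_derivative B (x t) (x' t) (x' t) - g (x t) (x t)) (at t)" for t
    unfolding x_def x'_def by (rule zonal_derivatives[OF gB])+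
  have dim': "DIM('a) = (d - 2) + 3" using dim d by simp
  have sphere3: "cos t *\<^sub>R b1 + sin t *\<^sub>R (cos a *\<^sub>R b2 + sin a *\<^sub>R c) \<in> sphere 0 1"
    if c: "c \<in> Basis - {b1, b2}" for t a c
  proof -
    let ?w = "cos a *\<^sub>R b2 + sin a *\<^sub>R c"
    have w: "?w \<bullet> ?w = 1" using circle_sphere[of b2 c a] b c by (auto simp: norm_eq_sqrt_inner)
    have o: "b1 \<bullet> ?w = 0" "?w \<bullet> b1 = 0" using b c by (auto simp: inner_add_left inner_add_right inner_Basis)
    have "(cos t *\<^sub>R b1 + sin t *\<^sub>R ?w) \<bullet> (cos t *\<^sub>R b1 + sin t *\<^sub>R ?w) = cos t * cos t * (b1 \<bullet> b1) + sin t * sin t * (?w \<bullet> ?w)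
       + cos t * sin t * (b1 \<bullet> ?w) + sin t * cos t * (?w \<bullet> b1)"
      unfolding inner_add_left[of "cos t *\<^sub>R b1"] inner_add_right[of _ "cos t *\<^sub>R b1"] inner_scaleR_left inner_scaleR_right
      by (simp only: algebra_simps)
    also have "\<dots> = 1" unfolding w o using b sin_cos_squared_add3[of t] by simp
    finally show ?thesis by (simp add: norm_eq_sqrt_inner)
  qed
  have inv3: "p (cos t *\<^sub>R b1 + sin t *\<^sub>R (cos a *\<^sub>R b2 + sin a *\<^sub>R c)) = p (cos t *\<^sub>R b1 + sin t *\<^sub>R b2)"
    if c: "c \<in> Basis - {b1, b2}" for t a c
  proof -
    have "f (cos t *\<^sub>R b1 + sin t *\<^sub>R (cos a *\<^sub>R b2 + sin a *\<^sub>R c)) = f (x t)"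
      by (rule zonal_invariance[OF inv sphere3[OF c] xs])
         (use b c in \<open>auto simp: x_def inner_add_right inner_Basis\<close>)
    then show ?thesis using p(4)[OF sphere3[OF c]] fp by (simp add: x_def)
  qed
  have ode: "sin t * (B (x t) (x' t) (x' t) - g (x t) (x t)) + (real (d - 2) + 1) * cos t * g (x t) (x' t)
     + real l * (real l + real (d - 2) + 1) * sin t * p (x t) = 0" if "sin t \<noteq> 0" for t
    unfolding x_def x'_def using zonal_ode[OF gB p(2) p(3) b dim' inv3 that] by simp
  \<comment> \<open>The angles t and -t have the same latitude. Evenness forces the derivative at
    the pole to vanish, the initial condition of the energy argument.\<close>
  have even: "p (x (- t)) = p (x t)" for t
  proof -
    have "f (x (- t)) = f (x t)"
      by (rule zonal_invariance[OF inv xs xs]) (use b in \<open>auto simp: x_def inner_diff_right inner_add_right inner_Basis\<close>)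
    then show ?thesis using fp by simp
  qed
  have "g (x 0) (x' 0) = 0"
  proof -
    have "((\<lambda>t. p (x (- t))) has_real_derivative g (x (- 0)) (x' (- 0)) * (- 1)) (at 0)"
      by (rule DERIV_chain2[OF D(1)]) (auto intro!: derivative_eq_intros)
    then have "((\<lambda>t. p (x t)) has_real_derivative - g (x 0) (x' 0)) (at 0)" unfolding even by simp
    from DERIV_unique[OF this D(1)] show ?thesis by simp
  qed
  moreover have "real l * (real l + real (d - 2) + 1) = real l * (real l + real d - 1)" using d by (simp add: of_nat_diff)
  moreover have "real l * (real l + real d - 1) > 0" using d l by (intro mult_pos_pos) auto
  ultimately have "gegenbauer_solution (\<lambda>t. p (x t)) (\<lambda>t. g (x t) (x' t)) (\<lambda>t. B (x t) (x' t) (x' t) - g (x t) (x t))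
      (real l * (real l + real d - 1)) (d - 2)"
    by unfold_locales (use D ode le[OF xs] fp in auto)
  then show ?thesis unfolding x_def[symmetric] fp by blast
qed

text \<open>The function k, the integral of the kernel in its second variable, is a harmonic and
  invariant under all reflections, hence constant on the sphere. A nonzero constant would make F = 1
  a solution of the zonal equation. So k vanishes there, every \<open>Y m\<close> has integral equal
  to its inner product with k, and f is a combination of the \<open>Y m\<close>.\<close>

lemma integral_harmonic_zero:
  assumes f: "spherical_harmonic l f" shows "(\<integral>x. f x \<partial>\<sigma>) = 0"
proof -
  define k where "k x = (\<integral>y. K x y \<partial>\<sigma>)" for x
  have k_harm: "spherical_harmonic l k"
  proof -
    have "k x = (\<Sum>m=1..n. (\<integral>y. Y m y \<partial>\<sigma>) * Y m x)" for x
      unfolding k_def K_def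
      by (subst Bochner_Integration.integral_sum)
         (auto intro!: square_integrable_imp_integrable harmonic_square_integrable Y_harmonic simp: mult.commute)
    then have "k = (\<lambda>x. \<Sum>m=1..n. (\<integral>y. Y m y \<partial>\<sigma>) * Y m x)" by blast
    moreover have "spherical_harmonic l (\<lambda>x. \<Sum>m=1..n. (\<integral>y. Y m y \<partial>\<sigma>) * Y m x)"
      by (intro spherical_harmonic_sum spherical_harmonic_cmult Y_harmonic)
    ultimately show ?thesis by metis
  qed
  have k_inv: "k (reflect v x) = k x" if "x \<in> sphere 0 1" for v x
  proof -
    have "k x = (\<integral>y. K (reflect v x) (reflect v y) \<partial>\<sigma>)"
      unfolding k_def by (rule Bochner_Integration.integral_cong[OF refl]) (use that K_reflect in simp)
    also have "\<dots> = k (reflect v x)" unfolding k_def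
      by (rule integral_surface_measure_reflect) (rule spherical_harmonic_measurable[OF K_harmonic])
    finally show ?thesis by simp
  qed
  have k_const: "k x = k z" if "x \<in> sphere 0 1" "z \<in> sphere 0 1" for x z
    using k_inv[OF that(1), of "x - z"] reflect_swap[of x z] that by simp
  obtain b1 b2 :: 'a where b: "b1 \<in> Basis" "b2 \<in> Basis" "b1 \<noteq> b2" by (rule obtain_basis)
  have b1s: "b1 \<in> sphere 0 1" using b by simp
  have kz: "k x = 0" if "x \<in> sphere 0 1" for x
  proof (rule ccontr)
    assume "k x \<noteq> 0"
    then have kb: "k b1 \<noteq> 0" using k_const[OF that b1s] by simp
    define h where "h = (\<lambda>y. (1 / k b1) * k y)"
    have h1: "h y = 1" if "y \<in> sphere 0 1" for y using k_const[OF that b1s] kb by (simp add: h_def)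
    have "spherical_harmonic l h" unfolding h_def by (rule spherical_harmonic_cmult[OF k_harm])
    then have "\<exists>F1 F2. gegenbauer_solution (\<lambda>t. h (cos t *\<^sub>R b1 + sin t *\<^sub>R b2)) F1 F2 (real l * (real l + real d - 1)) (d - 2)"
      by (rule zonal_solution[OF b]) (simp_all add: h1)
    then obtain F1 F2 where "gegenbauer_solution (\<lambda>t. 1) F1 F2 (real l * (real l + real d - 1)) (d - 2)"
      unfolding h1[OF circle_sphere[OF b]] by blast
    then interpret gegenbauer_solution "\<lambda>t. 1" F1 F2 "real l * (real l + real d - 1)" "d - 2" .
    have F1z: "F1 t = 0" for t by (rule DERIV_unique[OF F]) simp
    have "F2 t = 0" for t using F1[of t] unfolding F1z[abs_def] using DERIV_unique[of "\<lambda>_. 0::real"] by force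
    \<comment> \<open>With F = 1 and both derivatives zero the equation at pi/2 reads lam =
      0.\<close>
    with ode[of "pi / 2"] F1z lam show False by auto
  qed
  have "(\<integral>x. f x \<partial>\<sigma>) = (\<Sum>m=1..n. (\<integral>y. Y m y * f y \<partial>\<sigma>) * (\<integral>x. Y m x \<partial>\<sigma>))"
  proof -
    have "(\<integral>x. f x \<partial>\<sigma>) = (\<integral>x. (\<Sum>m=1..n. (\<integral>y. Y m y * f y \<partial>\<sigma>) * Y m x) \<partial>\<sigma>)"
    proof (rule Bochner_Integration.integral_cong[OF refl])
      fix x assume "x \<in> space \<sigma>"
      then have x: "x \<in> sphere 0 1" by simp
      have "f x = (\<integral>y. K x y * f y \<partial>\<sigma>)" by (rule reproducing[OF f x, symmetric])
      also have "\<dots> = (\<integral>y. (\<Sum>m=1..n. Y m x * (Y m y * f y)) \<partial>\<sigma>)"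
        by (simp only: K_def sum_distrib_right mult.assoc)
      also have "\<dots> = (\<Sum>m=1..n. Y m x * (\<integral>y. Y m y * f y \<partial>\<sigma>))"
        using f by (subst Bochner_Integration.integral_sum) (auto intro!: harmonic_mult_integrable Y_harmonic)
      finally show "f x = (\<Sum>m=1..n. (\<integral>y. Y m y * f y \<partial>\<sigma>) * Y m x)" by (simp add: mult.commute)
    qed
    also have "\<dots> = (\<Sum>m=1..n. (\<integral>y. Y m y * f y \<partial>\<sigma>) * (\<integral>x. Y m x \<partial>\<sigma>))"
      by (subst Bochner_Integration.integral_sum)
         (auto intro!: square_integrable_imp_integrable harmonic_square_integrable Y_harmonic)
    finally show ?thesis .
  qed
  also have "\<dots> = 0"
  proof (rule sum.neutral, rule ballI)
    fix m assume m: "m \<in> {1..n}"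
    have "(\<integral>x. Y m x \<partial>\<sigma>) = (\<Sum>k=1..n. if k = m then (\<integral>x. Y k x \<partial>\<sigma>) else 0)" using m by simp
    also have "\<dots> = (\<Sum>k=1..n. (\<integral>y. Y m y * Y k y \<partial>\<sigma>) * (\<integral>x. Y k x \<partial>\<sigma>))"
      by (rule sum.cong[OF refl]) (use m in \<open>simp add: Y_orthonormal\<close>)
    also have "\<dots> = (\<integral>y. Y m y * k y \<partial>\<sigma>)"
    proof -
      have keq: "k y = (\<Sum>k=1..n. (\<integral>x. Y k x \<partial>\<sigma>) * Y k y)" for y
        unfolding k_def K_def
        by (subst Bochner_Integration.integral_sum)
           (auto intro!: square_integrable_imp_integrable harmonic_square_integrable Y_harmonic simp: mult.commute)
      have "(\<integral>y. Y m y * k y \<partial>\<sigma>) = (\<integral>y. (\<Sum>k=1..n. (Y m y * Y k y) * (\<integral>x. Y k x \<partial>\<sigma>)) \<partial>\<sigma>)"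
        by (simp add: keq sum_distrib_left mult_ac)
      also have "\<dots> = (\<Sum>k=1..n. (\<integral>y. Y m y * Y k y \<partial>\<sigma>) * (\<integral>x. Y k x \<partial>\<sigma>))"
        using m by (subst Bochner_Integration.integral_sum) (auto intro!: harmonic_mult_integrable Y_harmonic)
      finally show ?thesis by simp
    qed
    also have "\<dots> = (\<integral>y. 0 \<partial>\<sigma>)" by (rule Bochner_Integration.integral_cong[OF refl]) (simp add: kz)
    finally show "(\<integral>y. Y m y * f y \<partial>\<sigma>) * (\<integral>x. Y m x \<partial>\<sigma>) = 0" by simp
  qed
  finally show ?thesis .
qed

section \<open>Decay and absolute moments of the kernel\<close>

definition decay_const :: real where "decay_const = 3 * exp 1 * real (d - 1) ^ (d - 1)"

text \<open>This is \<open>decay\<close> with e = d - 2, where \<open>kap\<close> is at most (d -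
  1)/l because l (l + d - 1) is at least l^2. The other hemisphere is reached by the parity of
  harmonics, \<open>G_minus\<close>.\<close>

lemma G_decay:
  fixes b1 :: 'a
  assumes b1: "b1 \<in> Basis" and y: "y \<in> sphere 0 1"
  shows "(real l * sqrt (1 - (y \<bullet> b1)\<^sup>2)) ^ (d - 1) * (G b1 y)\<^sup>2 \<le> decay_const"
proof -
  have b1s: "b1 \<in> sphere 0 1" using b1 by simp
  obtain b2 where b2: "b2 \<in> Basis" "b1 \<noteq> b2"
  proof -
    obtain a b :: 'a where "a \<in> Basis" "b \<in> Basis" "a \<noteq> b" by (rule obtain_basis)
    then show ?thesis using that by metis
  qed
  have harm: "spherical_harmonic l (G b1)"
    unfolding G_def[abs_def] by (rule spherical_harmonic_cmult[OF K_harmonic])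
  have inv: "G b1 (reflect v y) = G b1 y" if "y \<in> sphere 0 1" "b1 \<bullet> v = 0" for v y
    using G_reflect[OF b1s that(1), of v] reflect_orthogonal[OF that(2)] by simp
  obtain F1 F2 where gs: "gegenbauer_solution (\<lambda>t. G b1 (cos t *\<^sub>R b1 + sin t *\<^sub>R b2)) F1 F2 (real l * (real l + real d - 1)) (d - 2)"
    using zonal_solution[OF b1 b2 harm inv G_bound[OF b1s]] by blast
  interpret S: gegenbauer_solution "\<lambda>t. G b1 (cos t *\<^sub>R b1 + sin t *\<^sub>R b2)" F1 F2 "real l * (real l + real d - 1)" "d - 2"
    by (rule gs)
  have main: "(real l * sqrt (1 - (y \<bullet> b1)\<^sup>2)) ^ (d - 1) * (G b1 y)\<^sup>2 \<le> decay_const"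
    if y: "y \<in> sphere 0 1" and pos: "y \<bullet> b1 \<ge> 0" for y
  proof -
    define t where "t = arccos (y \<bullet> b1)"
    have le1: "y \<bullet> b1 \<le> 1" using Basis_le_norm[OF b1, of y] y by simp
    have cost: "cos t = y \<bullet> b1" unfolding t_def using pos le1 by (intro cos_arccos) auto
    have sint: "sin t = sqrt (1 - (y \<bullet> b1)\<^sup>2)" unfolding t_def using pos le1 by (intro sin_arccos) auto
    have t: "0 \<le> t" "t \<le> pi / 2"
      unfolding t_def by (rule arccos_lbound arccos_le_pi2; use pos le1 in linarith)+
    show ?thesis
    \<comment> \<open>The energy estimate starts at positive angles; at the pole the left side is 0,
      since d - 1 is positive.\<close>
    proof (cases "t = 0")
      case True
      then have "sqrt (1 - (y \<bullet> b1)\<^sup>2) = 0" using sint by simp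
      moreover have "0 \<le> decay_const" by (simp add: decay_const_def)
      ultimately show ?thesis using d by (simp add: power_0_left)
    next
      case False
      have Gy: "G b1 y = G b1 (cos t *\<^sub>R b1 + sin t *\<^sub>R b2)"
      proof (rule zonal_invariance[OF inv y circle_sphere[OF b1 b2]])
        have "b1 \<bullet> (cos t *\<^sub>R b1 + sin t *\<^sub>R b2) = cos t"
          using b1 b2 by (simp add: inner_add_right inner_Basis)
        then show "b1 \<bullet> y = b1 \<bullet> (cos t *\<^sub>R b1 + sin t *\<^sub>R b2)"
          unfolding cost by (simp add: inner_commute)
      qed
      have e: "d - 2 + 1 = d - 1" using d by simp
      have dec: "sin t ^ (d - 1) * (G b1 y)\<^sup>2 \<le> 3 * exp 1 * S.kap ^ (d - 1)"
        using S.decay[of t] False t unfolding e Gy by simp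
      have kap: "real l * S.kap \<le> real (d - 1)"
      proof -
        have "real l \<le> sqrt (real l * (real l + real d - 1))"
          using d by (intro real_le_rsqrt) (simp add: power2_eq_square mult_left_mono)
        then have "real l / sqrt (real l * (real l + real d - 1)) \<le> 1" using S.lam by (simp only: divide_le_eq_1_pos real_sqrt_gt_0_iff)
        then have "real (d - 1) * (real l / sqrt (real l * (real l + real d - 1))) \<le> real (d - 1) * 1"
          by (intro mult_left_mono) auto
        moreover have "real (d - 2) + 1 = real (d - 1)" using d by (simp add: of_nat_diff)
        ultimately show ?thesis by (simp add: S.kap_def mult.commute)
      qed
      have "(real l * sin t) ^ (d - 1) * (G b1 y)\<^sup>2 = real l ^ (d - 1) * (sin t ^ (d - 1) * (G b1 y)\<^sup>2)"
        by (simp add: power_mult_distrib mult.assoc)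
      also have "\<dots> \<le> real l ^ (d - 1) * (3 * exp 1 * S.kap ^ (d - 1))"
        by (intro mult_left_mono dec) auto
      also have "\<dots> = 3 * exp 1 * (real l * S.kap) ^ (d - 1)"
        by (simp add: power_mult_distrib mult_ac)
      also have "\<dots> \<le> decay_const"
        unfolding decay_const_def using kap S.kap_pos by (intro mult_left_mono power_mono) auto
      finally show ?thesis unfolding sint .
    qed
  qed
  show ?thesis
  proof (cases "y \<bullet> b1 \<ge> 0")
    case True then show ?thesis by (rule main[OF y])
  next
    case False
    have "(G b1 (- y))\<^sup>2 = (G b1 y)\<^sup>2" using G_minus[OF y, of b1] by (metis power2_abs)
    with main[of "- y"] False y show ?thesis by simp
  qed
qed

text \<open>Decomposition into shells with l sin between 2^k and 2^(k+1). Each shell lies in a cap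
  of measure at most a constant times (2^k / l)^d, which cancels the factor 2^(-kd) of the
  hypothesis and leaves l^(-d) times \<rho>^k. Points with l sin < 1 are put into shell 0, where |G|
  <= 1 <= A.\<close>

lemma dyadic_bound:
  fixes b1 :: 'a
  assumes b1: "b1 \<in> Basis" and \<rho>: "\<rho> > 0" and A: "A \<ge> 1"
    and bound: "\<And>y k. y \<in> sphere 0 1 \<Longrightarrow> 2 ^ k \<le> real l * sqrt (1 - (y \<bullet> b1)\<^sup>2) \<Longrightarrow>
      \<bar>G b1 y\<bar> ^ q \<le> A * (\<rho> ^ k / 2 ^ (k * d))"
  shows "(\<integral>y. \<bar>G b1 y\<bar> ^ q \<partial>\<sigma>) \<le> A * real (d + 1) * 2 * 4 ^ d / real l ^ d * (\<Sum>k | 2 ^ k \<le> l. \<rho> ^ k)"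
proof -
  define I where "I = {k::nat. 2 ^ k \<le> l}"
  have "I \<subseteq> {..<l}" unfolding I_def by (auto intro: order_less_le_trans[OF less_exp])
  then have fin: "finite I" by (rule finite_subset) simp
  define s where "s y = sqrt (1 - (y \<bullet> b1)\<^sup>2)" for y
  define Cap where "Cap k = {y \<in> sphere 0 1. 1 - (y \<bullet> b1)\<^sup>2 \<le> (2 ^ (k + 1) / real l)\<^sup>2}" for k :: nat
  have b1s: "b1 \<in> sphere 0 1" using b1 by simp
  have l0: "real l > 0" using l by simp
  have s_le: "s y \<le> 1" for y unfolding s_def by simp
  have inCap: "y \<in> Cap k" if "y \<in> sphere 0 1" "real l * s y \<le> 2 ^ (k + 1)" for y k
  proof -
    have "(y \<bullet> b1)\<^sup>2 \<le> 1" using Basis_le_norm[OF b1, of y] that(1) by (simp add: abs_square_le_1)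
    then have s0: "s y \<ge> 0" "(s y)\<^sup>2 = 1 - (y \<bullet> b1)\<^sup>2" by (simp_all add: s_def)
    have "s y \<le> 2 ^ (k + 1) / real l" using that(2) l0 by (simp add: field_simps)
    then have "(s y)\<^sup>2 \<le> (2 ^ (k + 1) / real l)\<^sup>2" using s0(1) by (intro power_mono)
    then show ?thesis using that(1) s0(2) by (simp add: Cap_def)
  qed
  have Cap_meas: "Cap k \<in> sets \<sigma>" for k
  proof -
    have "Cap k = sphere 0 1 \<inter> {x. 1 - (x \<bullet> b1)\<^sup>2 \<le> (2 ^ (k + 1) / real l)\<^sup>2}" by (auto simp: Cap_def)
    moreover have "closed {x. 1 - (x \<bullet> b1)\<^sup>2 \<le> (2 ^ (k + 1) / real l)\<^sup>2}"
      by (intro closed_Collect_le continuous_intros)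
    ultimately have "Cap k \<in> sets borel" by (simp only: borel_closed closed_Int closed_sphere)
    then show ?thesis unfolding sets_surface_measure_borel by (auto simp: Cap_def)
  qed
  have pointwise: "\<bar>G b1 y\<bar> ^ q \<le> (\<Sum>k\<in>I. A * (\<rho> ^ k / 2 ^ (k * d)) * indicator (Cap k) y)" if y: "y \<in> sphere 0 1" for y
  proof -
    have "\<exists>k\<in>I. \<bar>G b1 y\<bar> ^ q \<le> A * (\<rho> ^ k / 2 ^ (k * d)) \<and> y \<in> Cap k"
    proof (cases "real l * s y < 1")
      case True
      have "\<bar>G b1 y\<bar> ^ q \<le> 1" using G_bound[OF b1s y] by (intro power_le_one) auto
      then have "\<bar>G b1 y\<bar> ^ q \<le> A * (\<rho> ^ 0 / 2 ^ (0 * d))" using A by simp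
      moreover have "y \<in> Cap 0" using True by (intro inCap y) simp
      moreover have "0 \<in> I" using l by (simp add: I_def)
      ultimately show ?thesis by blast
    next
      case False
      \<comment> \<open>The shell index is the binary logarithm of an integer part j. The upper
        bound holds because l sin < j + 1 and j + 1 is still at most 2^(k+1).\<close>
      define j where "j = nat \<lfloor>real l * s y\<rfloor>"
      have j: "1 \<le> j" "real j \<le> real l * s y" "real l * s y < real j + 1" using False by (auto simp: j_def le_nat_floor)
      obtain k where k: "2 ^ k \<le> j" "j < 2 ^ (k + 1)" using ex_power_ivl1[of 2 j] j(1) by auto
      have lo: "2 ^ k \<le> real l * s y"
      proof -
        have "2 ^ k \<le> real j" using of_nat_mono[OF k(1), where 'a=real] by simp
        then show ?thesis using j(2) by linarith
      qed
      have hi: "real l * s y \<le> 2 ^ (k + 1)"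
      proof -
        have "j + 1 \<le> 2 ^ (k + 1)" using k(2) by simp
        from of_nat_mono[OF this, where 'a=real] have "real j + 1 \<le> 2 ^ (k + 1)" by simp
        then show ?thesis using j(3) by linarith
      qed
      have "real l * s y \<le> real l" using s_le[of y] l0 by (simp add: mult_left_le)
      with lo have "2 ^ k \<le> real l" by linarith
      then have "real (2 ^ k) \<le> real l" by (simp only: of_nat_power of_nat_numeral)
      then have "k \<in> I" unfolding I_def by (simp only: of_nat_le_iff mem_Collect_eq)
      moreover have "\<bar>G b1 y\<bar> ^ q \<le> A * (\<rho> ^ k / 2 ^ (k * d))"
        using bound[OF y] lo unfolding s_def by blast
      ultimately show ?thesis using inCap[OF y hi] by blast
    qed
    then obtain k where k: "k \<in> I" "\<bar>G b1 y\<bar> ^ q \<le> A * (\<rho> ^ k / 2 ^ (k * d))" "y \<in> Cap k" by blast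
    have "\<bar>G b1 y\<bar> ^ q \<le> A * (\<rho> ^ k / 2 ^ (k * d)) * indicator (Cap k) y" using k by simp
    also have "\<dots> \<le> (\<Sum>k\<in>I. A * (\<rho> ^ k / 2 ^ (k * d)) * indicator (Cap k) y)"
      using \<rho> A by (intro member_le_sum[OF k(1) _ fin]) simp
    finally show ?thesis .
  qed
  have icap: "integrable \<sigma> (\<lambda>y. A * (\<rho> ^ k / 2 ^ (k * d)) * indicator (Cap k) y)" for k
    using Cap_meas[of k] by (intro integrable_mult_right integrable_real_indicator) (simp_all add: emeasure_eq_measure)
  have "(\<integral>y. \<bar>G b1 y\<bar> ^ q \<partial>\<sigma>) \<le> (\<integral>y. (\<Sum>k\<in>I. A * (\<rho> ^ k / 2 ^ (k * d)) * indicator (Cap k) y) \<partial>\<sigma>)"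
  proof (rule integral_mono)
    show "integrable \<sigma> (\<lambda>y. \<bar>G b1 y\<bar> ^ q)"
    proof (rule integrable_const_bound[of _ 1])
      show "AE y in \<sigma>. norm (\<bar>G b1 y\<bar> ^ q) \<le> 1"
        using G_bound[OF b1s] by (intro AE_I2) (simp add: power_le_one)
      show "(\<lambda>y. \<bar>G b1 y\<bar> ^ q) \<in> borel_measurable \<sigma>"
        by (intro borel_measurable_power borel_measurable_abs G_measurable)
    qed
    show "integrable \<sigma> (\<lambda>y. \<Sum>k\<in>I. A * (\<rho> ^ k / 2 ^ (k * d)) * indicator (Cap k) y)"
      by (intro Bochner_Integration.integrable_sum icap)
  qed (use pointwise in simp)
  also have "\<dots> = (\<Sum>k\<in>I. \<integral>y. A * (\<rho> ^ k / 2 ^ (k * d)) * indicator (Cap k) y \<partial>\<sigma>)"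
    by (rule Bochner_Integration.integral_sum) (rule icap)
  also have "\<dots> = (\<Sum>k\<in>I. A * (\<rho> ^ k / 2 ^ (k * d)) * measure \<sigma> (Cap k))"
  proof -
    have "Cap k \<inter> sphere 0 1 = Cap k" for k by (auto simp: Cap_def)
    then show ?thesis by simp
  qed
  also have "\<dots> \<le> (\<Sum>k\<in>I. A * real (d + 1) * 2 * 4 ^ d / real l ^ d * \<rho> ^ k)"
  proof (rule sum_mono)
    fix k assume "k \<in> I"
    have "measure \<sigma> (Cap k) \<le> DIM('a) * (2 * (2 * (2 ^ (k + 1) / real l)) ^ (DIM('a) - 1))"
      unfolding Cap_def by (rule measure_surface_measure_cap[OF b1]) simp
    also have "\<dots> = real (d + 1) * 2 * (4 ^ d * 2 ^ (k * d)) / real l ^ d"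
      unfolding dim by (simp add: power_divide power_mult_distrib power_mult[symmetric] power_add mult_ac)
    finally have "A * (\<rho> ^ k / 2 ^ (k * d)) * measure \<sigma> (Cap k) \<le> A * (\<rho> ^ k / 2 ^ (k * d)) * (real (d + 1) * 2 * (4 ^ d * 2 ^ (k * d)) / real l ^ d)"
      using A \<rho> by (intro mult_left_mono) auto
    also have "\<dots> = A * real (d + 1) * 2 * 4 ^ d / real l ^ d * \<rho> ^ k" by simp
    finally show "A * (\<rho> ^ k / 2 ^ (k * d)) * measure \<sigma> (Cap k) \<le> A * real (d + 1) * 2 * 4 ^ d / real l ^ d * \<rho> ^ k" .
  qed
  also have "\<dots> = A * real (d + 1) * 2 * 4 ^ d / real l ^ d * (\<Sum>k\<in>I. \<rho> ^ k)"
    by (rule sum_distrib_left[symmetric])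
  finally show ?thesis unfolding I_def .
qed

lemma decay_const_ge: "decay_const \<ge> 1"
proof -
  have "1 \<le> 3 * exp (1::real)" using exp_ge_add_one_self[of "1::real"] by simp
  moreover have "1 \<le> real (d - 1) ^ (d - 1)" using d by (intro one_le_power) simp
  ultimately have "1 * 1 \<le> 3 * exp 1 * real (d - 1) ^ (d - 1)" by (intro mult_mono) auto
  then show ?thesis by (simp add: decay_const_def)
qed

lemma G_square_dyadic:
  fixes b1 :: 'a
  assumes b1: "b1 \<in> Basis" and y: "y \<in> sphere 0 1" and k: "2 ^ k \<le> real l * sqrt (1 - (y \<bullet> b1)\<^sup>2)"
  shows "(G b1 y)\<^sup>2 \<le> decay_const / 2 ^ (k * (d - 1))"
proof -
  have "2 ^ (k * (d - 1)) * (G b1 y)\<^sup>2 \<le> (real l * sqrt (1 - (y \<bullet> b1)\<^sup>2)) ^ (d - 1) * (G b1 y)\<^sup>2"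
    unfolding power_mult by (intro mult_right_mono power_mono k) auto
  also have "\<dots> \<le> decay_const" by (rule G_decay[OF b1 y])
  finally show ?thesis by (simp add: field_simps)
qed

text \<open>The ratio sqrt 2 expresses 3 (d-1)/2 >= d - 1/2, which holds for d >= 2 with equality
  for d = 2. The comparison is made between squares to avoid half-integral exponents, at the price
  of raising the cube of the decay constant to its fourth power.\<close>

lemma integral_G3:
  fixes b1 :: 'a
  assumes b1: "b1 \<in> Basis"
  shows "(\<integral>y. \<bar>G b1 y\<bar> ^ 3 \<partial>\<sigma>) \<le> decay_const\<^sup>2 * real (d + 1) * 2 * 4 ^ d / real l ^ d * (\<Sum>k | 2 ^ k \<le> l. sqrt 2 ^ k)"
proof (rule dyadic_bound[OF b1])
  fix y k assume y: "y \<in> sphere 0 1" "2 ^ k \<le> real l * sqrt (1 - (y \<bullet> b1)\<^sup>2)"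
  let ?D = decay_const
  have D: "?D \<ge> 1" by (rule decay_const_ge)
  have "(\<bar>G b1 y\<bar> ^ 3)\<^sup>2 = ((G b1 y)\<^sup>2) ^ 3"
    by (simp add: power_mult[symmetric] power_even_abs)
  also have "\<dots> \<le> (?D / 2 ^ (k * (d - 1))) ^ 3" by (intro power_mono G_square_dyadic[OF b1 y]) simp
  also have "\<dots> = ?D ^ 3 / 2 ^ (3 * (k * (d - 1)))" by (simp add: power_divide power_mult[symmetric] mult.commute)
  also have "\<dots> \<le> ?D ^ 4 / 2 ^ (k * (2 * d - 1))"
  proof (rule frac_le)
    show "?D ^ 3 \<le> ?D ^ 4" using D by (intro power_increasing) auto
    have "2 * d - 1 \<le> 3 * (d - 1)" using d by simp
    then have "k * (2 * d - 1) \<le> k * (3 * (d - 1))" by (rule mult_le_mono2)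
    then show "(2::real) ^ (k * (2 * d - 1)) \<le> 2 ^ (3 * (k * (d - 1)))" by (intro power_increasing) auto
  qed (use D in auto)
  also have "\<dots> = (?D\<^sup>2 * (sqrt 2 ^ k / 2 ^ (k * d)))\<^sup>2"
  proof -
    have "(sqrt 2 ^ k)\<^sup>2 = (2::real) ^ k" by (simp add: power_mult[symmetric] mult.commute[of k 2]) (simp add: power_mult)
    moreover have "(2 ^ (k * d))\<^sup>2 = (2::real) ^ (k * (2 * d - 1)) * 2 ^ k"
    proof -
      have "k * d * 2 = k * (2 * d - 1) + k" using d by (cases d) (auto simp: algebra_simps)
      then show ?thesis by (simp only: power_mult[symmetric] power_add[symmetric])
    qed
    ultimately show ?thesis by (simp add: power_mult_distrib power_divide power_mult[symmetric])
  qed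
  finally show "\<bar>G b1 y\<bar> ^ 3 \<le> ?D\<^sup>2 * (sqrt 2 ^ k / 2 ^ (k * d))"
    by (rule power2_le_imp_le) simp
qed (use decay_const_ge in \<open>auto simp: one_le_power\<close>)

text \<open>Here 5 (d-1)/2 >= d + 1/2, again with equality for d = 2, so the ratio is 1 / sqrt 2 and
  the dyadic sum stays bounded.\<close>

lemma integral_G5:
  fixes b1 :: 'a
  assumes b1: "b1 \<in> Basis"
  shows "(\<integral>y. \<bar>G b1 y\<bar> ^ 5 \<partial>\<sigma>) \<le> decay_const ^ 3 * real (d + 1) * 2 * 4 ^ d / real l ^ d * (\<Sum>k | 2 ^ k \<le> l. (1 / sqrt 2) ^ k)"
proof (rule dyadic_bound[OF b1])
  fix y k assume y: "y \<in> sphere 0 1" "2 ^ k \<le> real l * sqrt (1 - (y \<bullet> b1)\<^sup>2)"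
  let ?D = decay_const
  have D: "?D \<ge> 1" by (rule decay_const_ge)
  have "(\<bar>G b1 y\<bar> ^ 5)\<^sup>2 = ((G b1 y)\<^sup>2) ^ 5"
    by (simp add: power_mult[symmetric] power_even_abs)
  also have "\<dots> \<le> (?D / 2 ^ (k * (d - 1))) ^ 5" by (intro power_mono G_square_dyadic[OF b1 y]) simp
  also have "\<dots> = ?D ^ 5 / 2 ^ (5 * (k * (d - 1)))" by (simp add: power_divide power_mult[symmetric] mult.commute)
  also have "\<dots> \<le> ?D ^ 6 / 2 ^ (k * (2 * d + 1))"
  proof (rule frac_le)
    show "?D ^ 5 \<le> ?D ^ 6" using D by (intro power_increasing) auto
    have "2 * d + 1 \<le> 5 * (d - 1)" using d by simp
    then have "k * (2 * d + 1) \<le> k * (5 * (d - 1))" by (rule mult_le_mono2)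
    then show "(2::real) ^ (k * (2 * d + 1)) \<le> 2 ^ (5 * (k * (d - 1)))" by (intro power_increasing) auto
  qed (use D in auto)
  also have "\<dots> = (?D ^ 3 * ((1 / sqrt 2) ^ k / 2 ^ (k * d)))\<^sup>2"
  proof -
    have "((1 / sqrt 2) ^ k)\<^sup>2 = 1 / (2::real) ^ k" by (simp add: power_divide power_mult[symmetric] mult.commute[of k 2]) (simp add: power_mult)
    moreover have "(2 ^ (k * d))\<^sup>2 * 2 ^ k = (2::real) ^ (k * (2 * d + 1))"
    proof -
      have "k * d * 2 + k = k * (2 * d + 1)" by (simp add: algebra_simps)
      then show ?thesis by (simp only: power_mult[symmetric] power_add[symmetric])
    qed
    ultimately show ?thesis by (simp add: power_mult_distrib power_divide power_mult[symmetric] mult.commute)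
  qed
  finally show "\<bar>G b1 y\<bar> ^ 5 \<le> ?D ^ 3 * ((1 / sqrt 2) ^ k / 2 ^ (k * d))"
    by (rule power2_le_imp_le) (use D in simp)
qed (use decay_const_ge in \<open>auto simp: one_le_power\<close>)

lemma integral_G_reflect:
  assumes x: "x \<in> sphere 0 1" and b1: "(b1::'a) \<in> Basis"
  shows "(\<integral>y. \<bar>G x y\<bar> ^ q \<partial>\<sigma>) = (\<integral>y. \<bar>G b1 y\<bar> ^ q \<partial>\<sigma>)"
proof -
  have s: "reflect (x - b1) x = b1" by (rule reflect_swap) (use x b1 in simp)
  have "(\<integral>y. \<bar>G x y\<bar> ^ q \<partial>\<sigma>) = (\<integral>y. \<bar>G b1 (reflect (x - b1) y)\<bar> ^ q \<partial>\<sigma>)"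
    by (rule Bochner_Integration.integral_cong[OF refl])
       (use G_reflect[OF x, of _ "x - b1"] s in simp)
  also have "\<dots> = (\<integral>y. \<bar>G b1 y\<bar> ^ q \<partial>\<sigma>)"
    by (rule integral_surface_measure_reflect) (intro borel_measurable_power borel_measurable_abs G_measurable)
  finally show ?thesis .
qed

end

text \<open>Geometric sums up to the binary logarithm of l: the growing one is of the size of its
  last term, about sqrt l, and the decaying one is bounded.\<close>

lemma sum_dyadic_sqrt:
  assumes "l \<ge> 1" shows "(\<Sum>k | 2 ^ k \<le> (l::nat). sqrt 2 ^ k) \<le> sqrt 2 / (sqrt 2 - 1) * sqrt (real l)"
    "(\<Sum>k | 2 ^ k \<le> l. (1 / sqrt 2) ^ k) \<le> 1 / (1 - 1 / sqrt 2)"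
proof -
  obtain K where K: "2 ^ K \<le> l" "l < 2 ^ (K + 1)" using ex_power_ivl1[of 2 l] assms by auto
  have eq: "{k. 2 ^ k \<le> l} = {..<Suc K}"
  proof (rule set_eqI)
    fix k
    have "2 ^ k \<le> l \<longleftrightarrow> k \<le> K"
    proof
      assume "2 ^ k \<le> l"
      with K(2) have "(2::nat) ^ k < 2 ^ (K + 1)" by linarith
      then have "k < K + 1" by (rule power_less_imp_less_exp[rotated]) simp
      then show "k \<le> K" by simp
    next
      assume "k \<le> K"
      then have "(2::nat) ^ k \<le> 2 ^ K" by (intro power_increasing) auto
      with K(1) show "2 ^ k \<le> l" by linarith
    qed
    then show "k \<in> {k. 2 ^ k \<le> l} \<longleftrightarrow> k \<in> {..<Suc K}" by auto
  qed
  have r: "sqrt 2 > (1::real)" by simp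
  have "(sqrt 2 ^ K)\<^sup>2 = (2::real) ^ K" by (simp add: power_mult[symmetric] mult.commute[of K 2]) (simp add: power_mult)
  also have "\<dots> \<le> real l" using of_nat_mono[OF K(1), where 'a=real] by simp
  finally have "sqrt 2 ^ K \<le> sqrt (real l)" by (rule real_le_rsqrt)
  then have "sqrt 2 * sqrt 2 ^ K \<le> sqrt 2 * sqrt (real l)" by (intro mult_left_mono) auto
  then have "sqrt 2 ^ Suc K - 1 \<le> sqrt 2 * sqrt (real l)" unfolding power_Suc by linarith
  then have "(sqrt 2 ^ Suc K - 1) / (sqrt 2 - 1) \<le> sqrt 2 * sqrt (real l) / (sqrt 2 - 1)"
    by (rule divide_right_mono) (use r in linarith)
  moreover have "(\<Sum>k<Suc K. sqrt 2 ^ k) = (sqrt 2 ^ Suc K - 1) / (sqrt 2 - 1)"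
    by (rule geometric_sum) (use r in simp)
  ultimately show "(\<Sum>k | 2 ^ k \<le> l. sqrt 2 ^ k) \<le> sqrt 2 / (sqrt 2 - 1) * sqrt (real l)"
    unfolding eq by simp
  have q: "0 < 1 / sqrt (2::real)" "1 / sqrt (2::real) < 1" using r by (simp_all add: field_simps)
  have "(\<Sum>k<Suc K. (1 / sqrt (2::real)) ^ k) = (1 - (1 / sqrt 2) ^ Suc K) / (1 - 1 / sqrt 2)"
    using q by (subst sum_gp_strict) auto
  also have "\<dots> \<le> 1 / (1 - 1 / sqrt 2)"
    using q by (intro divide_right_mono) auto
  finally show "(\<Sum>k | 2 ^ k \<le> l. (1 / sqrt 2) ^ k) \<le> 1 / (1 - 1 / sqrt (2::real))" unfolding eq .
qed

text \<open>The dimension contributes l^(d-1) and the caps l^(-d); the remaining 1/l is multiplied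
  by sqrt l for the third moment and by a constant for the fifth. Reflections move x to a basis
  vector, so C is uniform in l, the basis and x.\<close>

theorem kernel_moment_bounds:
  fixes d :: nat
  assumes "d \<ge> 2"
  shows "\<exists>C\<ge>0. \<forall>l (Y :: nat \<Rightarrow> 'a::euclidean_space \<Rightarrow> real) x. harmonic_basis d l Y \<longrightarrow> x \<in> sphere 0 1 \<longrightarrow>
     real (harmonic_dim d l) * (\<integral>y. \<bar>harmonic_basis.G d l Y x y\<bar> ^ 3 \<partial>surface_measure) \<le> C / sqrt (real l) \<and>
     real (harmonic_dim d l) * (\<integral>y. \<bar>harmonic_basis.G d l Y x y\<bar> ^ 5 \<partial>surface_measure) \<le> C / real l"
proof -
  define D where "D = 3 * exp 1 * real (d - 1) ^ (d - 1)"
  define N where "N = real ((d + 1) * d ^ (d - 1))"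
  define E where "E = real (d + 1) * 2 * 4 ^ d"
  define C3 where "C3 = N * (D\<^sup>2 * E * (sqrt 2 / (sqrt 2 - 1)))"
  define C5 where "C5 = N * (D ^ 3 * E * (1 / (1 - 1 / sqrt 2)))"
  have nonneg: "D \<ge> 0" "N \<ge> 0" "E \<ge> 0" by (simp_all add: D_def N_def E_def)
  have C: "0 \<le> C3" "0 \<le> C5" using nonneg by (simp_all add: C3_def C5_def)
  show ?thesis
  proof (intro exI[of _ "max C3 C5"] conjI allI impI)
    show "0 \<le> max C3 C5" using C by simp
    fix l and Y :: "nat \<Rightarrow> 'a \<Rightarrow> real" and x :: 'a
    assume "harmonic_basis d l Y" and x: "x \<in> sphere 0 1"
    then interpret H: harmonic_basis d l Y by simp
    obtain b1 b2 :: 'a where b1: "b1 \<in> Basis" by (rule H.obtain_basis)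
    have l0: "real l > 0" using H.l by simp
    have D: "H.decay_const = D" by (simp add: H.decay_const_def D_def)
    have nl: "real H.n \<le> N * real l ^ (d - 1)" using H.n_upper by (simp add: N_def)
    have pw: "real l ^ d = real l ^ (d - 1) * real l" using assms by (simp flip: power_Suc2)
    have "real H.n * (\<integral>y. \<bar>H.G x y\<bar> ^ 3 \<partial>surface_measure) \<le> (N * real l ^ (d - 1)) *
       (D\<^sup>2 * E / real l ^ d * (sqrt 2 / (sqrt 2 - 1) * sqrt (real l)))"
    proof (rule mult_mono[OF nl])
      have "(\<integral>y. \<bar>H.G x y\<bar> ^ 3 \<partial>surface_measure) \<le> D\<^sup>2 * E / real l ^ d * (\<Sum>k | 2 ^ k \<le> l. sqrt 2 ^ k)"
        using H.integral_G3[OF b1] unfolding H.integral_G_reflect[OF x b1] D E_def by (simp only: mult.assoc)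
      also have "\<dots> \<le> D\<^sup>2 * E / real l ^ d * (sqrt 2 / (sqrt 2 - 1) * sqrt (real l))"
        using nonneg by (intro mult_left_mono sum_dyadic_sqrt H.l) auto
      finally show "(\<integral>y. \<bar>H.G x y\<bar> ^ 3 \<partial>surface_measure) \<le> D\<^sup>2 * E / real l ^ d * (sqrt 2 / (sqrt 2 - 1) * sqrt (real l))" .
    qed (use nonneg in auto)
    also have "\<dots> = C3 / real l * sqrt (real l)" unfolding C3_def pw using l0 by (simp add: mult_ac)
    also have "\<dots> = C3 / sqrt (real l)" 
    proof -
      have "C3 / (t * t) * t = C3 / t" if "t > 0" for t :: real using that by simp
      from this[of "sqrt (real l)"] l0 show ?thesis by simp
    qed
    also have "\<dots> \<le> max C3 C5 / sqrt (real l)" by (intro divide_right_mono) auto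
    finally show "real H.n * (\<integral>y. \<bar>H.G x y\<bar> ^ 3 \<partial>surface_measure) \<le> max C3 C5 / sqrt (real l)" .
    have "real H.n * (\<integral>y. \<bar>H.G x y\<bar> ^ 5 \<partial>surface_measure) \<le> (N * real l ^ (d - 1)) *
       (D ^ 3 * E / real l ^ d * (1 / (1 - 1 / sqrt 2)))"
    proof (rule mult_mono[OF nl])
      have "(\<integral>y. \<bar>H.G x y\<bar> ^ 5 \<partial>surface_measure) \<le> D ^ 3 * E / real l ^ d * (\<Sum>k | 2 ^ k \<le> l. (1 / sqrt 2) ^ k)"
        using H.integral_G5[OF b1] unfolding H.integral_G_reflect[OF x b1] D E_def by (simp only: mult.assoc)
      also have "\<dots> \<le> D ^ 3 * E / real l ^ d * (1 / (1 - 1 / sqrt 2))"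
        using nonneg by (intro mult_left_mono sum_dyadic_sqrt H.l) auto
      finally show "(\<integral>y. \<bar>H.G x y\<bar> ^ 5 \<partial>surface_measure) \<le> D ^ 3 * E / real l ^ d * (1 / (1 - 1 / sqrt 2))" .
    qed (use nonneg in auto)
    also have "\<dots> = C5 / real l" unfolding C5_def pw using l0 by (simp add: mult_ac)
    also have "\<dots> \<le> max C3 C5 / real l" by (intro divide_right_mono) auto
    finally show "real H.n * (\<integral>y. \<bar>H.G x y\<bar> ^ 5 \<partial>surface_measure) \<le> max C3 C5 / real l" .
  qed
qed

section \<open>The central limit theorem on the sphere\<close>

context harmonic_basis
begin

text \<open>The standard deviation of the coefficients is moved into the functions, so that the
  coefficients become standard Gaussian and the squares of the functions sum to 1 at each
  point.\<close>

definition y :: "nat \<Rightarrow> 'a \<Rightarrow> real" where "y m x = sqrt (\<mu> / real n) * Y m x"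

lemma ratio_pos: "\<mu> / real n > 0"
  using mass_pos n_pos by simp

lemma y_mult: "y m x * y m' x' = \<mu> / real n * (Y m x * Y m' x')"
proof -
  have "sqrt (\<mu> / real n) * sqrt (\<mu> / real n) = \<mu> / real n"
    using less_imp_le[OF ratio_pos] by (simp only: real_sqrt_mult_self abs_of_nonneg)
  then show ?thesis unfolding y_def by (metis (no_types, lifting) mult.assoc mult.left_commute)
qed

sublocale F: gaussian_field \<sigma> "{1..n}" y
proof
  show "finite {1..n}" by simp
  show "y m \<in> borel_measurable \<sigma>" if "m \<in> {1..n}" for m
    unfolding y_def[abs_def]
    by (intro borel_measurable_times borel_measurable_const spherical_harmonic_measurable[OF Y_harmonic[OF that]])
  show "(\<Sum>m\<in>{1..n}. (y m x)\<^sup>2) = 1" if "x \<in> space \<sigma>" for x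
  proof -
    have "(\<Sum>m\<in>{1..n}. (y m x)\<^sup>2) = \<mu> / real n * K x x"
      unfolding power2_eq_square y_mult K_def sum_distrib_left ..
    then show ?thesis using K_diag[of x] that mass_pos n_pos by simp
  qed
  have mass_eq: "measure \<sigma> (space \<sigma>) = \<mu>" using measure_sphere by simp
  show "(\<integral>x. y m x * y m' x \<partial>\<sigma>) = (if m = m' then measure \<sigma> (space \<sigma>) / real (card {1..n}) else 0)"
    if "m \<in> {1..n}" "m' \<in> {1..n}" for m m'
    unfolding y_mult mass_eq by (simp add: Y_orthonormal[OF that])
  show "(\<integral>x. y m x \<partial>\<sigma>) = 0" if "m \<in> {1..n}" for m
    unfolding y_def by (simp add: integral_harmonic_zero[OF Y_harmonic[OF that]])
  show "measure \<sigma> (space \<sigma>) > 0" unfolding mass_eq by (rule mass_pos)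
qed

lemma field_mass: "F.\<mu> = \<mu>"
  using measure_sphere by simp

lemma field_G: "F.G x x' = G x x'"
  unfolding F.G_def G_def K_def y_mult sum_distrib_left ..

lemma field_kappa_le:
  assumes "\<And>x. x \<in> sphere 0 1 \<Longrightarrow> real n * (\<integral>x'. \<bar>G x x'\<bar> ^ q \<partial>\<sigma>) \<le> B"
  shows "F.\<kappa> q \<le> B / \<mu>"
proof -
  have "F.A q \<le> F.\<mu> * (B / real n)"
  proof (rule F.A_le)
    fix x assume "x \<in> space \<sigma>"
    then show "(\<integral>x'. \<bar>F.G x x'\<bar> ^ q \<partial>\<sigma>) \<le> B / real n"
      unfolding field_G using assms[of x] n_pos by (simp add: pos_le_divide_eq mult.commute)
  qed
  then have "F.A q \<le> \<mu> * (B / real n)" unfolding field_mass .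
  then have "real n * F.A q / \<mu>\<^sup>2 \<le> real n * (\<mu> * (B / real n)) / \<mu>\<^sup>2"
    by (intro divide_right_mono mult_left_mono) auto
  also have "\<dots> = B / \<mu>" using n_pos mass_pos by (simp add: power2_eq_square)
  finally show ?thesis unfolding F.\<kappa>_def field_mass by simp
qed

text \<open>Restricted to the index set because the points of the product space
  \<open>gauss_space\<close> are extensional functions.\<close>

definition coefficients :: "(nat \<Rightarrow> 'w \<Rightarrow> real) \<Rightarrow> 'w \<Rightarrow> nat \<Rightarrow> real" where
  "coefficients a \<omega> = (\<lambda>m\<in>{1..n}. a m \<omega> / sqrt (\<mu> / real n))"

lemma distr_coefficients:
  assumes P: "prob_space P" and a: "gaussian_coefficients P d l a"
  shows "coefficients a \<in> P \<rightarrow>\<^sub>M gauss_space {1..n}"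
    "distr P (gauss_space {1..n}) (coefficients a) = gauss_space {1..n}"
proof -
  interpret P: prob_space P by (rule P)
  let ?s = "sqrt (\<mu> / real n)"
  have s: "?s > 0" using ratio_pos by simp
  have ind: "P.indep_vars (\<lambda>_. borel) a {1..n}"
    and dis: "\<And>m. m \<in> {1..n} \<Longrightarrow> distributed P lborel (a m) (normal_density 0 ?s)"
    using a by (auto simp: gaussian_coefficients_def)
  have ind': "P.indep_vars (\<lambda>_. borel) (\<lambda>m \<omega>. a m \<omega> / ?s) {1..n}"
    by (rule P.indep_vars_compose2[OF ind]) simp
  have std: "distr P borel (\<lambda>\<omega>. a m \<omega> / ?s) = std_normal_distribution" if "m \<in> {1..n}" for m
  proof -
    have "distributed P lborel (\<lambda>\<omega>. (a m \<omega> - 0) / ?s) std_normal_density"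
      using dis[OF that] P.normal_standard_normal_convert[OF s] by blast
    then have "distr P lborel (\<lambda>\<omega>. a m \<omega> / ?s) = density lborel std_normal_density"
      using distributed_distr_eq_density by fastforce
    moreover have "distr P borel (\<lambda>\<omega>. a m \<omega> / ?s) = distr P lborel (\<lambda>\<omega>. a m \<omega> / ?s)"
      by (rule distr_cong) simp_all
    ultimately show ?thesis by simp
  qed
  have rv: "(\<lambda>\<omega>. a m \<omega> / ?s) \<in> borel_measurable P" if "m \<in> {1..n}" for m
    using ind' that unfolding P.indep_vars_def by blast
  have sets_eq: "sets (gauss_space {1..n}) = sets (\<Pi>\<^sub>M m\<in>{1..n}. borel)"
    unfolding gauss_space_def by (rule sets_PiM_cong) auto
  have eq: "coefficients a = (\<lambda>\<omega>. \<lambda>m\<in>{1..n}. a m \<omega> / ?s)"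
    by (rule ext) (simp add: coefficients_def)
  have "distr P (\<Pi>\<^sub>M m\<in>{1..n}. borel) (\<lambda>\<omega>. \<lambda>m\<in>{1..n}. a m \<omega> / ?s) = (\<Pi>\<^sub>M m\<in>{1..n}. distr P borel (\<lambda>\<omega>. a m \<omega> / ?s))"
    using ind' rv P.indep_vars_iff_distr_eq_PiM'[of "{1..n}" "\<lambda>m \<omega>. a m \<omega> / ?s" "\<lambda>_. borel"] n_pos by fastforce
  also have "\<dots> = gauss_space {1..n}"
    unfolding gauss_space_def by (rule PiM_cong) (simp_all add: std)
  finally have d: "distr P (\<Pi>\<^sub>M m\<in>{1..n}. borel) (coefficients a) = gauss_space {1..n}" unfolding eq .
  have "coefficients a \<in> P \<rightarrow>\<^sub>M (\<Pi>\<^sub>M m\<in>{1..n}. borel)"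
    unfolding eq by (rule measurable_restrict) (rule rv)
  then show "coefficients a \<in> P \<rightarrow>\<^sub>M gauss_space {1..n}"
    using measurable_cong_sets[OF refl sets_eq, of P] by blast
  show "distr P (gauss_space {1..n}) (coefficients a) = gauss_space {1..n}"
    using d distr_cong[OF refl sets_eq, of P "coefficients a" "coefficients a"] by simp
qed

lemma sphere_functional_eq_SF:
  fixes aa :: "nat \<Rightarrow> nat \<Rightarrow> 'w \<Rightarrow> real" and YY :: "nat \<Rightarrow> nat \<Rightarrow> 'a \<Rightarrow> real"
  assumes "YY l = Y"
  shows "sphere_functional d aa YY M l \<omega> = F.SF M (coefficients (aa l) \<omega>)"
proof -
  have s: "sqrt (\<mu> / real n) \<noteq> 0" using mass_pos n_pos by simp
  have "eigenfunction d aa YY l \<omega> x = F.T (coefficients (aa l) \<omega>) x" for x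
    unfolding eigenfunction_def F.T_def
    by (rule sum.cong) (use s assms in \<open>auto simp: coefficients_def y_def\<close>)
  then show ?thesis unfolding sphere_functional_def F.SF_def by simp
qed

end

lemma standardized_distr:
  assumes f: "f \<in> P \<rightarrow>\<^sub>M N" "distr P N f = N" and g: "g \<in> borel_measurable N"
  shows "standardized P (\<lambda>\<omega>. g (f \<omega>)) \<omega> = standardized N g (f \<omega>)"
proof -
  have E: "(\<integral>\<omega>. h (f \<omega>) \<partial>P) = (\<integral>x. h x \<partial>N)" if "h \<in> borel_measurable N" for h :: "_ \<Rightarrow> real"
  proof -
    have "(\<integral>x. h x \<partial>N) = (\<integral>x. h x \<partial>distr P N f)" by (simp only: f(2))
    also have "\<dots> = (\<integral>\<omega>. h (f \<omega>) \<partial>P)" by (rule integral_distr[OF f(1) that])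
    finally show ?thesis by (rule sym)
  qed
  show ?thesis unfolding standardized_def using E[OF g] E[of "\<lambda>x. (g x - (\<integral>x. g x \<partial>N))\<^sup>2"] g by simp
qed

text \<open>Expectation and standardization depend only on the joint law of the coefficients, so
  everything is transported to \<open>gauss_space\<close>. Then n^(-1/2), \<open>\<kappa> 3\<close>
  and the square root of \<open>\<kappa> 5\<close> are each of order l^(-1/2). Measurability is part
  of the conclusion because the weak limit concerns genuine distributions.\<close>

lemma sphere_functional_distance:
  fixes d :: nat and M :: "real \<Rightarrow> real"
  assumes d: "d \<ge> 2" and M: "square_integrable std_normal_distribution M" and J2: "hermite_coeff 2 M \<noteq> 0"
  shows "\<exists>C\<ge>0. \<forall>l (Y :: nat \<Rightarrow> nat \<Rightarrow> 'a::euclidean_space \<Rightarrow> real) (P :: 'w measure) a h.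
    harmonic_basis d l (Y l) \<longrightarrow> prob_space P \<longrightarrow> gaussian_coefficients P d l (a l) \<longrightarrow> 1-lipschitz_on UNIV h \<longrightarrow>
    sphere_functional d a Y M l \<in> borel_measurable P \<and>
    \<bar>(\<integral>t. h t \<partial>distr P borel (standardized P (sphere_functional d a Y M l))) - (\<integral>t. h t \<partial>std_normal_distribution)\<bar>
      \<le> C / sqrt (real l)"
proof -
  obtain C where C: "C \<ge> 0" and clt: "\<And>(S :: 'a measure) I y h. gaussian_field S I y \<Longrightarrow> 1-lipschitz_on UNIV h \<Longrightarrow>
    \<bar>(\<integral>b. h (standardized (gauss_space I) (gaussian_field.SF S I y M) b) \<partial>gauss_space I) - (\<integral>t. h t \<partial>std_normal_distribution)\<bar>
    \<le> C * (1 / sqrt (real (card I)) + gaussian_field.\<kappa> S I y 3 + sqrt (gaussian_field.\<kappa> S I y 5))"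
    using gaussian_field_clt[OF M J2] by blast
  obtain D where D: "D \<ge> 0" and ker: "\<And>l (Y :: nat \<Rightarrow> 'a \<Rightarrow> real) x. harmonic_basis d l Y \<Longrightarrow> x \<in> sphere 0 1 \<Longrightarrow>
     real (harmonic_dim d l) * (\<integral>y. \<bar>harmonic_basis.G d l Y x y\<bar> ^ 3 \<partial>surface_measure) \<le> D / sqrt (real l) \<and>
     real (harmonic_dim d l) * (\<integral>y. \<bar>harmonic_basis.G d l Y x y\<bar> ^ 5 \<partial>surface_measure) \<le> D / real l"
    using kernel_moment_bounds[OF d] by blast
  have mM: "M \<in> borel_measurable borel" using M by (rule square_integrable_std_normal_measurable)
  define C' where "C' = C * (sqrt (real (d - 1)) + D / sphere_mass d + sqrt (D / sphere_mass d))"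
  have mu0: "sphere_mass d > 0" unfolding sphere_mass_def by (intro divide_pos_pos mult_pos_pos Gamma_real_pos) auto
  have "C' \<ge> 0" unfolding C'_def using C D mu0 by simp
  moreover have "sphere_functional d a Y M l \<in> borel_measurable P \<and>
    \<bar>(\<integral>t. h t \<partial>distr P borel (standardized P (sphere_functional d a Y M l))) - (\<integral>t. h t \<partial>std_normal_distribution)\<bar>
      \<le> C' / sqrt (real l)"
    if H: "harmonic_basis d l (Y l)" and P: "prob_space P" and a: "gaussian_coefficients P d l (a l)" and h: "1-lipschitz_on UNIV h"
    for l and Y :: "nat \<Rightarrow> nat \<Rightarrow> 'a \<Rightarrow> real" and P :: "'w measure" and a h
  proof -
    interpret H: harmonic_basis d l "Y l" by (rule H)
    have l0: "real l > 0" using H.l by simp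
    let ?N = "gauss_space {1..H.n}" and ?b = "H.coefficients (a l)"
    note b = H.distr_coefficients[OF P a]
    have SFm: "H.F.SF M \<in> borel_measurable ?N" by (rule H.F.SF_measurable[OF mM])
    have eq: "sphere_functional d a Y M l = (\<lambda>\<omega>. H.F.SF M (?b \<omega>))"
      by (rule ext) (rule H.sphere_functional_eq_SF, rule refl)
    have meas: "sphere_functional d a Y M l \<in> borel_measurable P"
      unfolding eq by (rule measurable_compose[OF b(1) SFm])
    have hm: "h \<in> borel_measurable borel"
      by (rule borel_measurable_continuous_onI) (rule lipschitz_on_continuous_on[OF h])
    have stm: "standardized ?N (H.F.SF M) \<in> borel_measurable ?N"
      unfolding standardized_def[abs_def] using SFm by simp
    have st: "standardized P (sphere_functional d a Y M l) = (\<lambda>\<omega>. standardized ?N (H.F.SF M) (?b \<omega>))"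
      unfolding eq by (rule ext) (rule standardized_distr[OF b SFm])
    have "(\<integral>t. h t \<partial>distr P borel (standardized P (sphere_functional d a Y M l))) = (\<integral>\<omega>. h (standardized ?N (H.F.SF M) (?b \<omega>)) \<partial>P)"
      unfolding st by (rule integral_distr[OF measurable_compose[OF b(1) stm] hm])
    also have "\<dots> = (\<integral>b. h (standardized ?N (H.F.SF M) b) \<partial>distr P ?N ?b)"
      by (rule integral_distr[OF b(1), symmetric]) (rule measurable_compose[OF stm hm])
    also have "\<dots> = (\<integral>b. h (standardized ?N (H.F.SF M) b) \<partial>?N)" unfolding b(2) ..
    finally have int: "(\<integral>t. h t \<partial>distr P borel (standardized P (sphere_functional d a Y M l))) = (\<integral>b. h (standardized ?N (H.F.SF M) b) \<partial>?N)" .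
    have k3: "H.F.\<kappa> 3 \<le> D / sqrt (real l) / sphere_mass d"
      by (rule H.field_kappa_le) (use ker[OF H] in blast)
    have k5: "H.F.\<kappa> 5 \<le> D / real l / sphere_mass d"
      by (rule H.field_kappa_le) (use ker[OF H] in blast)
    have n1: "1 / sqrt (real (card {1..H.n})) \<le> sqrt (real (d - 1)) / sqrt (real l)"
    proof -
      have "sqrt (real l) \<le> sqrt (real (d - 1)) * sqrt (real H.n)"
        unfolding real_sqrt_mult[symmetric] by (intro real_sqrt_le_mono H.n_lower)
      moreover have "sqrt (real H.n) > 0" "sqrt (real l) > 0" using H.n_pos l0 by simp_all
      ultimately show ?thesis by (simp add: field_simps)
    qed
    have "C * (1 / sqrt (real (card {1..H.n})) + H.F.\<kappa> 3 + sqrt (H.F.\<kappa> 5))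
      \<le> C * (sqrt (real (d - 1)) / sqrt (real l) + D / sqrt (real l) / sphere_mass d + sqrt (D / real l / sphere_mass d))"
      by (intro mult_left_mono add_mono n1 k3 real_sqrt_le_mono k5 C)
    also have "\<dots> = C' / sqrt (real l)"
      unfolding C'_def by (simp add: add_divide_distrib distrib_left real_sqrt_divide real_sqrt_mult mult_ac)
    finally have "\<bar>(\<integral>b. h (standardized ?N (H.F.SF M) b) \<partial>?N) - (\<integral>t. h t \<partial>std_normal_distribution)\<bar> \<le> C' / sqrt (real l)"
      using clt[OF H.F.gaussian_field_axioms h] by linarith
    with meas show ?thesis unfolding int by simp
  qed
  ultimately show ?thesis by blast
qed

text \<open>Weak convergence is tested on piecewise linear steps; scaling by the length of the ramp
  makes them 1-Lipschitz, so the distance estimate applies to them.\<close>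

lemma lipschitz_cts_step:
  assumes "u < v" shows "1-lipschitz_on UNIV (\<lambda>t. (v - u) * cts_step u v t)"
proof (rule lipschitz_onI)
  fix s t
  have "(v - u) * cts_step u v x = max 0 (min (v - u) (v - x))" for x
    using assms by (auto simp: cts_step_def)
  then show "dist ((v - u) * cts_step u v s) ((v - u) * cts_step u v t) \<le> 1 * dist s t"
    by (auto simp: dist_real_def)
qed simp

theorem theorem1p7:
  fixes d :: nat
    and P :: "'w measure"
    and Y :: "nat \<Rightarrow> nat \<Rightarrow> 'a::euclidean_space \<Rightarrow> real"
    and a :: "nat \<Rightarrow> nat \<Rightarrow> 'w \<Rightarrow> real"
    and M :: "real \<Rightarrow> real"
  assumes "d \<ge> 2" and "DIM('a) = d + 1"
    and "prob_space P"
    and "\<And>l. l \<ge> 1 \<Longrightarrow> orthonormal_harmonic_basis d l (Y l)"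
    and "\<And>l. l \<ge> 1 \<Longrightarrow> gaussian_coefficients P d l (a l)"
    and "M \<in> borel_measurable borel"
    and "integrable std_normal_distribution (\<lambda>t. (M t)\<^sup>2)"
    and "J2 M \<noteq> 0"
  shows "(\<exists>C. \<forall>\<^sub>F l in sequentially.
            wasserstein
              (distr P borel (standardized P (sphere_functional d a Y M (2 * l))))
              std_normal_distribution
              \<le> ereal (C * real l powr (- 1 / 2)))
       \<and> weak_conv_m
           (\<lambda>l. distr P borel (standardized P (sphere_functional d a Y M (2 * l))))
           std_normal_distribution"
proof -
  interpret P: prob_space P by fact
  have M: "square_integrable std_normal_distribution M"
    using assms(6,7) by (simp add: square_integrable_def)
  have "hermite2 t = He 2 t" for t
    unfolding Hermite_explicit by (simp add: hermite2_def power2_eq_square)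
  then have J2: "hermite_coeff 2 M \<noteq> 0"
    using assms(8) by (simp add: J2_def hermite_coeff_def)
  have H: "harmonic_basis d l (Y l)" if "l \<ge> 1" for l
    using assms(1,2,4) that by unfold_locales auto
  let ?law = "\<lambda>l. distr P borel (standardized P (sphere_functional d a Y M (2 * l)))"
  obtain C where C: "C \<ge> 0" and est: "\<And>l (Y :: nat \<Rightarrow> nat \<Rightarrow> 'a \<Rightarrow> real) (P :: 'w measure) a h.
    harmonic_basis d l (Y l) \<Longrightarrow> prob_space P \<Longrightarrow> gaussian_coefficients P d l (a l) \<Longrightarrow> 1-lipschitz_on UNIV h \<Longrightarrow>
    sphere_functional d a Y M l \<in> borel_measurable P \<and>
    \<bar>(\<integral>t. h t \<partial>distr P borel (standardized P (sphere_functional d a Y M l))) - (\<integral>t. h t \<partial>std_normal_distribution)\<bar>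
      \<le> C / sqrt (real l)"
    using sphere_functional_distance[OF assms(1) M J2, where 'a='a and 'w='w] by blast
  have dist: "\<bar>(\<integral>t. h t \<partial>?law l) - (\<integral>t. h t \<partial>std_normal_distribution)\<bar> \<le> C * real l powr (- 1 / 2)"
    if l: "l \<ge> 1" and h: "1-lipschitz_on UNIV h" for l h
  proof -
    have l2: "2 * l \<ge> 1" using l by simp
    have "\<bar>(\<integral>t. h t \<partial>?law l) - (\<integral>t. h t \<partial>std_normal_distribution)\<bar> \<le> C / sqrt (real (2 * l))"
      using est[of "2 * l" Y P a, OF H[OF l2] assms(3) assms(5)[OF l2] h] by blast
    also have "\<dots> \<le> C / sqrt (real l)" using C l by (intro divide_left_mono) auto
    also have "\<dots> = C * real l powr (- 1 / 2)"
      using l powr_minus_divide[of "real l" "1 / 2"] by (simp add: powr_half_sqrt)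
    finally show ?thesis .
  qed
  have "\<forall>\<^sub>F l in sequentially. wasserstein (?law l) std_normal_distribution \<le> ereal (C * real l powr (- 1 / 2))"
    using eventually_ge_at_top[of 1]
  proof eventually_elim
    case (elim l)
    show ?case unfolding wasserstein_def
      by (rule SUP_least) (use dist[OF elim] in simp)
  qed
  moreover have "weak_conv_m ?law std_normal_distribution"
  proof (rule integral_cts_step_conv_imp_weak_conv)
    show "real_distribution (?law l)" for l
    proof (rule P.real_distribution_distr)
      have "sphere_functional d a Y M (2 * l) \<in> borel_measurable P"
      proof (cases "l = 0")
        case True
        \<comment> \<open>Division by zero makes \<open>harmonic_dim d 0\<close> equal to 0, so the
          field of degree 0 is the empty sum and the functional is constant.\<close>
        then show ?thesis by (simp add: sphere_functional_def[abs_def] eigenfunction_def harmonic_dim_def)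
      next
        case False
        then have l2: "2 * l \<ge> 1" by simp
        show ?thesis
          using est[of "2 * l" Y P a, OF H[OF l2] assms(3) assms(5)[OF l2] lipschitz_cts_step[OF zero_less_one]] by blast
      qed
      then show "standardized P (sphere_functional d a Y M (2 * l)) \<in> borel_measurable P"
        unfolding standardized_def[abs_def] by simp
    qed
    show "real_distribution std_normal_distribution" by (rule real_dist_normal_dist)
    fix u v :: real assume uv: "u < v"
    let ?E = "\<integral>t. cts_step u v t \<partial>std_normal_distribution"
    have lim: "(\<lambda>l. C * real l powr (- 1 / 2) / (v - u)) \<longlonglongrightarrow> 0"
    proof -
      have "(\<lambda>l. real l powr (- 1 / 2)) \<longlonglongrightarrow> 0"
        by (rule tendsto_neg_powr[OF _ filterlim_real_sequentially]) simp
      from tendsto_divide[OF tendsto_mult[OF tendsto_const[of C] this] tendsto_const[of "v - u"]] uv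
      show ?thesis by simp
    qed
    have "(\<lambda>l. (\<integral>t. cts_step u v t \<partial>?law l) - ?E) \<longlonglongrightarrow> 0"
    proof (rule Lim_null_comparison[OF _ lim])
      show "\<forall>\<^sub>F l in sequentially. norm ((\<integral>t. cts_step u v t \<partial>?law l) - ?E) \<le> C * real l powr (- 1 / 2) / (v - u)"
        using eventually_ge_at_top[of 1]
      proof eventually_elim
        case (elim l)
        have "\<bar>(v - u) * (\<integral>t. cts_step u v t \<partial>?law l) - (v - u) * ?E\<bar> \<le> C * real l powr (- 1 / 2)"
          using dist[OF elim lipschitz_cts_step[OF uv]] by simp
        then have "(v - u) * \<bar>(\<integral>t. cts_step u v t \<partial>?law l) - ?E\<bar> \<le> C * real l powr (- 1 / 2)"
          using uv by (simp add: right_diff_distrib[symmetric] abs_mult)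
        then show ?case using uv by (simp add: pos_le_divide_eq mult.commute)
      qed
    qed
    then show "(\<lambda>l. integral\<^sup>L (?law l) (cts_step u v)) \<longlonglongrightarrow> integral\<^sup>L std_normal_distribution (cts_step u v)"
      by (rule LIM_zero_cancel)
  qed
  ultimately show ?thesis by blast
qed

end
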